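(* For any $r_0>0$, there exists $\beta=\beta(r_0)>0$ such that for $|\xi|\ge r_0$, $$\sigma(\mathbb{M}(\xi))\subset\{\lambda\in\mathbb{C}\mid\mathrm{Re}\,\lambda<-\beta\},$$ where $\mathbb{M}(\xi)$ is the operator defined in the context.
   Context: Fix $\gamma\ge1$. $L^2(\mathbb{R}^3_v)$ is the space of complex-valued functions. Let $\chi_0=\sqrt M$ with $M(v)=(2\pi)^{-3/2}e^{-|v|^2/2}$, $Lf=\Delta_vf-\frac{|v|^2}4f+\frac32f$, $\tau_af=\int\chi_0f\,dv\in\mathbb{C}$, $\tau_bf=\int v\chi_0f\,dv\in\mathbb{C}^3$. For $\xi\in\mathbb{R}^3\setminus\{0\}$, $\mathbb{M}(\xi)$ is the closed densely defined operator (with its natural domain) on $L^2(\mathbb{R}^3_v)\times\mathbb{C}\times\mathbb{C}^3$ given by $$\mathbb{M}(\xi)(f,\rho,u)=\begin{pmatrix}Lf-i(v\cdot\xi)f-i\frac{v\cdot\xi}{|\xi|^2}\chi_0(\tau_af-\rho)+v\chi_0\cdot u\\ -i\xi\cdot u\\ i\frac{\xi}{|\xi|^2}\tau_af+\tau_bf-i\xi\left(\gamma+\frac1{|\xi|^2}\right)\rho-(1+|\xi|^2)u\end{pmatrix},$$ and $\sigma(\cdot)$ denotes the spectrum. *)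

theory Defs
  imports "HOL-Analysis.Analysis"
begin

class complex_normed_space = real_normed_vector +
  fixes scaleC :: "complex \<Rightarrow> 'a \<Rightarrow> 'a"  (infixr \<open>*\<^sub>C\<close> 75)
  assumes scaleC_add_right: "c *\<^sub>C (x + y) = c *\<^sub>C x + c *\<^sub>C y"
    and scaleC_add_left: "(c + d) *\<^sub>C x = c *\<^sub>C x + d *\<^sub>C x"
    and scaleC_scaleC: "c *\<^sub>C d *\<^sub>C x = (c * d) *\<^sub>C x"
    and scaleC_of_real: "complex_of_real r *\<^sub>C x = r *\<^sub>R x"
    and norm_scaleC: "norm (c *\<^sub>C x) = cmod c * norm x"

instantiation complex :: complex_normed_space
begin
definition scaleC_complex :: "complex \<Rightarrow> complex \<Rightarrow> complex"
  where "c *\<^sub>C x = c * x"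
instance
  by standard (simp_all add: scaleC_complex_def algebra_simps norm_mult scaleR_conv_of_real)
end

instantiation vec :: (complex_normed_space, finite) complex_normed_space
begin
definition scaleC_vec :: "complex \<Rightarrow> 'a ^ 'b \<Rightarrow> 'a ^ 'b"
  where "c *\<^sub>C x = (\<chi> i. c *\<^sub>C (x $ i))"
instance
proof
  fix c :: complex and x :: "'a ^ 'b"
  show "norm (c *\<^sub>C x) = cmod c * norm x"
    by (simp add: scaleC_vec_def norm_vec_def norm_scaleC L2_set_right_distrib)
qed (simp_all add: scaleC_vec_def vec_eq_iff scaleC_add_right scaleC_add_left
       scaleC_scaleC scaleC_of_real)
end

instantiation prod :: (complex_normed_space, complex_normed_space) complex_normed_space
begin
definition scaleC_prod :: "complex \<Rightarrow> 'a \<times> 'b \<Rightarrow> 'a \<times> 'b"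
  where "c *\<^sub>C x = (c *\<^sub>C fst x, c *\<^sub>C snd x)"
instance
proof
  fix c :: complex and x :: "'a \<times> 'b"
  have "(cmod c * norm (fst x))\<^sup>2 + (cmod c * norm (snd x))\<^sup>2
      = (cmod c)\<^sup>2 * ((norm (fst x))\<^sup>2 + (norm (snd x))\<^sup>2)"
    by (simp add: algebra_simps power_mult_distrib)
  then show "norm (c *\<^sub>C x) = cmod c * norm x"
    by (simp add: scaleC_prod_def norm_prod_def norm_scaleC real_sqrt_mult)
qed (simp_all add: scaleC_prod_def prod_eq_iff scaleC_add_right scaleC_add_left
       scaleC_scaleC scaleC_of_real)
end

text \<open>An unbounded operator is given by its domain \<open>D\<close> and a function \<open>A\<close> whose values outside
  \<open>D\<close> are irrelevant.  For complex linear \<open>A\<close>, the inverse of \<open>\<lambda> - A\<close> is automatically complex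
  linear, so that \<open>bounded_linear\<close> (a notion over the reals) expresses its boundedness.\<close>

definition resolvent_set ::
    "'a::complex_normed_space set \<Rightarrow> ('a \<Rightarrow> 'a) \<Rightarrow> complex set" where
  "resolvent_set D A =
     {l. bij_betw (\<lambda>x. l *\<^sub>C x - A x) D UNIV \<and>
         bounded_linear (inv_into D (\<lambda>x. l *\<^sub>C x - A x))}"

definition spectrum ::
    "'a::complex_normed_space set \<Rightarrow> ('a \<Rightarrow> 'a) \<Rightarrow> complex set" where
  "spectrum D A = - resolvent_set D A"

definition sq_integrable :: "(real^3 \<Rightarrow> complex) \<Rightarrow> bool" where
  "sq_integrable f \<longleftrightarrow>
     f \<in> borel_measurable lborel \<and> integrable lborel (\<lambda>v. (cmod (f v))\<^sup>2)"

lemma sq_integrable_zero: "sq_integrable (\<lambda>v. 0)"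
  by (simp add: sq_integrable_def)

lemma sq_integrable_scale:
  assumes "sq_integrable f" shows "sq_integrable (\<lambda>v. c * f v)"
  using assms by (auto simp: sq_integrable_def norm_mult power_mult_distrib)

lemma sq_integrable_add:
  assumes f: "sq_integrable f" and g: "sq_integrable g"
  shows "sq_integrable (\<lambda>v. f v + g v)"
proof -
  have [measurable]: "f \<in> borel_measurable lborel" "g \<in> borel_measurable lborel"
    using f g by (auto simp: sq_integrable_def)
  have "integrable lborel (\<lambda>v. (cmod (f v + g v))\<^sup>2)"
  proof (rule Bochner_Integration.integrable_bound)
    show "integrable lborel (\<lambda>v. 2 * (cmod (f v))\<^sup>2 + 2 * (cmod (g v))\<^sup>2)"
      using f g by (auto simp: sq_integrable_def)
    have "(cmod (f v + g v))\<^sup>2 \<le> 2 * (cmod (f v))\<^sup>2 + 2 * (cmod (g v))\<^sup>2" for v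
    proof -
      have "(cmod (f v + g v))\<^sup>2 \<le> (cmod (f v) + cmod (g v))\<^sup>2"
        by (intro power_mono norm_triangle_ineq) auto
      moreover have "0 \<le> (cmod (f v) - cmod (g v))\<^sup>2" by simp
      ultimately show ?thesis by (simp add: power2_eq_square algebra_simps)
    qed
    then show "AE v in lborel. norm ((cmod (f v + g v))\<^sup>2)
        \<le> norm (2 * (cmod (f v))\<^sup>2 + 2 * (cmod (g v))\<^sup>2)"
      by simp
  qed measurable
  then show ?thesis by (auto simp: sq_integrable_def)
qed

lemma sq_integrable_uminus:
  assumes "sq_integrable f" shows "sq_integrable (\<lambda>v. - f v)"
  using assms by (auto simp: sq_integrable_def)

lemma sq_integrable_diff:
  assumes "sq_integrable f" "sq_integrable g" shows "sq_integrable (\<lambda>v. f v - g v)"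
  using sq_integrable_add[OF assms(1) sq_integrable_uminus[OF assms(2)]] by simp

lemma integrable_inner_sq_integrable:
  assumes f: "sq_integrable f" and g: "sq_integrable g"
  shows "integrable lborel (\<lambda>v. f v \<bullet> g v)"
proof (rule Bochner_Integration.integrable_bound)
  have [measurable]: "f \<in> borel_measurable lborel" "g \<in> borel_measurable lborel"
    using f g by (auto simp: sq_integrable_def)
  show "(\<lambda>v. f v \<bullet> g v) \<in> borel_measurable lborel" by measurable
  show "integrable lborel (\<lambda>v. (cmod (f v))\<^sup>2 + (cmod (g v))\<^sup>2)"
    using f g by (auto simp: sq_integrable_def)
  have "norm (f v \<bullet> g v) \<le> (cmod (f v))\<^sup>2 + (cmod (g v))\<^sup>2" for v
  proof -
    have "\<bar>f v \<bullet> g v\<bar> \<le> cmod (f v) * cmod (g v)" by (rule Cauchy_Schwarz_ineq2)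
    moreover have "0 \<le> (cmod (f v) - cmod (g v))\<^sup>2" by simp
    moreover have "0 \<le> cmod (f v) * cmod (g v)" by simp
    ultimately show ?thesis
      unfolding real_norm_def power2_eq_square left_diff_distrib right_diff_distrib
      by (smt (verit) mult.commute)
  qed
  then show "AE v in lborel. norm (f v \<bullet> g v) \<le> norm ((cmod (f v))\<^sup>2 + (cmod (g v))\<^sup>2)"
    by simp
qed

quotient_type L2 = "real^3 \<Rightarrow> complex" /
  partial: "\<lambda>f g. sq_integrable f \<and> sq_integrable g \<and> (AE v in lborel. f v = g v)"
proof (rule part_equivpI)
  show "\<exists>f. sq_integrable f \<and> sq_integrable f \<and> (AE v in lborel. f v = f v)"
    using sq_integrable_zero by auto
  show "symp (\<lambda>f g. sq_integrable f \<and> sq_integrable g \<and> (AE v in lborel. f v = g v))"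
    by (auto simp: symp_def)
  show "transp (\<lambda>f g. sq_integrable f \<and> sq_integrable g \<and> (AE v in lborel. f v = g v))"
    by (auto simp: transp_def)
qed

instantiation L2 :: real_inner
begin

lift_definition zero_L2 :: L2 is "\<lambda>v. 0"
  by (simp add: sq_integrable_zero)

lift_definition plus_L2 :: "L2 \<Rightarrow> L2 \<Rightarrow> L2" is "\<lambda>f g v. f v + g v"
  by (auto simp: sq_integrable_add)

lift_definition minus_L2 :: "L2 \<Rightarrow> L2 \<Rightarrow> L2" is "\<lambda>f g v. f v - g v"
  by (auto simp: sq_integrable_diff)

lift_definition uminus_L2 :: "L2 \<Rightarrow> L2" is "\<lambda>f v. - f v"
  by (auto simp: sq_integrable_uminus)

lift_definition scaleR_L2 :: "real \<Rightarrow> L2 \<Rightarrow> L2" is "\<lambda>r f v. complex_of_real r * f v"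
  by (auto simp: sq_integrable_scale)

text \<open>The real inner product, i.e. the real part of the complex one.\<close>

lift_definition inner_L2 :: "L2 \<Rightarrow> L2 \<Rightarrow> real" is "\<lambda>f g. LINT v|lborel. f v \<bullet> g v"
  by (intro integral_cong_AE) (auto simp: sq_integrable_def)

definition norm_L2 :: "L2 \<Rightarrow> real" where "norm_L2 f = sqrt (f \<bullet> f)"
definition sgn_L2 :: "L2 \<Rightarrow> L2" where "sgn_L2 f = inverse (norm f) *\<^sub>R f"
definition dist_L2 :: "L2 \<Rightarrow> L2 \<Rightarrow> real" where "dist_L2 f g = norm (f - g)"
definition uniformity_L2 :: "(L2 \<times> L2) filter" where
  "uniformity_L2 = (INF e\<in>{0 <..}. principal {(x, y). dist x y < e})"
definition open_L2 :: "L2 set \<Rightarrow> bool" where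
  "open_L2 U \<longleftrightarrow> (\<forall>x\<in>U. eventually (\<lambda>(x', y). x' = x \<longrightarrow> y \<in> U) uniformity)"

instance
proof
  fix x y z :: L2 and r s :: real
  show "x + y + z = x + (y + z)"
    by transfer (auto simp: sq_integrable_add algebra_simps)
  show "x + y = y + x"
    by transfer (auto simp: sq_integrable_add algebra_simps)
  show "0 + x = x"
    by transfer auto
  show "- x + x = 0"
    by transfer (auto simp: sq_integrable_zero)
  show "x - y = x + - y"
    by transfer (auto simp: sq_integrable_diff)
  show "r *\<^sub>R (x + y) = r *\<^sub>R x + r *\<^sub>R y"
    by transfer (auto simp: distrib_left intro!: sq_integrable_add sq_integrable_scale)
  show "(r + s) *\<^sub>R x = r *\<^sub>R x + s *\<^sub>R x"
    by transfer (auto simp: distrib_right intro!: sq_integrable_add sq_integrable_scale)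
  show "r *\<^sub>R s *\<^sub>R x = (r * s) *\<^sub>R x"
    by transfer (auto simp: mult.assoc intro!: sq_integrable_add sq_integrable_scale)
  show "1 *\<^sub>R x = x"
    by transfer auto
  show "dist x y = norm (x - y)" by (rule dist_L2_def)
  show "sgn x = inverse (norm x) *\<^sub>R x" by (rule sgn_L2_def)
  show "uniformity = (INF e\<in>{0 <..}. principal {(x, y :: L2). dist x y < e})"
    by (rule uniformity_L2_def)
  show "open U = (\<forall>x\<in>U. eventually (\<lambda>(x', y). x' = x \<longrightarrow> y \<in> U) uniformity)" for U :: "L2 set"
    by (rule open_L2_def)
  show "x \<bullet> y = y \<bullet> x"
    by transfer (simp add: inner_commute)
  show "(x + y) \<bullet> z = x \<bullet> z + y \<bullet> z"
    by transfer (simp add: inner_add_left integrable_inner_sq_integrable)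
  show "r *\<^sub>R x \<bullet> y = r * (x \<bullet> y)"
    by transfer (simp flip: scaleR_conv_of_real)
  show "0 \<le> x \<bullet> x"
    by transfer simp
  show "x \<bullet> x = 0 \<longleftrightarrow> x = 0"
  proof transfer
    fix f :: "real^3 \<Rightarrow> complex"
    assume f: "sq_integrable f \<and> sq_integrable f \<and> (AE v in lborel. f v = f v)"
    have "(LINT v|lborel. f v \<bullet> f v) = 0 \<longleftrightarrow> (AE v in lborel. f v \<bullet> f v = 0)"
      using f by (intro integral_nonneg_eq_0_iff_AE integrable_inner_sq_integrable) auto
    then show "((LINT v|lborel. f v \<bullet> f v) = 0) =
        (sq_integrable f \<and> sq_integrable (\<lambda>v. 0) \<and> (AE v in lborel. f v = 0))"
      using f by (simp add: sq_integrable_zero)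
  qed
  show "norm x = sqrt (x \<bullet> x)" by (rule norm_L2_def)
qed

end

instantiation L2 :: complex_normed_space
begin

lift_definition scaleC_L2 :: "complex \<Rightarrow> L2 \<Rightarrow> L2" is "\<lambda>c f v. c * f v"
  by (auto simp: sq_integrable_scale)

instance
proof
  fix x y :: L2 and c d :: complex and r :: real
  show "c *\<^sub>C (x + y) = c *\<^sub>C x + c *\<^sub>C y"
    by transfer (auto simp: distrib_left intro!: sq_integrable_add sq_integrable_scale)
  show "(c + d) *\<^sub>C x = c *\<^sub>C x + d *\<^sub>C x"
    by transfer (auto simp: distrib_right intro!: sq_integrable_add sq_integrable_scale)
  show "c *\<^sub>C d *\<^sub>C x = (c * d) *\<^sub>C x"
    by transfer (auto simp: mult.assoc intro!: sq_integrable_add sq_integrable_scale)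
  show "complex_of_real r *\<^sub>C x = r *\<^sub>R x"
    by transfer (auto simp: sq_integrable_scale)
  have "(c *\<^sub>C x) \<bullet> (c *\<^sub>C x) = (cmod c)\<^sup>2 * (x \<bullet> x)"
    by transfer (simp add: norm_mult power_mult_distrib flip: power2_norm_eq_inner)
  then show "norm (c *\<^sub>C x) = cmod c * norm x"
    by (simp add: norm_L2_def real_sqrt_mult)
qed

end

definition partial_deriv :: "3 \<Rightarrow> (real^3 \<Rightarrow> complex) \<Rightarrow> real^3 \<Rightarrow> complex" where
  "partial_deriv j f = (\<lambda>v. frechet_derivative f (at v) (axis j 1))"

text \<open>All iterated partial derivatives exist and are (Frechet) differentiable, hence continuous.\<close>

definition smooth :: "(real^3 \<Rightarrow> complex) \<Rightarrow> bool" where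
  "smooth f \<longleftrightarrow> (\<forall>js v. foldr partial_deriv js f differentiable (at v))"

definition test_function :: "(real^3 \<Rightarrow> complex) \<Rightarrow> bool" where
  "test_function \<phi> \<longleftrightarrow> smooth \<phi> \<and> compact (closure {v. \<phi> v \<noteq> 0})"

definition classical_laplacian :: "(real^3 \<Rightarrow> complex) \<Rightarrow> real^3 \<Rightarrow> complex" where
  "classical_laplacian \<phi> v = (\<Sum>j\<in>UNIV. partial_deriv j (partial_deriv j \<phi>) v)"

definition locally_integrable :: "(real^3 \<Rightarrow> complex) \<Rightarrow> bool" where
  "locally_integrable h \<longleftrightarrow> h \<in> borel_measurable lborel \<and>
     (\<forall>K. compact K \<longrightarrow> set_integrable lborel K h)"

definition has_weak_laplacian ::
    "(real^3 \<Rightarrow> complex) \<Rightarrow> (real^3 \<Rightarrow> complex) \<Rightarrow> bool" where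
  "has_weak_laplacian f h \<longleftrightarrow> locally_integrable f \<and> locally_integrable h \<and>
     (\<forall>\<phi>. test_function \<phi> \<longrightarrow>
        (LINT v|lborel. f v * classical_laplacian \<phi> v) = (LINT v|lborel. h v * \<phi> v))"

text \<open>The weak Laplacian of \<open>f\<close>, if it exists, is unique up to null sets, so the choice is immaterial.\<close>

definition weak_laplacian :: "(real^3 \<Rightarrow> complex) \<Rightarrow> real^3 \<Rightarrow> complex" where
  "weak_laplacian f = (SOME h. has_weak_laplacian f h)"

definition maxwellian :: "real^3 \<Rightarrow> real" where
  "maxwellian v = (2 * pi) powr (- 3 / 2) * exp (- (norm v)\<^sup>2 / 2)"

definition chi0 :: "real^3 \<Rightarrow> real" where
  "chi0 v = sqrt (maxwellian v)"

definition L_op :: "(real^3 \<Rightarrow> complex) \<Rightarrow> real^3 \<Rightarrow> complex" where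
  "L_op f v = weak_laplacian f v - complex_of_real ((norm v)\<^sup>2 / 4) * f v + 3 / 2 * f v"

definition tau_a :: "(real^3 \<Rightarrow> complex) \<Rightarrow> complex" where
  "tau_a f = (LINT v|lborel. complex_of_real (chi0 v) * f v)"

definition tau_b :: "(real^3 \<Rightarrow> complex) \<Rightarrow> complex^3" where
  "tau_b f = (\<chi> j. LINT v|lborel. complex_of_real (v $ j * chi0 v) * f v)"

text \<open>No complex conjugation is needed, as the first vector is real.\<close>

definition rc_dot :: "real^3 \<Rightarrow> complex^3 \<Rightarrow> complex" where
  "rc_dot a u = (\<Sum>j\<in>UNIV. complex_of_real (a $ j) * u $ j)"

definition M_kinetic ::
    "real^3 \<Rightarrow> (real^3 \<Rightarrow> complex) \<Rightarrow> complex \<Rightarrow> complex^3 \<Rightarrow> real^3 \<Rightarrow> complex" where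
  "M_kinetic \<xi> f \<rho> u v =
     L_op f v - \<i> * complex_of_real (v \<bullet> \<xi>) * f v
     - \<i> * complex_of_real ((v \<bullet> \<xi>) / (norm \<xi>)\<^sup>2 * chi0 v) * (tau_a f - \<rho>)
     + complex_of_real (chi0 v) * rc_dot v u"

text \<open>The natural (maximal) domain: \<open>\<Delta>f\<close> is taken in the sense of distributions and the kinetic
  component is required to be square integrable.  As all other terms of that component are locally
  square integrable, this forces the distribution \<open>\<Delta>f\<close> to be a locally integrable function.\<close>

definition M_domain :: "real^3 \<Rightarrow> (L2 \<times> complex \<times> (complex^3)) set" where
  "M_domain \<xi> =
     {(f, \<rho>, u). (\<exists>h. has_weak_laplacian (rep_L2 f) h) \<and>
                 sq_integrable (M_kinetic \<xi> (rep_L2 f) \<rho> u)}"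

definition M_op ::
    "real \<Rightarrow> real^3 \<Rightarrow> L2 \<times> complex \<times> (complex^3) \<Rightarrow> L2 \<times> complex \<times> (complex^3)" where
  "M_op \<gamma> \<xi> = (\<lambda>(f, \<rho>, u).
     (abs_L2 (M_kinetic \<xi> (rep_L2 f) \<rho> u),
      - \<i> * rc_dot \<xi> u,
      \<chi> j. \<i> * complex_of_real (\<xi> $ j / (norm \<xi>)\<^sup>2) * tau_a (rep_L2 f) + tau_b (rep_L2 f) $ j
           - \<i> * complex_of_real (\<xi> $ j * (\<gamma> + 1 / (norm \<xi>)\<^sup>2)) * \<rho>
           - complex_of_real (1 + (norm \<xi>)\<^sup>2) * u $ j))"

end

theory Submission
  imports Defs "HOL-Probability.Probability"
begin

text \<open>Hermite functions turn \<open>\<lambda> - \<bbbM>(\<xi>)\<close> into an infinite linear system, and an energy argument that is uniform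
in \<open>\<xi>\<close> solves this system in a half plane.

\<^bold>\<open>Coordinates.\<close> Let \<open>h\<^sub>\<alpha>\<close> be the normalised Hermite functions with ground state \<open>\<chi>\<^sub>0\<close>.
In this orthonormal basis \<open>L\<close> is diagonal with eigenvalues \<open>-|\<alpha>|\<close>, multiplication by \<open>v \<bullet> \<xi>\<close> is a
Jacobi matrix \<open>J\<close> that couples neighbouring degrees, and the moments \<open>\<tau>\<^sub>a f\<close> and \<open>\<tau>\<^sub>b f\<close> are the
coefficients of degree \<open>0\<close> and \<open>1\<close>.  The maximal domain, defined by a distributional Laplacian, is
exactly the set of states whose formal image under the matrix is square summable
(\<open>coef_of_weak_laplacian\<close>, \<open>has_weak_laplacian_of_coef\<close>, combined in \<open>M_op_iff_residual\<close>).  One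
inclusion tests with cut-off Hermite functions, the other one expands the test function.

\<^bold>\<open>Coercivity.\<close> Write \<open>a = \<tau>\<^sub>a f\<close>, \<open>b = \<tau>\<^sub>b f\<close>.  In the energy
\<open>|f|\<^sup>2 + |a - \<rho>|\<^sup>2/|\<xi>|\<^sup>2 + \<gamma>|\<rho>|\<^sup>2 + |u|\<^sup>2\<close> all couplings between the components cancel except
the friction \<open>|b - u|\<^sup>2\<close>.  What remains controls every quantity but \<open>a\<close> and \<open>\<rho>\<close>.  These are
recovered by adding a small multiple of \<open>Re(-i(\<xi>\<bullet>b)a\<^sup>*) + Re(-i(\<xi>\<bullet>u)\<rho>\<^sup>*)\<close>, divided by \<open>1 + |\<xi>|\<^sup>2\<close>:
its derivative along the flow contains \<open>|\<xi>|\<^sup>2(|a|\<^sup>2 + \<gamma>|\<rho>|\<^sup>2)\<close> with the right sign.  All constants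
depend only on \<open>\<gamma>\<close> and a lower bound for \<open>|\<xi>|\<^sup>2\<close>, and the gap is uniform up to \<open>|\<xi>| = \<infinity>\<close>
(\<open>hypocoercive_estimate\<close>).

\<^bold>\<open>From finite to infinite.\<close> Summing up to degree \<open>N\<close> leaves a boundary term bounded by \<open>\<surd>N\<close> times
the masses of the shells of degree \<open>N\<close> and \<open>N + 1\<close>.  These masses are summable and
\<open>\<Sum> 1/\<surd>N\<close> diverges, so the boundary term is small along a subsequence (\<open>boundary_limit_zero\<close>).  This
gives the resolvent bound, hence injectivity, on the whole maximal domain
(\<open>resolvent_bound\<close>).  For surjectivity, the Galerkin truncations are injective, hence solvable,
and the same estimate shows that their solutions converge (\<open>resolvent_solution\<close>).\<close>

section \<open>Fourier uniqueness and integration by parts in three dimensions\<close>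

lemma Basis_real3: "(Basis :: (real^3) set) = range (\<lambda>j. axis j 1)"
  by (auto simp: Basis_vec_def)

lemma inj_axis1: "inj (\<lambda>j::3. axis j (1::real))"
  by (auto simp: inj_def axis_eq_axis)

lemma measurable_vec_nth [measurable]: "(\<lambda>v::real^3. v $ j) \<in> borel_measurable borel"
  by (intro borel_measurable_continuous_onI continuous_intros)

lemma has_bochner_integral_prod_coords:
  fixes g :: "3 \<Rightarrow> real \<Rightarrow> complex"
  assumes g: "\<And>j. integrable lborel (g j)"
  shows "has_bochner_integral lborel (\<lambda>v::real^3. \<Prod>j\<in>UNIV. g j (v $ j)) (\<Prod>j\<in>UNIV. LINT x|lborel. g j x)"
proof -
  interpret product_sigma_finite "\<lambda>_::real^3. lborel::real measure" ..
  define G where "G b = g (inv (\<lambda>j. axis j 1) b)" for b :: "real^3"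
  have G: "G (axis j 1) = g j" for j
    by (simp add: G_def inv_f_f[OF inj_axis1])
  define T where "T f = (\<Sum>b\<in>Basis. f b *\<^sub>R b)" for f :: "real^3 \<Rightarrow> real"
  have T: "T f $ j = f (axis j 1)" for f j
    unfolding T_def Basis_real3
    by (subst sum.reindex[OF inj_axis1]) (simp add: axis_def if_distrib cong: if_cong)
  have [measurable]: "g j \<in> borel_measurable borel" for j
    using g[of j, THEN borel_measurable_integrable] by simp
  have Tm: "T \<in> measurable (Pi\<^sub>M Basis (\<lambda>_. lborel)) borel"
    unfolding T_def by measurable
  have eq: "(\<Prod>j\<in>UNIV. g j (T f $ j)) = (\<Prod>b\<in>Basis. G b (f b))" for f
    unfolding Basis_real3 T by (subst prod.reindex[OF inj_axis1]) (simp add: G)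
  have Gi: "integrable lborel (G b)" for b
    by (simp add: G_def g)
  have mm: "(\<lambda>v::real^3. \<Prod>j\<in>UNIV. g j (v $ j)) \<in> borel_measurable borel"
    by measurable
  have L: "lborel = distr (Pi\<^sub>M Basis (\<lambda>_. lborel)) borel T"
    unfolding T_def by (rule lborel_eq)
  have I: "integrable (Pi\<^sub>M Basis (\<lambda>_. lborel)) (\<lambda>f. \<Prod>b\<in>Basis. G b (f b))"
    by (intro product_integrable_prod) (auto simp: Gi)
  have "integral\<^sup>L (Pi\<^sub>M Basis (\<lambda>_. lborel)) (\<lambda>f. \<Prod>b\<in>Basis. G b (f b)) = (\<Prod>b\<in>Basis. integral\<^sup>L lborel (G b))"
    by (intro product_integral_prod) (auto simp: Gi)
  also have "\<dots> = (\<Prod>j\<in>UNIV. integral\<^sup>L lborel (g j))"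
    unfolding Basis_real3 by (subst prod.reindex[OF inj_axis1]) (simp add: G)
  finally have jacobi: "integral\<^sup>L (Pi\<^sub>M Basis (\<lambda>_. lborel)) (\<lambda>f. \<Prod>b\<in>Basis. G b (f b)) = (\<Prod>j\<in>UNIV. integral\<^sup>L lborel (g j))" .
  show ?thesis
    unfolding has_bochner_integral_iff
    apply (subst (1 2) L)
    using I jacobi Tm mm by (simp add: integrable_distr_eq integral_distr eq)
qed

text \<open>Testing against all characters of the \<open>j\<close>-th coordinate determines the image of the signed measure
\<open>G dv\<close> under that coordinate.\<close>

lemma fourier_coord_real:
  fixes G :: "real^3 \<Rightarrow> real"
  assumes G: "integrable lborel G"
    and z: "\<And>s::real. (LINT v|lborel. complex_of_real (G v) * iexp (s * v $ j)) = 0"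
    and A: "A \<in> sets borel"
  shows "(LINT v|lborel. G v * indicator A (v $ j)) = 0"
proof -
  have [measurable]: "G \<in> borel_measurable borel" using G by auto
  (* Levy's uniqueness theorem concerns probability measures, so it is applied to the normalised
     images under the j-th coordinate of the measures with densities P and Q, the positive and
     negative part of G; their characteristic functions agree and their masses are both m. *)
  define P where "P v = max 0 (G v)" for v
  define Q where "Q v = max 0 (- G v)" for v
  have [measurable]: "P \<in> borel_measurable borel" "Q \<in> borel_measurable borel"
    unfolding P_def Q_def by measurable
  have Pi: "integrable lborel P" and Qi: "integrable lborel Q"
    unfolding P_def Q_def using G by auto
  have GPQ: "G v = P v - Q v" for v by (auto simp: P_def Q_def)
  have P0: "P v \<ge> 0" and Q0: "Q v \<ge> 0" for v by (auto simp: P_def Q_def)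
  define \<mu> where "\<mu> R = distr (density lborel (\<lambda>v. ennreal (R v))) borel (\<lambda>v::real^3. v $ j)" for R :: "real^3 \<Rightarrow> real"
  have ii: "(\<integral>x. f x \<partial>\<mu> R) = (LINT v|lborel. R v *\<^sub>R f (v $ j))"
    if [measurable]: "f \<in> borel_measurable borel" "R \<in> borel_measurable borel" and "\<And>v. R v \<ge> 0"
    for R and f :: "real \<Rightarrow> 'b::{banach, second_countable_topology}"
    unfolding \<mu>_def using that(3)
    by (subst integral_distr) (auto simp: integral_density)
  have emu: "emeasure (\<mu> R) UNIV = ennreal (integral\<^sup>L lborel R)"
    if "integrable lborel R" "\<And>v. R v \<ge> 0" for R
    unfolding \<mu>_def using that
    by (subst emeasure_distr) (auto simp: emeasure_density nn_integral_eq_integral)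
  define m where "m = integral\<^sup>L lborel P"
  have "(LINT v|lborel. complex_of_real (G v)) = 0" using z[of 0] by simp
  then have "integral\<^sup>L lborel G = 0" by (simp add: integral_complex_of_real)
  then have m2: "integral\<^sup>L lborel Q = m"
    using Bochner_Integration.integral_diff[OF Pi Qi] by (simp add: GPQ[symmetric] m_def)
  have m0: "m \<ge> 0" unfolding m_def by (rule integral_nonneg_AE) (simp add: P0)
  show ?thesis
  proof (cases "m = 0")
    case True
    have "AE v in lborel. P v = 0" "AE v in lborel. Q v = 0"
      using True m2 integral_nonneg_eq_0_iff_AE[OF Pi] integral_nonneg_eq_0_iff_AE[OF Qi] P0 Q0
      by (auto simp: m_def)
    then have "AE v in lborel. G v * indicator A (v $ j) = 0"
      by eventually_elim (simp add: GPQ)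
    then show ?thesis by (rule integral_eq_zero_AE)
  next
    case False
    then have mp: "m > 0" using m0 by simp
    have rd: "real_distribution (\<mu> (\<lambda>v. R v / m))"
      if "integrable lborel R" "\<And>v. R v \<ge> 0" "integral\<^sup>L lborel R = m" for R
    proof -
      have "emeasure (\<mu> (\<lambda>v. R v / m)) (space (\<mu> (\<lambda>v. R v / m))) = 1"
        using emu[of "\<lambda>v. R v / m"] that mp by (simp add: \<mu>_def)
      then show ?thesis
        unfolding real_distribution_def real_distribution_axioms_def
        by (auto intro!: prob_spaceI simp: \<mu>_def)
    qed
    have RP: "real_distribution (\<mu> (\<lambda>v. P v / m))" by (rule rd) (auto simp: Pi P0 m_def)
    have RQ: "real_distribution (\<mu> (\<lambda>v. Q v / m))" by (rule rd) (auto simp: Qi Q0 m2)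
    have "char (\<mu> (\<lambda>v. P v / m)) s = char (\<mu> (\<lambda>v. Q v / m)) s" for s
    proof -
      have cP: "integrable lborel (\<lambda>v. complex_of_real (P v) * iexp (s * v $ j))"
        by (rule Bochner_Integration.integrable_bound[OF Pi]) (auto simp: norm_mult)
      have cQ: "integrable lborel (\<lambda>v. complex_of_real (Q v) * iexp (s * v $ j))"
        by (rule Bochner_Integration.integrable_bound[OF Qi]) (auto simp: norm_mult)
      have "(LINT v|lborel. complex_of_real (P v) * iexp (s * v $ j)) - (LINT v|lborel. complex_of_real (Q v) * iexp (s * v $ j))
         = (LINT v|lborel. complex_of_real (G v) * iexp (s * v $ j))"
        by (subst Bochner_Integration.integral_diff[OF cP cQ, symmetric]) (simp add: GPQ algebra_simps)
      then have e: "(LINT v|lborel. complex_of_real (P v) * iexp (s * v $ j)) = (LINT v|lborel. complex_of_real (Q v) * iexp (s * v $ j))"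
        using z[of s] by simp
      have c: "char (\<mu> (\<lambda>v. R v / m)) s = (LINT v|lborel. complex_of_real (R v) * iexp (s * v $ j)) / m"
        if [measurable]: "R \<in> borel_measurable borel" and "\<And>v. R v \<ge> 0" for R
        unfolding char_def using that mp
        by (subst ii) (auto simp: scaleR_conv_of_real simp flip: integral_divide_zero)
      show ?thesis by (simp only: c[OF _ P0] c[OF _ Q0] \<open>P \<in> borel_measurable borel\<close> \<open>Q \<in> borel_measurable borel\<close> e)
    qed
    then have eq: "\<mu> (\<lambda>v. P v / m) = \<mu> (\<lambda>v. Q v / m)"
      by (intro Levy_uniqueness RP RQ) auto
    have c: "(\<integral>x. indicator A x \<partial>\<mu> (\<lambda>v. R v / m)) = (LINT v|lborel. R v * indicator A (v $ j)) / m"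
      if [measurable]: "R \<in> borel_measurable borel" and "\<And>v. R v \<ge> 0" for R
      using that mp A by (subst ii) (auto simp flip: integral_divide_zero)
    have "(LINT v|lborel. P v * indicator A (v $ j)) = (LINT v|lborel. Q v * indicator A (v $ j))"
      using c[of P] c[of Q] eq mp by (simp add: P0 Q0)
    moreover have "integrable lborel (\<lambda>v. P v * indicator A (v $ j))"
      by (rule Bochner_Integration.integrable_bound[OF Pi]) (use A in \<open>auto simp: indicator_def\<close>)
    moreover have "integrable lborel (\<lambda>v. Q v * indicator A (v $ j))"
      by (rule Bochner_Integration.integrable_bound[OF Qi]) (use A in \<open>auto simp: indicator_def\<close>)
    ultimately show ?thesis by (simp add: GPQ left_diff_distrib)
  qed
qed

lemma fourier_coord:
  fixes G :: "real^3 \<Rightarrow> complex"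
  assumes G: "integrable lborel G"
    and z: "\<And>s::real. (LINT v|lborel. G v * iexp (s * v $ j)) = 0"
    and A: "A \<in> sets borel"
  shows "(LINT v|lborel. G v * indicator A (v $ j)) = 0"
proof -
  have [measurable]: "G \<in> borel_measurable borel" using G by auto
  have b: "integrable lborel (\<lambda>v. G v * iexp (s * v $ j))" for s
    by (rule Bochner_Integration.integrable_bound[OF G]) (auto simp: norm_mult)
  have [measurable]: "(\<lambda>v. cnj (G v)) \<in> borel_measurable borel"
    by (rule measurable_compose[OF \<open>G \<in> borel_measurable borel\<close>])
      (intro borel_measurable_continuous_onI continuous_intros)
  have bc: "integrable lborel (\<lambda>v. cnj (G v) * iexp (s * v $ j))" for s
    by (rule Bochner_Integration.integrable_bound[OF G]) (auto simp: norm_mult)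
  have zc: "(LINT v|lborel. cnj (G v) * iexp (s * v $ j)) = 0" for s
  proof -
    have "(LINT v|lborel. cnj (G v * iexp ((-s) * v $ j))) = cnj (LINT v|lborel. G v * iexp ((-s) * v $ j))"
      by (rule Bochner_Integration.integral_cnj)
    also have "\<dots> = 0" by (simp only: z complex_cnj_zero)
    finally show ?thesis by (simp add: exp_cnj)
  qed
  have re: "(LINT v|lborel. complex_of_real (Re (G v)) * iexp (s * v $ j)) = 0" for s
  proof -
    have "complex_of_real (Re (G v)) * iexp (s * v $ j) = (G v * iexp (s * v $ j) + cnj (G v) * iexp (s * v $ j)) / 2" for v
      by (simp add: complex_eq_iff algebra_simps)
    then show ?thesis using b[of s] bc[of s] z[of s] zc[of s]
      by (simp only: integral_divide_zero Bochner_Integration.integral_add) simp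
  qed
  have im: "(LINT v|lborel. complex_of_real (Im (G v)) * iexp (s * v $ j)) = 0" for s
  proof -
    have "complex_of_real (Im (G v)) * iexp (s * v $ j) = (G v * iexp (s * v $ j) - cnj (G v) * iexp (s * v $ j)) / (2 * \<i>)" for v
      unfolding left_diff_distrib[symmetric] complex_diff_cnj by (subst nonzero_eq_divide_eq, simp, simp only: of_real_mult of_real_numeral mult_ac)
    then show ?thesis using b[of s] bc[of s] z[of s] zc[of s]
      by (simp only: integral_divide_zero Bochner_Integration.integral_diff) simp
  qed
  have iA: "integrable lborel (\<lambda>v. G v * indicator A (v $ j))"
    by (rule Bochner_Integration.integrable_bound[OF G]) (use A in \<open>auto simp: indicator_def\<close>)
  have ob: "Re (of_bool P) = of_bool P" "Im (of_bool P) = 0" for P by (cases P; simp)+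
  have "Re (LINT v|lborel. G v * indicator A (v $ j)) = 0"
    using fourier_coord_real[OF _ re A] G iA
    by (subst integral_Re[symmetric]) (auto simp: indicator_def ob)
  moreover have "Im (LINT v|lborel. G v * indicator A (v $ j)) = 0"
    using fourier_coord_real[OF _ im A] G iA
    by (subst integral_Im[symmetric]) (auto simp: indicator_def ob)
  ultimately show ?thesis by (simp add: complex_eq_iff)
qed

text \<open>Boxes generate the Borel sets and are closed under intersection; the sets on which the integral
vanishes form a Dynkin system.\<close>

lemma zero_AE_of_boxes:
  fixes F :: "real^3 \<Rightarrow> complex"
  assumes F: "integrable lborel F"
    and z: "\<And>a b. (LINT v|lborel. indicator (box a b) v *\<^sub>R F v) = 0"
  shows "AE v in lborel. F v = 0"
proof -
  have [measurable]: "F \<in> borel_measurable borel" using F by auto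
  have si: "set_integrable lborel A F" if "A \<in> sets borel" for A
    unfolding set_integrable_def using F that by (intro integrable_mult_indicator) auto
  (* The Dynkin system argument below needs the whole space, which is not a box. *)
  have tot: "(LINT v|lborel. F v) = 0"
  proof -
    have "(\<lambda>n. LINT v|lborel. indicator (box (vec (- real n)) (vec (real n))) v *\<^sub>R F v) \<longlonglongrightarrow> (LINT v|lborel. F v)"
    proof (rule integral_dominated_convergence[where w="\<lambda>v. norm (F v)"])
      show "AE v in lborel. (\<lambda>n. indicat_real (box (vec (- real n)) (vec (real n))) v *\<^sub>R F v) \<longlonglongrightarrow> F v"
      proof (rule AE_I2)
        fix v :: "real^3"
        obtain n0 where n0: "real n0 > norm v" using reals_Archimedean2 by blast
        have "v \<in> box (vec (- real n)) (vec (real n))" if "n \<ge> n0" for n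
        proof -
          have "\<bar>v $ i\<bar> < real n" for i
            using component_le_norm_cart[of v i] n0 that by linarith
          then show ?thesis by (auto simp: mem_box_cart abs_less_iff minus_less_iff)
        qed
        then have "\<forall>\<^sub>F n in sequentially. indicat_real (box (vec (- real n)) (vec (real n))) v *\<^sub>R F v = F v"
          unfolding eventually_sequentially by (intro exI[of _ n0]) auto
        then show "(\<lambda>n. indicat_real (box (vec (- real n)) (vec (real n))) v *\<^sub>R F v) \<longlonglongrightarrow> F v"
          by (rule tendsto_eventually)
      qed
    qed (use F in \<open>auto simp: indicator_def\<close>)
    then show ?thesis by (simp add: z LIMSEQ_const_iff)
  qed
  have all: "set_lebesgue_integral lborel A F = 0" if "A \<in> sets borel" for A
  proof -
    have "Int_stable (range (\<lambda>(a, b). box a b :: (real^3) set))"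
      by (auto simp: Int_stable_def box_Int_box)
    moreover have "range (\<lambda>(a, b). box a b :: (real^3) set) \<subseteq> Pow UNIV" by simp
    moreover have "A \<in> sigma_sets UNIV (range (\<lambda>(a, b). box a b))"
      using that by (simp add: borel_eq_box)
    ultimately show ?thesis
    proof (induction rule: sigma_sets_induct_disjoint)
      case (basic A)
      then show ?case using z by (auto simp: set_lebesgue_integral_def)
    next
      case empty
      then show ?case by (simp add: set_lebesgue_integral_def)
    next
      case (compl A)
      then have A: "A \<in> sets borel" by (simp add: borel_eq_box)
      have "indicat_real (UNIV - A) v *\<^sub>R F v = F v - indicat_real A v *\<^sub>R F v" for v
        by (auto simp: indicator_def)
      then show ?case
        using compl(2) tot si[OF A] F unfolding set_lebesgue_integral_def set_integrable_def by simp
    next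
      case (union A)
      then have A: "A i \<in> sets borel" for i by (auto simp: borel_eq_box)
      have "(LINT x:(\<Union>i. A i)|lborel. F x) = (\<Sum>i. (LINT x:(A i)|lborel. F x))"
        using A union(1) by (intro lebesgue_integral_countable_add si) (auto simp: disjoint_family_on_def)
      then show ?case using union by simp
    qed
  qed
  have "set_lebesgue_integral lborel A (\<lambda>v. Re (F v)) = 0" if "A \<in> sets borel" for A
    using integral_Re[OF si[OF that, unfolded set_integrable_def]] all[OF that]
    by (simp add: set_lebesgue_integral_def)
  then have re: "AE v in lborel. Re (F v) = 0"
    by (intro density_unique_real[of lborel "\<lambda>v. Re (F v)" "\<lambda>_. 0"]) (use F in \<open>auto simp: set_lebesgue_integral_def\<close>)
  have "set_lebesgue_integral lborel A (\<lambda>v. Im (F v)) = 0" if "A \<in> sets borel" for A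
    using integral_Im[OF si[OF that, unfolded set_integrable_def]] all[OF that]
    by (simp add: set_lebesgue_integral_def)
  then have im: "AE v in lborel. Im (F v) = 0"
    by (intro density_unique_real[of lborel "\<lambda>v. Im (F v)" "\<lambda>_. 0"]) (use F in \<open>auto simp: set_lebesgue_integral_def\<close>)
  from re im show ?thesis by eventually_elim (simp add: complex_eq_iff)
qed

text \<open>The three characters are traded one after the other for indicator functions of intervals.\<close>

lemma fourier_unique:
  fixes F :: "real^3 \<Rightarrow> complex"
  assumes F: "integrable lborel F"
    and z: "\<And>t. (LINT v|lborel. F v * iexp (t \<bullet> v)) = 0"
  shows "AE v in lborel. F v = 0"
proof (rule zero_AE_of_boxes[OF F])
  fix a b :: "real^3"
  have [measurable]: "F \<in> borel_measurable borel" using F by auto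
  define I where "I j = {a $ j <..< b $ j}" for j
  define XX where "XX j v = (indicator (I j) (v $ j) :: complex)" for j and v :: "real^3"
  have [measurable]: "XX j \<in> borel_measurable borel" for j
    unfolding XX_def I_def by measurable
  have XX: "norm (XX j v) \<le> 1" for j v by (simp add: XX_def indicator_def)
  define e where "e j s v = iexp (s * v $ j)" for j :: 3 and s :: real and v :: "real^3"
  have e: "norm (e j s v) = 1" for j s v by (simp add: e_def)
  have [measurable]: "e j s \<in> borel_measurable borel" for j s
    unfolding e_def by measurable
  have e0: "e j 0 v = 1" for j v by (simp add: e_def)
  have step: "(LINT v|lborel. G v * XX j v) = 0" if "integrable lborel G" "\<And>s. (LINT v|lborel. G v * e j s v) = 0" for G j
    using fourier_coord[OF that(1), of j "I j"] that(2) unfolding XX_def e_def I_def by simp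
  have bd: "integrable lborel (\<lambda>v. F v * g v)" if [measurable]: "g \<in> borel_measurable borel" and "\<And>v. norm (g v) \<le> 1" for g
    by (rule Bochner_Integration.integrable_bound[OF F]) (auto simp: norm_mult that mult_left_le)
  have 1: "(LINT v|lborel. F v * e 1 s1 v * e 2 s2 v * e 3 s3 v) = 0" for s1 s2 s3
  proof -
    have "F v * e 1 s1 v * e 2 s2 v * e 3 s3 v = F v * iexp (vector [s1, s2, s3] \<bullet> v)" for v
      by (simp add: e_def inner_vec_def sum_3 exp_add[symmetric] algebra_simps)
    then show ?thesis by (simp only: z)
  qed
  have 2: "(LINT v|lborel. (F v * e 1 s1 v * e 2 s2 v) * XX 3 v) = 0" for s1 s2
    using bd[of "\<lambda>v. e 1 s1 v * e 2 s2 v"] 1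
    by (intro step) (auto simp: norm_mult e mult.assoc)
  have 3: "(LINT v|lborel. (F v * e 1 s1 v * XX 3 v) * XX 2 v) = 0" for s1
    using bd[of "\<lambda>v. e 1 s1 v * XX 3 v"] 2
    by (intro step) (auto simp: norm_mult e XX mult_ac)
  have 4: "(LINT v|lborel. (F v * XX 2 v * XX 3 v) * XX 1 v) = 0"
    using bd[of "\<lambda>v. XX 2 v * XX 3 v"] 3
    by (intro step) (auto simp: norm_mult XX mult_le_one mult_ac)
  have "indicator (box a b) v *\<^sub>R F v = (F v * XX 2 v * XX 3 v) * XX 1 v" for v
    unfolding XX_def I_def by (auto simp: indicator_def mem_box_cart forall_3)
  then show "(LINT v|lborel. indicator (box a b) v *\<^sub>R F v) = 0" using 4 by simp
qed

lemma integral_translate: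
  fixes F :: "'a::euclidean_space \<Rightarrow> 'b::{banach, second_countable_topology}"
  assumes "F \<in> borel_measurable borel"
  shows "(LINT v|lborel. F (v + c)) = (LINT v|lborel. F v)"
  using integral_distr[of "(+) c" lborel borel F] assms lborel_distr_plus[of c]
  by (simp add: add.commute)

text \<open>Translation invariance of Lebesgue measure replaces Fubini's theorem and the fundamental theorem of
calculus: every difference quotient has integral zero.\<close>

lemma integral_directional_derivative_zero:
  fixes F F' :: "'a::euclidean_space \<Rightarrow> complex" and G :: "'a \<Rightarrow> real"
  assumes c: "continuous_on UNIV F" and m: "F' \<in> borel_measurable borel"
    and F: "integrable lborel F" and G: "integrable lborel G"
    and d: "\<And>v. ((\<lambda>t. F (v + t *\<^sub>R e)) has_vector_derivative F' v) (at 0)"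
    and b: "\<And>v t. \<bar>t\<bar> \<le> 1 \<Longrightarrow> norm (F' (v + t *\<^sub>R e)) \<le> G v"
  shows "(LINT v|lborel. F' v) = 0"
proof -
  have [measurable]: "F \<in> borel_measurable borel" by (rule borel_measurable_continuous_onI[OF c])
  note m[measurable]
  (* The difference quotients Q n integrate to 0 by translation invariance; the mean value
     inequality gives the majorant G. *)
  define r where "r n = 1 / real (Suc n)" for n
  have r: "0 < r n" "r n \<le> 1" for n by (auto simp: r_def)
  define Q where "Q n v = (F (v + r n *\<^sub>R e) - F v) /\<^sub>R r n" for n v
  have [measurable]: "Q n \<in> borel_measurable borel" for n unfolding Q_def by measurable
  have Ft: "integrable lborel (\<lambda>v. F (v + c))" for c
    using integrable_distr[of "(+) c" lborel borel F] F lborel_distr_plus[of c]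
    by (simp add: add.commute)
  have "(LINT v|lborel. Q n v) = 0" for n
    unfolding Q_def using Ft[of "r n *\<^sub>R e"] F integral_translate[of F "r n *\<^sub>R e"] by simp
  moreover have "(\<lambda>n. LINT v|lborel. Q n v) \<longlonglongrightarrow> (LINT v|lborel. F' v)"
  proof (rule integral_dominated_convergence[where w=G])
    show "AE v in lborel. (\<lambda>n. Q n v) \<longlonglongrightarrow> F' v"
    proof (rule AE_I2)
      fix v
      have "((\<lambda>t. norm (F (v + t *\<^sub>R e) - F v - t *\<^sub>R F' v) / norm t) \<longlongrightarrow> 0) (at 0)"
        using d[of v] by (simp add: has_vector_derivative_def has_derivative_at)
      also have "?this \<longleftrightarrow> ((\<lambda>t. norm ((F (v + t *\<^sub>R e) - F v) /\<^sub>R t - F' v)) \<longlongrightarrow> 0) (at 0)"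
      proof (rule Lim_cong_within)
        fix t :: real assume t: "t \<noteq> 0"
        have "(F (v + t *\<^sub>R e) - F v) /\<^sub>R t - F' v = (F (v + t *\<^sub>R e) - F v - t *\<^sub>R F' v) /\<^sub>R t"
          using t by (simp add: scaleR_diff_right)
        then show "norm (F (v + t *\<^sub>R e) - F v - t *\<^sub>R F' v) / norm t = norm ((F (v + t *\<^sub>R e) - F v) /\<^sub>R t - F' v)"
          using t by (simp add: divide_inverse_commute abs_inverse)
      qed simp_all
      finally have "((\<lambda>t. (F (v + t *\<^sub>R e) - F v) /\<^sub>R t) \<longlongrightarrow> F' v) (at 0)"
        by (simp add: tendsto_norm_zero_iff LIM_zero_iff)
      moreover have "filterlim r (at 0) sequentially"
        unfolding filterlim_at using r LIMSEQ_Suc[OF lim_1_over_n] 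
        by (auto simp: less_imp_neq[symmetric] r_def[abs_def])
      ultimately show "(\<lambda>n. Q n v) \<longlonglongrightarrow> F' v"
        unfolding Q_def by (rule filterlim_compose)
    qed
    show "AE v in lborel. norm (Q n v) \<le> G v" for n
    proof (rule AE_I2)
      fix v
      have deriv1: "((\<lambda>t. F (v + t *\<^sub>R e)) has_vector_derivative F' (v + t *\<^sub>R e)) (at t)" for t
      proof -
        have "((\<lambda>s. s - t) has_vector_derivative 1) (at t)"
          unfolding has_real_derivative_iff_has_vector_derivative[symmetric]
          by (auto intro!: derivative_eq_intros)
        then have "((\<lambda>s. F ((v + t *\<^sub>R e) + (s - t) *\<^sub>R e)) has_vector_derivative 1 *\<^sub>R F' (v + t *\<^sub>R e)) (at t)"
          using vector_diff_chain_at[of "\<lambda>s. s - t" 1 t "\<lambda>s. F ((v + t *\<^sub>R e) + s *\<^sub>R e)" "F' (v + t *\<^sub>R e)"] d[of "v + t *\<^sub>R e"]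
          by (auto simp: o_def)
        then show ?thesis by (simp add: algebra_simps)
      qed
      have "norm (F (v + r n *\<^sub>R e) - F (v + 0 *\<^sub>R e)) \<le> norm (r n - 0) * G v"
      proof -
        have "norm (F (v + 0 *\<^sub>R e) - F (v + r n *\<^sub>R e)) \<le> G v * norm (0 - r n)"
        proof (rule differentiable_bound[where S="{-1..1}" and f'="\<lambda>t s. s *\<^sub>R F' (v + t *\<^sub>R e)"])
          show "((\<lambda>t. F (v + t *\<^sub>R e)) has_derivative (\<lambda>s. s *\<^sub>R F' (v + t *\<^sub>R e))) (at t within {-1..1})" for t
            using deriv1[of t] by (simp add: has_vector_derivative_def has_derivative_at_withinI)
          show "onorm (\<lambda>s. s *\<^sub>R F' (v + t *\<^sub>R e)) \<le> G v" if "t \<in> {-1..1}" for t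
            by (rule onorm_le) (use b[of t v] that in \<open>simp add: abs_le_iff mult_mono' mult.commute[of "G v"] mult_left_mono\<close>)
        qed (use r[of n] in auto)
        then show ?thesis by (simp add: norm_minus_commute mult.commute)
      qed
      moreover have "norm (Q n v) = norm (F (v + r n *\<^sub>R e) - F (v + 0 *\<^sub>R e)) / r n"
        unfolding Q_def using r[of n] by (simp only: norm_scaleR) (simp add: divide_inverse mult.commute)
      ultimately show "norm (Q n v) \<le> G v"
        using r[of n] by (simp add: pos_divide_le_eq mult.commute)
    qed
  qed (use G in auto)
  ultimately show ?thesis by (simp add: LIMSEQ_const_iff)
qed

section \<open>Hermite functions on the line\<close>

text \<open>The eigenfunctions of the harmonic oscillator for the weight \<open>exp (-x\<^sup>2/4)\<close>, normalised; the
recursion is the action of the creation operator.\<close>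

fun hermite1 :: "nat \<Rightarrow> real \<Rightarrow> real" where
  "hermite1 0 x = (2 * pi) powr (- 1 / 4) * exp (- x\<^sup>2 / 4)"
| "hermite1 (Suc 0) x = x * hermite1 0 x"
| "hermite1 (Suc (Suc n)) x = (x * hermite1 (Suc n) x - sqrt (Suc n) * hermite1 n x) / sqrt (Suc (Suc n))"

declare hermite1.simps [simp del]

text \<open>For \<open>n = 0\<close> the truncated index \<open>n - 1\<close> is harmless, as its coefficient is \<open>\<surd>0\<close>.\<close>

lemma mult_hermite1: "x * hermite1 n x = sqrt (Suc n) * hermite1 (Suc n) x + sqrt n * hermite1 (n - 1) x"
proof (cases n)
  case (Suc m)
  then show ?thesis by (simp add: hermite1.simps(3) del: of_nat_Suc)
qed (simp add: hermite1.simps)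

text \<open>The annihilation operator \<open>d/dx + x/2\<close> lowers the index.\<close>

lemma hermite1_has_derivative:
  "(hermite1 n has_real_derivative (sqrt n * hermite1 (n - 1) x - x / 2 * hermite1 n x)) (at x)"
proof (induction n arbitrary: x rule: induct_nat_012)
  case 0
  show ?case unfolding hermite1.simps
    by (auto intro!: derivative_eq_intros simp: power2_eq_square)
next
  case 1
  show ?case unfolding hermite1.simps
    by (auto intro!: derivative_eq_intros simp: power2_eq_square hermite1.simps algebra_simps)
next
  case (ge2 n)
  have s: "sqrt (real (Suc n)) * sqrt (real (Suc n)) = real (Suc n)"
    "sqrt (real (Suc (Suc n))) * sqrt (real (Suc (Suc n))) = real (Suc (Suc n))" by simp_all
  have p: "sqrt (real (Suc (Suc n))) > 0" by simp
  have "(hermite1 (Suc (Suc n)) has_real_derivative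
      (hermite1 (Suc n) x + x * (sqrt (Suc n) * hermite1 n x - x / 2 * hermite1 (Suc n) x)
        - sqrt (Suc n) * (sqrt n * hermite1 (n - 1) x - x / 2 * hermite1 n x)) / sqrt (Suc (Suc n))) (at x)"
    unfolding hermite1.simps(3)
    by (rule DERIV_cdivide derivative_eq_intros ge2(1) ge2(2)[unfolded diff_Suc_1] refl)+
      (simp add: algebra_simps del: of_nat_Suc)
  note d = this
  have "hermite1 (Suc n) x + x * (sqrt (Suc n) * hermite1 n x - x / 2 * hermite1 (Suc n) x)
        - sqrt (Suc n) * (sqrt n * hermite1 (n - 1) x - x / 2 * hermite1 n x)
      = hermite1 (Suc n) x + sqrt (Suc n) * (x * hermite1 n x - sqrt n * hermite1 (n - 1) x)
        - x / 2 * (x * hermite1 (Suc n) x - sqrt (Suc n) * hermite1 n x)"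
    by (simp add: algebra_simps)
  also have "\<dots> = sqrt (Suc (Suc n)) * (sqrt (Suc (Suc n)) * hermite1 (Suc n) x - x / 2 * hermite1 (Suc (Suc n)) x)"
  proof -
    have q: "sqrt (real (Suc n)) * (sqrt (real (Suc n)) * y) = real (Suc n) * y"
      "sqrt (real (Suc (Suc n))) * (sqrt (real (Suc (Suc n))) * y) = (real (Suc n) + 1) * y" for y
      unfolding mult.assoc[symmetric] s by simp_all
    have "x * hermite1 n x - sqrt n * hermite1 (n - 1) x = sqrt (Suc n) * hermite1 (Suc n) x"
      "x * hermite1 (Suc n) x - sqrt (Suc n) * hermite1 n x = sqrt (Suc (Suc n)) * hermite1 (Suc (Suc n)) x"
      using mult_hermite1[of x n] mult_hermite1[of x "Suc n"] by simp_all
    then show ?thesis by (simp only: right_diff_distrib q) (simp only: distrib_right algebra_simps)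
  qed
  finally show ?case using d p by simp
qed

text \<open>The eigenvalue equation of the harmonic oscillator.\<close>

lemma hermite1_second_derivative:
  "((\<lambda>x. sqrt n * hermite1 (n - 1) x - x / 2 * hermite1 n x) has_real_derivative
     (x\<^sup>2 / 4 - 1 / 2 - n) * hermite1 n x) (at x)"
proof -
  have "((\<lambda>x. sqrt n * hermite1 (n - 1) x - x / 2 * hermite1 n x) has_real_derivative
      sqrt n * (sqrt (n - 1 :: nat) * hermite1 (n - 1 - 1) x - x / 2 * hermite1 (n - 1) x)
      - (1 / 2 * hermite1 n x + x / 2 * (sqrt n * hermite1 (n - 1) x - x / 2 * hermite1 n x))) (at x)"
    by (rule derivative_eq_intros hermite1_has_derivative refl | simp)+
  moreover have "sqrt n * (sqrt (n - 1 :: nat) * hermite1 (n - 1 - 1) x - x / 2 * hermite1 (n - 1) x)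
      - (1 / 2 * hermite1 n x + x / 2 * (sqrt n * hermite1 (n - 1) x - x / 2 * hermite1 n x))
      = (x\<^sup>2 / 4 - 1 / 2 - n) * hermite1 n x"
  proof (cases n)
    case (Suc m)
    have s: "sqrt (real (Suc m)) * sqrt (real (Suc m)) = real (Suc m)" by simp
    have "sqrt (Suc m) * (sqrt m * hermite1 (m - 1) x - x / 2 * hermite1 m x)
      - (1 / 2 * hermite1 (Suc m) x + x / 2 * (sqrt (Suc m) * hermite1 m x - x / 2 * hermite1 (Suc m) x))
      = - sqrt (Suc m) * (x * hermite1 m x - sqrt m * hermite1 (m - 1) x) + (x\<^sup>2 / 4 - 1 / 2) * hermite1 (Suc m) x"
      by (simp add: algebra_simps power2_eq_square)
    also have "x * hermite1 m x - sqrt m * hermite1 (m - 1) x = sqrt (Suc m) * hermite1 (Suc m) x"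
      using mult_hermite1[of x m] by simp
    also have "- sqrt (Suc m) * (sqrt (Suc m) * hermite1 (Suc m) x) = - real (Suc m) * hermite1 (Suc m) x"
      using s by (metis mult.assoc mult_minus_left)
    finally show ?thesis using Suc by (simp add: algebra_simps del: of_nat_Suc)
  qed (simp add: algebra_simps power2_eq_square)
  ultimately show ?thesis by simp
qed

lemma abs_le_exp_square:
  fixes x \<delta> :: real assumes "\<delta> > 0" shows "\<bar>x\<bar> \<le> (1 + 1 / \<delta>) * exp (\<delta> * x\<^sup>2)"
proof -
  have "0 \<le> (\<bar>x\<bar> - 1)\<^sup>2" by simp
  then have "\<bar>x\<bar> \<le> 1 + x\<^sup>2" by (simp add: power2_diff)
  also have "x\<^sup>2 \<le> exp (\<delta> * x\<^sup>2) / \<delta>"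
  proof -
    have "x\<^sup>2 * \<delta> \<le> exp (\<delta> * x\<^sup>2)"
      using exp_ge_add_one_self[of "\<delta> * x\<^sup>2"] unfolding mult.commute[of "x\<^sup>2"] by linarith
    then show ?thesis using assms by (simp only: pos_le_divide_eq)
  qed
  also have "1 \<le> exp (\<delta> * x\<^sup>2)" using assms by simp
  finally show ?thesis by (simp add: algebra_simps)
qed

text \<open>Every multiplication by \<open>x\<close> costs an arbitrarily small part of the decay rate, so the induction needs
all rates below \<open>1/4\<close> at once.\<close>

lemma hermite1_gaussian_bound: "\<forall>s<1/4. \<exists>C. \<forall>x. \<bar>hermite1 n x\<bar> \<le> C * exp (- s * x\<^sup>2)"
proof (induction n rule: induct_nat_012)
  case 0
  have "\<bar>hermite1 0 x\<bar> \<le> (2 * pi) powr (- 1 / 4) * exp (- s * x\<^sup>2)" if "s < 1/4" for s x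
    unfolding hermite1.simps using that mult_right_mono[of s "1/4" "x\<^sup>2"] by (simp add: abs_mult)
  then show ?case by blast
next
  case 1
  show ?case
  proof (intro allI impI)
    fix s :: real assume s: "s < 1/4"
    define \<delta> where "\<delta> = 1/4 - s"
    have "\<bar>hermite1 (Suc 0) x\<bar> \<le> ((1 + 1 / \<delta>) * (2 * pi) powr (- 1 / 4)) * exp (- s * x\<^sup>2)" for x
    proof -
      have "\<bar>hermite1 (Suc 0) x\<bar> = \<bar>x\<bar> * ((2 * pi) powr (- 1 / 4) * exp (- x\<^sup>2 / 4))"
        by (simp add: hermite1.simps abs_mult)
      also have "\<dots> \<le> ((1 + 1 / \<delta>) * exp (\<delta> * x\<^sup>2)) * ((2 * pi) powr (- 1 / 4) * exp (- x\<^sup>2 / 4))"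
        using s by (intro mult_right_mono abs_le_exp_square) (auto simp: \<delta>_def)
      also have "\<dots> = ((1 + 1 / \<delta>) * (2 * pi) powr (- 1 / 4)) * (exp (\<delta> * x\<^sup>2) * exp (- x\<^sup>2 / 4))"
        by simp
      also have "exp (\<delta> * x\<^sup>2) * exp (- x\<^sup>2 / 4) = exp (- s * x\<^sup>2)"
        unfolding \<delta>_def exp_add[symmetric] by (simp add: algebra_simps)
      finally show ?thesis .
    qed
    then show "\<exists>C. \<forall>x. \<bar>hermite1 (Suc 0) x\<bar> \<le> C * exp (- s * x\<^sup>2)" by blast
  qed
next
  case (ge2 n)
  show ?case
  proof (intro allI impI)
    fix s :: real assume s: "s < 1/4"
    define \<delta> where "\<delta> = (1/4 - s) / 2"
    have \<delta>: "\<delta> > 0" "s + \<delta> < 1/4" using s by (auto simp: \<delta>_def field_simps)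
    obtain C where C: "\<bar>hermite1 (Suc n) x\<bar> \<le> C * exp (- (s + \<delta>) * x\<^sup>2)" for x using ge2(2) \<delta> by blast
    obtain D where D: "\<bar>hermite1 n x\<bar> \<le> D * exp (- s * x\<^sup>2)" for x using ge2(1) s by blast
    have "\<bar>hermite1 (Suc (Suc n)) x\<bar> \<le> (((1 + 1 / \<delta>) * C + sqrt (Suc n) * D) / sqrt (Suc (Suc n))) * exp (- s * x\<^sup>2)" for x
    proof -
      have "\<bar>hermite1 (Suc (Suc n)) x\<bar> \<le> (\<bar>x\<bar> * \<bar>hermite1 (Suc n) x\<bar> + sqrt (Suc n) * \<bar>hermite1 n x\<bar>) / sqrt (Suc (Suc n))"
        unfolding hermite1.simps(3) abs_divide
        by (auto intro!: divide_right_mono order_trans[OF abs_triangle_ineq4] simp: abs_mult)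
      also have "\<bar>x\<bar> * \<bar>hermite1 (Suc n) x\<bar> \<le> ((1 + 1 / \<delta>) * exp (\<delta> * x\<^sup>2)) * (C * exp (- (s + \<delta>) * x\<^sup>2))"
        using \<delta> by (intro mult_mono abs_le_exp_square C) auto
      also have "\<dots> = (1 + 1 / \<delta>) * C * (exp (\<delta> * x\<^sup>2) * exp (- (s + \<delta>) * x\<^sup>2))" by simp
      also have "exp (\<delta> * x\<^sup>2) * exp (- (s + \<delta>) * x\<^sup>2) = exp (- s * x\<^sup>2)"
        unfolding exp_add[symmetric] by (simp add: algebra_simps)
      also have "sqrt (Suc n) * \<bar>hermite1 n x\<bar> \<le> sqrt (Suc n) * (D * exp (- s * x\<^sup>2))"
        by (intro mult_left_mono D) auto
      finally show ?thesis by (simp add: divide_right_mono algebra_simps)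
    qed
    then show "\<exists>C. \<forall>x. \<bar>hermite1 (Suc (Suc n)) x\<bar> \<le> C * exp (- s * x\<^sup>2)" by blast
  qed
qed

lemma hermite1_bound: obtains C where "C \<ge> 0" "\<And>x. \<bar>hermite1 n x\<bar> \<le> C * exp (- x\<^sup>2 / 8)"
proof -
  obtain C where C: "\<bar>hermite1 n x\<bar> \<le> C * exp (- (1/8) * x\<^sup>2)" for x
    using hermite1_gaussian_bound[of n, rule_format, of "1/8"] by auto
  have "0 \<le> C" using C[of 0] by simp
  then show ?thesis using C that by simp
qed

lemma hermite1_continuous: "continuous_on A (hermite1 n)"
  by (meson DERIV_isCont continuous_at_imp_continuous_on hermite1_has_derivative)

lemma hermite1_measurable [measurable]: "hermite1 n \<in> borel_measurable borel"
  by (rule borel_measurable_continuous_onI[OF hermite1_continuous])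

lemma integrable_gaussian: "a > 0 \<Longrightarrow> integrable lborel (\<lambda>x::real. exp (- a * x\<^sup>2))"
proof -
  assume a: "a > 0"
  have "integrable lborel (\<lambda>x::real. exp (- x\<^sup>2))"
    using has_bochner_integral_even_function[OF gaussian_moment_0] by (auto simp: has_bochner_integral_iff)
  from lborel_integrable_real_affine[OF this, of "sqrt a" 0] a
  show ?thesis by (simp add: power_mult_distrib)
qed

lemma hermite1_mult_bound: obtains K where "K \<ge> 0" "\<And>x. \<bar>hermite1 n x * hermite1 m x\<bar> \<le> K * exp (- (1/4) * x\<^sup>2)"
proof -
  obtain C where C: "C \<ge> 0" "\<And>x. \<bar>hermite1 n x\<bar> \<le> C * exp (- x\<^sup>2 / 8)" using hermite1_bound by blast
  obtain D where D: "D \<ge> 0" "\<And>x. \<bar>hermite1 m x\<bar> \<le> D * exp (- x\<^sup>2 / 8)" using hermite1_bound by blast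
  have "\<bar>hermite1 n x * hermite1 m x\<bar> \<le> C * D * exp (- (1/4) * x\<^sup>2)" for x
  proof -
    have "\<bar>hermite1 n x\<bar> * \<bar>hermite1 m x\<bar> \<le> (C * exp (- x\<^sup>2 / 8)) * (D * exp (- x\<^sup>2 / 8))"
      using C D by (intro mult_mono) auto
    also have "\<dots> = C * D * (exp (- x\<^sup>2 / 8) * exp (- x\<^sup>2 / 8))" by simp
    also have "exp (- x\<^sup>2 / 8) * exp (- x\<^sup>2 / 8) = exp (- (1/4) * x\<^sup>2)"
      unfolding exp_add[symmetric] by simp
    finally show ?thesis by (simp add: abs_mult)
  qed
  then show ?thesis using that[of "C * D"] C D by simp
qed

lemma integrable_hermite1_mult: "integrable lborel (\<lambda>x. hermite1 n x * hermite1 m x)"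
proof -
  obtain K where K: "K \<ge> 0" "\<And>x. \<bar>hermite1 n x * hermite1 m x\<bar> \<le> K * exp (- (1/4) * x\<^sup>2)"
    using hermite1_mult_bound by blast
  show ?thesis
  proof (rule Bochner_Integration.integrable_bound)
    show "integrable lborel (\<lambda>x::real. K * exp (- (1/4) * x\<^sup>2))"
      by (intro integrable_mult_right integrable_gaussian) simp
    show "AE x in lborel. norm (hermite1 n x * hermite1 m x) \<le> norm (K * exp (- (1/4) * x\<^sup>2))"
      using K by (auto intro!: AE_I2)
  qed measurable
qed

lemma hermite1_mult_derivative:
  "((\<lambda>x. hermite1 n x * hermite1 m x) has_real_derivative
     sqrt m * (hermite1 n x * hermite1 (m - 1) x) - sqrt (Suc n) * (hermite1 (Suc n) x * hermite1 m x)) (at x)"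
proof -
  have "((\<lambda>x. hermite1 n x * hermite1 m x) has_real_derivative
     (sqrt n * hermite1 (n - 1) x - x / 2 * hermite1 n x) * hermite1 m x + (sqrt m * hermite1 (m - 1) x - x / 2 * hermite1 m x) * hermite1 n x) (at x)"
    by (intro DERIV_mult hermite1_has_derivative)
  also have "(sqrt n * hermite1 (n - 1) x - x / 2 * hermite1 n x) * hermite1 m x
     + (sqrt m * hermite1 (m - 1) x - x / 2 * hermite1 m x) * hermite1 n x
     = sqrt m * (hermite1 n x * hermite1 (m - 1) x) - (x * hermite1 n x - sqrt n * hermite1 (n - 1) x) * hermite1 m x"
    by (simp add: algebra_simps)
  finally show ?thesis unfolding mult_hermite1 by (simp add: mult.assoc)
qed

text \<open>The integral of the derivative of \<open>h\<^sub>n h\<^sub>m\<close> vanishes.\<close>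

lemma hermite1_ladder_integral:
  "sqrt (Suc n) * (LINT x|lborel. hermite1 (Suc n) x * hermite1 m x) = sqrt m * (LINT x|lborel. hermite1 n x * hermite1 (m - 1) x)"
proof -
  define F' where "F' x = sqrt m * (hermite1 n x * hermite1 (m - 1) x) - sqrt (Suc n) * (hermite1 (Suc n) x * hermite1 m x)" for x
  obtain K1 where K1: "K1 \<ge> 0" "\<And>x. \<bar>hermite1 n x * hermite1 (m - 1) x\<bar> \<le> K1 * exp (- (1/4) * x\<^sup>2)"
    using hermite1_mult_bound by blast
  obtain K2 where K2: "K2 \<ge> 0" "\<And>x. \<bar>hermite1 (Suc n) x * hermite1 m x\<bar> \<le> K2 * exp (- (1/4) * x\<^sup>2)"
    using hermite1_mult_bound by blast
  define K where "K = sqrt m * K1 + sqrt (Suc n) * K2"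
  have K0: "K \<ge> 0" using K1 K2 by (simp add: K_def)
  have K: "\<bar>F' x\<bar> \<le> K * exp (- (1/4) * x\<^sup>2)" for x
  proof -
    have "\<bar>F' x\<bar> \<le> sqrt m * \<bar>hermite1 n x * hermite1 (m - 1) x\<bar> + sqrt (Suc n) * \<bar>hermite1 (Suc n) x * hermite1 m x\<bar>"
      unfolding F'_def by (rule order_trans[OF abs_triangle_ineq4]) (simp add: abs_mult)
    also have "\<dots> \<le> sqrt m * (K1 * exp (- (1/4) * x\<^sup>2)) + sqrt (Suc n) * (K2 * exp (- (1/4) * x\<^sup>2))"
      by (intro add_mono mult_left_mono K1 K2) auto
    finally show ?thesis by (simp add: K_def algebra_simps)
  qed
  have "(LINT x|lborel. complex_of_real (F' x)) = 0"
  proof (rule integral_directional_derivative_zero[where e=1 and F="\<lambda>x. complex_of_real (hermite1 n x * hermite1 m x)" and G="\<lambda>x. K * exp (1/4) * exp (- (1/8) * x\<^sup>2)"])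
    show "continuous_on UNIV (\<lambda>x. complex_of_real (hermite1 n x * hermite1 m x))"
      by (intro continuous_intros hermite1_continuous)
    show "(\<lambda>x. complex_of_real (F' x)) \<in> borel_measurable borel" unfolding F'_def by measurable
    show "complex_integrable lborel (\<lambda>x. complex_of_real (hermite1 n x * hermite1 m x))"
      by (intro integrable_of_real integrable_hermite1_mult)
    show "integrable lborel (\<lambda>x. K * exp (1/4) * exp (- (1/8) * x\<^sup>2))"
      by (intro integrable_mult_right integrable_gaussian) simp
    show "((\<lambda>t. complex_of_real (hermite1 n (v + t *\<^sub>R 1) * hermite1 m (v + t *\<^sub>R 1))) has_vector_derivative complex_of_real (F' v)) (at 0)" for v
    proof -
      have "((\<lambda>t. hermite1 n (t + v) * hermite1 m (t + v)) has_real_derivative F' v) (at 0)"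
        using hermite1_mult_derivative[of n m v] DERIV_shift[of "\<lambda>x. hermite1 n x * hermite1 m x" "F' v" 0 v]
        by (simp add: F'_def)
      then show ?thesis
        by (intro has_vector_derivative_of_real) (simp add: has_real_derivative_iff_has_vector_derivative add.commute)
    qed
    show "norm (complex_of_real (F' (v + t *\<^sub>R 1))) \<le> K * exp (1/4) * exp (- (1/8) * v\<^sup>2)" if t: "\<bar>t\<bar> \<le> 1" for v t :: real
    proof -
      have "t\<^sup>2 \<le> 1" using t by (simp add: abs_square_le_1)
      moreover have "0 \<le> (v + 2 * t)\<^sup>2" by simp
      ultimately have "- (1/4) * (v + t)\<^sup>2 \<le> 1/4 + - (1/8) * v\<^sup>2"
        by (simp add: power2_eq_square algebra_simps)
      then have "exp (- (1/4) * (v + t)\<^sup>2) \<le> exp (1/4) * exp (- (1/8) * v\<^sup>2)"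
        unfolding exp_add[symmetric] by simp
      then have "K * exp (- (1/4) * (v + t)\<^sup>2) \<le> K * (exp (1/4) * exp (- (1/8) * v\<^sup>2))"
        using K0 by (rule mult_left_mono)
      then show ?thesis using K[of "v + t"] by simp
    qed
  qed
  then have "(LINT x|lborel. F' x) = 0" by (simp add: integral_complex_of_real)
  then show ?thesis
    using integrable_hermite1_mult[of n "m - 1"] integrable_hermite1_mult[of "Suc n" m] by (simp add: F'_def)
qed

text \<open>The ladder relation moves both indices down by one until one of them is zero; the normalisation of
\<open>h\<^sub>0\<close> is that of the normal density.\<close>

lemma hermite1_orthonormal: "(LINT x|lborel. hermite1 n x * hermite1 m x) = of_bool (n = m)"
proof (induction n arbitrary: m)
  case 0
  show ?case
  proof (cases m)
    case 0
    have "hermite1 0 x * hermite1 0 x = std_normal_density x" for x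
    proof -
      have "hermite1 0 x * hermite1 0 x = ((2 * pi) powr (-1/4) * (2 * pi) powr (-1/4)) * (exp (- x\<^sup>2 / 4) * exp (- x\<^sup>2 / 4))"
        by (simp add: hermite1.simps mult_ac)
      also have "(2 * pi) powr (-1/4) * (2 * pi) powr (-1/4) = 1 / sqrt (2 * pi)"
        by (simp add: powr_add[symmetric] powr_minus powr_half_sqrt field_simps)
      also have "exp (- x\<^sup>2 / 4) * exp (- x\<^sup>2 / 4) = exp (- x\<^sup>2 / 2)"
        by (simp add: exp_add[symmetric])
      finally show ?thesis by (simp add: std_normal_density_def)
    qed
    then show ?thesis using 0 by (simp add: integral_normal_density)
  next
    case (Suc k)
    then show ?thesis using hermite1_ladder_integral[of k 0] by (simp add: mult.commute)
  qed
next
  case (Suc n)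
  have "sqrt (Suc n) * (LINT x|lborel. hermite1 (Suc n) x * hermite1 m x) = sqrt (Suc n) * of_bool (Suc n = m)"
    unfolding hermite1_ladder_integral Suc.IH by (cases m) (auto simp: of_bool_def)
  then show ?case by (simp del: of_nat_Suc)
qed

section \<open>Hermite functions in three dimensions\<close>

text \<open>Kept opaque because the simplifier would turn the entry \<open>1\<close> of an axis vector into \<open>Suc 0\<close>.\<close>

definition unit :: "3 \<Rightarrow> nat^3" where "unit j = axis j 1"

definition deg :: "nat^3 \<Rightarrow> nat" where "deg \<alpha> = (\<Sum>j\<in>UNIV. \<alpha> $ j)"

definition hermite3 :: "nat^3 \<Rightarrow> real^3 \<Rightarrow> complex" where
  "hermite3 \<alpha> v = (\<Prod>j\<in>UNIV. complex_of_real (hermite1 (\<alpha> $ j) (v $ j)))"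

lemma hermite3_split: "hermite3 \<alpha> v = complex_of_real (hermite1 (\<alpha> $ j) (v $ j)) * (\<Prod>i\<in>UNIV - {j}. complex_of_real (hermite1 (\<alpha> $ i) (v $ i)))"
  unfolding hermite3_def by (rule prod.remove) auto

text \<open>Where \<open>\<alpha>\<^sub>j = 0\<close>, the truncated difference \<open>\<alpha> - unit j\<close> has coefficient \<open>\<surd>0\<close>.\<close>

lemma mult_hermite3:
  "complex_of_real (v $ j) * hermite3 \<alpha> v
   = complex_of_real (sqrt (\<alpha> $ j + 1)) * hermite3 (\<alpha> + unit j) v + complex_of_real (sqrt (\<alpha> $ j)) * hermite3 (\<alpha> - unit j) v"
proof -
  have p: "(\<Prod>i\<in>UNIV - {j}. complex_of_real (hermite1 ((\<alpha> + unit j) $ i) (v $ i))) = (\<Prod>i\<in>UNIV - {j}. complex_of_real (hermite1 (\<alpha> $ i) (v $ i)))"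
     "(\<Prod>i\<in>UNIV - {j}. complex_of_real (hermite1 ((\<alpha> - unit j) $ i) (v $ i))) = (\<Prod>i\<in>UNIV - {j}. complex_of_real (hermite1 (\<alpha> $ i) (v $ i)))"
    by (rule prod.cong; simp add: axis_def unit_def)+
  have "complex_of_real (v $ j) * complex_of_real (hermite1 (\<alpha> $ j) (v $ j)) = complex_of_real (v $ j * hermite1 (\<alpha> $ j) (v $ j))"
    by simp
  also have "\<dots> = complex_of_real (sqrt (\<alpha> $ j + 1)) * complex_of_real (hermite1 ((\<alpha> + unit j) $ j) (v $ j))
      + complex_of_real (sqrt (\<alpha> $ j)) * complex_of_real (hermite1 ((\<alpha> - unit j) $ j) (v $ j))"
    unfolding mult_hermite1 by (simp add: axis_def unit_def)
  finally show ?thesis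
    unfolding hermite3_split[of _ _ j] p by (simp only: mult.assoc[symmetric] distrib_right)
qed

lemma chi0_eq_hermite3: "complex_of_real (chi0 v) = hermite3 0 v"
proof -
  have "hermite3 0 v = complex_of_real (\<Prod>j\<in>UNIV. hermite1 0 (v $ j))"
    by (simp add: hermite3_def)
  also have "(\<Prod>j\<in>UNIV. hermite1 0 (v $ j)) = ((2 * pi) powr (- 1/4))^3 * exp (\<Sum>j\<in>UNIV. - (v $ j)\<^sup>2 / 4)"
    by (simp add: hermite1.simps prod.distrib exp_sum)
  also have "(\<Sum>j\<in>UNIV. - (v $ j)\<^sup>2 / 4) = - (norm v)\<^sup>2 / 4"
    by (simp add: norm_vec_def L2_set_def sum_nonneg sum_negf sum_divide_distrib)
  also have "((2 * pi) powr (- 1/4))^3 * exp (- (norm v)\<^sup>2 / 4) = chi0 v"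
  proof -
    have "chi0 v = sqrt ((((2 * pi) powr (- 1/4))^3 * exp (- (norm v)\<^sup>2 / 4))\<^sup>2)"
      unfolding chi0_def maxwellian_def
      by (simp add: power_mult_distrib powr_powr flip: powr_realpow exp_of_nat_mult power_mult)
    then show ?thesis by simp
  qed
  finally show ?thesis by simp
qed

lemma hermite3_unit: "hermite3 (unit j) v = complex_of_real (v $ j * chi0 v)"
  using mult_hermite3[of v j 0] by (simp add: chi0_eq_hermite3)

lemma hermite3_continuous: "continuous_on A (hermite3 \<alpha>)"
proof -
  have "continuous_on A (\<lambda>v::real^3. hermite1 n (v $ j))" for n j
    by (rule continuous_on_compose2[OF hermite1_continuous[of UNIV]]) (auto intro!: continuous_intros)
  then show ?thesis unfolding hermite3_def[abs_def] by (intro continuous_intros)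
qed

lemma hermite3_measurable [measurable]: "hermite3 \<alpha> \<in> borel_measurable borel"
  by (rule borel_measurable_continuous_onI[OF hermite3_continuous])

lemma norm_sq_vec3: "(norm (v::real^3))\<^sup>2 = (\<Sum>j\<in>UNIV. (v $ j)\<^sup>2)"
  by (simp add: norm_vec_def L2_set_def sum_nonneg)

lemma hermite3_bound: obtains C where "C \<ge> 0" "\<And>v. norm (hermite3 \<alpha> v) \<le> C * exp (- (norm v)\<^sup>2 / 8)"
proof -
  have "\<exists>C\<ge>0. \<forall>x. \<bar>hermite1 (\<alpha> $ j) x\<bar> \<le> C * exp (- x\<^sup>2 / 8)" for j
    using hermite1_bound[of "\<alpha> $ j"] by metis
  then obtain C where C: "C j \<ge> 0" "\<bar>hermite1 (\<alpha> $ j) x\<bar> \<le> C j * exp (- x\<^sup>2 / 8)" for j x by metis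
  have "norm (hermite3 \<alpha> v) \<le> (\<Prod>j\<in>UNIV. C j) * exp (- (norm v)\<^sup>2 / 8)" for v
  proof -
    have "norm (hermite3 \<alpha> v) = (\<Prod>j\<in>UNIV. \<bar>hermite1 (\<alpha> $ j) (v $ j)\<bar>)"
      unfolding hermite3_def prod_norm[symmetric] by simp
    also have "\<dots> \<le> (\<Prod>j\<in>UNIV. C j * exp (- (v $ j)\<^sup>2 / 8))"
      by (intro prod_mono conjI C) auto
    also have "\<dots> = (\<Prod>j\<in>UNIV. C j) * exp (\<Sum>j\<in>UNIV. - (v $ j)\<^sup>2 / 8)"
      by (simp add: prod.distrib exp_sum)
    also have "(\<Sum>j\<in>UNIV. - (v $ j)\<^sup>2 / 8) = - (norm v)\<^sup>2 / 8"
      by (simp add: norm_sq_vec3 sum_negf sum_divide_distrib)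
    finally show ?thesis .
  qed
  then show ?thesis using that C by (meson prod_nonneg)
qed

lemma integrable_gaussian3: "a > 0 \<Longrightarrow> integrable lborel (\<lambda>v::real^3. exp (- a * (norm v)\<^sup>2))"
proof -
  assume a: "a > 0"
  have "integrable lborel (\<lambda>v::real^3. \<Prod>j\<in>UNIV. complex_of_real (exp (- a * (v $ j)\<^sup>2)))"
    using has_bochner_integral_prod_coords[of "\<lambda>_ x. complex_of_real (exp (- a * x\<^sup>2))"] integrable_gaussian[OF a]
    by (simp only: has_bochner_integral_iff integrable_of_real)
  moreover have "(\<Prod>j\<in>UNIV. complex_of_real (exp (- a * (v $ j)\<^sup>2))) = complex_of_real (exp (- a * (norm v)\<^sup>2))" for v :: "real^3"
    unfolding norm_sq_vec3 sum_distrib_left by (simp only: exp_sum of_real_prod finite)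
  ultimately show ?thesis by (simp only: complex_of_real_integrable_eq)
qed

lemma sq_integrable_gaussian_bound:
  assumes [measurable]: "f \<in> borel_measurable borel" and C: "a > 0" "\<And>v. norm (f v) \<le> C * exp (- a * (norm v)\<^sup>2)"
  shows "sq_integrable f"
  unfolding sq_integrable_def
proof
  show "integrable lborel (\<lambda>v. (cmod (f v))\<^sup>2)"
  proof (rule Bochner_Integration.integrable_bound)
    show "integrable lborel (\<lambda>v::real^3. C\<^sup>2 * exp (- (2 * a) * (norm v)\<^sup>2))"
      using C by (intro integrable_mult_right integrable_gaussian3) simp
    show "AE v in lborel. norm ((cmod (f v))\<^sup>2) \<le> norm (C\<^sup>2 * exp (- (2 * a) * (norm v)\<^sup>2))"
    proof (rule AE_I2)
      fix v
      have "(cmod (f v))\<^sup>2 \<le> (C * exp (- a * (norm v)\<^sup>2))\<^sup>2"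
        by (intro power_mono C) simp
      also have "\<dots> = C\<^sup>2 * exp (- (2 * a) * (norm v)\<^sup>2)"
        by (simp add: power_mult_distrib algebra_simps flip: exp_of_nat_mult)
      finally show "norm ((cmod (f v))\<^sup>2) \<le> norm (C\<^sup>2 * exp (- (2 * a) * (norm v)\<^sup>2))" by simp
    qed
  qed measurable
qed simp

lemma hermite3_sq_integrable: "sq_integrable (hermite3 \<alpha>)"
proof -
  obtain C where "C \<ge> 0" "\<And>v. norm (hermite3 \<alpha> v) \<le> C * exp (- (norm v)\<^sup>2 / 8)" using hermite3_bound by blast
  then show ?thesis by (intro sq_integrable_gaussian_bound[of _ "1/8" C]) auto
qed

lemma hermite3_orthonormal: "(LINT v|lborel. hermite3 \<alpha> v * hermite3 \<beta> v) = of_bool (\<alpha> = \<beta>)"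
proof -
  have "has_bochner_integral lborel (\<lambda>v::real^3. \<Prod>j\<in>UNIV. complex_of_real (hermite1 (\<alpha> $ j) (v $ j) * hermite1 (\<beta> $ j) (v $ j)))
     (\<Prod>j\<in>UNIV. LINT x|lborel. complex_of_real (hermite1 (\<alpha> $ j) x * hermite1 (\<beta> $ j) x))"
    by (intro has_bochner_integral_prod_coords integrable_of_real integrable_hermite1_mult)
  then have "(LINT v|lborel. hermite3 \<alpha> v * hermite3 \<beta> v) = (\<Prod>j\<in>UNIV. LINT x|lborel. complex_of_real (hermite1 (\<alpha> $ j) x * hermite1 (\<beta> $ j) x))"
    by (simp add: has_bochner_integral_iff hermite3_def prod.distrib)
  also have "\<dots> = (\<Prod>j\<in>UNIV. of_bool (\<alpha> $ j = \<beta> $ j))"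
    by (simp only: integral_complex_of_real hermite1_orthonormal) (auto intro!: prod.cong)
  also have "\<dots> = of_bool (\<alpha> = \<beta>)"
    by (auto simp: vec_eq_iff prod_zero_iff)
  finally show ?thesis .
qed

section \<open>The space of square integrable functions\<close>

lemma sq_integrable_measurable: "sq_integrable f \<Longrightarrow> f \<in> borel_measurable borel"
  by (simp add: sq_integrable_def)

lemma rep_L2_sq_integrable [simp]: "sq_integrable (rep_L2 x)"
  using Quotient3_rep_reflp[OF Quotient3_L2, of x] by simp

lemma rep_L2_measurable [measurable]: "rep_L2 x \<in> borel_measurable borel"
  by (rule sq_integrable_measurable) simp

lemma abs_rep_L2 [simp]: "abs_L2 (rep_L2 x) = x"
  by (rule Quotient3_abs_rep[OF Quotient3_L2])

lemma rep_abs_L2: "sq_integrable f \<Longrightarrow> AE v in lborel. rep_L2 (abs_L2 f) v = f v"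
  using rep_abs_rsp_left[OF Quotient3_L2, of f f] by simp

lemma abs_L2_eqI: "sq_integrable f \<Longrightarrow> sq_integrable g \<Longrightarrow> AE v in lborel. f v = g v \<Longrightarrow> abs_L2 f = abs_L2 g"
  using Quotient3_rel_abs[OF Quotient3_L2, of f g] by simp

lemma L2_eqI: "AE v in lborel. rep_L2 x v = rep_L2 y v \<Longrightarrow> x = y"
  using abs_L2_eqI[of "rep_L2 x" "rep_L2 y"] by simp

lemma abs_L2_add: "sq_integrable f \<Longrightarrow> sq_integrable g \<Longrightarrow> abs_L2 f + abs_L2 g = abs_L2 (\<lambda>v. f v + g v)"
  by (rule plus_L2.abs_eq) (auto simp: eq_onp_def)

lemma abs_L2_diff: "sq_integrable f \<Longrightarrow> sq_integrable g \<Longrightarrow> abs_L2 f - abs_L2 g = abs_L2 (\<lambda>v. f v - g v)"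
  by (rule minus_L2.abs_eq) (auto simp: eq_onp_def)

lemma abs_L2_scaleC: "sq_integrable f \<Longrightarrow> c *\<^sub>C abs_L2 f = abs_L2 (\<lambda>v. c * f v)"
  by (rule scaleC_L2.abs_eq) (auto simp: eq_onp_def)

lemma inner_abs_L2: "sq_integrable f \<Longrightarrow> sq_integrable g \<Longrightarrow> abs_L2 f \<bullet> abs_L2 g = (LINT v|lborel. f v \<bullet> g v)"
  by (rule inner_L2.abs_eq) auto

lemma norm_abs_L2: "sq_integrable f \<Longrightarrow> (norm (abs_L2 f))\<^sup>2 = (LINT v|lborel. (cmod (f v))\<^sup>2)"
  unfolding power2_norm_eq_inner by (simp add: inner_abs_L2)

lemma rep_L2_add: "AE v in lborel. rep_L2 (x + y) v = rep_L2 x v + rep_L2 y v"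
  using rep_abs_L2[OF sq_integrable_add[of "rep_L2 x" "rep_L2 y"]] abs_L2_add[of "rep_L2 x" "rep_L2 y"]
  by simp

lemma rep_L2_diff: "AE v in lborel. rep_L2 (x - y) v = rep_L2 x v - rep_L2 y v"
  using rep_abs_L2[OF sq_integrable_diff[of "rep_L2 x" "rep_L2 y"]] abs_L2_diff[of "rep_L2 x" "rep_L2 y"]
  by simp

lemma rep_L2_scaleC: "AE v in lborel. rep_L2 (c *\<^sub>C x) v = c * rep_L2 x v"
  using rep_abs_L2[OF sq_integrable_scale[of "rep_L2 x" c]] abs_L2_scaleC[of "rep_L2 x" c]
  by simp

lemma sq_integrable_cmod: "sq_integrable f \<Longrightarrow> sq_integrable (\<lambda>v. complex_of_real (cmod (f v)))"
  by (auto simp: sq_integrable_def)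

lemma integrable_mult_sq_integrable:
  assumes f: "sq_integrable f" and g: "sq_integrable g"
  shows "integrable lborel (\<lambda>v. f v * g v)"
proof (rule Bochner_Integration.integrable_bound)
  have [measurable]: "f \<in> borel_measurable lborel" "g \<in> borel_measurable lborel"
    using f g by (auto simp: sq_integrable_def)
  show "(\<lambda>v. f v * g v) \<in> borel_measurable lborel" by measurable
  show "integrable lborel (\<lambda>v. (cmod (f v)) * (cmod (g v)))"
    using integrable_inner_sq_integrable[OF sq_integrable_cmod[OF f] sq_integrable_cmod[OF g]] by (simp add: inner_complex_def)
qed (simp add: norm_mult)

lemma Cauchy_Schwarz_L2:
  assumes f: "sq_integrable f" and g: "sq_integrable g"
  shows "cmod (LINT v|lborel. f v * g v) \<le> norm (abs_L2 f) * norm (abs_L2 g)"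
proof -
  let ?a = "abs_L2 (\<lambda>v. complex_of_real (cmod (f v)))" and ?b = "abs_L2 (\<lambda>v. complex_of_real (cmod (g v)))"
  have n: "norm (abs_L2 (\<lambda>v. complex_of_real (cmod (h v)))) = norm (abs_L2 h)" if "sq_integrable h" for h
    using norm_abs_L2[OF that] norm_abs_L2[OF sq_integrable_cmod[OF that]]
    by (simp add: power2_eq_iff_nonneg[OF norm_ge_zero norm_ge_zero, symmetric])
  have "cmod (LINT v|lborel. f v * g v) \<le> (LINT v|lborel. cmod (f v * g v))"
    by (rule integral_norm_bound)
  also have "\<dots> = ?a \<bullet> ?b"
    using sq_integrable_cmod[OF f] sq_integrable_cmod[OF g] by (simp add: inner_abs_L2 norm_mult inner_complex_def)
  also have "\<dots> \<le> norm ?a * norm ?b" by (rule norm_cauchy_schwarz)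
  finally show ?thesis by (simp add: n f g)
qed

lemma sq_integrable_sum: "(\<And>i. i \<in> I \<Longrightarrow> sq_integrable (f i)) \<Longrightarrow> sq_integrable (\<lambda>v. \<Sum>i\<in>I. f i v)"
  by (induction I rule: infinite_finite_induct) (auto intro: sq_integrable_zero sq_integrable_add)

lemma abs_L2_zero: "abs_L2 (\<lambda>v. 0) = 0" by (simp add: zero_L2_def)

lemma abs_L2_sum:
  "(\<And>i. i \<in> I \<Longrightarrow> sq_integrable (f i)) \<Longrightarrow> (\<Sum>i\<in>I. abs_L2 (f i)) = abs_L2 (\<lambda>v. \<Sum>i\<in>I. f i v)"
  by (induction I rule: infinite_finite_induct) (auto simp: abs_L2_zero abs_L2_add sq_integrable_sum)

text \<open>Riesz and Fischer: a rapidly converging subsequence converges almost everywhere, because the norms of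
its increments are summable.\<close>

lemma L2_Cauchy_convergent:
  fixes X :: "nat \<Rightarrow> L2" assumes X: "Cauchy X" shows "convergent X"
proof -
  have "\<exists>N. \<forall>m\<ge>N. \<forall>n\<ge>N. norm (X m - X n) < (1/2)^k" for k
    using X by (rule CauchyD) simp
  then obtain Nf where Nf: "norm (X m - X n) < (1/2)^k" if "m \<ge> Nf k" "n \<ge> Nf k" for k m n
    by metis
  (* Adding k makes r strictly increasing even if Nf is constant. *)
  define r where "r k = k + (\<Sum>i\<le>k. Nf i)" for k
  have r: "strict_mono r" unfolding strict_mono_Suc_iff by (simp add: r_def)
  have "Nf k \<le> (\<Sum>i\<le>k. Nf i)" for k by (rule member_le_sum) auto
  then have rN: "r k \<ge> Nf k" and rN': "r (Suc k) \<ge> Nf k" for k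
    by (simp_all add: r_def trans_le_add2 le_SucI trans_le_add1)
  define y where "y k = X (r (Suc k)) - X (r k)" for k
  have ny: "norm (y k) \<le> (1/2)^k" for k
    unfolding y_def using Nf[of k] rN rN' by (simp add: less_imp_le)
  define f where "f k = rep_L2 (y k)" for k
  have fs: "sq_integrable (f k)" for k by (simp add: f_def)
  have [measurable]: "f k \<in> borel_measurable borel" for k by (rule sq_integrable_measurable[OF fs])
  define h where "h K v = (\<Sum>k<K. cmod (f k v))" for K v
  have h_nn: "h K v \<ge> 0" for K v by (simp add: h_def sum_nonneg)
  have [measurable]: "h K \<in> borel_measurable borel" for K unfolding h_def by measurable
  have hs: "sq_integrable (\<lambda>v. complex_of_real (h K v))" for K
    unfolding h_def of_real_sum by (intro sq_integrable_sum sq_integrable_cmod fs)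
  have nc: "norm (abs_L2 (\<lambda>v. complex_of_real (cmod (f k v)))) = norm (y k)" for k
    using norm_abs_L2[OF fs[of k]] norm_abs_L2[OF sq_integrable_cmod[OF fs[of k]]]
    by (simp add: power2_eq_iff_nonneg[OF norm_ge_zero norm_ge_zero, symmetric] f_def)
  have nh: "norm (abs_L2 (\<lambda>v. complex_of_real (h K v))) \<le> 2" for K
  proof -
    have "abs_L2 (\<lambda>v. complex_of_real (h K v)) = (\<Sum>k<K. abs_L2 (\<lambda>v. complex_of_real (cmod (f k v))))"
      unfolding h_def of_real_sum by (intro abs_L2_sum[symmetric] sq_integrable_cmod fs)
    also have "norm \<dots> \<le> (\<Sum>k<K. norm (y k))"
      by (rule order_trans[OF norm_sum]) (simp add: nc)
    also have "\<dots> \<le> (\<Sum>k<K. (1/2)^k)" by (intro sum_mono ny)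
    also have "\<dots> \<le> (\<Sum>k. (1/2)^k)" by (intro sum_le_suminf) auto
    also have "\<dots> = 2" by (subst suminf_geometric) auto
    finally show ?thesis .
  qed
  have inh: "(\<integral>\<^sup>+ v. ennreal ((h K v)\<^sup>2) \<partial>lborel) \<le> 4" for K
  proof -
    have "integrable lborel (\<lambda>v. (cmod (complex_of_real (h K v)))\<^sup>2)" using hs[of K] by (simp only: sq_integrable_def)
    then have i: "integrable lborel (\<lambda>v. (h K v)\<^sup>2)" by simp
    have "(LINT v|lborel. (h K v)\<^sup>2) \<le> 2\<^sup>2"
      using norm_abs_L2[OF hs[of K]] power_mono[OF nh[of K], of 2] by simp
    then show ?thesis using i by (subst nn_integral_eq_integral) (auto simp: ennreal_le_iff2 ennreal_leI simp flip: ennreal_numeral)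
  qed
  have incs: "incseq (\<lambda>K v. ennreal ((h K v)\<^sup>2))"
    by (intro incseq_SucI le_funI ennreal_leI power_mono h_nn) (simp add: h_def)
  have "(\<integral>\<^sup>+ v. (SUP K. ennreal ((h K v)\<^sup>2)) \<partial>lborel) = (SUP K. (\<integral>\<^sup>+ v. ennreal ((h K v)\<^sup>2) \<partial>lborel))"
    by (rule nn_integral_monotone_convergence_SUP[OF incs]) measurable
  also have "\<dots> \<le> 4" by (intro SUP_least inh)
  finally have fin: "(\<integral>\<^sup>+ v. (SUP K. ennreal ((h K v)\<^sup>2)) \<partial>lborel) \<le> 4" .
  have "AE v in lborel. (SUP K. ennreal ((h K v)\<^sup>2)) \<noteq> \<infinity>"
    by (rule nn_integral_PInf_AE) (use fin in \<open>auto simp: top_unique\<close>)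
  then have summ: "AE v in lborel. summable (\<lambda>k. cmod (f k v))"
  proof eventually_elim
    case (elim v)
    then obtain B where B: "B \<ge> 0" "(SUP K. ennreal ((h K v)\<^sup>2)) = ennreal B"
      by (cases "SUP K. ennreal ((h K v)\<^sup>2)") auto
    have "h K v \<le> sqrt B" for K
    proof -
      have "ennreal ((h K v)\<^sup>2) \<le> ennreal B" unfolding B(2)[symmetric] by (rule SUP_upper) simp
      then show ?thesis using B(1) h_nn by (simp add: real_le_rsqrt)
    qed
    then show ?case
      by (intro bounded_imp_summable[where B="sqrt B"]) (simp_all only: h_def lessThan_Suc_atMost[symmetric] norm_ge_zero)
  qed
  (* w is integrable by monotone convergence and dominates the squared tails of the telescoping
     series, so the pointwise limit F is also the limit in the mean. *)
  define w where "w v = (\<Sum>k. cmod (f k v))\<^sup>2" for v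
  have [measurable]: "w \<in> borel_measurable borel" unfolding w_def by measurable
  have wint: "integrable lborel w"
  proof (rule integrableI_bounded)
    have "(\<integral>\<^sup>+ v. ennreal (norm (w v)) \<partial>lborel) \<le> (\<integral>\<^sup>+ v. (SUP K. ennreal ((h K v)\<^sup>2)) \<partial>lborel)"
    proof (rule nn_integral_mono_AE)
      show "AE v in lborel. ennreal (norm (w v)) \<le> (SUP K. ennreal ((h K v)\<^sup>2))"
        using summ
      proof eventually_elim
        case (elim v)
        have "(\<lambda>K. (h K v)\<^sup>2) \<longlonglongrightarrow> w v"
          unfolding h_def w_def by (intro tendsto_power summable_LIMSEQ elim)
        then have "(\<lambda>K. ennreal ((h K v)\<^sup>2)) \<longlonglongrightarrow> ennreal (w v)" by (rule tendsto_ennrealI)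
        then have "ennreal (w v) \<le> (SUP K. ennreal ((h K v)\<^sup>2))"
          by (rule LIMSEQ_le_const2) (auto intro!: SUP_upper)
        moreover have "norm (w v) = w v" by (simp add: w_def)
        ultimately show ?case by simp
      qed
    qed
    also have "\<dots> < \<infinity>" using fin by (auto simp: le_less_trans)
    finally show "(\<integral>\<^sup>+ v. ennreal (norm (w v)) \<partial>lborel) < \<infinity>" .
  qed measurable
  define F where "F v = (\<Sum>k. f k v)" for v
  have [measurable]: "F \<in> borel_measurable borel" unfolding F_def by measurable
  have bd: "AE v in lborel. (cmod (F v - (\<Sum>k<K. f k v)))\<^sup>2 \<le> w v" for K
    using summ
  proof eventually_elim
    case (elim v)
    have s: "summable (\<lambda>k. f k v)" by (rule summable_norm_cancel[OF elim])
    have "F v - (\<Sum>k<K. f k v) = (\<Sum>k. f (k + K) v)"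
      unfolding F_def by (rule suminf_minus_initial_segment[OF s, symmetric])
    also have "cmod \<dots> \<le> (\<Sum>k. cmod (f (k + K) v))"
      by (rule summable_norm) (rule summable_ignore_initial_segment[OF elim])
    also have "\<dots> = (\<Sum>k. cmod (f k v)) - (\<Sum>k<K. cmod (f k v))"
      by (rule suminf_minus_initial_segment[OF elim])
    also have "\<dots> \<le> (\<Sum>k. cmod (f k v))" by (simp add: sum_nonneg)
    finally show ?case unfolding w_def by (intro power_mono) auto
  qed
  have Fs: "sq_integrable F"
    unfolding sq_integrable_def
  proof
    show "integrable lborel (\<lambda>v. (cmod (F v))\<^sup>2)"
      by (rule Bochner_Integration.integrable_bound[OF wint]) (use bd[of 0] in \<open>auto simp: w_def\<close>)
  qed simp
  have "(\<lambda>K. LINT v|lborel. (cmod (F v - (\<Sum>k<K. f k v)))\<^sup>2) \<longlonglongrightarrow> (LINT v|(lborel::(real^3) measure). (0::real))"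
  proof (rule integral_dominated_convergence[where w=w])
    show "AE v in lborel. (\<lambda>K. (cmod (F v - (\<Sum>k<K. f k v)))\<^sup>2) \<longlonglongrightarrow> 0"
      using summ
    proof eventually_elim
      case (elim v)
      have s: "summable (\<lambda>k. f k v)" by (rule summable_norm_cancel[OF elim])
      have "(\<lambda>K. (cmod (F v - (\<Sum>k<K. f k v)))\<^sup>2) \<longlonglongrightarrow> (cmod (F v - F v))\<^sup>2"
        unfolding F_def by (intro tendsto_intros summable_LIMSEQ s)
      then show ?case by simp
    qed
  qed (use wint bd in auto)
  moreover have "(LINT v|lborel. (cmod (F v - (\<Sum>k<K. f k v)))\<^sup>2) = (norm (abs_L2 F - (X (r K) - X (r 0))))\<^sup>2" for K
  proof -
    have "(\<Sum>k<K. y k) = X (r K) - X (r 0)" unfolding y_def by (rule sum_lessThan_telescope)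
    moreover have "(\<Sum>k<K. y k) = abs_L2 (\<lambda>v. \<Sum>k<K. f k v)"
      using abs_L2_sum[of "{..<K}" f] fs by (simp add: f_def)
    moreover have "abs_L2 F - abs_L2 (\<lambda>v. \<Sum>k<K. f k v) = abs_L2 (\<lambda>v. F v - (\<Sum>k<K. f k v))"
      by (intro abs_L2_diff Fs sq_integrable_sum fs)
    ultimately have "abs_L2 F - (X (r K) - X (r 0)) = abs_L2 (\<lambda>v. F v - (\<Sum>k<K. f k v))"
      by simp
    then show ?thesis by (simp add: norm_abs_L2 Fs sq_integrable_sum fs sq_integrable_diff)
  qed
  ultimately have "(\<lambda>K. (norm (abs_L2 F - (X (r K) - X (r 0))))\<^sup>2) \<longlonglongrightarrow> 0" by simp
  from tendsto_real_sqrt[OF this] have "(\<lambda>K. norm (abs_L2 F - (X (r K) - X (r 0)))) \<longlonglongrightarrow> 0" by simp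
  then have "(\<lambda>K. abs_L2 F - (X (r K) - X (r 0))) \<longlonglongrightarrow> 0" by (rule tendsto_norm_zero_cancel)
  from tendsto_diff[OF tendsto_const[of "abs_L2 F + X (r 0)"] this] have "(X \<circ> r) \<longlonglongrightarrow> abs_L2 F + X (r 0)"
    by (simp add: o_def algebra_simps)
  then have "X \<longlonglongrightarrow> abs_L2 F + X (r 0)" by (rule Cauchy_converges_subseq[OF X r])
  then show ?thesis by (rule convergentI)
qed

section \<open>Hermite expansions\<close>

text \<open>The Hermitian inner product with a basis function, which is real.\<close>

definition coef :: "(real^3 \<Rightarrow> complex) \<Rightarrow> nat^3 \<Rightarrow> complex" where
  "coef f \<alpha> = (LINT v|lborel. f v * hermite3 \<alpha> v)"

abbreviation coef_L2 :: "L2 \<Rightarrow> nat^3 \<Rightarrow> complex" where "coef_L2 x \<equiv> coef (rep_L2 x)"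

lemma integrable_mult_hermite3: "sq_integrable f \<Longrightarrow> integrable lborel (\<lambda>v. f v * hermite3 \<alpha> v)"
  by (intro integrable_mult_sq_integrable hermite3_sq_integrable)

lemma coef_cong_AE:
  assumes "sq_integrable f" "sq_integrable g" "AE v in lborel. f v = g v" shows "coef f = coef g"
proof
  fix \<alpha>
  have [measurable]: "f \<in> borel_measurable borel" "g \<in> borel_measurable borel"
    using assms sq_integrable_measurable by auto
  show "coef f \<alpha> = coef g \<alpha>" unfolding coef_def
    by (rule integral_cong_AE) (use assms(3) in auto)
qed

lemma coef_add: "sq_integrable f \<Longrightarrow> sq_integrable g \<Longrightarrow> coef (\<lambda>v. f v + g v) \<alpha> = coef f \<alpha> + coef g \<alpha>"
  by (simp add: coef_def distrib_right integrable_mult_hermite3)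

lemma coef_diff: "sq_integrable f \<Longrightarrow> sq_integrable g \<Longrightarrow> coef (\<lambda>v. f v - g v) \<alpha> = coef f \<alpha> - coef g \<alpha>"
  by (simp add: coef_def left_diff_distrib integrable_mult_hermite3)

lemma coef_scale: "coef (\<lambda>v. c * f v) \<alpha> = c * coef f \<alpha>"
  by (simp add: coef_def mult.assoc)

lemma coef_rep_abs: "sq_integrable f \<Longrightarrow> coef_L2 (abs_L2 f) = coef f"
  by (intro coef_cong_AE rep_abs_L2) auto

lemma coef_L2_add: "coef_L2 (x + y) \<alpha> = coef_L2 x \<alpha> + coef_L2 y \<alpha>"
  using coef_cong_AE[OF _ sq_integrable_add rep_L2_add[of x y]] by (simp add: coef_add)

lemma coef_L2_diff: "coef_L2 (x - y) \<alpha> = coef_L2 x \<alpha> - coef_L2 y \<alpha>"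
  using coef_cong_AE[OF _ sq_integrable_diff rep_L2_diff[of x y]] by (simp add: coef_diff)

lemma coef_L2_scaleC: "coef_L2 (c *\<^sub>C x) \<alpha> = c * coef_L2 x \<alpha>"
  using coef_cong_AE[OF _ sq_integrable_scale rep_L2_scaleC[of c x]] by (simp add: coef_scale)

lemma coef_L2_zero: "coef_L2 0 \<alpha> = 0" using coef_L2_diff[of 0 0 \<alpha>] by simp

lemma coef_L2_sum: "coef_L2 (\<Sum>i\<in>I. x i) \<alpha> = (\<Sum>i\<in>I. coef_L2 (x i) \<alpha>)"
  by (induction I rule: infinite_finite_induct) (auto simp: coef_L2_zero coef_L2_add)

definition hermite_vec :: "nat^3 \<Rightarrow> L2" where "hermite_vec \<alpha> = abs_L2 (hermite3 \<alpha>)"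

lemma coef_L2_hermite_vec: "coef_L2 (hermite_vec \<alpha>) \<beta> = of_bool (\<alpha> = \<beta>)"
  by (simp add: hermite_vec_def coef_rep_abs hermite3_sq_integrable coef_def hermite3_orthonormal)

lemma norm_hermite_vec: "norm (hermite_vec \<alpha>) = 1"
proof -
  have "hermite3 \<alpha> v = complex_of_real (\<Prod>j\<in>UNIV. hermite1 (\<alpha> $ j) (v $ j))" for v by (simp add: hermite3_def)
  then have e: "hermite3 \<alpha> v * hermite3 \<alpha> v = complex_of_real ((cmod (hermite3 \<alpha> v))\<^sup>2)" for v
    by (simp only: norm_of_real power2_abs) (simp add: power2_eq_square)
  have "complex_of_real (LINT v|lborel. (cmod (hermite3 \<alpha> v))\<^sup>2) = 1"
    using hermite3_orthonormal[of \<alpha> \<alpha>] unfolding e integral_complex_of_real by simp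
  then have "(norm (hermite_vec \<alpha>))\<^sup>2 = 1" unfolding hermite_vec_def norm_abs_L2[OF hermite3_sq_integrable]
    using of_real_eq_1_iff by blast
  then show ?thesis by (simp add: power2_eq_1_iff) (smt (verit) norm_ge_zero)
qed

lemma norm_coef_L2_le: "cmod (coef_L2 x \<alpha>) \<le> norm x"
  using Cauchy_Schwarz_L2[of "rep_L2 x" "hermite3 \<alpha>"] norm_hermite_vec[of \<alpha>]
  by (simp add: coef_def hermite3_sq_integrable hermite_vec_def)

lemma inner_L2_coef_L2: "x \<bullet> (c *\<^sub>C hermite_vec \<alpha>) = Re (coef_L2 x \<alpha> * cnj c)"
proof -
  have "hermite3 \<alpha> v = complex_of_real (\<Prod>j\<in>UNIV. hermite1 (\<alpha> $ j) (v $ j))" for v by (simp add: hermite3_def)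
  then have r: "Im (hermite3 \<alpha> v) = 0" for v by (simp only: Im_complex_of_real)
  have "x \<bullet> (c *\<^sub>C hermite_vec \<alpha>) = (LINT v|lborel. rep_L2 x v \<bullet> (c * hermite3 \<alpha> v))"
    using inner_abs_L2[of "rep_L2 x" "\<lambda>v. c * hermite3 \<alpha> v"]
    by (simp add: hermite_vec_def abs_L2_scaleC hermite3_sq_integrable sq_integrable_scale)
  also have "\<dots> = (LINT v|lborel. Re (cnj c * (rep_L2 x v * hermite3 \<alpha> v)))"
    by (intro Bochner_Integration.integral_cong refl) (simp add: inner_complex_def r algebra_simps)
  also have "\<dots> = Re (LINT v|lborel. cnj c * (rep_L2 x v * hermite3 \<alpha> v))"
    by (rule integral_Re) (intro integrable_mult_right integrable_mult_hermite3, simp)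
  finally show ?thesis by (simp add: coef_def mult.commute)
qed

definition deg_le :: "nat \<Rightarrow> (nat^3) set" where "deg_le N = {\<alpha>. deg \<alpha> \<le> N}"

lemma nth_le_deg: "\<alpha> $ j \<le> deg \<alpha>"
  unfolding deg_def by (rule member_le_sum) auto

lemma finite_deg_le [simp]: "finite (deg_le N)"
proof (rule finite_subset)
  show "deg_le N \<subseteq> vec_lambda ` (UNIV \<rightarrow>\<^sub>E {..N})"
  proof
    fix \<alpha> assume "\<alpha> \<in> deg_le N"
    then have "(\<lambda>j. \<alpha> $ j) \<in> UNIV \<rightarrow>\<^sub>E {..N}" using nth_le_deg[of \<alpha>] by (auto simp: deg_le_def intro: order_trans)
    then show "\<alpha> \<in> vec_lambda ` (UNIV \<rightarrow>\<^sub>E {..N})" by (rule image_eqI[rotated]) simp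
  qed
qed (simp add: finite_PiE)

lemma deg_le_mono: "M \<le> N \<Longrightarrow> deg_le M \<subseteq> deg_le N" by (auto simp: deg_le_def)

definition hermite_sum :: "(nat^3 \<Rightarrow> complex) \<Rightarrow> (nat^3) set \<Rightarrow> L2" where
  "hermite_sum c A = (\<Sum>\<alpha>\<in>A. c \<alpha> *\<^sub>C hermite_vec \<alpha>)"

lemma coef_L2_hermite_sum: "finite A \<Longrightarrow> coef_L2 (hermite_sum c A) \<beta> = (if \<beta> \<in> A then c \<beta> else 0)"
  by (simp add: hermite_sum_def coef_L2_sum coef_L2_scaleC coef_L2_hermite_vec of_bool_def if_distrib sum.delta cong: if_cong)

lemma norm_hermite_sum: "finite A \<Longrightarrow> (norm (hermite_sum c A))\<^sup>2 = (\<Sum>\<alpha>\<in>A. (cmod (c \<alpha>))\<^sup>2)"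
  unfolding hermite_sum_def
  by (subst norm_sum_Pythagorean)
    (auto simp: pairwise_def orthogonal_def inner_L2_coef_L2 coef_L2_scaleC coef_L2_hermite_vec norm_scaleC norm_hermite_vec power_mult_distrib)

lemma Bessel: assumes "finite A" shows "(\<Sum>\<alpha>\<in>A. (cmod (coef_L2 x \<alpha>))\<^sup>2) \<le> (norm x)\<^sup>2"
proof -
  let ?S = "hermite_sum (coef_L2 x) A"
  have i: "x \<bullet> ?S = (\<Sum>\<alpha>\<in>A. (cmod (coef_L2 x \<alpha>))\<^sup>2)"
    unfolding hermite_sum_def inner_sum_right inner_L2_coef_L2
    by (intro sum.cong refl) (simp add: complex_mult_cnj cmod_power2)
  have "0 \<le> (norm (x - ?S))\<^sup>2" by simp
  also have "(norm (x - ?S))\<^sup>2 = (norm x)\<^sup>2 - 2 * (x \<bullet> ?S) + (norm ?S)\<^sup>2"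
    by (simp add: power2_norm_eq_inner algebra_simps inner_commute)
  finally show ?thesis using assms by (simp add: i norm_hermite_sum)
qed

lemma norm_exp_partial_sum: "norm (\<Sum>m<M. z ^ m /\<^sub>R fact m) \<le> exp (norm (z::complex))"
proof -
  have "norm (\<Sum>m<M. z ^ m /\<^sub>R fact m) \<le> (\<Sum>m<M. norm z ^ m /\<^sub>R fact m)"
    by (rule order_trans[OF norm_sum]) (simp add: norm_power)
  also have "\<dots> \<le> (\<Sum>m. norm z ^ m /\<^sub>R fact m)"
    by (rule sum_le_suminf) (auto intro: summable_exp simp: inverse_eq_divide[symmetric])
  finally show ?thesis by (simp add: exp_def)
qed

text \<open>If all coefficients vanish, so do the integrals of \<open>f \<chi>\<^sub>0\<close> against all powers of linear functions, hence
against all characters: the exponential series is dominated because \<open>\<chi>\<^sub>0\<close> decays like a Gaussian.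
Fourier uniqueness gives \<open>f \<chi>\<^sub>0 = 0\<close>.\<close>

lemma Hermite_complete:
  assumes f: "sq_integrable f" and z: "\<And>\<alpha>. coef f \<alpha> = 0"
  shows "AE v in lborel. f v = 0"
proof -
  have [measurable]: "f \<in> borel_measurable borel" by (rule sq_integrable_measurable[OF f])
  have "AE v in lborel. f v * hermite3 0 v = 0"
  proof (rule fourier_unique)
    show "integrable lborel (\<lambda>v. f v * hermite3 0 v)" by (rule integrable_mult_hermite3[OF f])
    fix t :: "real^3"
    define q where "q v = complex_of_real (t \<bullet> v)" for v
    have [measurable]: "q \<in> borel_measurable borel" unfolding q_def by measurable
    have q: "q v = (\<Sum>j\<in>UNIV. complex_of_real (t $ j) * complex_of_real (v $ j))" for v
      by (simp add: q_def inner_vec_def)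
    have step: "q v ^ Suc m * hermite3 \<alpha> v =
       (\<Sum>j\<in>UNIV. complex_of_real (t $ j * sqrt (\<alpha> $ j + 1)) * (q v ^ m * hermite3 (\<alpha> + unit j) v)
          + complex_of_real (t $ j * sqrt (\<alpha> $ j)) * (q v ^ m * hermite3 (\<alpha> - unit j) v))" for v m \<alpha>
    proof -
      have "q v ^ Suc m * hermite3 \<alpha> v = (\<Sum>j\<in>UNIV. q v ^ m * (complex_of_real (t $ j) * (complex_of_real (v $ j) * hermite3 \<alpha> v)))"
        by (subst power_Suc, subst (1) q) (simp add: sum_distrib_left sum_distrib_right mult_ac)
      then show ?thesis unfolding mult_hermite3 by (simp add: algebra_simps)
    qed
    have mom: "sq_integrable (\<lambda>v. q v ^ m * hermite3 \<alpha> v) \<and> (LINT v|lborel. f v * (q v ^ m * hermite3 \<alpha> v)) = 0" for m \<alpha>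
    proof (induction m arbitrary: \<alpha>)
      case 0
      then show ?case using z by (simp add: hermite3_sq_integrable coef_def)
    next
      case (Suc m)
      have s: "sq_integrable (\<lambda>v. q v ^ m * hermite3 \<alpha> v)" and i: "(LINT v|lborel. f v * (q v ^ m * hermite3 \<alpha> v)) = 0" for \<alpha>
        using Suc by auto
      have I: "integrable lborel (\<lambda>v. f v * (c * (q v ^ m * hermite3 \<alpha> v)))" for c \<alpha>
        by (intro integrable_mult_sq_integrable f sq_integrable_scale s)
      have "(LINT v|lborel. f v * (c * (q v ^ m * hermite3 \<alpha> v))) = c * (LINT v|lborel. f v * (q v ^ m * hermite3 \<alpha> v))" for c \<alpha>
        by (subst integral_mult_right_zero[symmetric]) (simp add: mult_ac)
      then have z: "(LINT v|lborel. f v * (c * (q v ^ m * hermite3 \<alpha> v))) = 0" for c \<alpha> by (simp add: i)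
      have "(LINT v|lborel. f v * (q v ^ Suc m * hermite3 \<alpha> v)) = 0"
        unfolding step sum_distrib_left distrib_left
        by (subst Bochner_Integration.integral_sum) (auto intro!: Bochner_Integration.integrable_add I simp: Bochner_Integration.integral_add I z)
      moreover have "sq_integrable (\<lambda>v. q v ^ Suc m * hermite3 \<alpha> v)"
        unfolding step by (intro sq_integrable_sum sq_integrable_add sq_integrable_scale s)
      ultimately show ?case by blast
    qed
    obtain C where C: "C \<ge> 0" "\<And>v. norm (hermite3 0 v) \<le> C * exp (- (norm v)\<^sup>2 / 8)" using hermite3_bound by blast
    (* Completing the square, |t.v| is at most 4|t|^2 + |v|^2/16, so the ground state keeps half of
       its guaranteed decay exp(-|v|^2/8) after multiplication by exp|t.v|. *)
    define K where "K = C * exp (4 * (norm t)\<^sup>2)"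
    define g where "g v = complex_of_real (K * exp (- (1/16) * (norm v)\<^sup>2))" for v :: "real^3"
    have [measurable]: "g \<in> borel_measurable borel" unfolding g_def by measurable
    have gs: "sq_integrable g"
      by (rule sq_integrable_gaussian_bound[of _ "1/16" K]) (use C in \<open>auto simp: g_def norm_mult K_def\<close>)
    have bdd: "exp (cmod (\<i> * q v)) * norm (hermite3 0 v) \<le> cmod (g v)" for v
    proof -
      have "\<bar>t \<bullet> v\<bar> \<le> norm t * norm v" by (rule Cauchy_Schwarz_ineq2)
      also have "\<dots> \<le> 4 * (norm t)\<^sup>2 + (norm v)\<^sup>2 / 16"
        using zero_le_power2[of "2 * norm t - norm v / 4"] by (simp add: power2_eq_square algebra_simps)
      finally have "exp (cmod (\<i> * q v)) \<le> exp (4 * (norm t)\<^sup>2 + (norm v)\<^sup>2 / 16)"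
        by (simp add: norm_mult q_def)
      then have "exp (cmod (\<i> * q v)) * norm (hermite3 0 v) \<le> exp (4 * (norm t)\<^sup>2 + (norm v)\<^sup>2 / 16) * (C * exp (- (norm v)\<^sup>2 / 8))"
        using C by (intro mult_mono) auto
      also have "\<dots> = C * (exp (4 * (norm t)\<^sup>2 + (norm v)\<^sup>2 / 16) * exp (- (norm v)\<^sup>2 / 8))" by simp
      also have "exp (4 * (norm t)\<^sup>2 + (norm v)\<^sup>2 / 16) * exp (- (norm v)\<^sup>2 / 8) = exp (4 * (norm t)\<^sup>2) * exp (- (1/16) * (norm v)\<^sup>2)"
        unfolding exp_add[symmetric] by simp
      also have "C * (exp (4 * (norm t)\<^sup>2) * exp (- (1/16) * (norm v)\<^sup>2)) = cmod (g v)"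
        unfolding g_def K_def norm_of_real using C by simp
      finally show ?thesis .
    qed
    define T where "T M v = f v * ((\<Sum>m<M. (\<i> * q v) ^ m /\<^sub>R fact m) * hermite3 0 v)" for M v
    have T: "T M v = (\<Sum>m<M. (\<i> ^ m / fact m) * (f v * (q v ^ m * hermite3 0 v)))" for M v
      unfolding T_def by (simp add: sum_distrib_left sum_distrib_right power_mult_distrib scaleR_conv_of_real field_simps)
    have "(LINT v|lborel. T M v) = 0" for M
      unfolding T using mom by (subst Bochner_Integration.integral_sum) (auto intro!: integrable_mult_right integrable_mult_sq_integrable f)
    moreover have "(\<lambda>M. LINT v|lborel. T M v) \<longlonglongrightarrow> (LINT v|lborel. f v * hermite3 0 v * iexp (t \<bullet> v))"
    proof (rule integral_dominated_convergence[where w="\<lambda>v. cmod (f v * g v)"])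
      show "AE v in lborel. (\<lambda>M. T M v) \<longlonglongrightarrow> f v * hermite3 0 v * iexp (t \<bullet> v)"
      proof (rule AE_I2)
        fix v
        have "(\<lambda>M. f v * ((\<Sum>m<M. (\<i> * q v) ^ m /\<^sub>R fact m) * hermite3 0 v)) \<longlonglongrightarrow> f v * (exp (\<i> * q v) * hermite3 0 v)"
          using exp_converges[of "\<i> * q v"] unfolding sums_def by (intro tendsto_intros)
        then show "(\<lambda>M. T M v) \<longlonglongrightarrow> f v * hermite3 0 v * iexp (t \<bullet> v)"
          by (simp add: T_def q_def mult_ac)
      qed
      show "AE v in lborel. norm (T M v) \<le> cmod (f v * g v)" for M
      proof (rule AE_I2)
        fix v
        have "norm (T M v) \<le> cmod (f v) * (exp (cmod (\<i> * q v)) * norm (hermite3 0 v))"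
          unfolding T_def norm_mult[of "f v"] norm_mult[of _ "hermite3 0 v"]
          by (intro mult_left_mono mult_right_mono norm_exp_partial_sum) auto
        also have "\<dots> \<le> cmod (f v) * cmod (g v)" by (intro mult_left_mono bdd) auto
        finally show "norm (T M v) \<le> cmod (f v * g v)" by (simp add: norm_mult)
      qed
      show "integrable lborel (\<lambda>v. cmod (f v * g v))"
        by (intro integrable_norm integrable_mult_sq_integrable f gs)
      show "T M \<in> borel_measurable lborel" for M unfolding T_def by measurable
    qed measurable
    ultimately show "(LINT v|lborel. f v * hermite3 0 v * iexp (t \<bullet> v)) = 0" by (simp add: LIMSEQ_const_iff)
  qed
  moreover have "hermite3 0 v \<noteq> 0" for v
    unfolding chi0_eq_hermite3[symmetric] by (simp add: chi0_def maxwellian_def)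
  ultimately show ?thesis by simp
qed

lemma coef_L2_eqI: assumes "\<And>\<alpha>. coef_L2 x \<alpha> = coef_L2 y \<alpha>" shows "x = y"
proof -
  have "AE v in lborel. rep_L2 (x - y) v = 0"
    by (rule Hermite_complete) (simp_all add: coef_L2_diff assms)
  then have "AE v in lborel. rep_L2 x v = rep_L2 y v"
    using rep_L2_diff[of x y] by eventually_elim simp
  then show ?thesis by (rule L2_eqI)
qed

lemma tendsto_coef_L2: "X \<longlonglongrightarrow> x \<Longrightarrow> (\<lambda>n. coef_L2 (X n) \<alpha>) \<longlonglongrightarrow> coef_L2 x \<alpha>"
proof -
  assume "X \<longlonglongrightarrow> x"
  then have "(\<lambda>n. norm (X n - x)) \<longlonglongrightarrow> 0" by (simp add: tendsto_norm_zero_iff LIM_zero_iff)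
  then have "(\<lambda>n. coef_L2 (X n) \<alpha> - coef_L2 x \<alpha>) \<longlonglongrightarrow> 0"
    by (rule Lim_null_comparison[rotated]) (auto simp: norm_coef_L2_le simp flip: coef_L2_diff intro!: always_eventually)
  then show ?thesis by (simp add: LIM_zero_iff)
qed

lemma Riesz_Fischer:
  assumes B: "\<And>N. (\<Sum>\<alpha>\<in>deg_le N. (cmod (c \<alpha>))\<^sup>2) \<le> B"
  obtains x where "coef_L2 x = c" "(\<lambda>N. hermite_sum c (deg_le N)) \<longlonglongrightarrow> x"
proof -
  define s where "s N = (\<Sum>\<alpha>\<in>deg_le N. (cmod (c \<alpha>))\<^sup>2)" for N
  have sm: "s M \<le> s N" if "M \<le> N" for M N
    unfolding s_def by (intro sum_mono2 deg_le_mono that) auto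
  have "convergent s"
    using B sm by (intro Bseq_mono_convergent) (auto simp: Bseq_def s_def sum_nonneg intro!: exI[of _ "max 1 B"] max.coboundedI2)
  then have sC: "Cauchy s" by (rule convergent_Cauchy)
  have d: "(norm (hermite_sum c (deg_le N) - hermite_sum c (deg_le M)))\<^sup>2 = s N - s M" if "M \<le> N" for M N
  proof -
    have "hermite_sum c (deg_le N) - hermite_sum c (deg_le M) = hermite_sum c (deg_le N - deg_le M)"
      unfolding hermite_sum_def by (rule sum_diff[symmetric]) (auto simp: deg_le_mono that)
    then show ?thesis unfolding s_def by (simp add: norm_hermite_sum sum_diff deg_le_mono that)
  qed
  have "Cauchy (\<lambda>N. hermite_sum c (deg_le N))"
  proof (rule CauchyI)
    fix e :: real assume e: "e > 0"
    then obtain M where M: "\<And>m n. m \<ge> M \<Longrightarrow> n \<ge> M \<Longrightarrow> norm (s m - s n) < e\<^sup>2"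
      using CauchyD[OF sC, of "e\<^sup>2"] by auto
    have "norm (hermite_sum c (deg_le m) - hermite_sum c (deg_le n)) < e" if "m \<ge> M" "n \<ge> M" for m n
    proof -
      have "(norm (hermite_sum c (deg_le m) - hermite_sum c (deg_le n)))\<^sup>2 < e\<^sup>2"
      proof (cases "n \<le> m")
        case True
        then show ?thesis using d[of n m] M[of m n] that by simp
      next
        case False
        then show ?thesis using d[of m n] M[of n m] that by (simp add: norm_minus_commute)
      qed
      then show ?thesis using e by (simp add: power2_less_imp_less)
    qed
    then show "\<exists>M. \<forall>m\<ge>M. \<forall>n\<ge>M. norm (hermite_sum c (deg_le m) - hermite_sum c (deg_le n)) < e" by blast
  qed
  from L2_Cauchy_convergent[OF this] obtain x where x: "(\<lambda>N. hermite_sum c (deg_le N)) \<longlonglongrightarrow> x"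
    by (auto simp: convergent_def)
  have "coef_L2 x \<alpha> = c \<alpha>" for \<alpha>
  proof -
    have "(\<lambda>N. coef_L2 (hermite_sum c (deg_le N)) \<alpha>) \<longlonglongrightarrow> c \<alpha>"
      by (rule tendsto_eventually) (auto simp: coef_L2_hermite_sum eventually_sequentially deg_le_def[THEN eqset_imp_iff])
    then show ?thesis using tendsto_coef_L2[OF x] LIMSEQ_unique by blast
  qed
  then show ?thesis using that x by blast
qed

lemma hermite_sum_coef_L2_tendsto: "(\<lambda>N. hermite_sum (coef_L2 x) (deg_le N)) \<longlonglongrightarrow> x"
proof -
  obtain y where y: "coef_L2 y = coef_L2 x" "(\<lambda>N. hermite_sum (coef_L2 x) (deg_le N)) \<longlonglongrightarrow> y"
    using Riesz_Fischer[of "coef_L2 x" "(norm x)\<^sup>2"] Bessel by auto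
  then have "y = x" by (intro coef_L2_eqI) simp
  with y show ?thesis by simp
qed

lemma Parseval_norm: "(\<lambda>N. \<Sum>\<alpha>\<in>deg_le N. (cmod (coef_L2 x \<alpha>))\<^sup>2) \<longlonglongrightarrow> (norm x)\<^sup>2"
  using tendsto_power[OF tendsto_norm[OF hermite_sum_coef_L2_tendsto[of x]], of 2] by (simp add: norm_hermite_sum)

text \<open>The bilinear form, without conjugation, is the one that occurs when a distribution is tested.\<close>

lemma Parseval:
  assumes f: "sq_integrable f" and g: "sq_integrable g"
  shows "(\<lambda>N. \<Sum>\<alpha>\<in>deg_le N. coef f \<alpha> * coef g \<alpha>) \<longlonglongrightarrow> (LINT v|lborel. f v * g v)"
proof -
  let ?S = "\<lambda>N v. \<Sum>\<alpha>\<in>deg_le N. coef f \<alpha> * hermite3 \<alpha> v"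
  have S: "sq_integrable (?S N)" for N
    by (intro sq_integrable_sum sq_integrable_scale hermite3_sq_integrable)
  have aS: "abs_L2 (?S N) = hermite_sum (coef_L2 (abs_L2 f)) (deg_le N)" for N
    unfolding hermite_sum_def hermite_vec_def coef_rep_abs[OF f] abs_L2_scaleC[OF hermite3_sq_integrable]
    by (intro abs_L2_sum[symmetric] sq_integrable_scale hermite3_sq_integrable)
  have "(LINT v|lborel. (f v - ?S N v) * g v) = (LINT v|lborel. f v * g v) - (\<Sum>\<alpha>\<in>deg_le N. coef f \<alpha> * coef g \<alpha>)" for N
  proof -
    have "(LINT v|lborel. ?S N v * g v) = (LINT v|lborel. (\<Sum>\<alpha>\<in>deg_le N. coef f \<alpha> * (g v * hermite3 \<alpha> v)))"
      by (simp add: sum_distrib_right sum_distrib_left mult_ac)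
    also have "\<dots> = (\<Sum>\<alpha>\<in>deg_le N. coef f \<alpha> * coef g \<alpha>)"
      unfolding coef_def[of g] by (subst Bochner_Integration.integral_sum) (auto intro!: integrable_mult_right integrable_mult_hermite3 g)
    finally show ?thesis using integrable_mult_sq_integrable[OF f g] integrable_mult_sq_integrable[OF S g]
      by (simp add: left_diff_distrib)
  qed
  moreover have "(\<lambda>N. LINT v|lborel. (f v - ?S N v) * g v) \<longlonglongrightarrow> 0"
  proof (rule Lim_null_comparison)
    show "\<forall>\<^sub>F N in sequentially. norm (LINT v|lborel. (f v - ?S N v) * g v) \<le> norm (abs_L2 f - hermite_sum (coef_L2 (abs_L2 f)) (deg_le N)) * norm (abs_L2 g)"
      using Cauchy_Schwarz_L2[OF sq_integrable_diff[OF f S] g]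
      by (auto simp: aS[symmetric] abs_L2_diff f S intro!: always_eventually)
    have "(\<lambda>N. norm (abs_L2 f - hermite_sum (coef_L2 (abs_L2 f)) (deg_le N)) * norm (abs_L2 g)) \<longlonglongrightarrow> norm (abs_L2 f - abs_L2 f) * norm (abs_L2 g)"
      by (intro tendsto_intros hermite_sum_coef_L2_tendsto)
    then show "(\<lambda>N. norm (abs_L2 f - hermite_sum (coef_L2 (abs_L2 f)) (deg_le N)) * norm (abs_L2 g)) \<longlonglongrightarrow> 0" by simp
  qed
  ultimately have "(\<lambda>N. (LINT v|lborel. f v * g v) - (\<Sum>\<alpha>\<in>deg_le N. coef f \<alpha> * coef g \<alpha>)) \<longlonglongrightarrow> 0" by simp
  from tendsto_diff[OF tendsto_const[of "LINT v|lborel. f v * g v"] this] show ?thesis by simp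
qed

section \<open>Smooth functions with compact support\<close>

text \<open>Differentiability of finite order, in a form that allows induction on the order for products.\<close>

primrec ntimes_diff :: "nat \<Rightarrow> (real \<Rightarrow> complex) \<Rightarrow> bool" where
  "ntimes_diff 0 f = True"
| "ntimes_diff (Suc n) f = (\<exists>f'. (\<forall>x. (f has_vector_derivative f' x) (at x)) \<and> ntimes_diff n f')"

lemma ntimes_diff_SucI: "(\<And>x. (f has_vector_derivative f' x) (at x)) \<Longrightarrow> ntimes_diff n f' \<Longrightarrow> ntimes_diff (Suc n) f"
  by auto

definition smooth_real :: "(real \<Rightarrow> complex) \<Rightarrow> bool" where "smooth_real f \<longleftrightarrow> (\<forall>n. ntimes_diff n f)"

definition deriv1 :: "(real \<Rightarrow> complex) \<Rightarrow> real \<Rightarrow> complex" where "deriv1 f x = vector_derivative f (at x)"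

lemma deriv1_eqI: "(\<And>x. (f has_vector_derivative f' x) (at x)) \<Longrightarrow> deriv1 f = f'"
  by (auto simp: deriv1_def vector_derivative_at)

lemma smooth_real_deriv1: assumes "smooth_real f"
  shows "(f has_vector_derivative deriv1 f x) (at x)" "smooth_real (deriv1 f)"
proof -
  from assms have "ntimes_diff (Suc 0) f" by (simp only: smooth_real_def)
  then obtain f' where f': "\<And>x. (f has_vector_derivative f' x) (at x)" by auto
  then have e: "deriv1 f = f'" by (rule deriv1_eqI)
  show "(f has_vector_derivative deriv1 f x) (at x)" using f' e by simp
  show "smooth_real (deriv1 f)" unfolding smooth_real_def
  proof
    fix n
    have "ntimes_diff (Suc n) f" using assms by (simp add: smooth_real_def)
    then obtain g where g: "\<And>x. (f has_vector_derivative g x) (at x)" "ntimes_diff n g" by auto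
    show "ntimes_diff n (deriv1 f)" using g(2) deriv1_eqI[OF g(1)] by simp
  qed
qed

lemma ntimes_diff_Suc_D: "ntimes_diff (Suc n) f \<Longrightarrow> ntimes_diff n f"
proof (induction n arbitrary: f)
  case (Suc n)
  then obtain f' where "\<forall>x. (f has_vector_derivative f' x) (at x)" "ntimes_diff (Suc n) f'" by auto
  with Suc.IH[of f'] show ?case by auto
qed simp

lemma ntimes_diff_add: "ntimes_diff n f \<Longrightarrow> ntimes_diff n g \<Longrightarrow> ntimes_diff n (\<lambda>x. f x + g x)"
proof (induction n arbitrary: f g)
  case (Suc n)
  then obtain f' g' where "\<forall>x. (f has_vector_derivative f' x) (at x)" "ntimes_diff n f'"
    "\<forall>x. (g has_vector_derivative g' x) (at x)" "ntimes_diff n g'" by auto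
  with Suc.IH[of f' g'] show ?case
    by (auto intro!: exI[of _ "\<lambda>x. f' x + g' x"] has_vector_derivative_add)
qed simp

lemma ntimes_diff_mult: "ntimes_diff n f \<Longrightarrow> ntimes_diff n g \<Longrightarrow> ntimes_diff n (\<lambda>x. f x * g x)"
proof (induction n arbitrary: f g)
  case (Suc n)
  then obtain f' g' where *: "\<forall>x. (f has_vector_derivative f' x) (at x)" "ntimes_diff n f'"
    "\<forall>x. (g has_vector_derivative g' x) (at x)" "ntimes_diff n g'" by auto
  have "ntimes_diff n (\<lambda>x. f x * g' x + f' x * g x)"
    using Suc * ntimes_diff_Suc_D by (intro ntimes_diff_add Suc.IH) auto
  with * show ?case
    by (auto intro!: exI[of _ "\<lambda>x. f x * g' x + f' x * g x"] has_vector_derivative_mult)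
qed simp

lemma ntimes_diff_const: "ntimes_diff n (\<lambda>x. c)"
proof (induction n arbitrary: c)
  case (Suc n)
  show ?case using Suc[of 0] by (auto intro!: exI[of _ "\<lambda>x. 0"])
qed simp

lemma ntimes_diff_affine: "ntimes_diff n f \<Longrightarrow> ntimes_diff n (\<lambda>x. f (d + c * x))"
proof (induction n arbitrary: f)
  case (Suc n)
  then obtain f' where *: "\<And>x. (f has_vector_derivative f' x) (at x)" "ntimes_diff n f'" by auto
  have "((\<lambda>x. f (d + c * x)) has_vector_derivative of_real c * f' (d + c * x)) (at x)" for x
  proof -
    have "((\<lambda>x. d + c * x) has_vector_derivative c) (at x)"
      unfolding has_real_derivative_iff_has_vector_derivative[symmetric] by (auto intro!: derivative_eq_intros)
    from vector_diff_chain_at[OF this *(1)] show ?thesis by (simp add: o_def scaleR_conv_of_real)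
  qed
  moreover have "ntimes_diff n (\<lambda>x. of_real c * f' (d + c * x))"
    by (intro ntimes_diff_mult ntimes_diff_const Suc.IH *)
  ultimately show ?case by (rule ntimes_diff_SucI)
qed simp

lemma smooth_real_mult: "smooth_real f \<Longrightarrow> smooth_real g \<Longrightarrow> smooth_real (\<lambda>x. f x * g x)"
  by (simp add: smooth_real_def ntimes_diff_mult)

lemma smooth_real_const: "smooth_real (\<lambda>x. c)"
  by (simp add: smooth_real_def ntimes_diff_const)

lemma smooth_real_affine: "smooth_real f \<Longrightarrow> smooth_real (\<lambda>x. f (d + c * x))"
  by (simp add: smooth_real_def ntimes_diff_affine)

lemma smooth_real_hermite1: "smooth_real (\<lambda>x. complex_of_real (hermite1 n x))"
proof -
  have "ntimes_diff k (\<lambda>x. complex_of_real (hermite1 n x))" for k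
  proof (induction k arbitrary: n)
    case (Suc k)
    have e: "sqrt n * hermite1 (n - 1) x - x / 2 * hermite1 n x = (sqrt n / 2) * hermite1 (n - 1) x + (- sqrt (Suc n) / 2) * hermite1 (Suc n) x" for x
      using mult_hermite1[of x n] by (simp add: field_simps)
    have "((\<lambda>x. complex_of_real (hermite1 n x)) has_vector_derivative
       complex_of_real (sqrt n / 2) * complex_of_real (hermite1 (n - 1) x) + complex_of_real (- sqrt (Suc n) / 2) * complex_of_real (hermite1 (Suc n) x)) (at x)" for x
      using has_vector_derivative_of_real[OF hermite1_has_derivative[of n x, unfolded e]]
      by (simp only: of_real_add of_real_mult)
    moreover have "ntimes_diff k (\<lambda>x. complex_of_real (sqrt n / 2) * complex_of_real (hermite1 (n - 1) x) + complex_of_real (- sqrt (Suc n) / 2) * complex_of_real (hermite1 (Suc n) x))"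
      by (intro ntimes_diff_add ntimes_diff_mult ntimes_diff_const Suc)
    ultimately show ?case by (rule ntimes_diff_SucI)
  qed simp
  then show ?thesis by (simp add: smooth_real_def)
qed

lemma smooth_real_iexp: "smooth_real (\<lambda>x. iexp (s * x))"
proof -
  have "ntimes_diff k (\<lambda>x. iexp (s * x))" for k
  proof (induction k)
    case (Suc k)
    have "((\<lambda>x. iexp (s * x)) has_vector_derivative (\<i> * s) * iexp (s * x)) (at x)" for x
    proof -
      have "((\<lambda>z. exp (\<i> * of_real s * z)) has_field_derivative (\<i> * s) * iexp (s * x)) (at (of_real x))"
        by (auto intro!: derivative_eq_intros simp: mult_ac)
      from has_vector_derivative_real_field[OF this] show ?thesis by (simp add: mult_ac)
    qed
    then show ?case by (rule ntimes_diff_SucI) (rule ntimes_diff_mult[OF ntimes_diff_const Suc])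
  qed simp
  then show ?thesis by (simp add: smooth_real_def)
qed

text \<open>The derivatives of \<open>exp (-1/x)\<close>, extended by zero, are of this form, with a polynomial in \<open>1/x\<close> as
prefactor.\<close>

definition flat_exp :: "real poly \<Rightarrow> real \<Rightarrow> real" where
  "flat_exp p x = (if x \<le> 0 then 0 else poly p (1 / x) * exp (- (1 / x)))"

lemma poly_times_exp_neg: "((\<lambda>y. poly p y * exp (- y)) \<longlongrightarrow> 0) at_top" for p :: "real poly"
proof -
  have "((\<lambda>y. \<Sum>i\<le>degree p. coeff p i * (y ^ i / exp y)) \<longlongrightarrow> (\<Sum>i\<le>degree p. coeff p i * 0)) at_top"
    by (intro tendsto_intros tendsto_power_div_exp_0)
  then show ?thesis by (simp add: poly_altdef sum_divide_distrib exp_minus inverse_eq_divide)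
qed

lemma flat_exp_has_derivative: "(flat_exp p has_real_derivative flat_exp ([:0, 0, 1:] * (p - pderiv p)) x) (at x)"
proof -
  consider "x < 0" | "x > 0" | "x = 0" by linarith
  then show ?thesis
  proof cases
    case 1
    have "(flat_exp p has_real_derivative 0) (at x)"
      by (rule has_field_derivative_transform_within_open[of "\<lambda>_. 0" _ _ "{..<0}"]) (use 1 in \<open>auto simp: flat_exp_def\<close>)
    then show ?thesis using 1 by (simp add: flat_exp_def)
  next
    case 2
    have "((\<lambda>x. poly p (1 / x) * exp (- (1 / x))) has_real_derivative
        (poly (pderiv p) (1 / x) * (- (1 / x\<^sup>2))) * exp (- (1 / x)) + exp (- (1 / x)) * (1 / x\<^sup>2) * poly p (1 / x)) (at x)"
    proof -
      have i: "((\<lambda>x. 1 / x) has_real_derivative - (1 / x\<^sup>2)) (at x)"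
        using 2 by (auto intro!: derivative_eq_intros simp: power2_eq_square)
      have "((\<lambda>x. poly p (1 / x)) has_real_derivative poly (pderiv p) (1 / x) * (- (1 / x\<^sup>2))) (at x)"
        by (rule DERIV_chain2[OF poly_DERIV i])
      moreover have "((\<lambda>x. exp (- (1 / x))) has_real_derivative exp (- (1 / x)) * (1 / x\<^sup>2)) (at x)"
        using DERIV_chain2[OF DERIV_exp DERIV_minus[OF i]] by simp
      ultimately show ?thesis by (rule DERIV_mult)
    qed
    also have "(poly (pderiv p) (1 / x) * (- (1 / x\<^sup>2))) * exp (- (1 / x)) + exp (- (1 / x)) * (1 / x\<^sup>2) * poly p (1 / x)
       = flat_exp ([:0, 0, 1:] * (p - pderiv p)) x"
      using 2 by (simp add: flat_exp_def power2_eq_square field_simps)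
    finally show ?thesis
      by (rule has_field_derivative_transform_within_open[of _ _ _ "{0<..}"]) (use 2 in \<open>auto simp: flat_exp_def\<close>)
  next
    case 3
    have "((\<lambda>h. flat_exp p h / h) \<longlongrightarrow> 0) (at 0)"
    proof (rule filterlim_split_at)
      show "((\<lambda>h. flat_exp p h / h) \<longlongrightarrow> 0) (at_left 0)"
        by (rule tendsto_eventually) (auto simp: eventually_at_filter flat_exp_def)
      have "((\<lambda>y. poly (pCons 0 p) y * exp (- y)) \<longlongrightarrow> 0) at_top" by (rule poly_times_exp_neg)
      then have "((\<lambda>h. poly (pCons 0 p) (inverse h) * exp (- inverse h)) \<longlongrightarrow> 0) (at_right 0)"
        by (rule filterlim_compose[OF _ filterlim_inverse_at_top_right])
      moreover have "\<forall>\<^sub>F h in at_right 0. poly (pCons 0 p) (inverse h) * exp (- inverse h) = flat_exp p h / h"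
        by (auto simp: eventually_at_filter flat_exp_def field_simps)
      ultimately show "((\<lambda>h. flat_exp p h / h) \<longlongrightarrow> 0) (at_right 0)" by (rule Lim_transform_eventually)
    qed
    then show ?thesis using 3 by (simp add: has_field_derivative_iff flat_exp_def)
  qed
qed

lemma smooth_real_flat_exp: "smooth_real (\<lambda>x. complex_of_real (flat_exp p x))"
proof -
  have "ntimes_diff k (\<lambda>x. complex_of_real (flat_exp p x))" for k
  proof (induction k arbitrary: p)
    case (Suc k)
    show ?case
      by (rule ntimes_diff_SucI[OF has_vector_derivative_of_real[OF flat_exp_has_derivative] Suc])
  qed simp
  then show ?thesis by (simp add: smooth_real_def)
qed

text \<open>Normalised to be \<open>1\<close> at \<open>0\<close>, so that the cutoffs \<open>bump (x/n)\<close> tend to \<open>1\<close> pointwise.\<close>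

definition bump :: "real \<Rightarrow> complex" where
  "bump x = complex_of_real (exp 2) * (complex_of_real (flat_exp 1 (1 + x)) * complex_of_real (flat_exp 1 (1 - x)))"

lemma smooth_real_bump: "smooth_real bump"
  unfolding bump_def[abs_def]
  using smooth_real_affine[OF smooth_real_flat_exp, of 1 1 1] smooth_real_affine[OF smooth_real_flat_exp, of 1 1 "-1"]
  by (intro smooth_real_mult smooth_real_const) simp_all

lemma bump_0 [simp]: "bump 0 = 1"
proof -
  have "exp 2 * (exp (- 1) * exp (- 1)) = (1::real)" unfolding exp_add[symmetric] by simp
  then show ?thesis unfolding bump_def flat_exp_def of_real_mult[symmetric] by simp
qed

lemma bump_zero: "\<bar>x\<bar> \<ge> 1 \<Longrightarrow> bump x = 0"
  by (cases "x \<ge> 0") (auto simp: bump_def flat_exp_def)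

lemma bump_nz: "\<bar>x\<bar> < 1 \<Longrightarrow> bump x \<noteq> 0"
  by (auto simp: bump_def flat_exp_def)

lemma smooth_real_continuous: "smooth_real f \<Longrightarrow> continuous_on A f"
  by (intro continuous_at_imp_continuous_on ballI has_vector_derivative_continuous[OF smooth_real_deriv1(1)])

lemma deriv1_zero_outside:
  assumes z: "\<And>x. \<bar>x\<bar> \<ge> 1 \<Longrightarrow> f x = 0" and x: "\<bar>x\<bar> > 1"
  shows "deriv1 f x = 0"
proof -
  have "open {y::real. \<bar>y\<bar> > 1}" by (intro open_Collect_less continuous_intros)
  then have "(f has_vector_derivative 0) (at x)"
    by (intro has_vector_derivative_transform_within_open[of "\<lambda>_. 0" 0 x "{y. \<bar>y\<bar> > 1}" f]) (use z x in auto)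
  then show ?thesis by (simp add: deriv1_def vector_derivative_at)
qed

lemma deriv1_zero_outside':
  assumes f: "smooth_real f" and z: "\<And>x. \<bar>x\<bar> \<ge> 1 \<Longrightarrow> f x = 0" and x: "\<bar>x\<bar> \<ge> 1"
  shows "deriv1 f x = 0"
proof (rule ccontr)
  assume nz: "deriv1 f x \<noteq> 0"
  have "isCont (deriv1 f) x" using smooth_real_continuous[OF smooth_real_deriv1(2)[OF f], of UNIV]
    by (simp add: continuous_on_eq_continuous_at)
  then have "\<forall>\<^sub>F y in nhds x. deriv1 f y \<noteq> 0"
    using nz by (simp add: continuous_within tendsto_imp_eventually_ne isCont_def eventually_nhds_conv_at)
  then obtain e where e: "e > 0" "\<And>y. dist y x < e \<Longrightarrow> deriv1 f y \<noteq> 0" by (auto simp: eventually_nhds_metric)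
  define y where "y = x + sgn x * (e / 2)"
  have "dist y x < e" "\<bar>y\<bar> > 1" using e(1) x by (auto simp: y_def dist_real_def abs_mult sgn_if split: if_splits)
  then show False using e(2)[of y] deriv1_zero_outside[of f y, OF z] by simp
qed

lemma bounded_of_zero_outside:
  assumes f: "smooth_real f" and z: "\<And>x. \<bar>x\<bar> \<ge> 1 \<Longrightarrow> f x = 0"
  shows "\<exists>B\<ge>0. \<forall>x. cmod (f x) \<le> B"
proof -
  have "compact (f ` {-1..1})" by (intro compact_continuous_image smooth_real_continuous f) simp
  then have "bounded (f ` {-1..1})" by (rule compact_imp_bounded)
  then obtain B where B: "\<And>x. x \<in> {-1..1} \<Longrightarrow> cmod (f x) \<le> B" unfolding bounded_iff by blast
  have "cmod (f x) \<le> max 0 B" for x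
    using B[of x] z[of x] by (cases "\<bar>x\<bar> \<ge> 1") (auto simp: abs_if split: if_splits)
  then show ?thesis by (intro exI[of _ "max 0 B"]) auto
qed

lemma bump_bounds: obtains B where "B \<ge> 0" "\<And>x. cmod (bump x) \<le> B" "\<And>x. cmod (deriv1 bump x) \<le> B" "\<And>x. cmod (deriv1 (deriv1 bump) x) \<le> B"
proof -
  have z1: "deriv1 bump x = 0" if "\<bar>x\<bar> \<ge> 1" for x
    by (rule deriv1_zero_outside'[OF smooth_real_bump bump_zero that])
  have z2: "deriv1 (deriv1 bump) x = 0" if "\<bar>x\<bar> \<ge> 1" for x
    by (rule deriv1_zero_outside'[OF smooth_real_deriv1(2)[OF smooth_real_bump] z1 that])
  obtain A where A: "A \<ge> 0" "\<And>x. cmod (bump x) \<le> A"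
    using bounded_of_zero_outside[OF smooth_real_bump bump_zero] by blast
  obtain B where B: "B \<ge> 0" "\<And>x. cmod (deriv1 bump x) \<le> B"
    using bounded_of_zero_outside[OF smooth_real_deriv1(2)[OF smooth_real_bump] z1] by blast
  obtain C where C: "C \<ge> 0" "\<And>x. cmod (deriv1 (deriv1 bump) x) \<le> C"
    using bounded_of_zero_outside[OF smooth_real_deriv1(2)[OF smooth_real_deriv1(2)[OF smooth_real_bump]] z2] by blast
  show ?thesis
    by (rule that[of "A + B + C"]) (use A B C in \<open>auto intro: add_increasing add_increasing2\<close>)
qed

section \<open>Products of functions of one variable\<close>

definition tensor :: "(3 \<Rightarrow> real \<Rightarrow> complex) \<Rightarrow> real^3 \<Rightarrow> complex" where
  "tensor g v = (\<Prod>j\<in>UNIV. g j (v $ j))"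

lemma hermite3_eq_tensor: "hermite3 \<alpha> = tensor (\<lambda>j x. complex_of_real (hermite1 (\<alpha> $ j) x))"
  by (simp add: hermite3_def tensor_def fun_eq_iff)

lemma tensor_upd: "tensor (g(i := h)) v = h (v $ i) * (\<Prod>j\<in>UNIV - {i}. g j (v $ j))"
  unfolding tensor_def by (subst prod.remove[of UNIV i]) auto

lemma tensor_has_derivative:
  assumes "\<And>j x. (g j has_vector_derivative g' j x) (at x)"
  shows "(tensor g has_derivative (\<lambda>w. \<Sum>i\<in>UNIV. w $ i *\<^sub>R tensor (g(i := g' i)) v)) (at v)"
proof -
  have "((\<lambda>v::real^3. g i (v $ i)) has_derivative (\<lambda>w. w $ i *\<^sub>R g' i (v $ i))) (at v)" for i
    using diff_chain_at[OF bounded_linear.has_derivative[OF bounded_linear_vec_nth has_derivative_ident] assms[of i, unfolded has_vector_derivative_def], of i v]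
    by (simp add: o_def)
  then have "((\<lambda>v::real^3. \<Prod>i\<in>UNIV. g i (v $ i)) has_derivative
      (\<lambda>w. \<Sum>i\<in>UNIV. (w $ i *\<^sub>R g' i (v $ i)) * (\<Prod>j\<in>UNIV - {i}. g j (v $ j)))) (at v)"
    by (rule has_derivative_prod)
  moreover have "tensor g = (\<lambda>v. \<Prod>i\<in>UNIV. g i (v $ i))" by (simp add: tensor_def fun_eq_iff)
  ultimately show ?thesis
    unfolding tensor_upd by (simp add: scaleR_conv_of_real mult_ac)
qed

lemma partial_deriv_tensor:
  assumes "\<And>j x. (g j has_vector_derivative g' j x) (at x)"
  shows "partial_deriv i (tensor g) = tensor (g(i := g' i))"
proof
  fix v
  have "frechet_derivative (tensor g) (at v) = (\<lambda>w. \<Sum>i\<in>UNIV. w $ i *\<^sub>R tensor (g(i := g' i)) v)"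
    by (rule frechet_derivative_at[OF tensor_has_derivative[OF assms], symmetric])
  then show "partial_deriv i (tensor g) v = tensor (g(i := g' i)) v"
    by (simp add: partial_deriv_def axis_def if_distrib[of "\<lambda>r. r *\<^sub>R _"] cong: if_cong)
qed

text \<open>Partial derivatives of a product of functions of one variable are again such products.\<close>

lemma smooth_tensor:
  assumes "\<And>j. smooth_real (g j)" shows "smooth (tensor g)"
proof -
  have ex: "\<exists>g'. (\<forall>j. smooth_real (g' j)) \<and> foldr partial_deriv js (tensor g) = tensor g'" for js
  proof (induction js)
    case Nil
    then show ?case using assms by auto
  next
    case (Cons i js)
    then obtain g' where g': "\<And>j. smooth_real (g' j)" "foldr partial_deriv js (tensor g) = tensor g'" by auto
    have "foldr partial_deriv (i # js) (tensor g) = tensor (g'(i := deriv1 (g' i)))"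
      using partial_deriv_tensor[of g' "\<lambda>j. deriv1 (g' j)" i] smooth_real_deriv1(1)[OF g'(1)] g'(2) by simp
    moreover have "\<forall>j. smooth_real ((g'(i := deriv1 (g' i))) j)" using g'(1) smooth_real_deriv1(2) by auto
    ultimately show ?case by blast
  qed
  show ?thesis unfolding smooth_def
  proof (intro allI)
    fix js v
    obtain g' where g': "\<And>j. smooth_real (g' j)" "foldr partial_deriv js (tensor g) = tensor g'"
      using ex[of js] by auto
    have "tensor g' differentiable (at v)"
      by (rule differentiableI[OF tensor_has_derivative[of g' "\<lambda>j. deriv1 (g' j)"]]) (rule smooth_real_deriv1(1)[OF g'(1)])
    then show "foldr partial_deriv js (tensor g) differentiable (at v)" by (simp add: g'(2))
  qed
qed

lemma test_function_tensor:
  assumes "\<And>j. smooth_real (g j)" and R: "\<And>j x. \<bar>x\<bar> \<ge> R \<Longrightarrow> g j x = 0"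
  shows "test_function (tensor g)"
  unfolding test_function_def
proof
  show "smooth (tensor g)" by (rule smooth_tensor[OF assms(1)])
  have "{v. tensor g v \<noteq> 0} \<subseteq> cbox (vec (- R)) (vec R)"
  proof
    fix v assume v: "v \<in> {v. tensor g v \<noteq> 0}"
    have "\<bar>v $ j\<bar> < R" for j using v R[of "v $ j" j] by (fastforce simp: tensor_def)
    then have "- R \<le> v $ j \<and> v $ j \<le> R" for j by (smt (verit) abs_less_iff)
    then show "v \<in> cbox (vec (- R)) (vec R)" by (simp add: mem_box_cart)
  qed
  then show "compact (closure {v. tensor g v \<noteq> 0})"
    using bounded_subset[OF bounded_cbox] compact_closure by blast
qed

lemma classical_laplacian_tensor:
  assumes "\<And>j. smooth_real (g j)"
  shows "classical_laplacian (tensor g) v = (\<Sum>j\<in>UNIV. tensor (g(j := deriv1 (deriv1 (g j)))) v)"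
proof -
  have "partial_deriv j (partial_deriv j (tensor g)) = tensor (g(j := deriv1 (deriv1 (g j))))" for j
  proof -
    have "partial_deriv j (tensor g) = tensor (g(j := deriv1 (g j)))"
      by (rule partial_deriv_tensor[of g "\<lambda>j. deriv1 (g j)"]) (rule smooth_real_deriv1(1)[OF assms])
    moreover have "smooth_real ((g(j := deriv1 (g j))) i)" for i using assms smooth_real_deriv1(2) by simp
    ultimately show ?thesis
      using partial_deriv_tensor[of "g(j := deriv1 (g j))" "\<lambda>i. deriv1 ((g(j := deriv1 (g j))) i)" j] smooth_real_deriv1(1) by simp
  qed
  then show ?thesis by (simp add: classical_laplacian_def)
qed

lemma test_function_differentiable: "test_function \<phi> \<Longrightarrow> \<phi> differentiable (at v)"
  unfolding test_function_def smooth_def by (drule conjunct1, drule spec[of _ "[]"]) simp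

lemma test_function_continuous: "test_function \<phi> \<Longrightarrow> continuous_on A \<phi>"
  by (intro continuous_at_imp_continuous_on ballI differentiable_imp_continuous_within test_function_differentiable)

lemma locally_integrable_mult_test_function:
  assumes h: "locally_integrable h" and t: "test_function \<phi>"
  shows "integrable lborel (\<lambda>v. h v * \<phi> v)"
proof -
  have [measurable]: "h \<in> borel_measurable borel" using h by (simp add: locally_integrable_def)
  let ?K = "closure {v. \<phi> v \<noteq> 0}"
  have K: "compact ?K" using t by (simp add: test_function_def)
  have c: "continuous_on UNIV \<phi>"
    by (rule test_function_continuous[OF t])
  have [measurable]: "\<phi> \<in> borel_measurable borel" by (rule borel_measurable_continuous_onI[OF c])
  have "bounded (\<phi> ` ?K)"
    by (intro compact_imp_bounded compact_continuous_image K) (rule continuous_on_subset[OF c], simp)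
  then obtain C where C: "\<And>v. v \<in> ?K \<Longrightarrow> cmod (\<phi> v) \<le> C" unfolding bounded_iff by blast
  have i: "integrable lborel (\<lambda>v. \<bar>C\<bar> *\<^sub>R (indicator ?K v *\<^sub>R h v))"
    using h K unfolding locally_integrable_def set_integrable_def by (intro integrable_scaleR_right) auto
  show "integrable lborel (\<lambda>v. h v * \<phi> v)"
  proof (rule Bochner_Integration.integrable_bound[OF i])
    show "AE v in lborel. norm (h v * \<phi> v) \<le> norm (\<bar>C\<bar> *\<^sub>R (indicat_real ?K v *\<^sub>R h v))"
    proof (rule AE_I2)
      fix v
      show "norm (h v * \<phi> v) \<le> norm (\<bar>C\<bar> *\<^sub>R (indicat_real ?K v *\<^sub>R h v))"
      proof (cases "v \<in> ?K")
        case True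
        then have "cmod (\<phi> v) \<le> \<bar>C\<bar>" using C[of v] by simp
        then show ?thesis using mult_left_mono[of "cmod (\<phi> v)" "\<bar>C\<bar>" "cmod (h v)"] True
          by (simp add: norm_mult mult.commute)
      next
        case False
        then have "\<phi> v = 0" using closure_subset[of "{v. \<phi> v \<noteq> 0}"] by auto
        then show ?thesis by simp
      qed
    qed
  qed simp
qed

text \<open>The fundamental lemma of the calculus of variations.  A positive bump times a character is a test
function, so the Fourier transform of \<open>h\<close> times the bump vanishes.\<close>

lemma AE_zero_of_test_functions:
  assumes h: "locally_integrable h" and z: "\<And>\<phi>. test_function \<phi> \<Longrightarrow> (LINT v|lborel. h v * \<phi> v) = 0"
  shows "AE v in lborel. h v = 0"
proof -
  have [measurable]: "h \<in> borel_measurable borel" using h by (simp add: locally_integrable_def)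
  define B where "B n = tensor (\<lambda>j x. bump (0 + (1 / real (Suc n)) * x))" for n
  have sb: "smooth_real (\<lambda>x. bump (0 + (1 / real (Suc n)) * x))" for n by (rule smooth_real_affine[OF smooth_real_bump])
  have bz: "bump (0 + (1 / real (Suc n)) * x) = 0" if "\<bar>x\<bar> \<ge> real (Suc n)" for n x
    using that by (intro bump_zero) (simp add: field_simps abs_mult del: of_nat_Suc)
  have "AE v in lborel. h v * B n v = 0" for n
  proof (rule fourier_unique)
    have t: "test_function (B n)" unfolding B_def by (rule test_function_tensor[OF sb bz])
    show "integrable lborel (\<lambda>v. h v * B n v)"
      by (rule locally_integrable_mult_test_function[OF h t])
    fix t :: "real^3"
    have "test_function (tensor (\<lambda>j x. bump (0 + (1 / real (Suc n)) * x) * iexp (t $ j * x)))"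
    proof (rule test_function_tensor[where R="real (Suc n)"])
      show "smooth_real (\<lambda>x. bump (0 + (1 / real (Suc n)) * x) * iexp (t $ j * x))" for j
        by (rule smooth_real_mult[OF sb smooth_real_iexp])
      show "bump (0 + (1 / real (Suc n)) * x) * iexp (t $ j * x) = 0" if "\<bar>x\<bar> \<ge> real (Suc n)" for j x
        by (simp only: bz[OF that] mult_zero_left)
    qed
    note z' = z[OF this]
    have e: "tensor (\<lambda>j x. bump (0 + (1 / real (Suc n)) * x) * iexp (t $ j * x)) v = B n v * iexp (t \<bullet> v)" for v
      by (simp add: tensor_def B_def prod.distrib inner_vec_def sum_distrib_left flip: exp_sum)
    show "(LINT v|lborel. h v * B n v * iexp (t \<bullet> v)) = 0" using z' unfolding e by (simp only: mult.assoc)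
  qed
  then have "AE v in lborel. \<forall>n. h v * B n v = 0" by (subst AE_all_countable) blast
  then show ?thesis
  proof eventually_elim
    case (elim v)
    obtain n where n: "real n > norm v" using reals_Archimedean2 by blast
    have "bump (0 + 1 / real (Suc n) * v $ j) \<noteq> 0" for j
    proof (rule bump_nz)
      have "\<bar>v $ j\<bar> < real (Suc n)" using component_le_norm_cart[of v j] n by simp
      then show "\<bar>0 + 1 / real (Suc n) * v $ j\<bar> < 1" by (simp add: abs_mult field_simps del: of_nat_Suc)
    qed
    then have "B n v \<noteq> 0" by (simp add: B_def tensor_def)
    then show ?case using elim by auto
  qed
qed

lemma locally_integrable_diff:
  assumes "locally_integrable f" "locally_integrable g" shows "locally_integrable (\<lambda>v. f v - g v)"
  using assms unfolding locally_integrable_def by (auto intro!: set_integral_diff)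

lemma weak_laplacian_unique:
  assumes "has_weak_laplacian f h" "has_weak_laplacian f h'"
  shows "AE v in lborel. h v = h' v"
proof -
  have "AE v in lborel. h v - h' v = 0"
  proof (rule AE_zero_of_test_functions)
    show "locally_integrable (\<lambda>v. h v - h' v)"
      using assms by (auto simp: has_weak_laplacian_def intro: locally_integrable_diff)
    show "(LINT v|lborel. (h v - h' v) * \<phi> v) = 0" if "test_function \<phi>" for \<phi>
      using assms that unfolding has_weak_laplacian_def left_diff_distrib
      by (subst Bochner_Integration.integral_diff) (auto simp: locally_integrable_mult_test_function)
  qed
  then show ?thesis by simp
qed

section \<open>Multiplication by a linear function as a Jacobi matrix\<close>

definition jacobi :: "real^3 \<Rightarrow> (nat^3 \<Rightarrow> complex) \<Rightarrow> nat^3 \<Rightarrow> complex" where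
  "jacobi \<xi> c \<alpha> = (\<Sum>j\<in>UNIV. complex_of_real (\<xi> $ j) *
     (complex_of_real (sqrt (\<alpha> $ j + 1)) * c (\<alpha> + unit j) + complex_of_real (sqrt (\<alpha> $ j)) * c (\<alpha> - unit j)))"

definition deg_eq :: "nat \<Rightarrow> (nat^3) set" where "deg_eq N = {\<alpha>. deg \<alpha> = N}"

definition shell_sq :: "(nat^3 \<Rightarrow> complex) \<Rightarrow> nat \<Rightarrow> real" where
  "shell_sq c N = (\<Sum>\<alpha>\<in>deg_eq N. (cmod (c \<alpha>))\<^sup>2)"

text \<open>The half of the bilinear form of the Jacobi matrix that raises the degree.\<close>

definition raising_form :: "real^3 \<Rightarrow> (nat^3 \<Rightarrow> complex) \<Rightarrow> (nat^3 \<Rightarrow> complex) \<Rightarrow> (nat^3) set \<Rightarrow> complex" where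
  "raising_form \<xi> x y A = (\<Sum>j\<in>UNIV. complex_of_real (\<xi> $ j) * (\<Sum>\<alpha>\<in>A. complex_of_real (sqrt (\<alpha> $ j + 1)) * x (\<alpha> + unit j) * y \<alpha>))"

lemma finite_deg_eq [simp]: "finite (deg_eq N)"
  by (rule finite_subset[OF _ finite_deg_le[of N]]) (auto simp: deg_eq_def deg_le_def)

lemma finite_deg_less: "finite {\<alpha>. deg \<alpha> < N}"
  by (rule finite_subset[OF _ finite_deg_le[of N]]) (auto simp: deg_le_def)

lemma deg_add_unit [simp]: "deg (\<alpha> + unit j) = Suc (deg \<alpha>)"
proof -
  have "deg (\<alpha> + unit j) = (\<Sum>i\<in>UNIV. \<alpha> $ i) + (\<Sum>i\<in>UNIV. unit j $ i)"
    by (simp add: deg_def sum.distrib)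
  also have "(\<Sum>i\<in>UNIV. unit j $ i) = 1" by (simp add: axis_def unit_def)
  finally show ?thesis by (simp add: deg_def)
qed

lemma unit_nth_same [simp]: "unit j $ j = 1" by (simp add: unit_def)

lemma unit_cancel: "\<alpha> $ j \<noteq> 0 \<Longrightarrow> \<alpha> - unit j + unit j = (\<alpha> :: nat^3)"
  by (auto simp: vec_eq_iff axis_def unit_def)

lemma add_unit_diff [simp]: "(\<alpha> :: nat^3) + unit j - unit j = \<alpha>"
  by (auto simp: vec_eq_iff axis_def unit_def)

lemma sum_jacobi_mult:
  "(\<Sum>\<alpha>\<in>deg_le N. jacobi \<xi> x \<alpha> * y \<alpha>) = raising_form \<xi> x y (deg_le N) + raising_form \<xi> y x {\<alpha>. deg \<alpha> < N}"
proof -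
  have "(\<Sum>\<alpha>\<in>deg_le N. complex_of_real (sqrt (\<alpha> $ j)) * x (\<alpha> - unit j) * y \<alpha>)
      = (\<Sum>\<beta>\<in>{\<alpha>. deg \<alpha> < N}. complex_of_real (sqrt (\<beta> $ j + 1)) * y (\<beta> + unit j) * x \<beta>)" for j
  proof -
    have "(\<Sum>\<alpha>\<in>deg_le N. complex_of_real (sqrt (\<alpha> $ j)) * x (\<alpha> - unit j) * y \<alpha>)
       = (\<Sum>\<alpha>\<in>{\<alpha>\<in>deg_le N. \<alpha> $ j \<noteq> 0}. complex_of_real (sqrt (\<alpha> $ j)) * x (\<alpha> - unit j) * y \<alpha>)"
      by (rule sum.mono_neutral_right) auto
    also have "\<dots> = (\<Sum>\<beta>\<in>{\<alpha>. deg \<alpha> < N}. complex_of_real (sqrt (\<beta> $ j + 1)) * y (\<beta> + unit j) * x \<beta>)"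
    proof (rule sum.reindex_bij_witness[of _ "\<lambda>\<beta>. \<beta> + unit j" "\<lambda>\<alpha>. \<alpha> - unit j"])
      fix \<alpha> assume a: "\<alpha> \<in> {\<alpha> \<in> deg_le N. \<alpha> $ j \<noteq> 0}"
      then show e: "\<alpha> - unit j + unit j = \<alpha>" by (simp add: unit_cancel)
      then show "\<alpha> - unit j \<in> {\<alpha>. deg \<alpha> < N}" using a deg_add_unit[of "\<alpha> - unit j" j] by (simp add: deg_le_def)
      have "real ((\<alpha> - unit j) $ j) + 1 = real (\<alpha> $ j)" using a by (simp add: axis_def unit_def)
      then show "complex_of_real (sqrt ((\<alpha> - unit j) $ j + 1)) * y (\<alpha> - unit j + unit j) * x (\<alpha> - unit j)
        = complex_of_real (sqrt (\<alpha> $ j)) * x (\<alpha> - unit j) * y \<alpha>" unfolding e by simp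
    qed (auto simp: deg_le_def)
    finally show ?thesis .
  qed
  note d = this
  have "(\<Sum>\<alpha>\<in>deg_le N. jacobi \<xi> x \<alpha> * y \<alpha>) = (\<Sum>j\<in>UNIV. \<Sum>\<alpha>\<in>deg_le N. complex_of_real (\<xi> $ j) *
     (complex_of_real (sqrt (\<alpha> $ j + 1)) * x (\<alpha> + unit j) * y \<alpha> + complex_of_real (sqrt (\<alpha> $ j)) * x (\<alpha> - unit j) * y \<alpha>))"
    unfolding jacobi_def sum_distrib_right by (subst sum.swap) (simp add: algebra_simps)
  also have "\<dots> = raising_form \<xi> x y (deg_le N) + raising_form \<xi> y x {\<alpha>. deg \<alpha> < N}"
    unfolding raising_form_def sum_distrib_left[symmetric] sum.distrib d distrib_left ..
  finally show ?thesis .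
qed

lemma raising_form_deg_le: "raising_form \<xi> x y (deg_le N) = raising_form \<xi> x y {\<alpha>. deg \<alpha> < N} + raising_form \<xi> x y (deg_eq N)"
proof -
  have "deg_le N = {\<alpha>. deg \<alpha> < N} \<union> deg_eq N" "{\<alpha>. deg \<alpha> < N} \<inter> deg_eq N = {}"
    by (auto simp: deg_le_def deg_eq_def)
  then show ?thesis unfolding raising_form_def
    by (simp add: sum.union_disjoint finite_deg_less distrib_left sum.distrib)
qed

text \<open>The Jacobi matrix is symmetric, so truncating at degree \<open>N\<close> leaves only the coupling between the
shells \<open>N\<close> and \<open>N + 1\<close>.\<close>

lemma Green_jacobi:
  "(\<Sum>\<alpha>\<in>deg_le N. jacobi \<xi> x \<alpha> * y \<alpha>) - (\<Sum>\<alpha>\<in>deg_le N. x \<alpha> * jacobi \<xi> y \<alpha>) = raising_form \<xi> x y (deg_eq N) - raising_form \<xi> y x (deg_eq N)"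
  using sum_jacobi_mult[of \<xi> x y N] sum_jacobi_mult[of \<xi> y x N]
  by (simp add: raising_form_deg_le mult.commute)

lemma shell_sq_nonneg: "shell_sq c N \<ge> 0" by (simp add: shell_sq_def sum_nonneg)

lemma sum_shell_sq: "(\<Sum>n\<le>N. shell_sq c n) = (\<Sum>\<alpha>\<in>deg_le N. (cmod (c \<alpha>))\<^sup>2)"
proof -
  have "(\<Sum>\<alpha>\<in>deg_le N. (cmod (c \<alpha>))\<^sup>2) = (\<Sum>n\<in>{..N}. sum (\<lambda>\<alpha>. (cmod (c \<alpha>))\<^sup>2) {\<alpha>\<in>deg_le N. deg \<alpha> = n})"
    by (rule sum.group[symmetric]) (simp_all, auto simp: deg_le_def)
  also have "\<dots> = (\<Sum>n\<le>N. shell_sq c n)"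
    unfolding shell_sq_def by (intro sum.cong) (auto simp: deg_le_def deg_eq_def)
  finally show ?thesis ..
qed

text \<open>The matrix entries on the shell of degree \<open>N\<close> are at most \<open>|\<xi>| \<surd>(N + 1)\<close>.\<close>

lemma raising_form_deg_eq_bound:
  "cmod (raising_form \<xi> x y (deg_eq N)) \<le> 3 * norm \<xi> * (sqrt (real N + 1) * (shell_sq x (N + 1) + shell_sq y N))"
proof -
  have s: "(\<Sum>\<alpha>\<in>deg_eq N. (cmod (x (\<alpha> + unit j)))\<^sup>2) \<le> shell_sq x (N + 1)" for j
  proof -
    have "inj_on (\<lambda>\<alpha>. \<alpha> + unit j) (deg_eq N)" by (auto simp: inj_on_def)
    then have "(\<Sum>\<alpha>\<in>deg_eq N. (cmod (x (\<alpha> + unit j)))\<^sup>2) = (\<Sum>\<alpha>\<in>(\<lambda>\<alpha>. \<alpha> + unit j) ` deg_eq N. (cmod (x \<alpha>))\<^sup>2)"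
      by (simp add: sum.reindex)
    also have "\<dots> \<le> shell_sq x (N + 1)"
      unfolding shell_sq_def by (intro sum_mono2 finite_deg_eq) (auto simp: deg_eq_def)
    finally show ?thesis .
  qed
  have a: "cmod (\<Sum>\<alpha>\<in>deg_eq N. complex_of_real (sqrt (\<alpha> $ j + 1)) * x (\<alpha> + unit j) * y \<alpha>)
     \<le> sqrt (real N + 1) * (shell_sq x (N + 1) + shell_sq y N)" for j
  proof -
    have "cmod (\<Sum>\<alpha>\<in>deg_eq N. complex_of_real (sqrt (\<alpha> $ j + 1)) * x (\<alpha> + unit j) * y \<alpha>)
       \<le> (\<Sum>\<alpha>\<in>deg_eq N. sqrt (real N + 1) * ((cmod (x (\<alpha> + unit j)))\<^sup>2 + (cmod (y \<alpha>))\<^sup>2))"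
    proof (rule sum_norm_le)
      fix \<alpha> assume "\<alpha> \<in> deg_eq N"
      then have "sqrt (\<alpha> $ j + 1) \<le> sqrt (real N + 1)" using nth_le_deg[of \<alpha> j] by (simp add: deg_eq_def)
      moreover have "cmod (x (\<alpha> + unit j)) * cmod (y \<alpha>) \<le> (cmod (x (\<alpha> + unit j)))\<^sup>2 + (cmod (y \<alpha>))\<^sup>2"
        using sum_squares_bound[of "cmod (x (\<alpha> + unit j))" "cmod (y \<alpha>)"]
          mult_nonneg_nonneg[of "cmod (x (\<alpha> + unit j))" "cmod (y \<alpha>)", OF norm_ge_zero norm_ge_zero] by linarith
      ultimately have "sqrt (\<alpha> $ j + 1) * (cmod (x (\<alpha> + unit j)) * cmod (y \<alpha>)) \<le> sqrt (real N + 1) * ((cmod (x (\<alpha> + unit j)))\<^sup>2 + (cmod (y \<alpha>))\<^sup>2)"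
        by (intro mult_mono) auto
      then show "cmod (complex_of_real (sqrt (\<alpha> $ j + 1)) * x (\<alpha> + unit j) * y \<alpha>) \<le> sqrt (real N + 1) * ((cmod (x (\<alpha> + unit j)))\<^sup>2 + (cmod (y \<alpha>))\<^sup>2)"
        by (simp add: norm_mult mult.assoc)
    qed
    also have "\<dots> = sqrt (real N + 1) * ((\<Sum>\<alpha>\<in>deg_eq N. (cmod (x (\<alpha> + unit j)))\<^sup>2) + shell_sq y N)"
      by (simp add: sum_distrib_left sum.distrib shell_sq_def distrib_left)
    also have "\<dots> \<le> sqrt (real N + 1) * (shell_sq x (N + 1) + shell_sq y N)"
      by (intro mult_left_mono add_right_mono s) simp
    finally show ?thesis .
  qed
  have "cmod (raising_form \<xi> x y (deg_eq N)) \<le> (\<Sum>j\<in>(UNIV::3 set). norm \<xi> * (sqrt (real N + 1) * (shell_sq x (N + 1) + shell_sq y N)))"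
    unfolding raising_form_def
  proof (rule sum_norm_le)
    fix j :: 3
    show "cmod (complex_of_real (\<xi> $ j) * (\<Sum>\<alpha>\<in>deg_eq N. complex_of_real (sqrt (\<alpha> $ j + 1)) * x (\<alpha> + unit j) * y \<alpha>))
       \<le> norm \<xi> * (sqrt (real N + 1) * (shell_sq x (N + 1) + shell_sq y N))"
      unfolding norm_mult norm_of_real
      by (intro mult_mono a component_le_norm_cart) auto
  qed
  then show ?thesis by simp
qed

text \<open>Otherwise \<open>s\<^sub>N\<close> would be bounded below by a multiple of \<open>1/(N + 1)\<close>.\<close>

lemma sqrt_times_summable_frequently_small:
  fixes s :: "nat \<Rightarrow> real"
  assumes s: "summable s" "\<And>n. s n \<ge> 0" and e: "e > 0"
  shows "\<exists>N\<ge>N0. sqrt (real N + 1) * s N < e"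
proof (rule ccontr)
  assume "\<not> ?thesis"
  then have a: "e \<le> sqrt (real N + 1) * s N" if "N \<ge> N0" for N using that by (simp add: not_less add.commute)
  have "e * (1 / real (Suc N)) \<le> s N" if "N \<ge> N0" for N
  proof -
    have "sqrt (real N + 1) * 1 \<le> sqrt (real N + 1) * sqrt (real N + 1)" by (intro mult_left_mono) auto
    then have "sqrt (real N + 1) \<le> real N + 1" by simp
    then have "e \<le> (real N + 1) * s N" using a[OF that] s(2)[of N] mult_right_mono[of "sqrt (real N + 1)" "real N + 1" "s N"] by (simp add: add.commute)
    then show ?thesis by (simp add: field_simps)
  qed
  then have "summable (\<lambda>n. e * (1 / real (Suc n)))"
    by (intro summable_comparison_test'[OF s(1), of N0]) (use e in auto)
  then have "summable (\<lambda>n. 1 / real (Suc n))" by (rule summable_mult_D) (use e in simp)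
  then show False using not_summable_harmonic[where 'a=real] summable_Suc_iff[of "\<lambda>n. 1 / real n"] by (simp add: inverse_eq_divide)
qed

lemma summable_shell_sq: assumes "\<And>N. (\<Sum>\<alpha>\<in>deg_le N. (cmod (c \<alpha>))\<^sup>2) \<le> B" shows "summable (shell_sq c)"
  by (rule bounded_imp_summable[where B=B]) (simp_all add: shell_sq_nonneg sum_shell_sq assms)

text \<open>The means by which boundary terms disappear: they need not tend to zero, but they are frequently
small, which suffices for a sequence that is known to converge.\<close>

lemma boundary_limit_zero:
  assumes u: "u \<longlonglongrightarrow> (L::'a::real_normed_vector)" and x: "summable (shell_sq x)" and y: "summable (shell_sq y)"
    and b: "\<And>N. norm (u N) \<le> C * (sqrt (real N + 1) * (shell_sq x (N + 1) + shell_sq x N + shell_sq y (N + 1) + shell_sq y N))"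
  shows "L = 0"
proof (rule ccontr)
  assume "L \<noteq> 0"
  then have L: "norm L > 0" by simp
  define s where "s N = shell_sq x (N + 1) + shell_sq x N + shell_sq y (N + 1) + shell_sq y N" for N
  have s: "summable s" unfolding s_def
    using x y summable_ignore_initial_segment[OF x, of 1] summable_ignore_initial_segment[OF y, of 1]
    by (intro summable_add) auto
  have s0: "s n \<ge> 0" for n by (simp add: s_def shell_sq_nonneg)
  have "\<forall>\<^sub>F N in sequentially. norm (u N) > norm L / 2"
    using tendsto_norm[OF u] L by (intro order_tendstoD) auto
  then obtain N0 where N0: "\<And>N. N \<ge> N0 \<Longrightarrow> norm (u N) > norm L / 2" by (auto simp: eventually_sequentially)
  obtain N where N: "N \<ge> N0" "sqrt (real N + 1) * s N < norm L / 2 / (\<bar>C\<bar> + 1)"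
    using sqrt_times_summable_frequently_small[OF s s0, of "norm L / 2 / (\<bar>C\<bar> + 1)" N0] L
    by (auto simp: divide_pos_pos)
  have "norm (u N) \<le> (\<bar>C\<bar> + 1) * (sqrt (real N + 1) * s N)"
  proof -
    have "C * (sqrt (real N + 1) * s N) \<le> (\<bar>C\<bar> + 1) * (sqrt (real N + 1) * s N)"
      using s0[of N] by (intro mult_right_mono mult_nonneg_nonneg) auto
    then show ?thesis using b[of N] unfolding s_def by linarith
  qed
  also have "\<dots> \<le> norm L / 2" using N(2)
    by (subst (asm) pos_less_divide_eq) (auto simp: algebra_simps)
  finally show False using N0[OF N(1)] by simp
qed

lemma inner_mult_hermite3: "complex_of_real (v \<bullet> \<xi>) * hermite3 \<alpha> v = jacobi \<xi> (\<lambda>\<beta>. hermite3 \<beta> v) \<alpha>"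
proof -
  have "complex_of_real (v \<bullet> \<xi>) * hermite3 \<alpha> v = (\<Sum>j\<in>UNIV. complex_of_real (\<xi> $ j) * (complex_of_real (v $ j) * hermite3 \<alpha> v))"
    by (simp add: inner_vec_def sum_distrib_right sum_distrib_left mult_ac)
  then show ?thesis unfolding mult_hermite3 jacobi_def .
qed

lemma sq_integrable_nth_mult_hermite3: "sq_integrable (\<lambda>v. complex_of_real (v $ j) * hermite3 \<alpha> v)"
  unfolding mult_hermite3 by (intro sq_integrable_add sq_integrable_scale hermite3_sq_integrable)

lemma sq_integrable_inner_mult_hermite3: "sq_integrable (\<lambda>v. complex_of_real (v \<bullet> \<xi>) * hermite3 \<alpha> v)"
  unfolding inner_mult_hermite3 jacobi_def by (intro sq_integrable_sum sq_integrable_scale sq_integrable_add hermite3_sq_integrable)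

lemma sq_integrable_norm_sq_mult_hermite3: "sq_integrable (\<lambda>v. complex_of_real ((norm v)\<^sup>2) * hermite3 \<alpha> v)"
proof -
  have "complex_of_real ((norm v)\<^sup>2) * hermite3 \<alpha> v = (\<Sum>j\<in>UNIV. complex_of_real (sqrt (\<alpha> $ j + 1)) * (complex_of_real (v $ j) * hermite3 (\<alpha> + unit j) v)
       + complex_of_real (sqrt (\<alpha> $ j)) * (complex_of_real (v $ j) * hermite3 (\<alpha> - unit j) v))" for v
  proof -
    have "complex_of_real ((norm v)\<^sup>2) * hermite3 \<alpha> v = (\<Sum>j\<in>UNIV. complex_of_real (v $ j) * (complex_of_real (v $ j) * hermite3 \<alpha> v))"
      unfolding norm_sq_vec3 by (simp add: sum_distrib_right power2_eq_square mult.assoc)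
    also have "\<dots> = (\<Sum>j\<in>UNIV. complex_of_real (v $ j) * (complex_of_real (sqrt (\<alpha> $ j + 1)) * hermite3 (\<alpha> + unit j) v + complex_of_real (sqrt (\<alpha> $ j)) * hermite3 (\<alpha> - unit j) v))"
      by (simp only: mult_hermite3[of v _ \<alpha>])
    finally show ?thesis by (simp add: distrib_left mult.left_commute)
  qed
  then show ?thesis
    by (simp only:) (intro sq_integrable_sum sq_integrable_scale sq_integrable_add sq_integrable_nth_mult_hermite3)
qed

lemma integral_mult_jacobi:
  assumes f: "sq_integrable f"
  shows "(LINT v|lborel. f v * (complex_of_real (v \<bullet> \<xi>) * hermite3 \<alpha> v)) = jacobi \<xi> (coef f) \<alpha>"
proof -
  have "(LINT v|lborel. f v * (complex_of_real (v \<bullet> \<xi>) * hermite3 \<alpha> v))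
     = (LINT v|lborel. (\<Sum>j\<in>UNIV. complex_of_real (\<xi> $ j) * (complex_of_real (sqrt (\<alpha> $ j + 1)) * (f v * hermite3 (\<alpha> + unit j) v) + complex_of_real (sqrt (\<alpha> $ j)) * (f v * hermite3 (\<alpha> - unit j) v))))"
    unfolding inner_mult_hermite3 jacobi_def by (simp add: sum_distrib_left distrib_left mult_ac)
  also have "\<dots> = jacobi \<xi> (coef f) \<alpha>"
    unfolding jacobi_def coef_def using integrable_mult_hermite3[OF f]
    by (subst Bochner_Integration.integral_sum) (auto intro!: integrable_mult_right Bochner_Integration.integrable_add)
  finally show ?thesis .
qed

text \<open>With this potential the kinetic part of the operator, without the field and drag terms, is
\<open>\<Delta> - kinetic_pot \<xi>\<close>.\<close>

definition kinetic_pot :: "real^3 \<Rightarrow> real^3 \<Rightarrow> complex" where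
  "kinetic_pot \<xi> v = complex_of_real ((norm v)\<^sup>2 / 4 - 3 / 2) + \<i> * complex_of_real (v \<bullet> \<xi>)"

text \<open>The formula is the eigenvalue equation of the harmonic oscillator for \<open>\<Delta> h\<^sub>\<alpha>\<close>.\<close>

definition lap_hermite3 :: "nat^3 \<Rightarrow> real^3 \<Rightarrow> complex" where
  "lap_hermite3 \<alpha> v = complex_of_real ((norm v)\<^sup>2 / 4 - 3 / 2 - deg \<alpha>) * hermite3 \<alpha> v"

lemma kinetic_pot_measurable [measurable]: "kinetic_pot \<xi> \<in> borel_measurable borel"
  unfolding kinetic_pot_def[abs_def] by measurable

lemma sq_integrable_kinetic_pot_mult_hermite3: "sq_integrable (\<lambda>v. kinetic_pot \<xi> v * hermite3 \<alpha> v)"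
proof -
  have "kinetic_pot \<xi> v * hermite3 \<alpha> v = (1/4) * (complex_of_real ((norm v)\<^sup>2) * hermite3 \<alpha> v) + ((-3/2) * hermite3 \<alpha> v + \<i> * (complex_of_real (v \<bullet> \<xi>) * hermite3 \<alpha> v))" for v
    by (simp add: kinetic_pot_def algebra_simps)
  then show ?thesis
    by (simp only:) (intro sq_integrable_add sq_integrable_scale sq_integrable_norm_sq_mult_hermite3 hermite3_sq_integrable sq_integrable_inner_mult_hermite3)
qed

lemma lap_hermite3_eq: "lap_hermite3 \<alpha> v = kinetic_pot \<xi> v * hermite3 \<alpha> v + (- of_nat (deg \<alpha>) * hermite3 \<alpha> v + (- \<i>) * (complex_of_real (v \<bullet> \<xi>) * hermite3 \<alpha> v))"
  by (simp add: lap_hermite3_def kinetic_pot_def algebra_simps)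

lemma sq_integrable_lap_hermite3: "sq_integrable (lap_hermite3 \<alpha>)"
  unfolding lap_hermite3_eq[of \<alpha> _ 0, THEN ext[of "lap_hermite3 \<alpha>"]]
  by (intro sq_integrable_add sq_integrable_scale hermite3_sq_integrable sq_integrable_inner_mult_hermite3 sq_integrable_kinetic_pot_mult_hermite3)

text \<open>Testing \<open>f\<close> with \<open>\<Delta> h\<^sub>\<alpha> - kinetic_pot \<xi> h\<^sub>\<alpha>\<close> produces row \<open>\<alpha>\<close> of the matrix.\<close>

lemma integral_mult_lap_hermite3:
  assumes f: "sq_integrable f"
  shows "(LINT v|lborel. f v * lap_hermite3 \<alpha> v) = (LINT v|lborel. f v * (kinetic_pot \<xi> v * hermite3 \<alpha> v)) + (- of_nat (deg \<alpha>) * coef f \<alpha> - \<i> * jacobi \<xi> (coef f) \<alpha>)"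
proof -
  have "f v * lap_hermite3 \<alpha> v = f v * (kinetic_pot \<xi> v * hermite3 \<alpha> v) + (- of_nat (deg \<alpha>) * (f v * hermite3 \<alpha> v) + (- \<i>) * (f v * (complex_of_real (v \<bullet> \<xi>) * hermite3 \<alpha> v)))" for v
    unfolding lap_hermite3_eq[of \<alpha> v \<xi>] by (simp add: algebra_simps)
  then show ?thesis
    using integrable_mult_sq_integrable[OF f sq_integrable_kinetic_pot_mult_hermite3] integrable_mult_hermite3[OF f]
      integrable_mult_sq_integrable[OF f sq_integrable_inner_mult_hermite3]
    by (simp add: integral_mult_jacobi[OF f] coef_def[of f \<alpha>] Bochner_Integration.integrable_diff)
qed

section \<open>Hermite coefficients of a weak Laplacian\<close>

lemma hermite1_first_derivative_eq:
  "sqrt n * hermite1 (n - 1) x - x / 2 * hermite1 n x = (sqrt n / 2) * hermite1 (n - 1) x + (- sqrt (Suc n) / 2) * hermite1 (Suc n) x"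
  using mult_hermite1[of x n] by (simp add: field_simps)

definition hermite1_d :: "nat \<Rightarrow> real \<Rightarrow> real" where "hermite1_d n x = sqrt n * hermite1 (n - 1) x - x / 2 * hermite1 n x"
text \<open>The eigenvalue equation solved for the second derivative.\<close>

definition hermite1_dd :: "nat \<Rightarrow> real \<Rightarrow> real" where "hermite1_dd n x = (x\<^sup>2 / 4 - 1 / 2 - n) * hermite1 n x"

lemma hermite1_derivs:
  "((\<lambda>x. complex_of_real (hermite1 n x)) has_vector_derivative complex_of_real (hermite1_d n x)) (at x)"
  "((\<lambda>x. complex_of_real (hermite1_d n x)) has_vector_derivative complex_of_real (hermite1_dd n x)) (at x)"
  using has_vector_derivative_of_real[OF hermite1_has_derivative[of n x]] has_vector_derivative_of_real[OF hermite1_second_derivative[of n x]]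
  by (simp_all only: hermite1_d_def[abs_def] hermite1_dd_def)

text \<open>Half of the decay exponent of the ground state is given away, which is enough for square
integrability and stable under multiplication by \<open>x\<close> of the Hermite functions.\<close>

definition gauss_bounded :: "(real \<Rightarrow> real) \<Rightarrow> bool" where
  "gauss_bounded k \<longleftrightarrow> (\<exists>C\<ge>0. \<forall>x. \<bar>k x\<bar> \<le> C * exp (- x\<^sup>2 / 8))"

lemma gauss_bounded_hermite1: "gauss_bounded (hermite1 n)" unfolding gauss_bounded_def using hermite1_bound by metis

lemma gauss_bounded_add: assumes "gauss_bounded f" "gauss_bounded g" shows "gauss_bounded (\<lambda>x. f x + g x)"
proof -
  from assms obtain C D where C: "C \<ge> 0" "\<And>x. \<bar>f x\<bar> \<le> C * exp (- x\<^sup>2 / 8)" and D: "D \<ge> 0" "\<And>x. \<bar>g x\<bar> \<le> D * exp (- x\<^sup>2 / 8)"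
    by (auto simp: gauss_bounded_def)
  have "\<bar>f x + g x\<bar> \<le> (C + D) * exp (- x\<^sup>2 / 8)" for x
    using C(2)[of x] D(2)[of x] abs_triangle_ineq[of "f x" "g x"] by (simp add: distrib_right)
  then show ?thesis unfolding gauss_bounded_def using C D by (intro exI[of _ "C + D"]) auto
qed

lemma gauss_bounded_cmult: assumes "gauss_bounded f" shows "gauss_bounded (\<lambda>x. c * f x)"
proof -
  from assms obtain C where C: "C \<ge> 0" "\<And>x. \<bar>f x\<bar> \<le> C * exp (- x\<^sup>2 / 8)" by (auto simp: gauss_bounded_def)
  have "\<bar>c * f x\<bar> \<le> (\<bar>c\<bar> * C) * exp (- x\<^sup>2 / 8)" for x
    using mult_left_mono[OF C(2)[of x], of "\<bar>c\<bar>"] by (simp add: abs_mult mult.assoc)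
  then show ?thesis unfolding gauss_bounded_def using C by (intro exI[of _ "\<bar>c\<bar> * C"]) auto
qed

lemma gauss_bounded_mult_hermite1: "gauss_bounded (\<lambda>x. x * hermite1 n x)"
  unfolding mult_hermite1 by (intro gauss_bounded_add gauss_bounded_cmult gauss_bounded_hermite1)

lemma gauss_bounded_hermite1_d: "gauss_bounded (hermite1_d n)"
  unfolding hermite1_d_def[abs_def] hermite1_first_derivative_eq by (intro gauss_bounded_add gauss_bounded_cmult gauss_bounded_hermite1)

lemma gauss_bounded_hermite1_dd: "gauss_bounded (hermite1_dd n)"
proof -
  have "hermite1_dd n x = (1/4) * (sqrt (Suc n) * (x * hermite1 (Suc n) x) + sqrt n * (x * hermite1 (n - 1) x)) + (- 1/2 - n) * hermite1 n x" for x
  proof -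
    have "hermite1_dd n x = (1/4) * (x * (x * hermite1 n x)) + (- 1/2 - n) * hermite1 n x"
      by (simp add: hermite1_dd_def power2_eq_square algebra_simps)
    then show ?thesis unfolding mult_hermite1[of x n] by (simp add: algebra_simps)
  qed
  then have "hermite1_dd n = (\<lambda>x. (1/4) * (sqrt (Suc n) * (x * hermite1 (Suc n) x) + sqrt n * (x * hermite1 (n - 1) x)) + (- 1/2 - n) * hermite1 n x)" ..
  then show ?thesis by (simp only:) (intro gauss_bounded_add gauss_bounded_cmult gauss_bounded_hermite1 gauss_bounded_mult_hermite1)
qed

lemma tensor_bound:
  assumes "\<And>j x. cmod (g j x) \<le> M * exp (- x\<^sup>2 / 8)"
  shows "cmod (tensor g v) \<le> M ^ 3 * exp (- (norm v)\<^sup>2 / 8)"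
proof -
  have "cmod (tensor g v) \<le> (\<Prod>j\<in>UNIV. M * exp (- (v $ j)\<^sup>2 / 8))"
    unfolding tensor_def prod_norm[symmetric] by (intro prod_mono conjI assms) auto
  also have "\<dots> = M ^ 3 * exp (\<Sum>j\<in>UNIV. - (v $ j)\<^sup>2 / 8)"
    by (simp add: prod.distrib exp_sum)
  also have "(\<Sum>j\<in>UNIV. - (v $ j)\<^sup>2 / 8) = - (norm v)\<^sup>2 / 8"
    by (simp add: norm_sq_vec3 sum_negf sum_divide_distrib)
  finally show ?thesis .
qed

lemma lap_hermite3_eq_sum:
  "lap_hermite3 \<alpha> v = (\<Sum>j\<in>UNIV. tensor ((\<lambda>j x. complex_of_real (hermite1 (\<alpha> $ j) x))(j := \<lambda>x. complex_of_real (hermite1_dd (\<alpha> $ j) x))) v)"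
proof -
  have "tensor ((\<lambda>j x. complex_of_real (hermite1 (\<alpha> $ j) x))(j := \<lambda>x. complex_of_real (hermite1_dd (\<alpha> $ j) x))) v
     = complex_of_real ((v $ j)\<^sup>2 / 4 - 1 / 2 - \<alpha> $ j) * hermite3 \<alpha> v" for j
    unfolding tensor_upd hermite3_split[of \<alpha> v j] by (simp add: hermite1_dd_def)
  then have "(\<Sum>j\<in>UNIV. tensor ((\<lambda>j x. complex_of_real (hermite1 (\<alpha> $ j) x))(j := \<lambda>x. complex_of_real (hermite1_dd (\<alpha> $ j) x))) v)
     = complex_of_real (\<Sum>j\<in>UNIV. (v $ j)\<^sup>2 / 4 - 1 / 2 - \<alpha> $ j) * hermite3 \<alpha> v"
    by (simp only: of_real_sum sum_distrib_right)
  also have "(\<Sum>j\<in>UNIV. (v $ j)\<^sup>2 / 4 - 1 / 2 - \<alpha> $ j) = (norm v)\<^sup>2 / 4 - 3 / 2 - deg \<alpha>"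
    by (simp add: norm_sq_vec3 deg_def sum_subtractf sum_divide_distrib)
  finally show ?thesis by (simp only: lap_hermite3_def)
qed

lemma integral_tendsto_L2_dominated:
  assumes f: "sq_integrable f" and g: "sq_integrable g"
    and m: "\<And>n. p n \<in> borel_measurable borel" and mq: "q \<in> borel_measurable borel"
    and b: "\<And>n v. cmod (p n v) \<le> cmod (g v)" and l: "\<And>v. (\<lambda>n. p n v) \<longlonglongrightarrow> q v"
  shows "(\<lambda>n. LINT v|lborel. f v * p n v) \<longlonglongrightarrow> (LINT v|lborel. f v * q v)"
proof (rule integral_dominated_convergence[where w="\<lambda>v. cmod (f v * g v)"])
  have [measurable]: "f \<in> borel_measurable borel" by (rule sq_integrable_measurable[OF f])
  note m[measurable] mq[measurable]
  show "(\<lambda>v. f v * q v) \<in> borel_measurable lborel" by measurable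
  show "(\<lambda>v. f v * p n v) \<in> borel_measurable lborel" for n by measurable
  show "integrable lborel (\<lambda>v. cmod (f v * g v))" by (intro integrable_norm integrable_mult_sq_integrable f g)
  show "AE v in lborel. (\<lambda>n. f v * p n v) \<longlonglongrightarrow> f v * q v" by (intro AE_I2 tendsto_intros l)
  show "AE v in lborel. norm (f v * p n v) \<le> cmod (f v * g v)" for n
    using b by (intro AE_I2) (simp add: norm_mult mult_left_mono)
qed

text \<open>A Hermite function is not a test function.  It is cut off by a product of bumps of width \<open>n\<close>; in
the limit the derivatives that fall on the cutoff vanish, and everything is dominated by Gaussians
against \<open>f\<close> and \<open>F\<close>.\<close>

lemma coef_of_weak_laplacian:
  assumes f: "sq_integrable f" and F: "sq_integrable F" and wl: "has_weak_laplacian f h"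
    and h: "\<And>v. h v = F v + kinetic_pot \<xi> v * f v"
  shows "coef F \<alpha> = - of_nat (deg \<alpha>) * coef f \<alpha> - \<i> * jacobi \<xi> (coef f) \<alpha>"
proof -
  define r where "r n = 1 / real (Suc n)" for n
  have r: "0 \<le> r n" "r n \<le> 1" for n by (simp_all add: r_def)
  have r0: "r \<longlonglongrightarrow> 0" unfolding r_def[abs_def] by (rule LIMSEQ_Suc[OF lim_1_over_n])
  obtain B where B: "B \<ge> 0" "\<And>x. cmod (bump x) \<le> B" "\<And>x. cmod (deriv1 bump x) \<le> B" "\<And>x. cmod (deriv1 (deriv1 bump) x) \<le> B"
    using bump_bounds by blast
  (* The cutoff bump(x/(n+1)) tends to 1, and its derivatives carry factors 1/(n+1).  The term
     0 + keeps the shape of the affine substitution lemma. *)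
  define b where "b n x = bump (0 + r n * x)" for n x
  define b1 where "b1 n x = complex_of_real (r n) * deriv1 bump (0 + r n * x)" for n x
  define b2 where "b2 n x = complex_of_real (r n) * (complex_of_real (r n) * deriv1 (deriv1 bump) (0 + r n * x))" for n x
  have chain: "((\<lambda>x. k (0 + c * x)) has_vector_derivative complex_of_real c * deriv1 k (0 + c * x)) (at x)" if "smooth_real k" for k c x
  proof -
    have "((\<lambda>x. 0 + c * x) has_vector_derivative c) (at x)"
      unfolding has_real_derivative_iff_has_vector_derivative[symmetric] by (auto intro!: derivative_eq_intros)
    from vector_diff_chain_at[OF this smooth_real_deriv1(1)[OF that]] show ?thesis by (simp add: o_def scaleR_conv_of_real)
  qed
  have db: "(b n has_vector_derivative b1 n x) (at x)" for n x
    unfolding b_def b1_def by (rule chain[OF smooth_real_bump])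
  have db1: "(b1 n has_vector_derivative b2 n x) (at x)" for n x
    unfolding b1_def b2_def by (intro has_vector_derivative_mult_right chain smooth_real_deriv1(2) smooth_real_bump)
  have bb: "cmod (b n x) \<le> B" "cmod (b1 n x) \<le> B" "cmod (b2 n x) \<le> B" for n x
  proof -
    show "cmod (b n x) \<le> B" by (simp only: b_def B)
    have "cmod (b1 n x) = r n * cmod (deriv1 bump (0 + r n * x))"
      unfolding b1_def norm_mult norm_of_real using r by simp
    also have "\<dots> \<le> 1 * B" using r B by (intro mult_mono) auto
    finally show "cmod (b1 n x) \<le> B" by simp
    have "cmod (b2 n x) = r n * (r n * cmod (deriv1 (deriv1 bump) (0 + r n * x)))"
      unfolding b2_def norm_mult norm_of_real using r by simp
    also have "\<dots> \<le> 1 * (1 * B)" using r B by (intro mult_mono) auto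
    finally show "cmod (b2 n x) \<le> B" by simp
  qed
  have lb: "(\<lambda>n. b n x) \<longlonglongrightarrow> 1" "(\<lambda>n. b1 n x) \<longlonglongrightarrow> 0" "(\<lambda>n. b2 n x) \<longlonglongrightarrow> 0" for x
  proof -
    have a: "(\<lambda>n. 0 + r n * x) \<longlonglongrightarrow> 0" using tendsto_mult[OF r0 tendsto_const[of x]] by simp
    have c: "(\<lambda>n. k (0 + r n * x)) \<longlonglongrightarrow> k 0" if "smooth_real k" for k
      using isCont_tendsto_compose[OF _ a, of k] smooth_real_continuous[OF that, of UNIV]
      by (simp add: continuous_on_eq_continuous_at)
    have rc: "(\<lambda>n. complex_of_real (r n)) \<longlonglongrightarrow> complex_of_real 0" by (intro tendsto_of_real r0)
    show "(\<lambda>n. b n x) \<longlonglongrightarrow> 1" using c[OF smooth_real_bump] by (simp add: b_def)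
    show "(\<lambda>n. b1 n x) \<longlonglongrightarrow> 0"
      using tendsto_mult[OF rc c[OF smooth_real_deriv1(2)[OF smooth_real_bump]]] by (simp add: b1_def)
    show "(\<lambda>n. b2 n x) \<longlonglongrightarrow> 0"
      using tendsto_mult[OF rc tendsto_mult[OF rc c[OF smooth_real_deriv1(2)[OF smooth_real_deriv1(2)[OF smooth_real_bump]]]]]
      by (simp add: b2_def)
  qed
  define H where "H j x = complex_of_real (hermite1 (\<alpha> $ j) x)" for j x
  define H1 where "H1 j x = complex_of_real (hermite1_d (\<alpha> $ j) x)" for j x
  define H2 where "H2 j x = complex_of_real (hermite1_dd (\<alpha> $ j) x)" for j x
  have dH: "(H j has_vector_derivative H1 j x) (at x)" "(H1 j has_vector_derivative H2 j x) (at x)" for j x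
    unfolding H_def H1_def H2_def by (rule hermite1_derivs)+
  define g where "g n j x = b n x * H j x" for n j x
  define g1 where "g1 n j x = b n x * H1 j x + b1 n x * H j x" for n j x
  define g2 where "g2 n j x = (b n x * H2 j x + b1 n x * H1 j x) + (b1 n x * H1 j x + b2 n x * H j x)" for n j x
  have dg: "deriv1 (g n j) = g1 n j" for n j
    by (rule deriv1_eqI) (unfold g_def g1_def, intro has_vector_derivative_mult db dH)
  have dg1: "deriv1 (g1 n j) = g2 n j" for n j
    by (rule deriv1_eqI) (unfold g1_def g2_def, intro has_vector_derivative_add has_vector_derivative_mult db db1 dH)
  have sg: "smooth_real (g n j)" for n j
    unfolding g_def[abs_def] b_def H_def by (intro smooth_real_mult smooth_real_affine smooth_real_bump smooth_real_hermite1)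
  define \<phi> where "\<phi> n = tensor (g n)" for n
  have test: "test_function (\<phi> n)" for n
    unfolding \<phi>_def
  proof (rule test_function_tensor[OF sg])
    fix j and x :: real assume x: "\<bar>x\<bar> \<ge> real (Suc n)"
    have "bump (0 + r n * x) = 0"
      using x by (intro bump_zero) (simp add: r_def field_simps abs_mult del: of_nat_Suc)
    then show "g n j x = 0" by (simp add: g_def b_def)
  qed
  have lap: "classical_laplacian (\<phi> n) v = (\<Sum>j\<in>UNIV. tensor ((g n)(j := g2 n j)) v)" for n v
    unfolding \<phi>_def by (subst classical_laplacian_tensor[OF sg]) (simp add: dg dg1)
  have "\<exists>M\<ge>0. \<forall>j x. cmod (H j x) \<le> M * exp (- x\<^sup>2 / 8) \<and> cmod (H1 j x) \<le> M * exp (- x\<^sup>2 / 8) \<and> cmod (H2 j x) \<le> M * exp (- x\<^sup>2 / 8)"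
  proof -
    have "\<exists>C\<ge>0. \<forall>x. \<bar>hermite1 (\<alpha> $ j) x\<bar> \<le> C * exp (- x\<^sup>2 / 8)" "\<exists>C\<ge>0. \<forall>x. \<bar>hermite1_d (\<alpha> $ j) x\<bar> \<le> C * exp (- x\<^sup>2 / 8)"
       "\<exists>C\<ge>0. \<forall>x. \<bar>hermite1_dd (\<alpha> $ j) x\<bar> \<le> C * exp (- x\<^sup>2 / 8)" for j
      using gauss_bounded_hermite1[of "\<alpha> $ j"] gauss_bounded_hermite1_d[of "\<alpha> $ j"] gauss_bounded_hermite1_dd[of "\<alpha> $ j"] by (simp_all add: gauss_bounded_def)
    then obtain C D E where C: "\<And>j. C j \<ge> 0" "\<And>j x. \<bar>hermite1 (\<alpha> $ j) x\<bar> \<le> C j * exp (- x\<^sup>2 / 8)"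
      and D: "\<And>j. D j \<ge> 0" "\<And>j x. \<bar>hermite1_d (\<alpha> $ j) x\<bar> \<le> D j * exp (- x\<^sup>2 / 8)"
      and E: "\<And>j. E j \<ge> 0" "\<And>j x. \<bar>hermite1_dd (\<alpha> $ j) x\<bar> \<le> E j * exp (- x\<^sup>2 / 8)" by metis
    define M where "M = (\<Sum>j\<in>UNIV. C j + D j + E j)"
    have M: "C j + D j + E j \<le> M" for j
      unfolding M_def by (rule member_le_sum) (use C(1) D(1) E(1) in \<open>auto simp: add_nonneg_nonneg\<close>)
    have ex: "c * exp (- x\<^sup>2 / 8) \<le> M * exp (- x\<^sup>2 / 8)" if "c \<le> M" for c x :: real
      using that by (intro mult_right_mono) auto
    have "M \<ge> 0" using M[of 1] C(1)[of 1] D(1)[of 1] E(1)[of 1] by linarith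
    moreover have "cmod (H j x) \<le> M * exp (- x\<^sup>2 / 8)" for j x
      unfolding H_def norm_of_real
      by (rule order_trans[OF C(2) ex]) (use M[of j] D(1)[of j] E(1)[of j] in linarith)
    moreover have "cmod (H1 j x) \<le> M * exp (- x\<^sup>2 / 8)" for j x
      unfolding H1_def norm_of_real
      by (rule order_trans[OF D(2) ex]) (use M[of j] C(1)[of j] E(1)[of j] in linarith)
    moreover have "cmod (H2 j x) \<le> M * exp (- x\<^sup>2 / 8)" for j x
      unfolding H2_def norm_of_real
      by (rule order_trans[OF E(2) ex]) (use M[of j] D(1)[of j] C(1)[of j] in linarith)
    ultimately show ?thesis by blast
  qed
  then obtain M where M: "M \<ge> 0" "\<And>j x. cmod (H j x) \<le> M * exp (- x\<^sup>2 / 8)"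
    "\<And>j x. cmod (H1 j x) \<le> M * exp (- x\<^sup>2 / 8)" "\<And>j x. cmod (H2 j x) \<le> M * exp (- x\<^sup>2 / 8)" by blast
  define K where "K = 4 * (B * M)"
  have K0: "K \<ge> 0" using B M by (simp add: K_def)
  have prodb: "cmod (p * q) \<le> B * M * exp (- x\<^sup>2 / 8)" if "cmod p \<le> B" "cmod q \<le> M * exp (- x\<^sup>2 / 8)" for p q and x :: real
    using mult_mono[OF that] B M by (simp add: norm_mult mult.assoc)
  have gK: "cmod (g n j x) \<le> K * exp (- x\<^sup>2 / 8)" for n j x
  proof -
    have "cmod (g n j x) \<le> B * M * exp (- x\<^sup>2 / 8)" unfolding g_def by (intro prodb bb M)
    also have "\<dots> \<le> K * exp (- x\<^sup>2 / 8)" using B M by (intro mult_right_mono) (auto simp: K_def)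
    finally show ?thesis .
  qed
  have g2K: "cmod (g2 n j x) \<le> K * exp (- x\<^sup>2 / 8)" for n j x
  proof -
    have "cmod (g2 n j x) \<le> (B * M * exp (- x\<^sup>2 / 8) + B * M * exp (- x\<^sup>2 / 8)) + (B * M * exp (- x\<^sup>2 / 8) + B * M * exp (- x\<^sup>2 / 8))"
      unfolding g2_def by (intro norm_triangle_le add_mono order_trans[OF norm_triangle_ineq] prodb bb M)
    then show ?thesis by (simp add: K_def)
  qed
  have gl: "(\<lambda>n. g n j x) \<longlonglongrightarrow> H j x" for j x
    using tendsto_mult[OF lb(1)[of x] tendsto_const[of "H j x"]] by (simp add: g_def)
  have g2l: "(\<lambda>n. g2 n j x) \<longlonglongrightarrow> H2 j x" for j x
  proof -
    have "(\<lambda>n. g2 n j x) \<longlonglongrightarrow> (1 * H2 j x + 0 * H1 j x) + (0 * H1 j x + 0 * H j x)"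
      unfolding g2_def by (intro tendsto_intros lb)
    then show ?thesis by simp
  qed
  have pl: "(\<lambda>n. tensor (g n) v) \<longlonglongrightarrow> hermite3 \<alpha> v" for v
    unfolding tensor_def hermite3_def using gl by (auto intro!: tendsto_prod simp: H_def)
  have ll: "(\<lambda>n. classical_laplacian (\<phi> n) v) \<longlonglongrightarrow> lap_hermite3 \<alpha> v" for v
    unfolding lap lap_hermite3_eq_sum
  proof (rule tendsto_sum)
    fix j :: 3
    show "(\<lambda>n. tensor ((g n)(j := g2 n j)) v) \<longlonglongrightarrow> tensor ((\<lambda>j x. complex_of_real (hermite1 (\<alpha> $ j) x))(j := \<lambda>x. complex_of_real (hermite1_dd (\<alpha> $ j) x))) v"
      unfolding tensor_upd using gl g2l by (intro tendsto_mult tendsto_prod) (auto simp: H_def H2_def)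
  qed
  have lb': "cmod (classical_laplacian (\<phi> n) v) \<le> 3 * K ^ 3 * exp (- (norm v)\<^sup>2 / 8)" for n v
  proof -
    have "cmod (classical_laplacian (\<phi> n) v) \<le> (\<Sum>j\<in>(UNIV::3 set). K ^ 3 * exp (- (norm v)\<^sup>2 / 8))"
      unfolding lap
    proof (intro sum_norm_le tensor_bound)
      fix j i x
      show "cmod (((g n)(j := g2 n j)) i x) \<le> K * exp (- x\<^sup>2 / 8)"
        using gK[of n i x] g2K[of n i x] by (cases "i = j") auto
    qed
    then show ?thesis by simp
  qed
  have cont: "continuous_on UNIV (\<phi> n)" for n by (rule test_function_continuous[OF test])
  have [measurable]: "\<phi> n \<in> borel_measurable borel" for n by (rule borel_measurable_continuous_onI[OF cont])
  have lapm: "classical_laplacian (\<phi> n) \<in> borel_measurable borel" for n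
  proof -
    have s1: "smooth_real (g2 n j)" for j using smooth_real_deriv1(2)[OF smooth_real_deriv1(2)[OF sg]] by (simp add: dg dg1)
    have "continuous_on UNIV (\<lambda>v. tensor ((g n)(j := g2 n j)) v)" for j
      unfolding tensor_def
      by (intro continuous_intros continuous_on_compose2[OF smooth_real_continuous[where A=UNIV]]) (auto simp: sg s1)
    then show ?thesis unfolding lap[abs_def]
      by (intro borel_measurable_continuous_onI continuous_intros) 
  qed
  have lim1: "(\<lambda>n. LINT v|lborel. f v * classical_laplacian (\<phi> n) v) \<longlonglongrightarrow> (LINT v|lborel. f v * lap_hermite3 \<alpha> v)"
  proof (rule integral_tendsto_L2_dominated[OF f, where g="\<lambda>v. complex_of_real (3 * K ^ 3 * exp (- (norm v)\<^sup>2 / 8))"])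
    show "sq_integrable (\<lambda>v::real^3. complex_of_real (3 * K ^ 3 * exp (- (norm v)\<^sup>2 / 8)))"
      by (rule sq_integrable_gaussian_bound[of _ "1/8" "3 * K ^ 3"]) (use K0 in \<open>auto simp: norm_mult norm_power\<close>)
    show "lap_hermite3 \<alpha> \<in> borel_measurable borel" by (rule sq_integrable_measurable[OF sq_integrable_lap_hermite3])
    show "cmod (classical_laplacian (\<phi> n) v) \<le> cmod (complex_of_real (3 * K ^ 3 * exp (- (norm v)\<^sup>2 / 8)))" for n v
      using lb'[of n v] K0 by (simp only: norm_of_real)
  qed (use lapm ll in auto)
  have pb: "cmod (\<phi> n v) \<le> B ^ 3 * cmod (hermite3 \<alpha> v)" for n v
  proof -
    have "\<phi> n v = (\<Prod>j\<in>UNIV. b n (v $ j)) * hermite3 \<alpha> v"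
      by (simp add: \<phi>_def tensor_def g_def prod.distrib hermite3_def H_def)
    moreover have "cmod (\<Prod>j\<in>UNIV. b n (v $ j)) \<le> (\<Prod>j\<in>(UNIV::3 set). B)"
      unfolding prod_norm[symmetric] by (intro prod_mono conjI bb) auto
    ultimately show ?thesis by (simp add: norm_mult mult_right_mono)
  qed
  have lim2: "(\<lambda>n. LINT v|lborel. F v * \<phi> n v) \<longlonglongrightarrow> coef F \<alpha>"
    unfolding coef_def
  proof (rule integral_tendsto_L2_dominated[OF F, where g="\<lambda>v. complex_of_real (B ^ 3) * hermite3 \<alpha> v"])
    show "cmod (\<phi> n v) \<le> cmod (complex_of_real (B ^ 3) * hermite3 \<alpha> v)" for n v
      using pb[of n v] B(1) by (simp add: norm_mult norm_power)
  qed (use pl in \<open>auto simp: \<phi>_def[symmetric] intro!: sq_integrable_scale hermite3_sq_integrable\<close>)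
  have pp: "cmod (kinetic_pot \<xi> v * \<phi> n v) \<le> cmod (complex_of_real (B ^ 3) * (kinetic_pot \<xi> v * hermite3 \<alpha> v))" for n v
    using mult_left_mono[OF pb[of n v], of "cmod (kinetic_pot \<xi> v)"] B(1) by (simp add: norm_mult norm_power mult_ac)
  have sp: "sq_integrable (\<lambda>v. complex_of_real (B ^ 3) * (kinetic_pot \<xi> v * hermite3 \<alpha> v))"
    by (intro sq_integrable_scale sq_integrable_kinetic_pot_mult_hermite3)
  have lim3: "(\<lambda>n. LINT v|lborel. f v * (kinetic_pot \<xi> v * \<phi> n v)) \<longlonglongrightarrow> (LINT v|lborel. f v * (kinetic_pot \<xi> v * hermite3 \<alpha> v))"
  proof (rule integral_tendsto_L2_dominated[OF f sp _ _ pp])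
    show "(\<lambda>n. kinetic_pot \<xi> v * \<phi> n v) \<longlonglongrightarrow> kinetic_pot \<xi> v * hermite3 \<alpha> v" for v
      using pl[of v] by (intro tendsto_intros) (simp add: \<phi>_def)
  qed measurable
  have i1: "integrable lborel (\<lambda>v. F v * \<phi> n v)" for n
  proof (rule integrable_mult_sq_integrable[OF F])
    have "integrable lborel (\<lambda>v. (cmod (complex_of_real (B ^ 3) * hermite3 \<alpha> v))\<^sup>2)"
      using sq_integrable_scale[OF hermite3_sq_integrable] by (simp only: sq_integrable_def)
    then have "integrable lborel (\<lambda>v. (cmod (\<phi> n v))\<^sup>2)"
      by (rule Bochner_Integration.integrable_bound)
        (use pb[of n] B(1) in \<open>auto simp: norm_mult norm_power intro!: power_mono\<close>)
    then show "sq_integrable (\<phi> n)" by (simp add: sq_integrable_def)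
  qed
  have i2: "integrable lborel (\<lambda>v. f v * (kinetic_pot \<xi> v * \<phi> n v))" for n
  proof (rule integrable_mult_sq_integrable[OF f])
    have "integrable lborel (\<lambda>v. (cmod (complex_of_real (B ^ 3) * (kinetic_pot \<xi> v * hermite3 \<alpha> v)))\<^sup>2)"
      using sp by (simp only: sq_integrable_def)
    then have "integrable lborel (\<lambda>v. (cmod (kinetic_pot \<xi> v * \<phi> n v))\<^sup>2)"
      by (rule Bochner_Integration.integrable_bound)
        (use pp[of _ n] in \<open>auto simp del: norm_mult intro!: power_mono AE_I2\<close>)
    then show "sq_integrable (\<lambda>v. kinetic_pot \<xi> v * \<phi> n v)" by (simp add: sq_integrable_def)
  qed
  have "(LINT v|lborel. f v * classical_laplacian (\<phi> n) v) = (LINT v|lborel. F v * \<phi> n v) + (LINT v|lborel. f v * (kinetic_pot \<xi> v * \<phi> n v))" for n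
  proof -
    have "(LINT v|lborel. f v * classical_laplacian (\<phi> n) v) = (LINT v|lborel. h v * \<phi> n v)"
      using wl test by (simp add: has_weak_laplacian_def)
    also have "\<dots> = (LINT v|lborel. F v * \<phi> n v + f v * (kinetic_pot \<xi> v * \<phi> n v))"
      by (simp add: h algebra_simps)
    finally show ?thesis using i1 i2 by simp
  qed
  then have "(\<lambda>n. LINT v|lborel. f v * classical_laplacian (\<phi> n) v) \<longlonglongrightarrow> coef F \<alpha> + (LINT v|lborel. f v * (kinetic_pot \<xi> v * hermite3 \<alpha> v))"
    using tendsto_add[OF lim2 lim3] by simp
  with lim1 have "(LINT v|lborel. f v * lap_hermite3 \<alpha> v) = coef F \<alpha> + (LINT v|lborel. f v * (kinetic_pot \<xi> v * hermite3 \<alpha> v))"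
    by (rule LIMSEQ_unique)
  then show ?thesis unfolding integral_mult_lap_hermite3[OF f, of _ \<xi>] by simp
qed

section \<open>Integration by parts against test functions\<close>

lemma directional_derivative:
  assumes "f differentiable (at v)"
  shows "((\<lambda>t. f (v + t *\<^sub>R e)) has_vector_derivative frechet_derivative f (at v) e) (at 0)"
proof -
  have D: "(f has_derivative frechet_derivative f (at v)) (at v)" using assms frechet_derivative_works by blast
  have l: "((\<lambda>t. v + t *\<^sub>R e) has_derivative (\<lambda>t. t *\<^sub>R e)) (at 0)" by (auto intro!: derivative_eq_intros)
  have "((f \<circ> (\<lambda>t. v + t *\<^sub>R e)) has_derivative (frechet_derivative f (at v) \<circ> (\<lambda>t. t *\<^sub>R e))) (at 0)"
    by (rule diff_chain_at[OF l]) (use D in simp)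
  moreover have "frechet_derivative f (at v) \<circ> (\<lambda>t. t *\<^sub>R e) = (\<lambda>t. t *\<^sub>R frechet_derivative f (at v) e)"
    by (rule ext) (simp only: o_apply linear_scale[OF has_derivative_linear[OF D]])
  ultimately show ?thesis unfolding has_vector_derivative_def by (simp only: o_def)
qed

lemma partial_deriv_directional:
  "f differentiable (at v) \<Longrightarrow> ((\<lambda>t. f (v + t *\<^sub>R axis j 1)) has_vector_derivative partial_deriv j f v) (at 0)"
  unfolding partial_deriv_def by (rule directional_derivative)

lemma partial_deriv_zero_outside_support:
  assumes "v \<notin> closure {v. \<phi> v \<noteq> 0}" shows "partial_deriv j \<phi> v = 0"
proof -
  have z: "\<phi> w = 0" if "w \<in> - closure {v. \<phi> v \<noteq> 0}" for w
    using that closure_subset[of "{v. \<phi> v \<noteq> 0}"] by blast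
  have "(\<phi> has_derivative (\<lambda>_. 0)) (at v)"
    by (rule has_derivative_transform_within_open[OF has_derivative_const[of 0] open_Compl[OF closed_closure] _ z[symmetric]])
      (use assms in simp_all)
  then have "frechet_derivative \<phi> (at v) = (\<lambda>_. 0)" by (rule frechet_derivative_at[symmetric])
  then show ?thesis by (simp add: partial_deriv_def)
qed

lemma test_function_partial_deriv:
  assumes "test_function \<phi>" shows "test_function (partial_deriv j \<phi>)"
proof -
  have "smooth (partial_deriv j \<phi>)"
    unfolding smooth_def
  proof (intro allI)
    fix js v
    have "foldr partial_deriv (js @ [j]) \<phi> differentiable (at v)"
      using assms unfolding test_function_def smooth_def by blast
    then show "foldr partial_deriv js (partial_deriv j \<phi>) differentiable (at v)" by simp
  qed
  moreover have "closure {v. partial_deriv j \<phi> v \<noteq> 0} \<subseteq> closure {v. \<phi> v \<noteq> 0}"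
    by (rule closure_minimal) (use partial_deriv_zero_outside_support in auto)
  then have "compact (closure {v. partial_deriv j \<phi> v \<noteq> 0})"
    using assms unfolding test_function_def compact_eq_bounded_closed
    by (intro conjI closed_closure) (rule bounded_subset, blast+)
  ultimately show ?thesis by (simp add: test_function_def)
qed

lemma integrable_continuous_compact_support:
  fixes F :: "real^3 \<Rightarrow> 'b::{banach, second_countable_topology}"
  assumes c: "continuous_on UNIV F" and K: "compact K" and z: "\<And>v. v \<notin> K \<Longrightarrow> F v = 0"
  shows "integrable lborel F"
proof -
  have "integrable lborel (\<lambda>v. indicator K v *\<^sub>R F v)"
    by (rule borel_integrable_compact[OF K]) (rule continuous_on_subset[OF c], simp)
  moreover have "indicator K v *\<^sub>R F v = F v" for v using z by (auto simp: indicator_def)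
  ultimately show ?thesis by simp
qed

lemma sq_integrable_continuous_compact_support:
  assumes c: "continuous_on UNIV F" and K: "compact K" and z: "\<And>v. v \<notin> K \<Longrightarrow> F v = 0"
  shows "sq_integrable F"
  unfolding sq_integrable_def
proof
  show "F \<in> borel_measurable lborel" using borel_measurable_continuous_onI[OF c] by simp
  show "integrable lborel (\<lambda>v. (cmod (F v))\<^sup>2)"
    by (rule integrable_continuous_compact_support[OF _ K]) (use c z in \<open>auto intro!: continuous_intros\<close>)
qed

lemma test_function_zero_outside: "v \<notin> closure {v. \<phi> v \<noteq> 0} \<Longrightarrow> \<phi> v = 0"
  using closure_subset[of "{v. \<phi> v \<noteq> 0}"] by auto

lemma integral_by_parts_test_function:
  assumes t: "test_function \<phi>" and k: "continuous_on UNIV k" and k': "continuous_on UNIV k'"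
    and d: "\<And>v. ((\<lambda>t. k (v + t *\<^sub>R axis j 1)) has_vector_derivative k' v) (at 0)"
  shows "(LINT v|lborel. partial_deriv j \<phi> v * k v) = - (LINT v|lborel. \<phi> v * k' v)"
proof -
  define S where "S = closure {v. \<phi> v \<noteq> 0}"
  have K: "compact S" using t by (simp add: test_function_def S_def)
  have tz: "\<phi> v = 0" if "v \<notin> S" for v
    using that unfolding S_def by (rule test_function_zero_outside)
  have pz: "partial_deriv i \<phi> v = 0" if "v \<notin> S" for i v
    using that unfolding S_def by (rule partial_deriv_zero_outside_support)
  note cc = test_function_continuous[OF t, of UNIV] test_function_continuous[OF test_function_partial_deriv[OF t], of UNIV j]
  define F' where "F' v = \<phi> v * k' v + partial_deriv j \<phi> v * k v" for v
  have cF': "continuous_on UNIV F'" unfolding F'_def by (intro continuous_on_add continuous_on_mult cc k k')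
  have zF': "F' v = 0" if "v \<notin> S" for v
    using that by (simp add: F'_def tz pz)
  have "bounded (F' ` S)"
    by (intro compact_imp_bounded compact_continuous_image K) (rule continuous_on_subset[OF cF'], simp)
  then obtain M where M: "\<And>v. v \<in> S \<Longrightarrow> cmod (F' v) \<le> M" unfolding bounded_iff by blast
  obtain R where R: "\<And>v. v \<in> S \<Longrightarrow> norm v \<le> R"
    using compact_imp_bounded[OF K] unfolding bounded_iff by blast
  have "(LINT v|lborel. F' v) = 0"
  proof (rule integral_directional_derivative_zero[where e="axis j 1" and F="\<lambda>v. \<phi> v * k v" and G="\<lambda>v. indicator (cball 0 (R + 1)) v *\<^sub>R \<bar>M\<bar>"])
    show c: "continuous_on UNIV (\<lambda>v. \<phi> v * k v)" by (intro continuous_on_mult cc k)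
    show "integrable lborel (\<lambda>v. \<phi> v * k v)"
      by (rule integrable_continuous_compact_support[OF c K]) (simp add: tz)
    show "F' \<in> borel_measurable borel" by (rule borel_measurable_continuous_onI[OF cF'])
    show "integrable lborel (\<lambda>v::real^3. indicator (cball 0 (R + 1)) v *\<^sub>R \<bar>M\<bar>)"
      by (rule borel_integrable_compact[OF compact_cball continuous_on_const])
    show "((\<lambda>t. \<phi> (v + t *\<^sub>R axis j 1) * k (v + t *\<^sub>R axis j 1)) has_vector_derivative F' v) (at 0)" for v
      using has_vector_derivative_mult[OF partial_deriv_directional[OF test_function_differentiable[OF t], of v j] d[of v]]
      unfolding F'_def scaleR_zero_left add_0_right .
    show "cmod (F' (v + s *\<^sub>R axis j 1)) \<le> indicator (cball 0 (R + 1)) v *\<^sub>R \<bar>M\<bar>" if s: "\<bar>s\<bar> \<le> 1" for v s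
    proof (cases "v + s *\<^sub>R axis j 1 \<in> S")
      case True
      have "norm v \<le> norm (v + s *\<^sub>R axis j 1) + norm (s *\<^sub>R axis j (1::real))"
        using norm_triangle_ineq4[of "v + s *\<^sub>R axis j 1" "s *\<^sub>R axis j 1"] by (simp only: add_diff_cancel_right')
      also have "\<dots> \<le> R + 1" using R[OF True] s by (simp add: norm_axis_1)
      finally show ?thesis using M[OF True] by (simp add: indicator_def)
    next
      case False
      then show ?thesis using zF' by simp
    qed
  qed
  moreover have "integrable lborel (\<lambda>v. \<phi> v * k' v)"
  proof (rule integrable_continuous_compact_support[OF _ K])
    show "continuous_on UNIV (\<lambda>v. \<phi> v * k' v)" by (intro continuous_on_mult cc k')
  qed (simp add: tz)
  moreover have "integrable lborel (\<lambda>v. partial_deriv j \<phi> v * k v)"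
  proof (rule integrable_continuous_compact_support[OF _ K])
    show "continuous_on UNIV (\<lambda>v. partial_deriv j \<phi> v * k v)" by (intro continuous_on_mult cc k)
  qed (simp add: pz)
  ultimately have "(LINT v|lborel. \<phi> v * k' v) + (LINT v|lborel. partial_deriv j \<phi> v * k v) = 0"
    unfolding F'_def by simp
  then show ?thesis by (simp only: eq_neg_iff_add_eq_0 add.commute)
qed

text \<open>Two integrations by parts in each coordinate.\<close>

lemma integral_laplacian_mult_hermite3:
  assumes t: "test_function \<phi>"
  shows "(LINT v|lborel. classical_laplacian \<phi> v * hermite3 \<alpha> v) = (LINT v|lborel. \<phi> v * lap_hermite3 \<alpha> v)"
proof -
  define H where "H j x = complex_of_real (hermite1 (\<alpha> $ j) x)" for j x
  define H1 where "H1 j x = complex_of_real (hermite1_d (\<alpha> $ j) x)" for j x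
  define H2 where "H2 j x = complex_of_real (hermite1_dd (\<alpha> $ j) x)" for j x
  have dH: "(H j has_vector_derivative H1 j x) (at x)" "(H1 j has_vector_derivative H2 j x) (at x)" for j x
    unfolding H_def H1_def H2_def by (rule hermite1_derivs)+
  have sm: "smooth_real (H j)" "smooth_real (H1 j)" "smooth_real (H2 j)" for j
  proof -
    show s: "smooth_real (H j)" unfolding H_def by (rule smooth_real_hermite1)
    show s1: "smooth_real (H1 j)" using smooth_real_deriv1(2)[OF s] deriv1_eqI[OF dH(1), of j] by simp
    show "smooth_real (H2 j)" using smooth_real_deriv1(2)[OF s1] deriv1_eqI[OF dH(2), of j] by simp
  qed
  have cp: "continuous_on UNIV (tensor g)" if "\<And>j. smooth_real (g j)" for g
    unfolding tensor_def[abs_def] by (intro continuous_intros continuous_on_compose2[OF smooth_real_continuous[where A=UNIV, OF that]]) auto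
  have df: "tensor g differentiable (at v)" if "\<And>j. smooth_real (g j)" for g v
    using smooth_tensor[of g, OF that] unfolding smooth_def by (drule_tac x="[]" in spec) simp
  have dpf: "((\<lambda>t. tensor g (v + t *\<^sub>R axis j 1)) has_vector_derivative tensor (g(j := deriv1 (g j))) v) (at 0)" if "\<And>j. smooth_real (g j)" for g v j
    using partial_deriv_directional[OF df[of g v, OF that], of j] partial_deriv_tensor[of g "\<lambda>j. deriv1 (g j)" j, OF smooth_real_deriv1(1)[OF that]] by simp
  have hermite3: "hermite3 \<alpha> = tensor H" unfolding hermite3_eq_tensor H_def ..
  have one: "(LINT v|lborel. partial_deriv j (partial_deriv j \<phi>) v * hermite3 \<alpha> v) = (LINT v|lborel. \<phi> v * tensor (H(j := H2 j)) v)" for j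
  proof -
    have s': "smooth_real ((H(j := H1 j)) i)" "smooth_real ((H(j := H2 j)) i)" for i using sm by simp_all
    have "(LINT v|lborel. partial_deriv j (partial_deriv j \<phi>) v * hermite3 \<alpha> v) = - (LINT v|lborel. partial_deriv j \<phi> v * tensor (H(j := H1 j)) v)"
      unfolding hermite3
      using dpf[of H, OF sm(1), where j=j] deriv1_eqI[OF dH(1), of j]
      by (intro integral_by_parts_test_function test_function_partial_deriv t cp sm s') simp
    also have "(LINT v|lborel. partial_deriv j \<phi> v * tensor (H(j := H1 j)) v) = - (LINT v|lborel. \<phi> v * tensor (H(j := H2 j)) v)"
      using dpf[of "H(j := H1 j)", OF s'(1), where j=j] deriv1_eqI[OF dH(2), of j]
      by (intro integral_by_parts_test_function t cp s') simp
    finally show ?thesis by simp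
  qed
  define S where "S = closure {v. \<phi> v \<noteq> 0}"
  have K: "compact S" using t by (simp add: test_function_def S_def)
  have tz: "\<phi> v = 0" if "v \<notin> S" for v
    using that unfolding S_def by (rule test_function_zero_outside)
  have pz: "partial_deriv i \<phi> v = 0" if "v \<notin> S" for i v
    using that unfolding S_def by (rule partial_deriv_zero_outside_support)
  have i1: "integrable lborel (\<lambda>v. partial_deriv j (partial_deriv j \<phi>) v * hermite3 \<alpha> v)" for j
  proof -
    let ?q = "partial_deriv j (partial_deriv j \<phi>)"
    have tq: "test_function ?q" by (intro test_function_partial_deriv t)
    show ?thesis
    proof (rule integrable_continuous_compact_support)
      show "continuous_on UNIV (\<lambda>v. ?q v * hermite3 \<alpha> v)"
        by (intro continuous_intros hermite3_continuous test_function_continuous tq)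
      show "compact (closure {v. ?q v \<noteq> 0})" using tq by (simp only: test_function_def)
      show "?q v * hermite3 \<alpha> v = 0" if "v \<notin> closure {v. ?q v \<noteq> 0}" for v
        by (simp only: test_function_zero_outside[OF that] mult_zero_left)
    qed
  qed
  have i2: "integrable lborel (\<lambda>v. \<phi> v * tensor (H(j := H2 j)) v)" for j
  proof -
    have "smooth_real ((H(j := H2 j)) i)" for i using sm by simp
    then have "continuous_on UNIV (\<lambda>v. \<phi> v * tensor (H(j := H2 j)) v)"
      by (intro continuous_on_mult test_function_continuous[OF t] cp)
    then show ?thesis
      by (rule integrable_continuous_compact_support[OF _ K]) (simp add: tz)
  qed
  have "(LINT v|lborel. classical_laplacian \<phi> v * hermite3 \<alpha> v) = (\<Sum>j\<in>UNIV. LINT v|lborel. partial_deriv j (partial_deriv j \<phi>) v * hermite3 \<alpha> v)"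
    unfolding classical_laplacian_def sum_distrib_right by (rule Bochner_Integration.integral_sum) (rule i1)
  also have "\<dots> = (\<Sum>j\<in>UNIV. LINT v|lborel. \<phi> v * tensor (H(j := H2 j)) v)" by (simp only: one)
  also have "\<dots> = (LINT v|lborel. \<phi> v * lap_hermite3 \<alpha> v)"
    unfolding lap_hermite3_eq_sum H_def[symmetric] H2_def[symmetric] sum_distrib_left
    by (rule Bochner_Integration.integral_sum[symmetric]) (rule i2)
  finally show ?thesis .
qed

lemma sq_integrable_imp_locally_integrable:
  assumes f: "sq_integrable f" shows "locally_integrable f"
  unfolding locally_integrable_def
proof (intro conjI allI impI)
  show "f \<in> borel_measurable lborel" using f by (simp add: sq_integrable_def)
  fix K :: "(real^3) set" assume K: "compact K"
  have i: "integrable lborel (\<lambda>v. indicator K v *\<^sub>R (1::real))" using K by (rule borel_integrable_compact) auto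
  have "(cmod (indicator K v))\<^sup>2 = indicator K v *\<^sub>R (1::real)" for v by (simp add: indicator_def)
  then have "sq_integrable (indicator K)"
    unfolding sq_integrable_def using i borel_compact[OF K] by simp
  from integrable_mult_sq_integrable[OF f this] show "set_integrable lborel K f"
    unfolding set_integrable_def by (rule Bochner_Integration.integrable_cong[THEN iffD1, rotated -1]) (auto simp: indicator_def)
qed

lemma locally_integrable_add:
  assumes "locally_integrable f" "locally_integrable g" shows "locally_integrable (\<lambda>v. f v + g v)"
  using assms unfolding locally_integrable_def by (auto intro!: set_integral_add)

lemma locally_integrable_mult_continuous:
  assumes f: "locally_integrable f" and c: "continuous_on UNIV p" shows "locally_integrable (\<lambda>v. p v * f v)"
  unfolding locally_integrable_def
proof (intro conjI allI impI)
  have fm[measurable]: "f \<in> borel_measurable borel" using f by (simp add: locally_integrable_def)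
  have pm[measurable]: "p \<in> borel_measurable borel" by (rule borel_measurable_continuous_onI[OF c])
  show "(\<lambda>v. p v * f v) \<in> borel_measurable lborel" by measurable
  fix K :: "(real^3) set" assume K: "compact K"
  have "bounded (p ` K)"
    by (intro compact_imp_bounded compact_continuous_image K) (rule continuous_on_subset[OF c], simp)
  then obtain M where M: "\<And>v. v \<in> K \<Longrightarrow> cmod (p v) \<le> M" unfolding bounded_iff by blast
  have i: "integrable lborel (\<lambda>v. \<bar>M\<bar> *\<^sub>R (indicat_real K v *\<^sub>R f v))"
    using f K unfolding locally_integrable_def set_integrable_def by (intro integrable_scaleR_right) auto
  show "set_integrable lborel K (\<lambda>v. p v * f v)"
    unfolding set_integrable_def
  proof (rule Bochner_Integration.integrable_bound[OF i])
    show "(\<lambda>v. indicat_real K v *\<^sub>R (p v * f v)) \<in> borel_measurable lborel"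
      using borel_compact[OF K] by measurable
    show "AE v in lborel. norm (indicat_real K v *\<^sub>R (p v * f v)) \<le> norm (\<bar>M\<bar> *\<^sub>R (indicat_real K v *\<^sub>R f v))"
    proof (rule AE_I2)
      fix v
      show "norm (indicat_real K v *\<^sub>R (p v * f v)) \<le> norm (\<bar>M\<bar> *\<^sub>R (indicat_real K v *\<^sub>R f v))"
      proof (cases "v \<in> K")
        case True
        then have "cmod (p v) \<le> \<bar>M\<bar>" using M[of v] by simp
        then show ?thesis using True by (simp add: norm_mult mult_right_mono)
      qed simp
    qed
  qed
qed

lemma kinetic_pot_continuous: "continuous_on A (kinetic_pot \<xi>)"
  unfolding kinetic_pot_def[abs_def] by (intro continuous_intros) simp_all

text \<open>A test function \<open>\<phi>\<close> and \<open>\<Delta>\<phi> - kinetic_pot \<xi> \<phi>\<close> are expanded in Hermite functions.  By Parseval's identity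
the two sides differ by the limit of boundary terms, which exists and is therefore zero.\<close>

lemma has_weak_laplacian_of_coef:
  assumes f: "sq_integrable f" and F: "sq_integrable F"
    and c: "\<And>\<alpha>. coef F \<alpha> = - of_nat (deg \<alpha>) * coef f \<alpha> - \<i> * jacobi \<xi> (coef f) \<alpha>"
  shows "has_weak_laplacian f (\<lambda>v. F v + kinetic_pot \<xi> v * f v)"
  unfolding has_weak_laplacian_def
proof (intro conjI allI impI)
  show "locally_integrable f" by (rule sq_integrable_imp_locally_integrable[OF f])
  show "locally_integrable (\<lambda>v. F v + kinetic_pot \<xi> v * f v)"
    by (intro locally_integrable_add locally_integrable_mult_continuous kinetic_pot_continuous sq_integrable_imp_locally_integrable f F)
  fix \<phi> assume t: "test_function \<phi>"
  define S where "S = closure {v. \<phi> v \<noteq> 0}"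
  have K: "compact S" using t by (simp add: test_function_def S_def)
  have tz: "\<phi> v = 0" if "v \<notin> S" for v
    using that unfolding S_def by (rule test_function_zero_outside)
  have pz: "partial_deriv i \<phi> v = 0" if "v \<notin> S" for i v
    using that unfolding S_def by (rule partial_deriv_zero_outside_support)
  have tc: "continuous_on UNIV \<phi>" by (rule test_function_continuous[OF t])
  have lc: "continuous_on UNIV (classical_laplacian \<phi>)"
    unfolding classical_laplacian_def[abs_def]
    by (intro continuous_intros test_function_continuous test_function_partial_deriv t)
  have lz: "classical_laplacian \<phi> v = 0" if "v \<notin> S" for v
  proof -
    have "partial_deriv j (partial_deriv j \<phi>) v = 0" for j
    proof (rule partial_deriv_zero_outside_support)
      have "closure {v. partial_deriv j \<phi> v \<noteq> 0} \<subseteq> S"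
        by (rule closure_minimal) (use pz in \<open>auto simp: S_def[symmetric] compact_imp_closed[OF K]\<close>)
      then show "v \<notin> closure {v. partial_deriv j \<phi> v \<noteq> 0}" using that by blast
    qed
    then show ?thesis by (simp add: classical_laplacian_def)
  qed
  have sq: "sq_integrable \<phi>" "sq_integrable (classical_laplacian \<phi>)" "sq_integrable (\<lambda>v. kinetic_pot \<xi> v * \<phi> v)"
  proof -
    show "sq_integrable \<phi>"
      by (rule sq_integrable_continuous_compact_support[OF tc K]) (rule tz)
    show "sq_integrable (classical_laplacian \<phi>)"
      by (rule sq_integrable_continuous_compact_support[OF lc K]) (rule lz)
    have "continuous_on UNIV (\<lambda>v. kinetic_pot \<xi> v * \<phi> v)" by (intro continuous_intros tc kinetic_pot_continuous)
    then show "sq_integrable (\<lambda>v. kinetic_pot \<xi> v * \<phi> v)"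
      by (rule sq_integrable_continuous_compact_support[OF _ K]) (simp add: tz)
  qed
  define k where "k v = classical_laplacian \<phi> v - kinetic_pot \<xi> v * \<phi> v" for v
  have k: "sq_integrable k" unfolding k_def by (intro sq_integrable_diff sq)
  have ck: "coef k \<alpha> = - of_nat (deg \<alpha>) * coef \<phi> \<alpha> - \<i> * jacobi \<xi> (coef \<phi>) \<alpha>" for \<alpha>
  proof -
    have "coef k \<alpha> = coef (classical_laplacian \<phi>) \<alpha> - coef (\<lambda>v. kinetic_pot \<xi> v * \<phi> v) \<alpha>"
      unfolding k_def by (rule coef_diff) (intro sq)+
    also have "coef (classical_laplacian \<phi>) \<alpha> = (LINT v|lborel. \<phi> v * lap_hermite3 \<alpha> v)"
      unfolding coef_def by (rule integral_laplacian_mult_hermite3[OF t])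
    also have "\<dots> = coef (\<lambda>v. kinetic_pot \<xi> v * \<phi> v) \<alpha> + (- of_nat (deg \<alpha>) * coef \<phi> \<alpha> - \<i> * jacobi \<xi> (coef \<phi>) \<alpha>)"
      unfolding integral_mult_lap_hermite3[OF sq(1), of _ \<xi>] coef_def[of "\<lambda>v. kinetic_pot \<xi> v * \<phi> v"] by (simp add: mult_ac)
    finally show ?thesis by simp
  qed
  have lim: "(\<lambda>N. (\<Sum>\<alpha>\<in>deg_le N. coef f \<alpha> * coef k \<alpha>) - (\<Sum>\<alpha>\<in>deg_le N. coef F \<alpha> * coef \<phi> \<alpha>))
     \<longlonglongrightarrow> (LINT v|lborel. f v * k v) - (LINT v|lborel. F v * \<phi> v)"
    by (intro tendsto_diff Parseval f F k sq)
  have eq: "(\<Sum>\<alpha>\<in>deg_le N. coef f \<alpha> * coef k \<alpha>) - (\<Sum>\<alpha>\<in>deg_le N. coef F \<alpha> * coef \<phi> \<alpha>)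
     = \<i> * (raising_form \<xi> (coef f) (coef \<phi>) (deg_eq N) - raising_form \<xi> (coef \<phi>) (coef f) (deg_eq N))" for N
    unfolding Green_jacobi[symmetric] ck c
    by (simp add: sum_subtractf[symmetric] sum_distrib_left algebra_simps)
  have B: "(\<Sum>\<alpha>\<in>deg_le N. (cmod (coef q \<alpha>))\<^sup>2) \<le> (norm (abs_L2 q))\<^sup>2" if "sq_integrable q" for q N
    using Bessel[of "deg_le N" "abs_L2 q"] by (simp add: coef_rep_abs that)
  have "(LINT v|lborel. f v * k v) - (LINT v|lborel. F v * \<phi> v) = 0"
  proof (rule boundary_limit_zero[OF lim[unfolded eq] summable_shell_sq[OF B[OF f]] summable_shell_sq[OF B[OF sq(1)]]])
    fix N
    have "cmod (\<i> * (raising_form \<xi> (coef f) (coef \<phi>) (deg_eq N) - raising_form \<xi> (coef \<phi>) (coef f) (deg_eq N)))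
      \<le> cmod (raising_form \<xi> (coef f) (coef \<phi>) (deg_eq N)) + cmod (raising_form \<xi> (coef \<phi>) (coef f) (deg_eq N))"
      by (simp add: norm_mult norm_triangle_ineq4)
    also have "\<dots> \<le> 3 * norm \<xi> * (sqrt (real N + 1) * (shell_sq (coef f) (N + 1) + shell_sq (coef \<phi>) N))
       + 3 * norm \<xi> * (sqrt (real N + 1) * (shell_sq (coef \<phi>) (N + 1) + shell_sq (coef f) N))"
      by (intro add_mono raising_form_deg_eq_bound)
    also have "\<dots> = (3 * norm \<xi>) * (sqrt (real N + 1) * (shell_sq (coef f) (N + 1) + shell_sq (coef f) N + shell_sq (coef \<phi>) (N + 1) + shell_sq (coef \<phi>) N))"
      by (simp add: algebra_simps)
    finally show "cmod (\<i> * (raising_form \<xi> (coef f) (coef \<phi>) (deg_eq N) - raising_form \<xi> (coef \<phi>) (coef f) (deg_eq N))) \<le> \<dots>" .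
  qed
  then have "(LINT v|lborel. f v * k v) = (LINT v|lborel. F v * \<phi> v)" by simp
  moreover have "(LINT v|lborel. f v * k v) = (LINT v|lborel. f v * classical_laplacian \<phi> v) - (LINT v|lborel. f v * (kinetic_pot \<xi> v * \<phi> v))"
    unfolding k_def right_diff_distrib
    by (rule Bochner_Integration.integral_diff) (intro integrable_mult_sq_integrable f sq)+
  moreover have "(LINT v|lborel. (F v + kinetic_pot \<xi> v * f v) * \<phi> v) = (LINT v|lborel. F v * \<phi> v) + (LINT v|lborel. f v * (kinetic_pot \<xi> v * \<phi> v))"
    using integrable_mult_sq_integrable[OF F sq(1)] integrable_mult_sq_integrable[OF f sq(3)]
    by (subst Bochner_Integration.integral_add[symmetric]) (auto simp: algebra_simps)
  ultimately show "(LINT v|lborel. f v * classical_laplacian \<phi> v) = (LINT v|lborel. (F v + kinetic_pot \<xi> v * f v) * \<phi> v)"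
    by (simp add: diff_eq_eq)
qed

section \<open>The algebra of the modified energy\<close>

lemma mult_le_weighted_squares:
  fixes p q e :: real assumes "e > 0" shows "p * q \<le> e * p\<^sup>2 + q\<^sup>2 / (4 * e)"
proof -
  have "0 \<le> (2 * e * p - q)\<^sup>2 / (4 * e)" using assms by simp
  also have "(2 * e * p - q)\<^sup>2 / (4 * e) = e * p\<^sup>2 + q\<^sup>2 / (4 * e) - p * q"
    using assms by (simp add: field_simps power2_eq_square)
  finally show ?thesis by simp
qed

lemma abs_Re_mult_le: "\<bar>Re (x * cnj y)\<bar> \<le> cmod x * cmod y"
  using abs_Re_le_cmod[of "x * cnj y"] by (simp add: norm_mult)

text \<open>The derivative of the corrector: the good terms \<open>k(|a|\<^sup>2 + |\<rho>|\<^sup>2)\<close>, of which half is spent on absorbing the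
products of \<open>a\<close> and \<open>\<rho>\<close> with the other variables.  Here \<open>k = |\<xi>|\<^sup>2\<close>; \<open>B\<close>, \<open>U\<close>, \<open>T\<close> are the
components along \<open>\<xi>\<close> of \<open>b\<close>, \<open>u\<close> and of the second moments, \<open>b2 = |b|\<^sup>2\<close>, \<open>u2 = |u|\<^sup>2\<close>, and
\<open>S2\<close> is the mass of degree \<open>2\<close>.\<close>

lemma coercivity_bracket:
  fixes a \<rho> B U T :: complex and k \<gamma> b2 u2 S2 :: real
  assumes k: "k > 0" and \<gamma>: "\<gamma> \<ge> 1" and nn: "b2 \<ge> 0" "u2 \<ge> 0" "S2 \<ge> 0"
    and B: "(cmod B)\<^sup>2 \<le> k * b2" and U: "(cmod U)\<^sup>2 \<le> k * u2" and T: "(cmod T)\<^sup>2 \<le> 18 * k\<^sup>2 * S2"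
  shows "k / 2 * ((cmod a)\<^sup>2 + (cmod \<rho>)\<^sup>2) - (1 + k) * (3 * b2 + 18 * S2 + 3 * (1 + k) * u2)
    \<le> Re (- \<i> * (B - U) * cnj a) + k * (cmod a)\<^sup>2 + Re (T * cnj a) + (cmod (a - \<rho>))\<^sup>2 + \<gamma> * k * (cmod \<rho>)\<^sup>2
       - (cmod B)\<^sup>2 + Re (\<i> * B * cnj \<rho>) - (1 + k) * Re (\<i> * U * cnj \<rho>) - (cmod U)\<^sup>2"
proof -
  have 1: "\<bar>Re (- \<i> * B * cnj a)\<bar> \<le> k / 8 * (cmod a)\<^sup>2 + 2 * b2"
  proof -
    have "\<bar>Re ((- \<i> * B) * cnj a)\<bar> \<le> cmod (- \<i> * B) * cmod a" by (rule abs_Re_mult_le)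
    also have "\<dots> \<le> k / 8 * (cmod a)\<^sup>2 + (cmod B)\<^sup>2 / (4 * (k / 8))"
      using mult_le_weighted_squares[of "k/8" "cmod a" "cmod B"] k by (simp add: norm_mult mult.commute)
    also have "(cmod B)\<^sup>2 / (4 * (k / 8)) \<le> 2 * b2" using B k by (simp add: field_simps)
    finally show ?thesis by simp
  qed
  have 2: "\<bar>Re (\<i> * U * cnj a)\<bar> \<le> k / 8 * (cmod a)\<^sup>2 + 2 * u2"
  proof -
    have "\<bar>Re ((\<i> * U) * cnj a)\<bar> \<le> cmod (\<i> * U) * cmod a" by (rule abs_Re_mult_le)
    also have "\<dots> \<le> k / 8 * (cmod a)\<^sup>2 + (cmod U)\<^sup>2 / (4 * (k / 8))"
      using mult_le_weighted_squares[of "k/8" "cmod a" "cmod U"] k by (simp add: norm_mult mult.commute)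
    also have "(cmod U)\<^sup>2 / (4 * (k / 8)) \<le> 2 * u2" using U k by (simp add: field_simps)
    finally show ?thesis by simp
  qed
  have 3: "\<bar>Re (T * cnj a)\<bar> \<le> k / 4 * (cmod a)\<^sup>2 + 18 * k * S2"
  proof -
    have "\<bar>Re (T * cnj a)\<bar> \<le> cmod T * cmod a" by (rule abs_Re_mult_le)
    also have "\<dots> \<le> k / 4 * (cmod a)\<^sup>2 + (cmod T)\<^sup>2 / (4 * (k / 4))"
      using mult_le_weighted_squares[of "k/4" "cmod a" "cmod T"] k by (simp add: mult.commute)
    also have "(cmod T)\<^sup>2 / (4 * (k / 4)) \<le> 18 * k * S2" using T k by (simp add: field_simps power2_eq_square)
    finally show ?thesis by simp
  qed
  have 4: "\<bar>Re (\<i> * B * cnj \<rho>)\<bar> \<le> k / 4 * (cmod \<rho>)\<^sup>2 + b2"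
  proof -
    have "\<bar>Re ((\<i> * B) * cnj \<rho>)\<bar> \<le> cmod (\<i> * B) * cmod \<rho>" by (rule abs_Re_mult_le)
    also have "\<dots> \<le> k / 4 * (cmod \<rho>)\<^sup>2 + (cmod B)\<^sup>2 / (4 * (k / 4))"
      using mult_le_weighted_squares[of "k/4" "cmod \<rho>" "cmod B"] k by (simp add: norm_mult mult.commute)
    also have "(cmod B)\<^sup>2 / (4 * (k / 4)) \<le> b2" using B k by (simp add: field_simps)
    finally show ?thesis by simp
  qed
  have 5: "(1 + k) * \<bar>Re (\<i> * U * cnj \<rho>)\<bar> \<le> k / 4 * (cmod \<rho>)\<^sup>2 + (1 + k)\<^sup>2 * u2"
  proof -
    have "(1 + k) * \<bar>Re ((\<i> * U) * cnj \<rho>)\<bar> \<le> (1 + k) * (cmod (\<i> * U) * cmod \<rho>)"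
      using k by (intro mult_left_mono abs_Re_mult_le) auto
    also have "\<dots> = cmod \<rho> * ((1 + k) * cmod U)" by (simp add: norm_mult)
    also have "\<dots> \<le> k / 4 * (cmod \<rho>)\<^sup>2 + ((1 + k) * cmod U)\<^sup>2 / (4 * (k / 4))"
      using k by (intro mult_le_weighted_squares) simp
    also have "((1 + k) * cmod U)\<^sup>2 / (4 * (k / 4)) \<le> (1 + k)\<^sup>2 * u2"
    proof -
      have "((1 + k) * cmod U)\<^sup>2 \<le> (1 + k)\<^sup>2 * (k * u2)"
        unfolding power_mult_distrib using U by (intro mult_left_mono) auto
      then show ?thesis using k by (simp add: field_simps)
    qed
    finally show ?thesis by simp
  qed
  have 6: "k * (cmod \<rho>)\<^sup>2 \<le> \<gamma> * k * (cmod \<rho>)\<^sup>2"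
    using \<gamma> k by (intro mult_right_mono) auto
  have 7: "Re (- \<i> * (B - U) * cnj a) = Re (- \<i> * B * cnj a) + Re (\<i> * U * cnj a)" by (simp add: algebra_simps)
  have 8: "- ((1 + k) * Re (\<i> * U * cnj \<rho>)) \<ge> - ((1 + k) * \<bar>Re (\<i> * U * cnj \<rho>)\<bar>)"
    using k by (simp add: mult_left_mono)
  have 9: "(1 + k) * (3 * b2 + 18 * S2 + 3 * (1 + k) * u2) \<ge> (3 + k) * b2 + 18 * k * S2 + (2 + k) * u2 + (1 + k)\<^sup>2 * u2"
  proof -
    have "(1 + k) * (3 * b2 + 18 * S2 + 3 * (1 + k) * u2) - ((3 + k) * b2 + 18 * k * S2 + (2 + k) * u2 + (1 + k)\<^sup>2 * u2)
      = 2 * k * b2 + 18 * S2 + (3 * k + 2 * k\<^sup>2) * u2"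
      by (simp add: power2_eq_square algebra_simps)
    also have "\<dots> \<ge> 0" using k nn by simp
    finally show ?thesis by simp
  qed
  have 10: "(3 + k) * b2 = 3 * b2 + k * b2" "(2 + k) * u2 = 2 * u2 + k * u2"
    "k / 2 * ((cmod a)\<^sup>2 + (cmod \<rho>)\<^sup>2) = k / 2 * (cmod a)\<^sup>2 + k / 2 * (cmod \<rho>)\<^sup>2"
    "k / 2 * (cmod a)\<^sup>2 = 1/2 * (k * (cmod a)\<^sup>2)" "k / 4 * (cmod a)\<^sup>2 = 1/4 * (k * (cmod a)\<^sup>2)" "k / 8 * (cmod a)\<^sup>2 = 1/8 * (k * (cmod a)\<^sup>2)"
    "k / 2 * (cmod \<rho>)\<^sup>2 = 1/2 * (k * (cmod \<rho>)\<^sup>2)" "k / 4 * (cmod \<rho>)\<^sup>2 = 1/4 * (k * (cmod \<rho>)\<^sup>2)"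
    by (simp_all add: algebra_simps)
  have 11: "(cmod (a - \<rho>))\<^sup>2 \<ge> 0" by simp
  show ?thesis
    unfolding 7 using 1 2 3 4 5 6 8 9 11 B U unfolding 10 by linarith
qed

text \<open>The friction \<open>b2 - 2 ub + u2 = |b - u|\<^sup>2\<close> and \<open>k u2\<close> control \<open>b\<close> and \<open>u\<close>, up to the factor \<open>r\<close> that
measures how small \<open>k\<close> may be; \<open>H2\<close> is the dissipation in degrees at least \<open>2\<close>.  The weight
\<open>r/36/(1 + k)\<close> is small enough to absorb the errors of the corrector.\<close>

lemma coercivity:
  fixes a \<rho> B U T :: complex and k \<gamma> b2 u2 ub S2 H2 r :: real
  assumes r: "0 < r" "r \<le> 1" "r \<le> k" and \<gamma>: "\<gamma> \<ge> 1" and nn: "b2 \<ge> 0" "u2 \<ge> 0" "S2 \<ge> 0"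
    and bu: "0 \<le> b2 - 2 * ub + u2" "b2 \<le> 2 * (b2 - 2 * ub + u2) + 2 * u2" and H2: "2 * S2 \<le> H2"
    and B: "(cmod B)\<^sup>2 \<le> k * b2" and U: "(cmod U)\<^sup>2 \<le> k * u2" and T: "(cmod T)\<^sup>2 \<le> 18 * k\<^sup>2 * S2"
  shows "r / 8 * (H2 + b2 + u2) + r\<^sup>2 / 288 * ((cmod a)\<^sup>2 + (cmod \<rho>)\<^sup>2)
    \<le> (H2 + b2) - 2 * ub + (1 + k) * u2 + (r / 36 / (1 + k)) / 2 *
     (Re (- \<i> * (B - U) * cnj a) + k * (cmod a)\<^sup>2 + Re (T * cnj a) + (cmod (a - \<rho>))\<^sup>2 + \<gamma> * k * (cmod \<rho>)\<^sup>2
       - (cmod B)\<^sup>2 + Re (\<i> * B * cnj \<rho>) - (1 + k) * Re (\<i> * U * cnj \<rho>) - (cmod U)\<^sup>2)"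
    (is "?l \<le> _ + ?e * ?br")
proof -
  have k: "k > 0" using r by linarith
  have "r * k \<le> 1 * k" using r k by (intro mult_right_mono) auto
  then have rk: "r * (1 + k) \<le> 2 * k" using r unfolding distrib_left by linarith
  define X where "X = (cmod a)\<^sup>2 + (cmod \<rho>)\<^sup>2"
  have X0: "X \<ge> 0" by (simp add: X_def)
  define V where "V = (1 + k) * u2"
  (* Half of the gain r/4 in the degree and velocity terms pays for the error terms of the bracket. *)
  define Q where "Q = ?e * ?br"
  define Y where "Y = k / (1 + k) * X"
  have q1: "?e * (k / 2 * X - (1 + k) * (3 * b2 + 18 * S2 + 3 * V)) \<le> Q" unfolding Q_def
  proof (rule mult_left_mono)
    show "k / 2 * X - (1 + k) * (3 * b2 + 18 * S2 + 3 * V) \<le> ?br"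
      using coercivity_bracket[OF k \<gamma> nn B U T, of a \<rho>] by (simp only: V_def X_def mult.assoc)
    show "0 \<le> ?e" using r k by simp
  qed
  moreover have q2: "?e * (k / 2 * X - (1 + k) * (3 * b2 + 18 * S2 + 3 * V)) = r / 144 * Y - r / 72 * (3 * b2 + 18 * S2 + 3 * V)"
    using k by (simp add: Y_def field_simps)
  ultimately have Q: "r / 144 * Y - r / 72 * (3 * b2 + 18 * S2 + 3 * V) \<le> Q" by simp
  have f1: "r / 144 * Y \<ge> r / 144 * (r / 2) * X"
  proof -
    have "r / 2 \<le> k / (1 + k)"
    proof -
      show ?thesis using rk k by (simp add: field_simps)
    qed
    then have "r / 2 * X \<le> Y" unfolding Y_def using X0 by (intro mult_right_mono)
    then have "r / 144 * (r / 2 * X) \<le> r / 144 * Y" using r by (intro mult_left_mono) auto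
    then show ?thesis by (simp only: mult.assoc)
  qed
  have f2: "r / 144 * (r / 2) * X = r\<^sup>2 / 288 * X" by (simp add: power2_eq_square)
  have f3: "r / 4 * b2 \<le> 1/2 * (b2 - 2 * ub + u2) + 1/2 * (k * u2)"
  proof -
    have "r / 4 * b2 \<le> r / 4 * (2 * (b2 - 2 * ub + u2) + 2 * u2)" using bu r by (intro mult_left_mono) auto
    also have "\<dots> = 1/2 * (r * (b2 - 2 * ub + u2)) + 1/2 * (r * u2)" by (simp add: algebra_simps)
    also have "\<dots> \<le> 1/2 * (1 * (b2 - 2 * ub + u2)) + 1/2 * (k * u2)"
      using r bu nn by (intro add_mono mult_left_mono mult_right_mono) auto
    finally show ?thesis by simp
  qed
  have f4: "r / 4 * V \<le> 1/2 * (k * u2)"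
  proof -
    have "r * (1 + k) * u2 \<le> 2 * k * u2" using nn rk by (intro mult_right_mono)
    then have "r * ((1 + k) * u2) \<le> 2 * (k * u2)" by (simp only: mult.assoc)
    then show ?thesis unfolding V_def by linarith
  qed
  have f5: "r / 72 * (3 * b2 + 18 * S2 + 3 * V) \<le> r / 8 * (b2 + H2 + V)"
  proof -
    have "V \<ge> 0" using nn k by (simp add: V_def)
    then have "3 * b2 + 18 * S2 + 3 * V \<le> 9 * (b2 + H2 + V)" using nn H2 by simp
    then have "r / 72 * (3 * b2 + 18 * S2 + 3 * V) \<le> r / 72 * (9 * (b2 + H2 + V))" using r by (intro mult_left_mono) auto
    also have "\<dots> = r / 8 * (b2 + H2 + V)" by simp
    finally show ?thesis .
  qed
  have f6: "r / 4 * H2 \<le> H2" using r nn H2 mult_right_mono[of "r/4" 1 H2] by simp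
  have f7: "r / 8 * u2 \<le> r / 8 * V" using r k nn by (intro mult_left_mono) (auto simp: V_def algebra_simps)
  define xb xH xV xu Z q where "xb = r / 8 * b2" and "xH = r / 8 * H2" and "xV = r / 8 * V" and "xu = r / 8 * u2"
    and "Z = r\<^sup>2 / 288 * X" and "q = k * u2"
  have g1: "Z - (xb + xH + xV) \<le> Q"
  proof -
    have "r / 8 * (b2 + H2 + V) = xb + xH + xV" by (simp add: xb_def xH_def xV_def algebra_simps)
    then show ?thesis using Q f1 f2 f5 unfolding Z_def by linarith
  qed
  have g2: "4 * xb \<le> (b2 - 2 * ub + u2) + q" using f3 unfolding xb_def q_def by argo
  have g3: "4 * xV \<le> q" using f4 unfolding xV_def q_def by argo
  have g4: "2 * xH \<le> H2" using f6 unfolding xH_def by linarith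
  have g5: "xu \<le> xV" using f7 by (simp only: xu_def xV_def)
  have l: "?l = xH + xb + xu + Z" by (simp add: xH_def xb_def xu_def Z_def X_def algebra_simps)
  have m: "(1 + k) * u2 = u2 + q" by (simp add: q_def algebra_simps)
  show ?thesis unfolding Q_def[symmetric] l m using g1 g2 g3 g4 g5 bu(1) by linarith
qed

text \<open>The couplings cancel in pairs of the form \<open>Re(i z w\<^sup>*) + Re(i w z\<^sup>*) = 0\<close>.  The last line of the left
side is the polarised corrector; its part linear in \<open>l\<close> is again \<open>Re l\<close> times the corrector,
because the corrector is a Hermitian form.\<close>

lemma energy_identity:
  fixes l a \<rho> B U T A0 :: complex and k \<gamma> S H ImJ ub u2 \<eta> :: real
  assumes k: "k > 0"
    and P1: "P1 = Re l * S + H - ImJ - (Re (- \<i> * (a - \<rho>) * cnj B) / k + ub)"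
    and g0: "g0 = l * a + \<i> * B" and s: "s = l * \<rho> + \<i> * U"
    and P4: "P4 = Re l * u2 - Re (\<i> * a * cnj U) / k - ub + (\<gamma> + 1 / k) * Re (\<i> * \<rho> * cnj U) + (1 + k) * u2"
    and G1: "G1 = l * B + B + \<i> * (of_real k * a + T) + \<i> * (a - \<rho>) - U"
    and W: "W = l * U - \<i> * a - B + \<i> * of_real (\<gamma> * k + 1) * \<rho> + of_real (1 + k) * U"
  shows "P1 + Re ((g0 - s) * cnj (a - \<rho>)) / k + \<gamma> * Re (s * cnj \<rho>) + P4
     + \<eta> / 2 * (Re (- \<i> * G1 * cnj a) + Re (- \<i> * B * cnj g0) + Re (- \<i> * W * cnj \<rho>) + Re (- \<i> * U * cnj s))
    = Re l * (S + (cmod (a - \<rho>))\<^sup>2 / k + \<gamma> * (cmod \<rho>)\<^sup>2 + u2 + \<eta> * (Re (- \<i> * B * cnj a) + Re (- \<i> * U * cnj \<rho>)))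
     - ImJ + (H - 2 * ub + (1 + k) * u2 + \<eta> / 2 *
     (Re (- \<i> * (B - U) * cnj a) + k * (cmod a)\<^sup>2 + Re (T * cnj a) + (cmod (a - \<rho>))\<^sup>2 + \<gamma> * k * (cmod \<rho>)\<^sup>2
       - (cmod B)\<^sup>2 + Re (\<i> * B * cnj \<rho>) - (1 + k) * Re (\<i> * U * cnj \<rho>) - (cmod U)\<^sup>2))"
proof -
  have i: "(1 + k * \<gamma>) / k = \<gamma> + 1 / k" using k by (simp add: field_simps)
  define q where "q = 1 / k"
  have d: "x / k = x * q" for x by (simp add: q_def)
  have A: "P1 + Re ((g0 - s) * cnj (a - \<rho>)) / k + \<gamma> * Re (s * cnj \<rho>) + P4
     = Re l * (S + (cmod (a - \<rho>))\<^sup>2 / k + \<gamma> * (cmod \<rho>)\<^sup>2 + u2) - ImJ + (H - 2 * ub + (1 + k) * u2)"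
    unfolding P1 g0 s P4 d cmod_power2 by (simp add: power2_eq_square algebra_simps)
  have Bb: "Re (- \<i> * G1 * cnj a) + Re (- \<i> * B * cnj g0) + Re (- \<i> * W * cnj \<rho>) + Re (- \<i> * U * cnj s)
     = 2 * Re l * (Re (- \<i> * B * cnj a) + Re (- \<i> * U * cnj \<rho>)) +
     (Re (- \<i> * (B - U) * cnj a) + k * (cmod a)\<^sup>2 + Re (T * cnj a) + (cmod (a - \<rho>))\<^sup>2 + \<gamma> * k * (cmod \<rho>)\<^sup>2
       - (cmod B)\<^sup>2 + Re (\<i> * B * cnj \<rho>) - (1 + k) * Re (\<i> * U * cnj \<rho>) - (cmod U)\<^sup>2)"
    unfolding G1 W g0 s cmod_power2 by (simp add: power2_eq_square algebra_simps)
  show ?thesis unfolding A Bb by (simp add: algebra_simps)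
qed

section \<open>The system in Hermite coordinates\<close>

text \<open>The Hermite coefficients of the electric field and drag terms, which have degree \<open>1\<close>.\<close>

definition field_coef :: "real^3 \<Rightarrow> complex \<Rightarrow> complex \<Rightarrow> complex^3 \<Rightarrow> nat^3 \<Rightarrow> complex" where
  "field_coef \<xi> a \<rho> u \<alpha> = (\<Sum>j\<in>UNIV. if \<alpha> = unit j then - \<i> * complex_of_real (\<xi> $ j / (norm \<xi>)\<^sup>2) * (a - \<rho>) + u $ j else 0)"

definition kinetic_coef :: "real^3 \<Rightarrow> (nat^3 \<Rightarrow> complex) \<Rightarrow> complex \<Rightarrow> complex^3 \<Rightarrow> nat^3 \<Rightarrow> complex" where
  "kinetic_coef \<xi> c \<rho> u \<alpha> = - of_nat (deg \<alpha>) * c \<alpha> - \<i> * jacobi \<xi> c \<alpha> + field_coef \<xi> (c 0) \<rho> u \<alpha>"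

text \<open>The last component of the operator, for a state with moments \<open>a\<close> and \<open>b\<close>.\<close>

definition velocity_part :: "real \<Rightarrow> real^3 \<Rightarrow> complex \<Rightarrow> complex^3 \<Rightarrow> complex \<Rightarrow> complex^3 \<Rightarrow> complex^3" where
  "velocity_part \<gamma> \<xi> a b \<rho> u = (\<chi> j. \<i> * complex_of_real (\<xi> $ j / (norm \<xi>)\<^sup>2) * a + b $ j
           - \<i> * complex_of_real (\<xi> $ j * (\<gamma> + 1 / (norm \<xi>)\<^sup>2)) * \<rho>
           - complex_of_real (1 + (norm \<xi>)\<^sup>2) * u $ j)"

definition first_shell :: "(nat^3 \<Rightarrow> complex) \<Rightarrow> complex^3" where "first_shell c = (\<chi> j. c (unit j))"

lemma rc_dot_bound: "cmod (rc_dot \<xi> b) \<le> norm \<xi> * norm b"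
proof -
  have "cmod (rc_dot \<xi> b) \<le> (\<Sum>j\<in>UNIV. \<bar>norm (\<xi> $ j)\<bar> * \<bar>norm (b $ j)\<bar>)"
    unfolding rc_dot_def by (rule sum_norm_le) (simp add: norm_mult)
  also have "\<dots> \<le> L2_set (\<lambda>j. norm (\<xi> $ j)) UNIV * L2_set (\<lambda>j. norm (b $ j)) UNIV"
    by (rule L2_set_mult_ineq)
  finally show ?thesis by (simp add: norm_vec_def)
qed

lemma rc_dot_bound_sq: "(cmod (rc_dot \<xi> b))\<^sup>2 \<le> (norm \<xi>)\<^sup>2 * (norm b)\<^sup>2"
  using power_mono[OF rc_dot_bound[of \<xi> b], of 2] by (simp add: power_mult_distrib)

lemma norm_sq_cvec3: "(norm (b::complex^3))\<^sup>2 = (\<Sum>j\<in>UNIV. (cmod (b $ j))\<^sup>2)"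
  by (simp add: norm_vec_def L2_set_def sum_nonneg)

lemma deg_0 [simp]: "deg 0 = 0" by (simp add: deg_def)
lemma deg_unit [simp]: "deg (unit j) = 1" using deg_add_unit[of 0 j] by simp
lemma unit_neq_0 [simp]: "unit j \<noteq> 0" using deg_unit[of j] by (metis deg_0 zero_neq_one)
lemma unit_eq_iff [simp]: "unit i = unit j \<longleftrightarrow> i = j" by (simp add: unit_def axis_eq_axis)

lemma field_coef_0 [simp]: "field_coef \<xi> a \<rho> u 0 = 0" by (simp add: field_coef_def unit_neq_0[symmetric] del: unit_neq_0)
lemma field_coef_unit: "field_coef \<xi> a \<rho> u (unit j) = - \<i> * complex_of_real (\<xi> $ j / (norm \<xi>)\<^sup>2) * (a - \<rho>) + u $ j"
  by (simp add: field_coef_def)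

lemma jacobi_0: "jacobi \<xi> c 0 = rc_dot \<xi> (first_shell c)"
  by (simp add: jacobi_def rc_dot_def first_shell_def)

text \<open>The part of degree \<open>2\<close> in the rows of degree \<open>1\<close>.\<close>

definition second_shell :: "real^3 \<Rightarrow> (nat^3 \<Rightarrow> complex) \<Rightarrow> complex^3" where
  "second_shell \<xi> c = (\<chi> j. \<Sum>i\<in>UNIV. complex_of_real (\<xi> $ i) * (complex_of_real (sqrt (unit j $ i + 1)) * c (unit j + unit i)))"

lemma jacobi_unit: "jacobi \<xi> c (unit j) = complex_of_real (\<xi> $ j) * c 0 + second_shell \<xi> c $ j"
proof -
  have "complex_of_real (\<xi> $ i) * (complex_of_real (sqrt (unit j $ i)) * c (unit j - unit i)) = (if i = j then complex_of_real (\<xi> $ j) * c 0 else 0)" for i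
    by (auto simp: unit_def axis_def)
  then have "(\<Sum>i\<in>UNIV. complex_of_real (\<xi> $ i) * (complex_of_real (sqrt (unit j $ i)) * c (unit j - unit i))) = complex_of_real (\<xi> $ j) * c 0"
    by simp
  then show ?thesis by (simp add: jacobi_def second_shell_def distrib_left sum.distrib)
qed

lemma norm_first_shell_le: "(norm (first_shell c))\<^sup>2 \<le> shell_sq c 1"
proof -
  have "(norm (first_shell c))\<^sup>2 = (\<Sum>\<alpha>\<in>range unit. (cmod (c \<alpha>))\<^sup>2)"
    by (subst sum.reindex) (simp_all add: norm_sq_cvec3 first_shell_def inj_def)
  also have "\<dots> \<le> shell_sq c 1" unfolding shell_sq_def by (intro sum_mono2 finite_deg_eq) (auto simp: deg_eq_def)
  finally show ?thesis .
qed

lemma norm_second_shell_le: "(norm (second_shell \<xi> c))\<^sup>2 \<le> 18 * (norm \<xi>)\<^sup>2 * shell_sq c 2"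
proof -
  have "(cmod (second_shell \<xi> c $ j))\<^sup>2 \<le> (norm \<xi>)\<^sup>2 * (2 * shell_sq c 2)" for j
  proof -
    define y where "y = (\<chi> i. complex_of_real (sqrt (unit j $ i + 1)) * c (unit j + unit i))"
    have "second_shell \<xi> c $ j = rc_dot \<xi> y" by (simp add: second_shell_def rc_dot_def y_def)
    then have "(cmod (second_shell \<xi> c $ j))\<^sup>2 \<le> (norm \<xi>)\<^sup>2 * (norm y)\<^sup>2" using rc_dot_bound_sq by simp
    moreover have "(norm y)\<^sup>2 \<le> 2 * shell_sq c 2"
    proof -
      have "(norm y)\<^sup>2 \<le> (\<Sum>i\<in>UNIV. 2 * (cmod (c (unit j + unit i)))\<^sup>2)"
        unfolding norm_sq_cvec3
      proof (rule sum_mono)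
        fix i
        have "(unit j $ i) \<le> 1" using nth_le_deg[of "unit j" i] by simp
        then show "(cmod (y $ i))\<^sup>2 \<le> 2 * (cmod (c (unit j + unit i)))\<^sup>2"
          by (simp add: y_def norm_mult power_mult_distrib mult_right_mono)
      qed
      also have "\<dots> = 2 * (\<Sum>\<alpha>\<in>range (\<lambda>i. unit j + unit i). (cmod (c \<alpha>))\<^sup>2)"
        by (subst sum.reindex) (simp_all add: inj_def sum_distrib_left)
      also have "\<dots> \<le> 2 * shell_sq c 2"
        unfolding shell_sq_def by (intro mult_left_mono sum_mono2 finite_deg_eq) (auto simp: deg_eq_def)
      finally show ?thesis .
    qed
    then have "(norm \<xi>)\<^sup>2 * (norm y)\<^sup>2 \<le> (norm \<xi>)\<^sup>2 * (2 * shell_sq c 2)" by (rule mult_left_mono) simp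
    ultimately show ?thesis by linarith
  qed
  then have "(norm (second_shell \<xi> c))\<^sup>2 \<le> (\<Sum>j\<in>(UNIV::3 set). (norm \<xi>)\<^sup>2 * (2 * shell_sq c 2))"
    unfolding norm_sq_cvec3 by (intro sum_mono)
  also have "\<dots> = 6 * (norm \<xi>)\<^sup>2 * shell_sq c 2" by simp
  also have "\<dots> \<le> 18 * (norm \<xi>)\<^sup>2 * shell_sq c 2" by (intro mult_right_mono shell_sq_nonneg) simp_all
  finally show ?thesis .
qed

definition mass :: "nat \<Rightarrow> (nat^3 \<Rightarrow> complex) \<Rightarrow> real" where "mass N c = (\<Sum>\<alpha>\<in>deg_le N. (cmod (c \<alpha>))\<^sup>2)"
text \<open>The quadratic form of \<open>-L\<close>.\<close>

definition weighted_mass :: "nat \<Rightarrow> (nat^3 \<Rightarrow> complex) \<Rightarrow> real" where "weighted_mass N c = (\<Sum>\<alpha>\<in>deg_le N. deg \<alpha> * (cmod (c \<alpha>))\<^sup>2)"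

lemma mass_nonneg: "mass N c \<ge> 0" by (simp add: mass_def sum_nonneg)
lemma weighted_mass_nonneg: "weighted_mass N c \<ge> 0" by (simp add: weighted_mass_def sum_nonneg)

lemma weighted_mass_eq: "weighted_mass N c = (\<Sum>n\<le>N. n * shell_sq c n)"
proof -
  have "weighted_mass N c = (\<Sum>n\<in>{..N}. sum (\<lambda>\<alpha>. deg \<alpha> * (cmod (c \<alpha>))\<^sup>2) {\<alpha>\<in>deg_le N. deg \<alpha> = n})"
    unfolding weighted_mass_def by (rule sum.group[symmetric]) (simp_all, auto simp: deg_le_def)
  also have "\<dots> = (\<Sum>n\<le>N. n * shell_sq c n)"
    unfolding shell_sq_def sum_distrib_left by (intro sum.cong) (auto simp: deg_le_def deg_eq_def)
  finally show ?thesis .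
qed

lemma mass_eq: "mass N c = (\<Sum>n\<le>N. shell_sq c n)"
  by (simp add: mass_def sum_shell_sq)

lemma shell_sq_0: "(cmod (c 0))\<^sup>2 = shell_sq c 0"
proof -
  have "deg_eq 0 = {0}" by (auto simp: deg_eq_def deg_def vec_eq_iff)
  then show ?thesis by (simp add: shell_sq_def)
qed

text \<open>The spectral gap of \<open>L\<close>.\<close>

lemma mass_le_weighted_mass: "mass N c - (cmod (c 0))\<^sup>2 \<le> weighted_mass N c"
proof -
  have "mass N c = (\<Sum>n\<in>{..N} - {0}. shell_sq c n) + shell_sq c 0"
    unfolding mass_eq by (subst sum.remove[of _ 0]) auto
  moreover have "(\<Sum>n\<in>{..N} - {0}. shell_sq c n) \<le> (\<Sum>n\<in>{..N} - {0}. n * shell_sq c n)"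
  proof (rule sum_mono)
    fix n assume "n \<in> {..N} - {0}"
    then have "1 * shell_sq c n \<le> n * shell_sq c n" by (intro mult_right_mono shell_sq_nonneg) auto
    then show "shell_sq c n \<le> n * shell_sq c n" by simp
  qed
  moreover have "(\<Sum>n\<in>{..N} - {0}. n * shell_sq c n) \<le> weighted_mass N c"
    unfolding weighted_mass_eq by (rule sum_mono2) (auto simp: shell_sq_nonneg)
  ultimately show ?thesis by (simp add: shell_sq_0)
qed

lemma weighted_mass_ge: assumes "N \<ge> 2" shows "shell_sq c 1 + 2 * shell_sq c 2 \<le> weighted_mass N c"
proof -
  have "(\<Sum>n\<in>{1,2}. n * shell_sq c n) \<le> weighted_mass N c"
    unfolding weighted_mass_eq using assms by (intro sum_mono2) (auto simp: shell_sq_nonneg)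
  then show ?thesis by simp
qed

lemma mass_ge: assumes "N \<ge> 2" shows "(cmod (c 0))\<^sup>2 + shell_sq c 1 \<le> mass N c"
proof -
  have "(\<Sum>n\<in>{0,1}. shell_sq c n) \<le> mass N c"
    unfolding mass_eq using assms by (intro sum_mono2) (auto simp: shell_sq_nonneg)
  then show ?thesis by (simp add: shell_sq_0)
qed

text \<open>By symmetry the form of the Jacobi matrix is real up to the boundary term.\<close>

lemma Im_sum_jacobi: "\<bar>Im (\<Sum>\<alpha>\<in>deg_le N. jacobi \<xi> c \<alpha> * cnj (c \<alpha>))\<bar> \<le> cmod (raising_form \<xi> c (\<lambda>\<alpha>. cnj (c \<alpha>)) (deg_eq N))"
proof -
  define Z U where "Z = (\<Sum>\<alpha>\<in>deg_le N. jacobi \<xi> c \<alpha> * cnj (c \<alpha>))" and "U = raising_form \<xi> c (\<lambda>\<alpha>. cnj (c \<alpha>)) (deg_eq N)"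
  have Jc: "jacobi \<xi> (\<lambda>\<alpha>. cnj (c \<alpha>)) \<alpha> = cnj (jacobi \<xi> c \<alpha>)" for \<alpha> by (simp add: jacobi_def)
  have uc: "raising_form \<xi> (\<lambda>\<alpha>. cnj (c \<alpha>)) c (deg_eq N) = cnj U" by (simp add: U_def raising_form_def)
  have "cnj Z = (\<Sum>\<alpha>\<in>deg_le N. c \<alpha> * cnj (jacobi \<xi> c \<alpha>))" by (simp add: Z_def mult.commute)
  then have "Z - cnj Z = U - cnj U"
    using Green_jacobi[of \<xi> c "\<lambda>\<alpha>. cnj (c \<alpha>)" N] by (simp only: Jc uc Z_def U_def)
  then have "Im (Z - cnj Z) = Im (U - cnj U)" by (rule arg_cong)
  then have "Im Z = Im U" by simp
  then show ?thesis using abs_Im_le_cmod[of U] by (simp only: Z_def U_def)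
qed

section \<open>The hypocoercive estimate\<close>

text \<open>Half of the dissipation constant \<open>r\<^sup>2/288\<close>, divided by the constant \<open>2 + 2/r + \<gamma>\<close> that bounds the modified
energy by the square of the norm.\<close>

definition gap :: "real \<Rightarrow> real \<Rightarrow> real" where "gap \<gamma> r = r\<^sup>2 / 288 / (2 * (2 + 2 / r + \<gamma>))"

text \<open>Bounds the polarised modified energy by the product of the norms.  It may depend on \<open>\<xi>\<close>, as only the
resolvent bound, but not the gap, is affected.\<close>

definition form_const :: "real \<Rightarrow> real^3 \<Rightarrow> real" where "form_const \<gamma> \<xi> = 2 + 4 / (norm \<xi>)\<^sup>2 + \<gamma> + norm \<xi>"

definition total_mass :: "nat \<Rightarrow> (nat^3 \<Rightarrow> complex) \<Rightarrow> complex \<Rightarrow> complex^3 \<Rightarrow> real" where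
  "total_mass N c \<rho> u = mass N c + (cmod \<rho>)\<^sup>2 + (norm u)\<^sup>2"

lemma total_mass_nonneg: "total_mass N c \<rho> u \<ge> 0" by (simp add: total_mass_def mass_nonneg)

text \<open>The equations \<open>(l - \<bbbM>(\<xi>))(c, \<rho>, u) = (g, s, w)\<close>, in the kinetic component only up to degree \<open>N\<close>.\<close>

definition residual ::
  "real \<Rightarrow> real^3 \<Rightarrow> complex \<Rightarrow> nat \<Rightarrow> (nat^3 \<Rightarrow> complex) \<Rightarrow> complex \<Rightarrow> complex^3 \<Rightarrow> (nat^3 \<Rightarrow> complex) \<Rightarrow> complex \<Rightarrow> complex^3 \<Rightarrow> bool" where
  "residual \<gamma> \<xi> l N c \<rho> u g s w \<longleftrightarrow>
     (\<forall>\<alpha>\<in>deg_le N. g \<alpha> = l * c \<alpha> - kinetic_coef \<xi> c \<rho> u \<alpha>) \<and> s = l * \<rho> + \<i> * rc_dot \<xi> u \<and>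
     w = l *\<^sub>C u - velocity_part \<gamma> \<xi> (c 0) (first_shell c) \<rho> u"

lemma inner_cvec3: "(x::complex^3) \<bullet> y = Re (\<Sum>j\<in>UNIV. x $ j * cnj (y $ j))"
  by (simp add: inner_vec_def inner_complex_def)

lemma rc_dot_cnj: "(\<Sum>j\<in>UNIV. complex_of_real (\<xi> $ j) * cnj (u $ j)) = cnj (rc_dot \<xi> u)"
  by (simp add: rc_dot_def)

text \<open>The five quantities that enter the energy identity, obtained by testing the equations with the state and
by projecting the rows of degree \<open>1\<close> and the velocity equation onto \<open>\<xi>\<close>.\<close>

lemma residual_energy:
  assumes R: "residual \<gamma> \<xi> l N c \<rho> u g s w" and N: "N \<ge> 2" and \<xi>: "\<xi> \<noteq> 0"
  defines "a \<equiv> c 0" and "b \<equiv> first_shell c" and "k \<equiv> (norm \<xi>)\<^sup>2"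
  defines "B \<equiv> rc_dot \<xi> b" and "U \<equiv> rc_dot \<xi> u" and "T \<equiv> rc_dot \<xi> (second_shell \<xi> c)"
  shows "Re (\<Sum>\<alpha>\<in>deg_le N. g \<alpha> * cnj (c \<alpha>)) = Re l * mass N c + weighted_mass N c - Im (\<Sum>\<alpha>\<in>deg_le N. jacobi \<xi> c \<alpha> * cnj (c \<alpha>))
      - (Re (- \<i> * (a - \<rho>) * cnj B) / k + u \<bullet> b)" (is ?P1)
    and "g 0 = l * a + \<i> * B" (is ?g0) and "s = l * \<rho> + \<i> * U" (is ?s)
    and "w \<bullet> u = Re l * (norm u)\<^sup>2 - Re (\<i> * a * cnj U) / k - u \<bullet> b + (\<gamma> + 1 / k) * Re (\<i> * \<rho> * cnj U) + (1 + k) * (norm u)\<^sup>2" (is ?P4)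
    and "rc_dot \<xi> (first_shell g) = l * B + B + \<i> * (of_real k * a + T) + \<i> * (a - \<rho>) - U" (is ?G1)
    and "rc_dot \<xi> w = l * U - \<i> * a - B + \<i> * of_real (\<gamma> * k + 1) * \<rho> + of_real (1 + k) * U" (is ?W)
proof -
  have k: "k > 0" using \<xi> by (simp add: k_def)
  have g: "g \<alpha> = l * c \<alpha> + of_nat (deg \<alpha>) * c \<alpha> + \<i> * jacobi \<xi> c \<alpha> - field_coef \<xi> a \<rho> u \<alpha>" if "\<alpha> \<in> deg_le N" for \<alpha>
    using R that by (simp add: residual_def kinetic_coef_def a_def)
  have w: "w $ j = l * u $ j - \<i> * complex_of_real (\<xi> $ j / k) * a - b $ j
      + \<i> * complex_of_real (\<xi> $ j * (\<gamma> + 1 / k)) * \<rho> + complex_of_real (1 + k) * u $ j" for j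
    using R by (simp add: residual_def velocity_part_def scaleC_vec_def scaleC_complex_def a_def b_def k_def)
  have D0: "0 \<in> deg_le N" by (simp add: deg_le_def)
  have D1: "unit j \<in> deg_le N" for j using N by (simp add: deg_le_def)
  show ?g0 using g[OF D0] by (simp add: jacobi_0 B_def b_def a_def)
  show ?s using R by (simp add: residual_def U_def)
  have x2: "(\<Sum>j\<in>UNIV. complex_of_real (\<xi> $ j) * complex_of_real (\<xi> $ j)) = complex_of_real k"
    unfolding k_def norm_sq_vec3 of_real_sum by (simp add: power2_eq_square)
  have x2': "(\<Sum>j\<in>UNIV. complex_of_real (\<xi> $ j) * (complex_of_real (\<xi> $ j) * z)) = complex_of_real k * z" for z
    unfolding x2[symmetric] sum_distrib_right by (simp add: mult.assoc)
  have x3: "(\<Sum>j\<in>UNIV. complex_of_real (\<xi> $ j) * (complex_of_real (\<xi> $ j / k) * z)) = z" for z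
  proof -
    have "(\<Sum>j\<in>UNIV. complex_of_real (\<xi> $ j) * (complex_of_real (\<xi> $ j / k) * z)) = (\<Sum>j\<in>UNIV. complex_of_real (\<xi> $ j) * (complex_of_real (\<xi> $ j) * (z / complex_of_real k)))"
      by simp
    then show ?thesis unfolding x2' using k by simp
  qed
  have rd: "rc_dot \<xi> y = (\<Sum>j\<in>UNIV. complex_of_real (\<xi> $ j) * y $ j)" for y by (simp add: rc_dot_def)
  have lin: "(\<Sum>j\<in>UNIV. complex_of_real (\<xi> $ j) * (z * y $ j)) = z * rc_dot \<xi> y" for z y
    unfolding rd sum_distrib_left by (simp add: mult_ac)
  show ?G1
  proof -
    have gj: "first_shell g $ j = l * b $ j + b $ j + \<i> * (complex_of_real (\<xi> $ j) * a + second_shell \<xi> c $ j) + \<i> * (complex_of_real (\<xi> $ j / k) * (a - \<rho>)) - u $ j" for j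
      using g[OF D1, of j] by (simp add: first_shell_def b_def jacobi_unit field_coef_unit a_def k_def algebra_simps)
    have "rc_dot \<xi> (first_shell g) = (\<Sum>j\<in>UNIV. complex_of_real (\<xi> $ j) * (l * b $ j) + complex_of_real (\<xi> $ j) * b $ j
       + (complex_of_real (\<xi> $ j) * (complex_of_real (\<xi> $ j) * (\<i> * a)) + complex_of_real (\<xi> $ j) * (\<i> * second_shell \<xi> c $ j))
       + complex_of_real (\<xi> $ j) * (complex_of_real (\<xi> $ j / k) * (\<i> * (a - \<rho>))) - complex_of_real (\<xi> $ j) * u $ j)"
      unfolding rd gj by (intro sum.cong refl) (simp add: algebra_simps)
    also have "\<dots> = l * B + B + (of_real k * (\<i> * a) + \<i> * T) + \<i> * (a - \<rho>) - U"
      unfolding sum_subtractf sum.distrib lin x2' x3 rd[symmetric] B_def T_def U_def ..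
    finally show ?thesis by (simp add: algebra_simps)
  qed
  show ?W
  proof -
    have "rc_dot \<xi> w = (\<Sum>j\<in>UNIV. complex_of_real (\<xi> $ j) * (l * u $ j) - complex_of_real (\<xi> $ j) * (complex_of_real (\<xi> $ j / k) * (\<i> * a))
       - complex_of_real (\<xi> $ j) * b $ j + complex_of_real (\<xi> $ j) * (complex_of_real (\<xi> $ j) * (\<i> * complex_of_real (\<gamma> + 1 / k) * \<rho>))
       + complex_of_real (\<xi> $ j) * (complex_of_real (1 + k) * u $ j))"
      unfolding rd w by (intro sum.cong refl) (simp add: algebra_simps)
    also have "\<dots> = l * U - \<i> * a - B + of_real k * (\<i> * complex_of_real (\<gamma> + 1 / k) * \<rho>) + of_real (1 + k) * U"
      unfolding sum_subtractf sum.distrib lin x2' x3 rd[symmetric] B_def U_def ..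
    also have "of_real k * (\<i> * complex_of_real (\<gamma> + 1 / k) * \<rho>) = \<i> * complex_of_real (k * (\<gamma> + 1 / k)) * \<rho>" by simp
    also have "k * (\<gamma> + 1 / k) = \<gamma> * k + 1" using k by (simp add: field_simps)
    finally show ?thesis .
  qed
  have lc: "(\<Sum>j\<in>UNIV. z * complex_of_real (\<xi> $ j) * cnj (y $ j)) = z * cnj (rc_dot \<xi> y)" for z y
    unfolding rc_dot_cnj[symmetric] sum_distrib_left by (simp add: mult_ac)
  show ?P4
  proof -
    have "(\<Sum>j\<in>UNIV. w $ j * cnj (u $ j)) = (\<Sum>j\<in>UNIV. l * (u $ j * cnj (u $ j)) - (\<i> * a / complex_of_real k) * complex_of_real (\<xi> $ j) * cnj (u $ j)
       - b $ j * cnj (u $ j) + (\<i> * complex_of_real (\<gamma> + 1 / k) * \<rho>) * complex_of_real (\<xi> $ j) * cnj (u $ j)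
       + complex_of_real (1 + k) * (u $ j * cnj (u $ j)))"
      unfolding w by (intro sum.cong refl) (simp add: algebra_simps)
    also have "\<dots> = l * (\<Sum>j\<in>UNIV. u $ j * cnj (u $ j)) - \<i> * a / complex_of_real k * cnj U - (\<Sum>j\<in>UNIV. b $ j * cnj (u $ j))
       + (\<i> * complex_of_real (\<gamma> + 1 / k) * \<rho>) * cnj U + complex_of_real (1 + k) * (\<Sum>j\<in>UNIV. u $ j * cnj (u $ j))"
      unfolding sum_subtractf sum.distrib lc U_def sum_distrib_left ..
    also have "(\<Sum>j\<in>UNIV. u $ j * cnj (u $ j)) = complex_of_real ((norm u)\<^sup>2)"
      unfolding norm_sq_cvec3 of_real_sum by (simp add: complex_norm_square[symmetric])
    finally have e: "(\<Sum>j\<in>UNIV. w $ j * cnj (u $ j)) = l * complex_of_real ((norm u)\<^sup>2) - (\<i> * a * cnj U) / complex_of_real k - (\<Sum>j\<in>UNIV. b $ j * cnj (u $ j))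
       + complex_of_real (\<gamma> + 1 / k) * (\<i> * \<rho> * cnj U) + complex_of_real ((1 + k) * (norm u)\<^sup>2)" by (simp add: mult_ac)
    have Rc: "Re (complex_of_real x * z) = x * Re z" "Re (z * complex_of_real x) = Re z * x" "Re (z / complex_of_real x) = Re z / x" for x z
      by (simp_all add: Re_divide_of_real)
    have "w \<bullet> u = Re l * (norm u)\<^sup>2 - Re (\<i> * a * cnj U) / k - b \<bullet> u + (\<gamma> + 1 / k) * Re (\<i> * \<rho> * cnj U) + (1 + k) * (norm u)\<^sup>2"
      unfolding inner_cvec3 e by (simp only: plus_complex.sel minus_complex.sel Rc Re_complex_of_real)
    then show ?thesis by (simp add: inner_commute)
  qed
  show ?P1
  proof -
    have "(\<Sum>\<alpha>\<in>deg_le N. g \<alpha> * cnj (c \<alpha>)) = (\<Sum>\<alpha>\<in>deg_le N. l * (c \<alpha> * cnj (c \<alpha>)) + of_nat (deg \<alpha>) * (c \<alpha> * cnj (c \<alpha>))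
       + \<i> * (jacobi \<xi> c \<alpha> * cnj (c \<alpha>)) - field_coef \<xi> a \<rho> u \<alpha> * cnj (c \<alpha>))"
      by (intro sum.cong refl) (simp add: g algebra_simps)
    also have "\<dots> = l * (\<Sum>\<alpha>\<in>deg_le N. c \<alpha> * cnj (c \<alpha>)) + (\<Sum>\<alpha>\<in>deg_le N. of_nat (deg \<alpha>) * (c \<alpha> * cnj (c \<alpha>)))
       + \<i> * (\<Sum>\<alpha>\<in>deg_le N. jacobi \<xi> c \<alpha> * cnj (c \<alpha>)) - (\<Sum>\<alpha>\<in>deg_le N. field_coef \<xi> a \<rho> u \<alpha> * cnj (c \<alpha>))"
      unfolding sum_subtractf sum.distrib sum_distrib_left ..
    also have "(\<Sum>\<alpha>\<in>deg_le N. c \<alpha> * cnj (c \<alpha>)) = complex_of_real (mass N c)"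
      unfolding mass_def of_real_sum by (simp add: complex_norm_square[symmetric])
    also have "(\<Sum>\<alpha>\<in>deg_le N. of_nat (deg \<alpha>) * (c \<alpha> * cnj (c \<alpha>))) = complex_of_real (weighted_mass N c)"
      unfolding weighted_mass_def of_real_sum by (simp add: complex_norm_square[symmetric])
    also have "(\<Sum>\<alpha>\<in>deg_le N. field_coef \<xi> a \<rho> u \<alpha> * cnj (c \<alpha>)) = (- \<i> * (a - \<rho>) / complex_of_real k) * cnj B + (\<Sum>j\<in>UNIV. u $ j * cnj (b $ j))"
    proof -
      have "(\<Sum>\<alpha>\<in>deg_le N. field_coef \<xi> a \<rho> u \<alpha> * cnj (c \<alpha>)) = (\<Sum>\<alpha>\<in>range unit. field_coef \<xi> a \<rho> u \<alpha> * cnj (c \<alpha>))"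
      proof (rule sum.mono_neutral_right)
        show "range unit \<subseteq> deg_le N" using D1 by auto
        show "\<forall>\<alpha>\<in>deg_le N - range unit. field_coef \<xi> a \<rho> u \<alpha> * cnj (c \<alpha>) = 0"
          by (auto simp: field_coef_def intro!: sum.neutral)
      qed simp
      also have "\<dots> = (\<Sum>j\<in>UNIV. field_coef \<xi> a \<rho> u (unit j) * cnj (b $ j))"
        by (subst sum.reindex) (simp_all add: inj_def b_def first_shell_def)
      also have "\<dots> = (\<Sum>j\<in>UNIV. (- \<i> * (a - \<rho>) / complex_of_real k) * complex_of_real (\<xi> $ j) * cnj (b $ j) + u $ j * cnj (b $ j))"
        unfolding field_coef_unit k_def by (intro sum.cong refl) (simp only: distrib_right, simp add: mult_ac)
      finally show ?thesis unfolding sum.distrib lc B_def .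
    qed
    finally have e: "(\<Sum>\<alpha>\<in>deg_le N. g \<alpha> * cnj (c \<alpha>)) = l * complex_of_real (mass N c) + complex_of_real (weighted_mass N c)
       + \<i> * (\<Sum>\<alpha>\<in>deg_le N. jacobi \<xi> c \<alpha> * cnj (c \<alpha>)) - ((- \<i> * (a - \<rho>) * cnj B) / complex_of_real k + (\<Sum>j\<in>UNIV. u $ j * cnj (b $ j)))"
      by simp
    have Rc: "Re (z * complex_of_real x) = Re z * x" "Re (z / complex_of_real x) = Re z / x" "Re (\<i> * z) = - Im z" for x z
      by (simp_all add: Re_divide_of_real)
    show ?thesis unfolding inner_cvec3 e by (simp only: plus_complex.sel minus_complex.sel Rc Re_complex_of_real)
  qed
qed

text \<open>The modified energy form, polarised between right side and state, by the Cauchy and Schwarz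
inequality.\<close>

lemma residual_right_side_bound:
  fixes \<eta> :: real
  assumes N: "N \<ge> 2" and \<xi>: "\<xi> \<noteq> 0" and \<gamma>: "\<gamma> \<ge> 1" and \<eta>: "0 \<le> \<eta>" "\<eta> \<le> 1/2"
  shows "Re (\<Sum>\<alpha>\<in>deg_le N. g \<alpha> * cnj (c \<alpha>)) + Re ((g 0 - s) * cnj (c 0 - \<rho>)) / (norm \<xi>)\<^sup>2 + \<gamma> * Re (s * cnj \<rho>) + w \<bullet> u
     + \<eta> / 2 * (Re (- \<i> * rc_dot \<xi> (first_shell g) * cnj (c 0)) + Re (- \<i> * rc_dot \<xi> (first_shell c) * cnj (g 0))
       + Re (- \<i> * rc_dot \<xi> w * cnj \<rho>) + Re (- \<i> * rc_dot \<xi> u * cnj s))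
    \<le> form_const \<gamma> \<xi> * (sqrt (total_mass N g s w) * sqrt (total_mass N c \<rho> u))"
proof -
  define k where "k = (norm \<xi>)\<^sup>2"
  have k: "k > 0" using \<xi> by (simp add: k_def)
  define y x where "y = sqrt (total_mass N g s w)" and "x = sqrt (total_mass N c \<rho> u)"
  have y0: "y \<ge> 0" and x0: "x \<ge> 0" by (simp_all add: y_def x_def total_mass_nonneg)
  have le: "cmod (q 0) \<le> sqrt (total_mass N q z v) \<and> norm (first_shell q) \<le> sqrt (total_mass N q z v) \<and> cmod z \<le> sqrt (total_mass N q z v) \<and> norm v \<le> sqrt (total_mass N q z v)
       \<and> L2_set (\<lambda>\<alpha>. cmod (q \<alpha>)) (deg_le N) \<le> sqrt (total_mass N q z v)" for q z and v :: "complex^3"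
  proof -
    have n: "shell_sq q 1 \<ge> 0" "mass N q \<ge> 0" "(cmod (q 0))\<^sup>2 + shell_sq q 1 \<le> mass N q" "(norm (first_shell q))\<^sup>2 \<le> shell_sq q 1"
      using shell_sq_nonneg mass_nonneg mass_ge[OF N] norm_first_shell_le by auto
    have sq: "(cmod (q 0))\<^sup>2 \<ge> 0" "(cmod z)\<^sup>2 \<ge> 0" "(norm v)\<^sup>2 \<ge> 0" by simp_all
    have "(cmod (q 0))\<^sup>2 \<le> total_mass N q z v" "(norm (first_shell q))\<^sup>2 \<le> total_mass N q z v" "(cmod z)\<^sup>2 \<le> total_mass N q z v"
      "(norm v)\<^sup>2 \<le> total_mass N q z v" "mass N q \<le> total_mass N q z v"
      unfolding total_mass_def using n sq by linarith+
    then show ?thesis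
      unfolding L2_set_def mass_def[symmetric] by (intro conjI real_le_rsqrt real_sqrt_le_mono)
  qed
  note leg = le[of g s w, folded y_def] and lec = le[of c \<rho> u, folded x_def]
  have t1: "Re (\<Sum>\<alpha>\<in>deg_le N. g \<alpha> * cnj (c \<alpha>)) \<le> y * x"
  proof -
    have "Re (\<Sum>\<alpha>\<in>deg_le N. g \<alpha> * cnj (c \<alpha>)) \<le> cmod (\<Sum>\<alpha>\<in>deg_le N. g \<alpha> * cnj (c \<alpha>))" by (rule complex_Re_le_cmod)
    also have "\<dots> \<le> (\<Sum>\<alpha>\<in>deg_le N. \<bar>cmod (g \<alpha>)\<bar> * \<bar>cmod (c \<alpha>)\<bar>)" by (rule sum_norm_le) (simp add: norm_mult)
    also have "\<dots> \<le> L2_set (\<lambda>\<alpha>. cmod (g \<alpha>)) (deg_le N) * L2_set (\<lambda>\<alpha>. cmod (c \<alpha>)) (deg_le N)" by (rule L2_set_mult_ineq)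
    also have "\<dots> \<le> y * x" using leg lec y0 by (intro mult_mono) (auto simp: L2_set_nonneg)
    finally show ?thesis .
  qed
  have R: "Re (p * cnj q) \<le> P * Q" if "cmod p \<le> P" "cmod q \<le> Q" for p q P Q
  proof -
    have "Re (p * cnj q) \<le> cmod p * cmod q" using abs_Re_mult_le[of p q] by linarith
    also have "\<dots> \<le> P * Q" using that norm_ge_zero[of p] norm_ge_zero[of q] by (intro mult_mono) linarith+
    finally show ?thesis .
  qed
  have t2: "Re ((g 0 - s) * cnj (c 0 - \<rho>)) / k \<le> 4 / k * (y * x)"
  proof -
    have "cmod (g 0 - s) \<le> 2 * y" "cmod (c 0 - \<rho>) \<le> 2 * x"
      using leg lec norm_triangle_ineq4[of "g 0" s] norm_triangle_ineq4[of "c 0" \<rho>] by linarith+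
    then have "Re ((g 0 - s) * cnj (c 0 - \<rho>)) \<le> (2 * y) * (2 * x)" by (rule R)
    then have "Re ((g 0 - s) * cnj (c 0 - \<rho>)) / k \<le> (2 * y) * (2 * x) / k" using k by (intro divide_right_mono) auto
    then show ?thesis by simp
  qed
  have t3: "\<gamma> * Re (s * cnj \<rho>) \<le> \<gamma> * (y * x)" using leg lec \<gamma> by (intro mult_left_mono R) auto
  have t4: "w \<bullet> u \<le> y * x"
  proof -
    have "w \<bullet> u \<le> norm w * norm u" by (rule norm_cauchy_schwarz)
    also have "\<dots> \<le> y * x" using leg lec y0 by (intro mult_mono) auto
    finally show ?thesis .
  qed
  have rb: "cmod (- \<i> * rc_dot \<xi> v) \<le> norm \<xi> * q" if "norm v \<le> q" for v q
    using rc_dot_bound[of \<xi> v] mult_left_mono[OF that, of "norm \<xi>"] by (simp add: norm_mult)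
  have t5: "Re (- \<i> * rc_dot \<xi> (first_shell g) * cnj (c 0)) \<le> norm \<xi> * y * x" using leg lec by (intro R rb) auto
  have t6: "Re (- \<i> * rc_dot \<xi> (first_shell c) * cnj (g 0)) \<le> norm \<xi> * x * y" using leg lec by (intro R rb) auto
  have t7: "Re (- \<i> * rc_dot \<xi> w * cnj \<rho>) \<le> norm \<xi> * y * x" using leg lec by (intro R rb) auto
  have t8: "Re (- \<i> * rc_dot \<xi> u * cnj s) \<le> norm \<xi> * x * y" using leg lec by (intro R rb) auto
  have t9: "\<eta> / 2 * (Re (- \<i> * rc_dot \<xi> (first_shell g) * cnj (c 0)) + Re (- \<i> * rc_dot \<xi> (first_shell c) * cnj (g 0))
       + Re (- \<i> * rc_dot \<xi> w * cnj \<rho>) + Re (- \<i> * rc_dot \<xi> u * cnj s)) \<le> norm \<xi> * (y * x)" (is "\<eta> / 2 * ?z \<le> _")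
  proof -
    have "?z \<le> norm \<xi> * y * x + norm \<xi> * x * y + norm \<xi> * y * x + norm \<xi> * x * y"
      using t5 t6 t7 t8 by linarith
    also have "\<dots> = 4 * (norm \<xi> * (y * x))" by (simp add: algebra_simps)
    finally have "\<eta> / 2 * ?z \<le> \<eta> / 2 * (4 * (norm \<xi> * (y * x)))" using \<eta> by (intro mult_left_mono) auto
    also have "\<dots> \<le> (1/2) / 2 * (4 * (norm \<xi> * (y * x)))" using \<eta> y0 x0 by (intro mult_right_mono divide_right_mono) auto
    finally show ?thesis by simp
  qed
  have "form_const \<gamma> \<xi> * (y * x) = y * x + 4 / k * (y * x) + \<gamma> * (y * x) + y * x + norm \<xi> * (y * x)"
    by (simp add: form_const_def k_def algebra_simps)
  then show ?thesis using t1 t2 t3 t4 t9 unfolding k_def[symmetric] y_def[symmetric] x_def[symmetric] by linarith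
qed

text \<open>Half of the dissipation pays for a slightly negative \<open>Re l\<close>; the other half controls the state.  This uses
that the modified energy lies between \<open>0\<close> and \<open>2 + 2/r + \<gamma>\<close> times the squared norm.\<close>

lemma hypocoercive_estimate:
  assumes R: "residual \<gamma> \<xi> l N c \<rho> u g s w" and N: "N \<ge> 2"
    and r: "0 < r" "r \<le> 1" "r \<le> (norm \<xi>)\<^sup>2" and \<gamma>: "\<gamma> \<ge> 1" and l: "Re l \<ge> - gap \<gamma> r"
  shows "r\<^sup>2 / 576 * (weighted_mass N c + total_mass N c \<rho> u) \<le> form_const \<gamma> \<xi> * (sqrt (total_mass N g s w) * sqrt (total_mass N c \<rho> u))
     + cmod (raising_form \<xi> c (\<lambda>\<alpha>. cnj (c \<alpha>)) (deg_eq N))"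
proof -
  have \<xi>: "\<xi> \<noteq> 0" using r by auto
  define k where "k = (norm \<xi>)\<^sup>2"
  have k: "k > 0" "r \<le> k" using \<xi> r by (simp_all add: k_def)
  define a b where "a = c 0" and "b = first_shell c"
  define B U T where "B = rc_dot \<xi> b" and "U = rc_dot \<xi> u" and "T = rc_dot \<xi> (second_shell \<xi> c)"
  note E = residual_energy[OF R N \<xi>, folded a_def b_def k_def, folded B_def U_def T_def]
  (* The weight of the corrector: the factor 1/(1+k) makes the corrector bounded uniformly in the
     wave number, and r/36 makes its errors absorbable. *)
  define \<eta> where "\<eta> = r / 36 / (1 + k)"
  have e36: "\<eta> * (1 + k) = r / 36"
    by (rule nonzero_eq_divide_eq[THEN iffD1, OF _ \<eta>_def]) (use k in simp)
  have e0: "0 \<le> \<eta>" using r k by (simp add: \<eta>_def)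
  have "\<eta> * 1 \<le> \<eta> * (1 + k)" using e0 k by (intro mult_left_mono) auto
  then have \<eta>: "0 \<le> \<eta>" "\<eta> \<le> 1/2" "\<eta> * (1 + k) \<le> 1" using r e36 e0 by linarith+
  define S where "S = mass N c"
  define ImJ where "ImJ = Im (\<Sum>\<alpha>\<in>deg_le N. jacobi \<xi> c \<alpha> * cnj (c \<alpha>))"
  (* Ef is the modified energy of the state and Df its dissipation. *)
  define Ef where "Ef = S + (cmod (a - \<rho>))\<^sup>2 / k + \<gamma> * (cmod \<rho>)\<^sup>2 + (norm u)\<^sup>2 + \<eta> * (Re (- \<i> * B * cnj a) + Re (- \<i> * U * cnj \<rho>))"
  define Df where "Df = weighted_mass N c - 2 * (u \<bullet> b) + (1 + k) * (norm u)\<^sup>2 + \<eta> / 2 *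
     (Re (- \<i> * (B - U) * cnj a) + k * (cmod a)\<^sup>2 + Re (T * cnj a) + (cmod (a - \<rho>))\<^sup>2 + \<gamma> * k * (cmod \<rho>)\<^sup>2
       - (cmod B)\<^sup>2 + Re (\<i> * B * cnj \<rho>) - (1 + k) * Re (\<i> * U * cnj \<rho>) - (cmod U)\<^sup>2)"
  define X where "X = total_mass N c \<rho> u"
  have X: "X = S + (cmod \<rho>)\<^sup>2 + (norm u)\<^sup>2" by (simp add: X_def S_def total_mass_def)
  have X0: "X \<ge> 0" by (simp add: X_def total_mass_nonneg)
  have ba: "(cmod a)\<^sup>2 + (norm b)\<^sup>2 \<le> S"
    using mass_ge[OF N, of c] norm_first_shell_le[of c] by (simp add: a_def b_def S_def)
  have B2: "(cmod B)\<^sup>2 \<le> k * (norm b)\<^sup>2" and U2: "(cmod U)\<^sup>2 \<le> k * (norm u)\<^sup>2"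
    unfolding B_def U_def k_def by (rule rc_dot_bound_sq)+
  have T2: "(cmod T)\<^sup>2 \<le> 18 * k\<^sup>2 * shell_sq c 2"
  proof -
    have "(cmod T)\<^sup>2 \<le> k * (norm (second_shell \<xi> c))\<^sup>2" unfolding T_def k_def by (rule rc_dot_bound_sq)
    also have "\<dots> \<le> k * (18 * k * shell_sq c 2)" using k norm_second_shell_le[of \<xi> c] by (intro mult_left_mono) (auto simp: k_def)
    finally show ?thesis by (simp add: power2_eq_square)
  qed
  have main: "Re l * Ef - ImJ + Df \<le> form_const \<gamma> \<xi> * (sqrt (total_mass N g s w) * sqrt X)"
    unfolding Ef_def Df_def X_def S_def ImJ_def
    by (rule ord_eq_le_trans[OF energy_identity[OF k(1) E, where \<eta>=\<eta>, symmetric]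
        residual_right_side_bound[OF N \<xi> \<gamma> \<eta>(1,2), of g c s \<rho> w u, folded a_def b_def k_def, folded B_def U_def]])
  have I: "\<bar>ImJ\<bar> \<le> cmod (raising_form \<xi> c (\<lambda>\<alpha>. cnj (c \<alpha>)) (deg_eq N))" unfolding ImJ_def by (rule Im_sum_jacobi)
  have D: "r / 8 * (weighted_mass N c + (norm u)\<^sup>2) + r\<^sup>2 / 288 * ((cmod a)\<^sup>2 + (cmod \<rho>)\<^sup>2) \<le> Df"
  proof -
    have bu: "(norm (b - u))\<^sup>2 = (norm b)\<^sup>2 - 2 * (u \<bullet> b) + (norm u)\<^sup>2"
      by (simp add: power2_norm_eq_inner algebra_simps inner_commute)
    have bu': "(norm b)\<^sup>2 \<le> 2 * (norm (b - u))\<^sup>2 + 2 * (norm u)\<^sup>2"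
    proof -
      have "norm b \<le> norm (b - u) + norm u" using norm_triangle_ineq[of "b - u" u] by simp
      then have "(norm b)\<^sup>2 \<le> (norm (b - u) + norm u)\<^sup>2" by (intro power_mono) auto
      also have "\<dots> \<le> 2 * (norm (b - u))\<^sup>2 + 2 * (norm u)\<^sup>2"
        using sum_squares_bound[of "norm (b - u)" "norm u"] by (simp add: power2_sum)
      finally show ?thesis .
    qed
    have H2: "2 * shell_sq c 2 \<le> weighted_mass N c - (norm b)\<^sup>2"
      using weighted_mass_ge[OF N, of c] norm_first_shell_le[of c] by (simp add: b_def)
    have "r / 8 * ((weighted_mass N c - (norm b)\<^sup>2) + (norm b)\<^sup>2 + (norm u)\<^sup>2) + r\<^sup>2 / 288 * ((cmod a)\<^sup>2 + (cmod \<rho>)\<^sup>2) \<le>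
      ((weighted_mass N c - (norm b)\<^sup>2) + (norm b)\<^sup>2) - 2 * (u \<bullet> b) + (1 + k) * (norm u)\<^sup>2 + (r / 36 / (1 + k)) / 2 *
     (Re (- \<i> * (B - U) * cnj a) + k * (cmod a)\<^sup>2 + Re (T * cnj a) + (cmod (a - \<rho>))\<^sup>2 + \<gamma> * k * (cmod \<rho>)\<^sup>2
       - (cmod B)\<^sup>2 + Re (\<i> * B * cnj \<rho>) - (1 + k) * Re (\<i> * U * cnj \<rho>) - (cmod U)\<^sup>2)"
      by (rule coercivity[OF r(1,2) k(2) \<gamma> _ _ _ _ _ H2 B2 U2 T2]) (use bu bu' in \<open>simp_all add: shell_sq_nonneg flip: bu\<close>)
    then show ?thesis by (simp add: Df_def \<eta>_def)
  qed
  have D': "r\<^sup>2 / 288 * (weighted_mass N c + X) \<le> Df"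
  proof -
    have Sd: "S - (cmod a)\<^sup>2 \<le> weighted_mass N c" using mass_le_weighted_mass[of N c] by (simp add: S_def a_def)
    have r2: "r\<^sup>2 / 288 \<le> r / 16"
    proof -
      have "r * r \<le> r * 1" using r by (intro mult_left_mono) auto
      then show ?thesis using r by (simp add: power2_eq_square)
    qed
    have "r\<^sup>2 / 288 * (weighted_mass N c + X) = r\<^sup>2 / 288 * (weighted_mass N c + (S - (cmod a)\<^sup>2) + (norm u)\<^sup>2) + r\<^sup>2 / 288 * ((cmod a)\<^sup>2 + (cmod \<rho>)\<^sup>2)"
      by (simp add: X algebra_simps add_divide_distrib)
    also have "r\<^sup>2 / 288 * (weighted_mass N c + (S - (cmod a)\<^sup>2) + (norm u)\<^sup>2) \<le> r / 16 * (weighted_mass N c + (S - (cmod a)\<^sup>2) + (norm u)\<^sup>2)"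
      using r2 weighted_mass_nonneg[of N c] ba zero_le_power2[of "norm b"] zero_le_power2[of "norm u"]
      by (intro mult_right_mono) linarith+
    also have "\<dots> \<le> r / 16 * (2 * (weighted_mass N c + (norm u)\<^sup>2))"
    proof (rule mult_left_mono)
      show "weighted_mass N c + (S - (cmod a)\<^sup>2) + (norm u)\<^sup>2 \<le> 2 * (weighted_mass N c + (norm u)\<^sup>2)"
        unfolding distrib_left using Sd zero_le_power2[of "norm u"] by linarith
    qed (use r in simp)
    also have "r / 16 * (2 * (weighted_mass N c + (norm u)\<^sup>2)) = r / 8 * (weighted_mass N c + (norm u)\<^sup>2)" by simp
    finally show ?thesis using D by linarith
  qed
  have Gb: "\<bar>\<eta> * (Re (- \<i> * B * cnj a) + Re (- \<i> * U * cnj \<rho>))\<bar> \<le> X"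
  proof -
    have one: "\<bar>Re (- \<i> * Q * cnj z)\<bar> \<le> (1 + k) * (q + (cmod z)\<^sup>2)" if Q: "(cmod Q)\<^sup>2 \<le> k * q" "q \<ge> 0" for Q z q
    proof -
      have "\<bar>Re ((- \<i> * Q) * cnj z)\<bar> \<le> cmod (- \<i> * Q) * cmod z" by (rule abs_Re_mult_le)
      also have "\<dots> \<le> (cmod Q)\<^sup>2 + (cmod z)\<^sup>2"
      proof -
        have nQ: "cmod (- \<i> * Q) = cmod Q" by (simp add: norm_mult)
        show ?thesis
          unfolding nQ using sum_squares_bound[of "cmod Q" "cmod z"] mult_nonneg_nonneg[OF norm_ge_zero[of Q] norm_ge_zero[of z]]
          unfolding mult.assoc by linarith
      qed
      also have "\<dots> \<le> k * q + (cmod z)\<^sup>2" using Q by simp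
      also have "\<dots> \<le> (1 + k) * (q + (cmod z)\<^sup>2)" using k Q by (simp add: algebra_simps)
      finally show ?thesis .
    qed
    have "\<bar>\<eta> * (Re (- \<i> * B * cnj a) + Re (- \<i> * U * cnj \<rho>))\<bar> = \<eta> * \<bar>Re (- \<i> * B * cnj a) + Re (- \<i> * U * cnj \<rho>)\<bar>"
      using \<eta> by (simp add: abs_mult)
    also have "\<dots> \<le> \<eta> * ((1 + k) * ((norm b)\<^sup>2 + (cmod a)\<^sup>2) + (1 + k) * ((norm u)\<^sup>2 + (cmod \<rho>)\<^sup>2))"
      by (intro mult_left_mono order_trans[OF abs_triangle_ineq] add_mono one B2 U2 \<eta>) simp_all
    also have "\<dots> = (\<eta> * (1 + k)) * ((norm b)\<^sup>2 + (cmod a)\<^sup>2 + (norm u)\<^sup>2 + (cmod \<rho>)\<^sup>2)" by (simp add: algebra_simps)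
    also have "\<dots> \<le> 1 * ((norm b)\<^sup>2 + (cmod a)\<^sup>2 + (norm u)\<^sup>2 + (cmod \<rho>)\<^sup>2)" using \<eta> by (intro mult_right_mono) auto
    also have "\<dots> \<le> X" using ba by (simp add: X)
    finally show ?thesis .
  qed
  have z2: "(cmod (a - \<rho>))\<^sup>2 / k \<le> 2 / r * X"
  proof -
    have "(cmod (a - \<rho>))\<^sup>2 \<le> (cmod a + cmod \<rho>)\<^sup>2" by (intro power_mono norm_triangle_ineq4) auto
    also have "\<dots> \<le> 2 * ((cmod a)\<^sup>2 + (cmod \<rho>)\<^sup>2)" using sum_squares_bound[of "cmod a" "cmod \<rho>"] by (simp add: power2_sum)
    also have "\<dots> \<le> 2 * X" using ba zero_le_power2[of "norm b"] zero_le_power2[of "norm u"] unfolding X distrib_left by linarith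
    finally have "(cmod (a - \<rho>))\<^sup>2 / k \<le> 2 * X / k" using k by (intro divide_right_mono) auto
    also have "\<dots> \<le> 2 * X / r" using k r X0 by (intro divide_left_mono) auto
    finally show ?thesis by simp
  qed
  have z0: "(cmod (a - \<rho>))\<^sup>2 / k \<ge> 0" using k by simp
  have g1: "(cmod \<rho>)\<^sup>2 \<le> \<gamma> * (cmod \<rho>)\<^sup>2" using \<gamma> mult_right_mono[of 1 \<gamma> "(cmod \<rho>)\<^sup>2"] by simp
  have E0: "Ef \<ge> 0" using Gb z0 g1 X unfolding Ef_def abs_le_iff by linarith
  have E1: "Ef \<le> (2 + 2 / r + \<gamma>) * X"
  proof -
    have "(cmod \<rho>)\<^sup>2 \<le> X"
      using ba zero_le_power2[of "cmod a"] zero_le_power2[of "norm b"] zero_le_power2[of "norm u"] X by linarith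
    then have "\<gamma> * (cmod \<rho>)\<^sup>2 \<le> \<gamma> * X" using \<gamma> by (intro mult_left_mono) auto
    moreover have "S + (norm u)\<^sup>2 \<le> X" by (simp add: X)
    ultimately have "Ef \<le> X + 2 / r * X + \<gamma> * X + X" using Gb z2 unfolding Ef_def abs_le_iff by linarith
    then show ?thesis by (simp add: algebra_simps)
  qed
  have "Re l * Ef \<ge> - (r\<^sup>2 / 576 * X)"
  proof -
    have th: "2 + 2 / r + \<gamma> > 0" using r \<gamma> by (simp add: add_pos_pos)
    have "gap \<gamma> r * Ef \<le> gap \<gamma> r * ((2 + 2 / r + \<gamma>) * X)"
      using E1 th by (intro mult_left_mono) (auto simp: gap_def)
    also have "\<dots> = r\<^sup>2 / 576 * X"
    proof -
      define \<Theta> where "\<Theta> = 2 + 2 / r + \<gamma>"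
      have "\<Theta> > 0" using th by (simp only: \<Theta>_def)
      then show ?thesis unfolding gap_def \<Theta>_def[symmetric] by simp
    qed
    finally have "- gap \<gamma> r * Ef \<ge> - (r\<^sup>2 / 576 * X)" by simp
    moreover have "Re l * Ef \<ge> - gap \<gamma> r * Ef" using l E0 by (intro mult_right_mono) auto
    ultimately show ?thesis by linarith
  qed
  moreover have "r\<^sup>2 / 576 * (weighted_mass N c + X) + r\<^sup>2 / 576 * X \<le> r\<^sup>2 / 288 * (weighted_mass N c + X)"
  proof -
    have "r\<^sup>2 / 288 * (weighted_mass N c + X) - (r\<^sup>2 / 576 * (weighted_mass N c + X) + r\<^sup>2 / 576 * X) = r\<^sup>2 / 576 * weighted_mass N c" by (simp add: field_simps)
    then show ?thesis using weighted_mass_nonneg[of N c] by (smt (verit) divide_nonneg_nonneg mult_nonneg_nonneg zero_le_power2)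
  qed
  ultimately show ?thesis using main I D' unfolding X_def[symmetric] by linarith
qed

section \<open>Resolvent bound and Galerkin solutions\<close>

lemma jacobi_add: "jacobi \<xi> (\<lambda>\<alpha>. c \<alpha> + d \<alpha>) \<alpha> = jacobi \<xi> c \<alpha> + jacobi \<xi> d \<alpha>"
  by (simp add: jacobi_def sum.distrib algebra_simps)

lemma jacobi_scale: "jacobi \<xi> (\<lambda>\<alpha>. z * c \<alpha>) \<alpha> = z * jacobi \<xi> c \<alpha>"
  by (simp add: jacobi_def sum_distrib_left algebra_simps)

lemma field_coef_add: "field_coef \<xi> (a + a') (\<rho> + \<rho>') (u + u') \<alpha> = field_coef \<xi> a \<rho> u \<alpha> + field_coef \<xi> a' \<rho>' u' \<alpha>"
  unfolding field_coef_def sum.distrib[symmetric] by (intro sum.cong) (auto simp: algebra_simps add_divide_distrib diff_divide_distrib)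

lemma field_coef_scale: "field_coef \<xi> (z * a) (z * \<rho>) (z *\<^sub>C u) \<alpha> = z * field_coef \<xi> a \<rho> u \<alpha>"
  unfolding field_coef_def sum_distrib_left by (intro sum.cong) (auto simp: scaleC_vec_def scaleC_complex_def algebra_simps diff_divide_distrib)

lemma kinetic_coef_add: "kinetic_coef \<xi> (\<lambda>\<alpha>. c \<alpha> + d \<alpha>) (\<rho> + \<rho>') (u + u') \<alpha> = kinetic_coef \<xi> c \<rho> u \<alpha> + kinetic_coef \<xi> d \<rho>' u' \<alpha>"
  by (simp add: kinetic_coef_def jacobi_add field_coef_add algebra_simps)

lemma kinetic_coef_scale: "kinetic_coef \<xi> (\<lambda>\<alpha>. z * c \<alpha>) (z * \<rho>) (z *\<^sub>C u) \<alpha> = z * kinetic_coef \<xi> c \<rho> u \<alpha>"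
  unfolding kinetic_coef_def jacobi_scale field_coef_scale by (simp add: algebra_simps)

lemma velocity_part_add: "velocity_part \<gamma> \<xi> (a + a') (b + b') (\<rho> + \<rho>') (u + u') = velocity_part \<gamma> \<xi> a b \<rho> u + velocity_part \<gamma> \<xi> a' b' \<rho>' u'"
  by (simp add: velocity_part_def vec_eq_iff algebra_simps add_divide_distrib)

lemma velocity_part_scale: "velocity_part \<gamma> \<xi> (z * a) (z *\<^sub>C b) (z * \<rho>) (z *\<^sub>C u) = z *\<^sub>C velocity_part \<gamma> \<xi> a b \<rho> u"
  by (simp add: velocity_part_def vec_eq_iff scaleC_vec_def scaleC_complex_def algebra_simps)

lemma first_shell_add: "first_shell (\<lambda>\<alpha>. c \<alpha> + d \<alpha>) = first_shell c + first_shell d" by (simp add: first_shell_def vec_eq_iff)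
lemma first_shell_scale: "first_shell (\<lambda>\<alpha>. z * c \<alpha>) = z *\<^sub>C first_shell c" by (simp add: first_shell_def vec_eq_iff scaleC_vec_def scaleC_complex_def)
lemma rc_dot_add: "rc_dot \<xi> (u + v) = rc_dot \<xi> u + rc_dot \<xi> v" by (simp add: rc_dot_def sum.distrib algebra_simps)
lemma rc_dot_scale: "rc_dot \<xi> (z *\<^sub>C u) = z * rc_dot \<xi> u"
  by (simp add: rc_dot_def sum_distrib_left scaleC_vec_def scaleC_complex_def algebra_simps)

lemma scaleC_commute: "z *\<^sub>C l *\<^sub>C (x::'a::complex_normed_space) = l *\<^sub>C z *\<^sub>C x"
  by (simp add: scaleC_scaleC mult.commute)

lemma scaleC_minus_right: "z *\<^sub>C (x - y) = z *\<^sub>C x - z *\<^sub>C (y::'a::complex_normed_space)"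
  using scaleC_add_right[of z "x - y" y] by (simp add: eq_diff_eq)

lemma residual_add:
  assumes "residual \<gamma> \<xi> l N c \<rho> u g s w" "residual \<gamma> \<xi> l N c' \<rho>' u' g' s' w'"
  shows "residual \<gamma> \<xi> l N (\<lambda>\<alpha>. c \<alpha> + c' \<alpha>) (\<rho> + \<rho>') (u + u') (\<lambda>\<alpha>. g \<alpha> + g' \<alpha>) (s + s') (w + w')"
  using assms unfolding residual_def kinetic_coef_add first_shell_add velocity_part_add rc_dot_add scaleC_add_right
  by (simp add: distrib_left add_diff_add)

lemma residual_scale:
  assumes "residual \<gamma> \<xi> l N c \<rho> u g s w"
  shows "residual \<gamma> \<xi> l N (\<lambda>\<alpha>. z * c \<alpha>) (z * \<rho>) (z *\<^sub>C u) (\<lambda>\<alpha>. z * g \<alpha>) (z * s) (z *\<^sub>C w)"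
  using assms unfolding residual_def kinetic_coef_scale first_shell_scale velocity_part_scale rc_dot_scale scaleC_commute[of l z]
  by (simp add: scaleC_minus_right right_diff_distrib distrib_left mult.left_commute)

lemma scaleC_minus1: "(-1) *\<^sub>C (x::'a::complex_normed_space) = - x"
  using scaleC_of_real[of "-1" x] by simp

lemma residual_diff:
  assumes "residual \<gamma> \<xi> l N c \<rho> u g s w" "residual \<gamma> \<xi> l N c' \<rho>' u' g' s' w'"
  shows "residual \<gamma> \<xi> l N (\<lambda>\<alpha>. c \<alpha> - c' \<alpha>) (\<rho> - \<rho>') (u - u') (\<lambda>\<alpha>. g \<alpha> - g' \<alpha>) (s - s') (w - w')"
  using residual_add[OF assms(1) residual_scale[OF assms(2), of "-1"]] by (simp add: scaleC_minus1)

lemma residual_mono: "residual \<gamma> \<xi> l M c \<rho> u g s w \<Longrightarrow> N \<le> M \<Longrightarrow> residual \<gamma> \<xi> l N c \<rho> u g s w"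
  using deg_le_mono[of N M] by (auto simp: residual_def)

text \<open>The image of a basis of the span is independent and has the same number of elements, so it cannot be
enlarged inside the span.\<close>

lemma injective_endomorphism_of_span_onto:
  fixes T :: "'a::real_vector \<Rightarrow> 'a"
  assumes T: "linear T" and S: "finite S" and sub: "T ` span S \<subseteq> span S" and inj: "inj_on T (span S)"
  shows "span S \<subseteq> T ` span S"
proof -
  obtain B where B: "B \<subseteq> S" "independent B" "S \<subseteq> span B"
    by (rule maximal_independent_subset)
  have sp: "span B = span S" by (intro equalityI span_mono[OF B(1)] span_minimal[OF B(3) subspace_span])
  have fB: "finite B" using B(1) S by (rule finite_subset)
  have BS: "B \<subseteq> span S" unfolding sp[symmetric] by (rule span_superset)
  have iB: "inj_on T (span B)" using inj sp by simp
  have TB: "independent (T ` B)" using linear_independent_injective_image[OF T B(2) iB] .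
  have card: "card (T ` B) = card B" by (rule card_image) (rule inj_on_subset[OF inj BS])
  show ?thesis
  proof
    fix y assume y: "y \<in> span S"
    have "y \<in> span (T ` B)"
    proof (rule ccontr)
      assume ny: "y \<notin> span (T ` B)"
      then have ind: "independent (insert y (T ` B))" using TB by (simp add: independent_insert)
      have "insert y (T ` B) \<subseteq> span B" using y sub BS sp by auto
      from independent_span_bound[OF fB ind this] have "card (insert y (T ` B)) \<le> card B" by simp
      moreover have "y \<notin> T ` B" using ny span_base[of y "T ` B"] by blast
      ultimately show False using card fB by simp
    qed
    then show "y \<in> T ` span S" unfolding linear_span_image[OF T] sp .
  qed
qed

lemma coef_L2_scaleR: "coef_L2 (r *\<^sub>R x) \<alpha> = complex_of_real r * coef_L2 x \<alpha>"
  by (simp add: coef_L2_scaleC flip: scaleC_of_real)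

lemma hermite_sum_add: "hermite_sum (\<lambda>\<alpha>. c \<alpha> + d \<alpha>) A = hermite_sum c A + hermite_sum d A"
  by (simp add: hermite_sum_def scaleC_add_left sum.distrib)

lemma scaleC_sum_right: "z *\<^sub>C (\<Sum>i\<in>I. f i) = (\<Sum>i\<in>I. z *\<^sub>C (f i :: 'a::complex_normed_space))"
proof -
  have z: "z *\<^sub>C (0::'a) = 0" using scaleC_minus_right[of z "0::'a" 0] by simp
  show ?thesis by (induction I rule: infinite_finite_induct) (simp_all add: z scaleC_add_right)
qed

lemma hermite_sum_scale: "hermite_sum (\<lambda>\<alpha>. z * c \<alpha>) A = z *\<^sub>C hermite_sum c A"
  by (simp add: hermite_sum_def scaleC_sum_right scaleC_scaleC)

lemma hermite_sum_in_span:
  "hermite_sum c A \<in> span (hermite_vec ` A \<union> (\<lambda>\<alpha>. \<i> *\<^sub>C hermite_vec \<alpha>) ` A)"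
  unfolding hermite_sum_def
proof (rule span_sum)
  fix \<alpha> assume a: "\<alpha> \<in> A"
  have "c \<alpha> *\<^sub>C hermite_vec \<alpha> = (complex_of_real (Re (c \<alpha>)) + complex_of_real (Im (c \<alpha>)) * \<i>) *\<^sub>C hermite_vec \<alpha>"
    using complex_eq[of "c \<alpha>"] by (simp only: mult.commute)
  also have "\<dots> = Re (c \<alpha>) *\<^sub>R hermite_vec \<alpha> + Im (c \<alpha>) *\<^sub>R (\<i> *\<^sub>C hermite_vec \<alpha>)"
    unfolding scaleC_add_left scaleC_scaleC[symmetric] scaleC_of_real ..
  also have "\<dots> \<in> span (hermite_vec ` A \<union> (\<lambda>\<alpha>. \<i> *\<^sub>C hermite_vec \<alpha>) ` A)"
    using a by (intro span_add span_scale span_base) auto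
  finally show "c \<alpha> *\<^sub>C hermite_vec \<alpha> \<in> span (hermite_vec ` A \<union> (\<lambda>\<alpha>. \<i> *\<^sub>C hermite_vec \<alpha>) ` A)" .
qed

lemma raising_form_deg_eq_zero: "(\<And>\<alpha>. deg \<alpha> > N \<Longrightarrow> c \<alpha> = 0) \<Longrightarrow> raising_form \<xi> c d (deg_eq N) = 0"
  unfolding raising_form_def by (intro sum.neutral ballI) (simp add: deg_eq_def)

text \<open>Bounds the solutions of the quadratic inequality left by the estimate when there is no boundary term.\<close>

lemma quadratic_absorb:
  fixes \<kappa> d x C y :: real
  assumes "\<kappa> > 0" "d \<ge> 0" "x \<ge> 0" "C \<ge> 0" "y \<ge> 0" and e: "\<kappa> * (d + x\<^sup>2) \<le> C * (y * x)"
  shows "x \<le> C / \<kappa> * y" "d \<le> (C / \<kappa> * y)\<^sup>2"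
proof -
  have kd: "0 \<le> \<kappa> * d" using assms by simp
  have "\<kappa> * x\<^sup>2 \<le> C * (y * x)" using e kd unfolding distrib_left by linarith
  then have "x * (\<kappa> * x) \<le> x * (C * y)" by (simp add: power2_eq_square mult_ac)
  then show x: "x \<le> C / \<kappa> * y"
  proof (cases "x = 0")
    case False
    then have "\<kappa> * x \<le> C * y" using \<open>x * (\<kappa> * x) \<le> x * (C * y)\<close> assms(3) by simp
    then show ?thesis using assms(1) by (simp add: field_simps)
  qed (use assms in simp)
  have "\<kappa> * d \<le> C * (y * x)" 
  proof -
    have "0 \<le> \<kappa> * x\<^sup>2" using assms(1) by simp
    then show ?thesis using e unfolding distrib_left by linarith
  qed
  then have "d \<le> (C / \<kappa> * y) * x" using assms(1) by (simp add: field_simps)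
  also have "\<dots> \<le> (C / \<kappa> * y) * (C / \<kappa> * y)" using x assms by (intro mult_left_mono) auto
  finally show "d \<le> (C / \<kappa> * y)\<^sup>2" by (simp add: power2_eq_square)
qed

context
  fixes \<gamma> r :: real and \<xi> :: "real^3" and l :: complex
  assumes r: "0 < r" "r \<le> 1" "r \<le> (norm \<xi>)\<^sup>2" and \<gamma>: "\<gamma> \<ge> 1" and l: "Re l \<ge> - gap \<gamma> r"
begin

definition inverse_const :: real where "inverse_const = form_const \<gamma> \<xi> / (r\<^sup>2 / 576)"

lemma form_const_nonneg: "form_const \<gamma> \<xi> \<ge> 0" using \<gamma> by (simp add: form_const_def)

lemma inverse_const_nonneg: "inverse_const \<ge> 0" using form_const_nonneg by (simp add: inverse_const_def)

lemma truncated_bound: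
  assumes R: "residual \<gamma> \<xi> l N c \<rho> u g s w" and N: "N \<ge> 2" and z: "\<And>\<alpha>. deg \<alpha> > N \<Longrightarrow> c \<alpha> = 0"
  shows "sqrt (total_mass N c \<rho> u) \<le> inverse_const * sqrt (total_mass N g s w)" "weighted_mass N c \<le> (inverse_const * sqrt (total_mass N g s w))\<^sup>2"
proof -
  have e: "r\<^sup>2 / 576 * (weighted_mass N c + (sqrt (total_mass N c \<rho> u))\<^sup>2) \<le> form_const \<gamma> \<xi> * (sqrt (total_mass N g s w) * sqrt (total_mass N c \<rho> u))"
    using hypocoercive_estimate[OF R N r \<gamma> l] raising_form_deg_eq_zero[of N c, OF z] by (simp add: total_mass_nonneg)
  have "r\<^sup>2 / 576 > 0" using r by simp
  note q = quadratic_absorb[OF this weighted_mass_nonneg real_sqrt_ge_zero[OF total_mass_nonneg] form_const_nonneg real_sqrt_ge_zero[OF total_mass_nonneg] e]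
  show "sqrt (total_mass N c \<rho> u) \<le> inverse_const * sqrt (total_mass N g s w)" "weighted_mass N c \<le> (inverse_const * sqrt (total_mass N g s w))\<^sup>2"
    unfolding inverse_const_def by (rule q)+
qed

text \<open>The truncated system is a linear endomorphism of a finite-dimensional space.  A truncated state has
an empty shell of degree \<open>N + 1\<close>, so the estimate applies without boundary term.\<close>

lemma Galerkin_solution:
  assumes N: "N \<ge> 2"
  shows "\<exists>c \<rho> u. (\<forall>\<alpha>. deg \<alpha> > N \<longrightarrow> c \<alpha> = 0) \<and> residual \<gamma> \<xi> l N c \<rho> u g s w"
proof -
  define T :: "L2 \<times> complex \<times> (complex^3) \<Rightarrow> L2 \<times> complex \<times> (complex^3)" where
    "T = (\<lambda>(f, \<rho>, u). (hermite_sum (\<lambda>\<alpha>. l * coef_L2 f \<alpha> - kinetic_coef \<xi> (coef_L2 f) \<rho> u \<alpha>) (deg_le N),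
       l * \<rho> + \<i> * rc_dot \<xi> u, l *\<^sub>C u - velocity_part \<gamma> \<xi> (coef_L2 f 0) (first_shell (coef_L2 f)) \<rho> u))"
  define V :: "(L2 \<times> complex \<times> (complex^3)) set" where "V = {x. \<forall>\<alpha>. \<alpha> \<notin> deg_le N \<longrightarrow> coef_L2 (fst x) \<alpha> = 0}"
  define S :: "(L2 \<times> complex \<times> (complex^3)) set" where
    "S = (\<lambda>f. (f, 0)) ` (hermite_vec ` deg_le N \<union> (\<lambda>\<alpha>. \<i> *\<^sub>C hermite_vec \<alpha>) ` deg_le N) \<union> (\<lambda>p. (0, p)) ` Basis"
  have cfa: "coef_L2 (f + f') = (\<lambda>\<alpha>. coef_L2 f \<alpha> + coef_L2 f' \<alpha>)" for f f' by (rule ext) (rule coef_L2_add)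
  have cfs: "coef_L2 (t *\<^sub>R f) = (\<lambda>\<alpha>. complex_of_real t * coef_L2 f \<alpha>)" for t f by (rule ext) (rule coef_L2_scaleR)
  have lin: "linear T"
  proof (rule linearI)
    fix x y :: "L2 \<times> complex \<times> (complex^3)"
    obtain f \<rho> u f' \<rho>' u' where x: "x = (f, \<rho>, u)" and y: "y = (f', \<rho>', u')" by (metis surj_pair)
    show "T (x + y) = T x + T y"
      unfolding x y T_def
      by (simp add: cfa kinetic_coef_add first_shell_add velocity_part_add rc_dot_add scaleC_add_right hermite_sum_add[symmetric]) (simp add: algebra_simps)
  next
    fix t :: real and x :: "L2 \<times> complex \<times> (complex^3)"
    obtain f \<rho> u where x: "x = (f, \<rho>, u)" by (metis surj_pair)
    have tx: "t *\<^sub>R x = (t *\<^sub>R f, complex_of_real t * \<rho>, complex_of_real t *\<^sub>C u)"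
      by (simp add: x scaleC_of_real scaleR_conv_of_real)
    have "T (t *\<^sub>R x) = (hermite_sum (\<lambda>\<alpha>. complex_of_real t * (l * coef_L2 f \<alpha> - kinetic_coef \<xi> (coef_L2 f) \<rho> u \<alpha>)) (deg_le N),
       complex_of_real t * (l * \<rho> + \<i> * rc_dot \<xi> u), complex_of_real t *\<^sub>C (l *\<^sub>C u - velocity_part \<gamma> \<xi> (coef_L2 f 0) (first_shell (coef_L2 f)) \<rho> u))"
      unfolding tx T_def prod.case cfs kinetic_coef_scale first_shell_scale velocity_part_scale rc_dot_scale scaleC_commute[of l "complex_of_real t"]
      by (simp add: scaleC_minus_right right_diff_distrib distrib_left mult.left_commute)
    also have "\<dots> = t *\<^sub>R T x"
      unfolding x T_def hermite_sum_scale scaleC_of_real by (simp add: scaleR_conv_of_real)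
    finally show "T (t *\<^sub>R x) = t *\<^sub>R T x" .
  qed
  have finS: "finite S" by (simp add: S_def)
  have subV: "subspace V" by (auto simp: subspace_def V_def coef_L2_zero coef_L2_add coef_L2_scaleR)
  have SV: "S \<subseteq> V" by (auto simp: S_def V_def coef_L2_zero coef_L2_hermite_vec coef_L2_scaleC of_bool_def)
  have VS: "V \<subseteq> span S"
  proof
    fix x assume x: "x \<in> V"
    obtain f p where fp: "x = (f, p)" by (cases x)
    have "f = hermite_sum (coef_L2 f) (deg_le N)"
      by (rule coef_L2_eqI) (use x in \<open>auto simp: coef_L2_hermite_sum V_def fp\<close>)
    then have "f \<in> span (hermite_vec ` deg_le N \<union> (\<lambda>\<alpha>. \<i> *\<^sub>C hermite_vec \<alpha>) ` deg_le N)" using hermite_sum_in_span by metis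
    then have "(f, 0::complex \<times> (complex^3)) \<in> (\<lambda>f. (f, 0)) ` span (hermite_vec ` deg_le N \<union> (\<lambda>\<alpha>. \<i> *\<^sub>C hermite_vec \<alpha>) ` deg_le N)" by blast
    also have "\<dots> = span ((\<lambda>f. (f, 0)) ` (hermite_vec ` deg_le N \<union> (\<lambda>\<alpha>. \<i> *\<^sub>C hermite_vec \<alpha>) ` deg_le N))"
      by (rule linear_span_image[symmetric]) (auto intro!: linearI)
    also have "\<dots> \<subseteq> span S" unfolding S_def by (rule span_mono) auto
    finally have 1: "(f, 0) \<in> span S" .
    have "p \<in> span Basis" by simp
    then have "(0::L2, p) \<in> (\<lambda>p. (0, p)) ` span Basis" by blast
    also have "\<dots> = span ((\<lambda>p. (0::L2, p)) ` Basis)"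
      by (rule linear_span_image[symmetric]) (auto intro!: linearI)
    also have "\<dots> \<subseteq> span S" unfolding S_def by (rule span_mono) auto
    finally have 2: "(0, p) \<in> span S" .
    have "x = (f, 0) + (0, p)" by (simp add: fp)
    then show "x \<in> span S" using span_add[OF 1 2] by simp
  qed
  have sp: "span S = V" using span_minimal[OF SV subV] VS by blast
  have TV: "T ` V \<subseteq> V" by (auto simp: T_def V_def coef_L2_hermite_sum split: prod.splits)
  (* Truncated states have no boundary term, so the estimate gives injectivity. *)
  have zero: "x = 0" if x: "x \<in> V" "T x = 0" for x
  proof -
    obtain f \<rho> u where fp: "x = (f, \<rho>, u)" by (metis surj_pair)
    have z: "coef_L2 f \<alpha> = 0" if "deg \<alpha> > N" for \<alpha> using x(1) that by (simp add: V_def fp deg_le_def)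
    have T0: "hermite_sum (\<lambda>\<alpha>. l * coef_L2 f \<alpha> - kinetic_coef \<xi> (coef_L2 f) \<rho> u \<alpha>) (deg_le N) = 0"
      "l * \<rho> + \<i> * rc_dot \<xi> u = 0" "l *\<^sub>C u - velocity_part \<gamma> \<xi> (coef_L2 f 0) (first_shell (coef_L2 f)) \<rho> u = 0"
      using x(2) by (simp_all add: T_def fp zero_prod_def)
    have "l * coef_L2 f \<alpha> - kinetic_coef \<xi> (coef_L2 f) \<rho> u \<alpha> = 0" if "\<alpha> \<in> deg_le N" for \<alpha>
      using arg_cong[OF T0(1), of "\<lambda>f. coef_L2 f \<alpha>"] that by (simp add: coef_L2_hermite_sum coef_L2_zero)
    then have "residual \<gamma> \<xi> l N (coef_L2 f) \<rho> u (\<lambda>_. 0) 0 0" using T0 by (simp add: residual_def)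
    from truncated_bound(1)[OF this N z] have "total_mass N (coef_L2 f) \<rho> u \<le> 0" by (simp add: total_mass_def mass_def)
    then have s0: "mass N (coef_L2 f) = 0" "(cmod \<rho>)\<^sup>2 = 0" "(norm u)\<^sup>2 = 0"
      unfolding total_mass_def using mass_nonneg[of N "coef_L2 f"] zero_le_power2[of "cmod \<rho>"] zero_le_power2[of "norm u"] by linarith+
    have "coef_L2 f \<alpha> = 0" for \<alpha>
    proof (cases "\<alpha> \<in> deg_le N")
      case True
      then show ?thesis using s0(1) by (simp add: mass_def sum_nonneg_eq_0_iff)
    next
      case False
      then show ?thesis using x(1) by (simp add: V_def fp)
    qed
    then have "f = 0" by (intro coef_L2_eqI) (simp add: coef_L2_zero)
    then show "x = 0" using s0 by (simp add: fp zero_prod_def)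
  qed
  have inj: "inj_on T V"
  proof (rule inj_onI)
    fix x y assume xy: "x \<in> V" "y \<in> V" "T x = T y"
    have "x - y = 0"
      by (rule zero) (use xy subspace_diff[OF subV] linear_diff[OF lin] in auto)
    then show "x = y" by simp
  qed
  have "(hermite_sum g (deg_le N), s, w) \<in> V" by (simp add: V_def coef_L2_hermite_sum)
  then have "(hermite_sum g (deg_le N), s, w) \<in> T ` V"
    using injective_endomorphism_of_span_onto[OF lin finS] TV inj unfolding sp by blast
  then obtain x where x: "x \<in> V" "T x = (hermite_sum g (deg_le N), s, w)" by auto
  obtain f \<rho> u where fp: "x = (f, \<rho>, u)" by (metis surj_pair)
  have T0: "hermite_sum (\<lambda>\<alpha>. l * coef_L2 f \<alpha> - kinetic_coef \<xi> (coef_L2 f) \<rho> u \<alpha>) (deg_le N) = hermite_sum g (deg_le N)"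
      "l * \<rho> + \<i> * rc_dot \<xi> u = s" "l *\<^sub>C u - velocity_part \<gamma> \<xi> (coef_L2 f 0) (first_shell (coef_L2 f)) \<rho> u = w"
    using x(2) by (simp_all add: T_def fp)
  have "g \<alpha> = l * coef_L2 f \<alpha> - kinetic_coef \<xi> (coef_L2 f) \<rho> u \<alpha>" if "\<alpha> \<in> deg_le N" for \<alpha>
    using arg_cong[OF T0(1), of "\<lambda>f. coef_L2 f \<alpha>"] that by (simp add: coef_L2_hermite_sum)
  then have "residual \<gamma> \<xi> l N (coef_L2 f) \<rho> u g s w" using T0(2,3) by (simp add: residual_def)
  moreover have "\<forall>\<alpha>. deg \<alpha> > N \<longrightarrow> coef_L2 f \<alpha> = 0" using x(1) by (simp add: V_def fp deg_le_def)
  ultimately show ?thesis by blast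
qed

text \<open>The truncated estimates converge to the full one, except for the boundary terms, which are frequently
small.\<close>

lemma resolvent_bound:
  assumes R: "\<And>N. residual \<gamma> \<xi> l N (coef_L2 f) \<rho> u (coef_L2 g) s w"
  shows "sqrt ((norm f)\<^sup>2 + (cmod \<rho>)\<^sup>2 + (norm u)\<^sup>2) \<le> inverse_const * sqrt ((norm g)\<^sup>2 + (cmod s)\<^sup>2 + (norm w)\<^sup>2)"
proof -
  define x where "x = sqrt ((norm f)\<^sup>2 + (cmod \<rho>)\<^sup>2 + (norm u)\<^sup>2)"
  define y where "y = sqrt ((norm g)\<^sup>2 + (cmod s)\<^sup>2 + (norm w)\<^sup>2)"
  have X: "(\<lambda>N. total_mass N (coef_L2 h) z v) \<longlonglongrightarrow> (norm h)\<^sup>2 + (cmod z)\<^sup>2 + (norm v)\<^sup>2" for h z and v :: "complex^3"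
    unfolding total_mass_def mass_def by (intro tendsto_intros Parseval_norm)
  define t where "t N = max 0 (r\<^sup>2 / 576 * total_mass N (coef_L2 f) \<rho> u - form_const \<gamma> \<xi> * (sqrt (total_mass N (coef_L2 g) s w) * sqrt (total_mass N (coef_L2 f) \<rho> u)))" for N
  have "(\<lambda>N. t (N + 2)) \<longlonglongrightarrow> max 0 (r\<^sup>2 / 576 * x\<^sup>2 - form_const \<gamma> \<xi> * (y * x))"
  proof -
    have xx: "x\<^sup>2 = (norm f)\<^sup>2 + (cmod \<rho>)\<^sup>2 + (norm u)\<^sup>2" by (simp add: x_def)
    have "t \<longlonglongrightarrow> max 0 (r\<^sup>2 / 576 * x\<^sup>2 - form_const \<gamma> \<xi> * (y * x))"
      unfolding t_def xx unfolding x_def y_def by (intro tendsto_intros X)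
    then show ?thesis by (rule LIMSEQ_ignore_initial_segment)
  qed
  moreover have s1: "summable (shell_sq (coef_L2 f))" by (rule summable_shell_sq[OF Bessel]) simp
  have "max 0 (r\<^sup>2 / 576 * x\<^sup>2 - form_const \<gamma> \<xi> * (y * x)) = 0"
  proof -
    (* The estimate starts at degree 2, because the first moments are coupled to the second ones. *)
    define tt where "tt N = (if N < 2 then 0 else t N)" for N
    have "tt \<longlonglongrightarrow> max 0 (r\<^sup>2 / 576 * x\<^sup>2 - form_const \<gamma> \<xi> * (y * x))"
      by (rule LIMSEQ_offset[of _ 2]) (use calculation in \<open>simp add: tt_def\<close>)
    then show ?thesis
    proof (rule boundary_limit_zero[OF _ s1 s1, where C="3 * norm \<xi>"])
      fix N
      show "norm (tt N) \<le> 3 * norm \<xi> * (sqrt (real N + 1) * (shell_sq (coef_L2 f) (N + 1) + shell_sq (coef_L2 f) N + shell_sq (coef_L2 f) (N + 1) + shell_sq (coef_L2 f) N))"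
      proof (cases "N < 2")
        case True
        then show ?thesis by (simp add: tt_def shell_sq_nonneg)
      next
        case False
        then have N: "N \<ge> 2" by simp
        have "r\<^sup>2 / 576 * total_mass N (coef_L2 f) \<rho> u \<le> r\<^sup>2 / 576 * (weighted_mass N (coef_L2 f) + total_mass N (coef_L2 f) \<rho> u)"
          using weighted_mass_nonneg by (intro mult_left_mono) auto
        then have "r\<^sup>2 / 576 * total_mass N (coef_L2 f) \<rho> u - form_const \<gamma> \<xi> * (sqrt (total_mass N (coef_L2 g) s w) * sqrt (total_mass N (coef_L2 f) \<rho> u))
            \<le> cmod (raising_form \<xi> (coef_L2 f) (\<lambda>\<alpha>. cnj (coef_L2 f \<alpha>)) (deg_eq N))"
          using hypocoercive_estimate[OF R N r \<gamma> l] by linarith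
        then have "norm (t N) \<le> cmod (raising_form \<xi> (coef_L2 f) (\<lambda>\<alpha>. cnj (coef_L2 f \<alpha>)) (deg_eq N))"
          by (simp add: t_def)
        also have "\<dots> \<le> 3 * norm \<xi> * (sqrt (real N + 1) * (shell_sq (coef_L2 f) (N + 1) + shell_sq (\<lambda>\<alpha>. cnj (coef_L2 f \<alpha>)) N))"
          by (rule raising_form_deg_eq_bound)
        also have "shell_sq (\<lambda>\<alpha>. cnj (coef_L2 f \<alpha>)) N = shell_sq (coef_L2 f) N" by (simp add: shell_sq_def)
        also have "3 * norm \<xi> * (sqrt (real N + 1) * (shell_sq (coef_L2 f) (N + 1) + shell_sq (coef_L2 f) N))
           \<le> 3 * norm \<xi> * (sqrt (real N + 1) * (shell_sq (coef_L2 f) (N + 1) + shell_sq (coef_L2 f) N + shell_sq (coef_L2 f) (N + 1) + shell_sq (coef_L2 f) N))"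
          using shell_sq_nonneg[of "coef_L2 f"] by (intro mult_left_mono) auto
        finally show ?thesis using False by (simp add: tt_def)
      qed
    qed
  qed
  then have "r\<^sup>2 / 576 * (0 + x\<^sup>2) \<le> form_const \<gamma> \<xi> * (y * x)" by (simp add: max_def split: if_splits)
  then have "x \<le> inverse_const * y"
    unfolding inverse_const_def using r form_const_nonneg by (intro quadratic_absorb[of "r\<^sup>2 / 576" 0]) (auto simp: x_def y_def)
  then show ?thesis by (simp add: x_def y_def)
qed

end

section \<open>Convergence of the Galerkin solutions\<close>

lemma convergent_of_tail_bound:
  fixes z :: "nat \<Rightarrow> 'a::complete_space"
  assumes b: "\<And>N M. N0 \<le> N \<Longrightarrow> N \<le> M \<Longrightarrow> dist (z M) (z N) \<le> \<delta> N" and d: "\<delta> \<longlonglongrightarrow> 0"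
  shows "convergent z"
proof -
  have "Cauchy z"
    unfolding Cauchy_altdef
  proof (intro allI impI)
    fix e :: real assume e: "e > 0"
    have "\<forall>\<^sub>F N in sequentially. \<delta> N < e" using d e by (rule order_tendstoD)
    then obtain N1 where N1: "\<And>N. N \<ge> N1 \<Longrightarrow> \<delta> N < e" by (auto simp: eventually_sequentially)
    show "\<exists>M. \<forall>m\<ge>M. \<forall>n>m. dist (z m) (z n) < e"
    proof (intro exI allI impI)
      fix m n assume mn: "max N0 N1 \<le> m" "m < n"
      have "dist (z n) (z m) \<le> \<delta> m" using mn by (intro b) auto
      also have "\<delta> m < e" using mn by (intro N1) auto
      finally show "dist (z m) (z n) < e" by (simp add: dist_commute)
    qed
  qed
  then show ?thesis by (rule Cauchy_convergent)
qed

lemma sqrt_over_n_tendsto_0: "(\<lambda>N. sqrt (real N + 1) / real N) \<longlonglongrightarrow> 0"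
proof -
  have "(\<lambda>N. sqrt (1 / real N + 1 / real N * (1 / real N))) \<longlonglongrightarrow> sqrt (0 + 0 * 0)"
    by (intro tendsto_intros lim_1_over_n)
  moreover have eq: "sqrt (1 / real N + 1 / real N * (1 / real N)) = sqrt (real N + 1) / real N" if "N > 0" for N
  proof -
    have "1 / real N + 1 / real N * (1 / real N) = (real N + 1) / (real N)\<^sup>2"
      using that by (simp add: power2_eq_square add_divide_distrib)
    then show ?thesis by (simp add: real_sqrt_divide)
  qed
  have "\<forall>\<^sub>F N in sequentially. sqrt (1 / real N + 1 / real N * (1 / real N)) = sqrt (real N + 1) / real N"
    by (rule eventually_mono[OF eventually_gt_at_top[of 0]]) (rule eq)
  ultimately show ?thesis using Lim_transform_eventually by force
qed

lemma tendsto_jacobi: "(\<And>\<alpha>. (\<lambda>n. C n \<alpha>) \<longlonglongrightarrow> c \<alpha>) \<Longrightarrow> (\<lambda>n. jacobi \<xi> (C n) \<alpha>) \<longlonglongrightarrow> jacobi \<xi> c \<alpha>"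
  unfolding jacobi_def by (intro tendsto_intros)

lemma tendsto_field_coef:
  assumes "A \<longlonglongrightarrow> a" "P \<longlonglongrightarrow> \<rho>" "U \<longlonglongrightarrow> u"
  shows "(\<lambda>n. field_coef \<xi> (A n) (P n) (U n) \<alpha>) \<longlonglongrightarrow> field_coef \<xi> a \<rho> u \<alpha>"
  unfolding field_coef_def
proof (rule tendsto_sum)
  fix j
  show "(\<lambda>n. if \<alpha> = unit j then - \<i> * complex_of_real (\<xi> $ j / (norm \<xi>)\<^sup>2) * (A n - P n) + U n $ j else 0)
    \<longlonglongrightarrow> (if \<alpha> = unit j then - \<i> * complex_of_real (\<xi> $ j / (norm \<xi>)\<^sup>2) * (a - \<rho>) + u $ j else 0)"
    by (cases "\<alpha> = unit j") (simp_all only: if_True if_False refl, intro tendsto_intros assms, simp)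
qed

lemma tendsto_kinetic_coef:
  assumes "\<And>\<alpha>. (\<lambda>n. C n \<alpha>) \<longlonglongrightarrow> c \<alpha>" "P \<longlonglongrightarrow> \<rho>" "U \<longlonglongrightarrow> u"
  shows "(\<lambda>n. kinetic_coef \<xi> (C n) (P n) (U n) \<alpha>) \<longlonglongrightarrow> kinetic_coef \<xi> c \<rho> u \<alpha>"
  unfolding kinetic_coef_def by (intro tendsto_intros tendsto_jacobi tendsto_field_coef assms)

lemma tendsto_rc_dot: "U \<longlonglongrightarrow> u \<Longrightarrow> (\<lambda>n. rc_dot \<xi> (U n)) \<longlonglongrightarrow> rc_dot \<xi> u"
  unfolding rc_dot_def by (intro tendsto_intros)

context
  fixes \<gamma> r :: real and \<xi> :: "real^3" and l :: complex
  assumes r: "0 < r" "r \<le> 1" "r \<le> (norm \<xi>)\<^sup>2" and \<gamma>: "\<gamma> \<ge> 1" and l: "Re l \<ge> - gap \<gamma> r"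
begin

text \<open>The difference of two Galerkin solutions solves the homogeneous equations up to the smaller degree, so
the estimate bounds it by its boundary term.  The bound on the weighted masses makes that term tend
to zero.  The coefficients converge, and the equations, each of which involves finitely many
coefficients, pass to the limit.\<close>

lemma resolvent_solution:
  "\<exists>f \<rho> u. \<forall>N. residual \<gamma> \<xi> l N (coef_L2 f) \<rho> u (coef_L2 g) s w"
proof -
  have "\<forall>N. \<exists>c \<rho> u. N \<ge> 2 \<longrightarrow> (\<forall>\<alpha>. deg \<alpha> > N \<longrightarrow> c \<alpha> = 0) \<and> residual \<gamma> \<xi> l N c \<rho> u (coef_L2 g) s w"
    using Galerkin_solution[OF r \<gamma> l] by blast
  then obtain C P U where z: "\<And>N \<alpha>. N \<ge> 2 \<Longrightarrow> deg \<alpha> > N \<Longrightarrow> C N \<alpha> = 0"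
    and R: "\<And>N. N \<ge> 2 \<Longrightarrow> residual \<gamma> \<xi> l N (C N) (P N) (U N) (coef_L2 g) s w" by metis
  define K where "K = (inverse_const \<gamma> r \<xi> * sqrt ((norm g)\<^sup>2 + (cmod s)\<^sup>2 + (norm w)\<^sup>2))\<^sup>2"
  have K0: "K \<ge> 0" by (simp add: K_def)
  have xg: "total_mass N (coef_L2 g) s w \<le> (norm g)\<^sup>2 + (cmod s)\<^sup>2 + (norm w)\<^sup>2" for N
    using Bessel[of "deg_le N" g] by (simp add: total_mass_def mass_def)
  have bX: "total_mass N (C N) (P N) (U N) \<le> K" and bD: "weighted_mass N (C N) \<le> K" if N: "N \<ge> 2" for N
  proof -
    note tb = truncated_bound[OF r \<gamma> l R[OF N] N z[OF N]]
    have le: "inverse_const \<gamma> r \<xi> * sqrt (total_mass N (coef_L2 g) s w) \<le> inverse_const \<gamma> r \<xi> * sqrt ((norm g)\<^sup>2 + (cmod s)\<^sup>2 + (norm w)\<^sup>2)"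
      using inverse_const_nonneg[OF r \<gamma> l] xg by (intro mult_left_mono) auto
    have "(sqrt (total_mass N (C N) (P N) (U N)))\<^sup>2 \<le> K"
      unfolding K_def by (rule power_mono[OF order_trans[OF tb(1) le] real_sqrt_ge_zero[OF total_mass_nonneg]])
    then show "total_mass N (C N) (P N) (U N) \<le> K" by (simp add: total_mass_nonneg)
    have "(inverse_const \<gamma> r \<xi> * sqrt (total_mass N (coef_L2 g) s w))\<^sup>2 \<le> K"
      unfolding K_def using inverse_const_nonneg[OF r \<gamma> l] by (intro power_mono le mult_nonneg_nonneg) (simp_all add: total_mass_nonneg)
    then show "weighted_mass N (C N) \<le> K" using tb(2) by linarith
  qed
  have lev: "shell_sq (C M) n \<le> K / real N" if "N \<ge> 2" "N \<le> n" "2 \<le> M" for M N n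
  proof (cases "n \<le> M")
    case True
    have "real N * shell_sq (C M) n \<le> real n * shell_sq (C M) n"
      using that shell_sq_nonneg by (intro mult_right_mono) auto
    also have "\<dots> \<le> weighted_mass M (C M)"
      unfolding weighted_mass_eq by (rule member_le_sum) (use True shell_sq_nonneg in auto)
    also have "\<dots> \<le> K" using bD that by simp
    finally show ?thesis using that by (simp add: field_simps)
  next
    case False
    then have "shell_sq (C M) n = 0" unfolding shell_sq_def using z[OF that(3)]
      by (intro sum.neutral ballI) (simp add: deg_eq_def)
    then show ?thesis using K0 by simp
  qed
  (* The bound on the degree-weighted masses makes each shell of degree at least N of size K/N, so
     the boundary term, of size sqrt N times a shell, is O(1/sqrt N). *)
  define D where "D N = (3 * norm \<xi> * (8 * K)) / (r\<^sup>2 / 576) * (sqrt (real N + 1) / real N)" for N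
  have diff: "total_mass N (\<lambda>\<alpha>. C M \<alpha> - C N \<alpha>) (P M - P N) (U M - U N) \<le> D N" if N: "2 \<le> N" "N \<le> M" for N M
  proof -
    define d where "d \<alpha> = C M \<alpha> - C N \<alpha>" for \<alpha>
    have M: "M \<ge> 2" using N by simp
    (* Up to degree N both Galerkin solutions satisfy the equations with the same right side. *)
    have "residual \<gamma> \<xi> l N d (P M - P N) (U M - U N) (\<lambda>_. 0) 0 0"
      using residual_diff[OF residual_mono[OF R[OF M] N(2)] R[OF N(1)]] by (simp add: d_def[abs_def])
    from hypocoercive_estimate[OF this N(1) r \<gamma> l]
    have e: "r\<^sup>2 / 576 * (weighted_mass N d + total_mass N d (P M - P N) (U M - U N)) \<le> cmod (raising_form \<xi> d (\<lambda>\<alpha>. cnj (d \<alpha>)) (deg_eq N))"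
      by (simp add: total_mass_def[of _ "\<lambda>_. 0"] mass_def)
    have ld: "shell_sq d n \<le> 4 * (K / real N)" if n: "N \<le> n" for n
    proof -
      have "shell_sq d n \<le> (\<Sum>\<alpha>\<in>deg_eq n. 2 * (cmod (C M \<alpha>))\<^sup>2 + 2 * (cmod (C N \<alpha>))\<^sup>2)"
        unfolding shell_sq_def
      proof (rule sum_mono)
        fix \<alpha>
        have "(cmod (d \<alpha>))\<^sup>2 \<le> (cmod (C M \<alpha>) + cmod (C N \<alpha>))\<^sup>2"
          unfolding d_def by (intro power_mono norm_triangle_ineq4) auto
        then show "(cmod (d \<alpha>))\<^sup>2 \<le> 2 * (cmod (C M \<alpha>))\<^sup>2 + 2 * (cmod (C N \<alpha>))\<^sup>2"
          using sum_squares_bound[of "cmod (C M \<alpha>)" "cmod (C N \<alpha>)"] by (simp add: power2_sum)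
      qed
      also have "\<dots> = 2 * shell_sq (C M) n + 2 * shell_sq (C N) n"
        by (simp add: sum.distrib sum_distrib_left shell_sq_def)
      finally show ?thesis using lev[OF N(1) n M] lev[OF N(1) n N(1)] by linarith
    qed
    have "cmod (raising_form \<xi> d (\<lambda>\<alpha>. cnj (d \<alpha>)) (deg_eq N)) \<le> 3 * norm \<xi> * (sqrt (real N + 1) * (shell_sq d (N + 1) + shell_sq (\<lambda>\<alpha>. cnj (d \<alpha>)) N))"
      by (rule raising_form_deg_eq_bound)
    also have "shell_sq (\<lambda>\<alpha>. cnj (d \<alpha>)) N = shell_sq d N" by (simp add: shell_sq_def)
    also have "3 * norm \<xi> * (sqrt (real N + 1) * (shell_sq d (N + 1) + shell_sq d N)) \<le> 3 * norm \<xi> * (sqrt (real N + 1) * (4 * (K / real N) + 4 * (K / real N)))"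
      by (intro mult_left_mono add_mono ld) auto
    also have "\<dots> = (3 * norm \<xi> * (8 * K)) * (sqrt (real N + 1) / real N)" by simp
    finally have e2: "r\<^sup>2 / 576 * (weighted_mass N d + total_mass N d (P M - P N) (U M - U N)) \<le> (3 * norm \<xi> * (8 * K)) * (sqrt (real N + 1) / real N)"
      using e by linarith
    have p: "r\<^sup>2 / 576 > 0" using r by simp
    have "r\<^sup>2 / 576 * total_mass N d (P M - P N) (U M - U N) \<le> r\<^sup>2 / 576 * (weighted_mass N d + total_mass N d (P M - P N) (U M - U N))"
      using weighted_mass_nonneg[of N d] by (intro mult_left_mono) auto
    with e2 have "r\<^sup>2 / 576 * total_mass N d (P M - P N) (U M - U N) \<le> (3 * norm \<xi> * (8 * K)) * (sqrt (real N + 1) / real N)" by linarith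
    then have "total_mass N d (P M - P N) (U M - U N) \<le> (3 * norm \<xi> * (8 * K)) * (sqrt (real N + 1) / real N) / (r\<^sup>2 / 576)"
      using p by (subst pos_le_divide_eq) (simp_all add: mult.commute)
    also have "\<dots> = D N" unfolding D_def by (rule times_divide_eq_left[symmetric])
    finally show ?thesis by (simp only: d_def[abs_def])
  qed
  have "D \<longlonglongrightarrow> (3 * norm \<xi> * (8 * K)) / (r\<^sup>2 / 576) * 0"
    unfolding D_def by (intro tendsto_intros sqrt_over_n_tendsto_0)
  then have "(\<lambda>N. sqrt (D N)) \<longlonglongrightarrow> sqrt 0" by (intro tendsto_real_sqrt) simp
  then have D0: "(\<lambda>N. sqrt (D N)) \<longlonglongrightarrow> 0" by simp
  have le: "cmod (C M \<alpha> - C N \<alpha>) \<le> sqrt (D N)" if "2 \<le> N" "N \<le> M" "deg \<alpha> \<le> N" for N M \<alpha>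
  proof (rule real_le_rsqrt)
    have "(cmod (C M \<alpha> - C N \<alpha>))\<^sup>2 \<le> mass N (\<lambda>\<alpha>. C M \<alpha> - C N \<alpha>)"
      unfolding mass_def by (rule member_le_sum[where f="\<lambda>\<alpha>. (cmod (C M \<alpha> - C N \<alpha>))\<^sup>2"]) (use that in \<open>auto simp: deg_le_def[THEN eqset_imp_iff]\<close>)
    also have "\<dots> \<le> D N" using diff[OF that(1,2)] unfolding total_mass_def
      using zero_le_power2[of "cmod (P M - P N)"] zero_le_power2[of "norm (U M - U N)"] by linarith
    finally show "(cmod (C M \<alpha> - C N \<alpha>))\<^sup>2 \<le> D N" .
  qed
  have leP: "cmod (P M - P N) \<le> sqrt (D N)" and leU: "norm (U M - U N) \<le> sqrt (D N)" if "2 \<le> N" "N \<le> M" for N M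
    using diff[OF that] mass_nonneg[of N "\<lambda>\<alpha>. C M \<alpha> - C N \<alpha>"] zero_le_power2[of "cmod (P M - P N)"] zero_le_power2[of "norm (U M - U N)"]
    unfolding total_mass_def by (intro real_le_rsqrt; linarith)+
  have "convergent (\<lambda>N. C N \<alpha>)" for \<alpha>
    by (rule convergent_of_tail_bound[OF _ D0, of "max 2 (deg \<alpha>)"]) (auto simp: dist_norm intro!: le)
  then obtain c where c: "\<And>\<alpha>. (\<lambda>N. C N \<alpha>) \<longlonglongrightarrow> c \<alpha>" unfolding convergent_def by metis
  have "convergent P" by (rule convergent_of_tail_bound[OF _ D0, of 2]) (auto simp: dist_norm intro!: leP)
  then obtain \<rho> where \<rho>: "P \<longlonglongrightarrow> \<rho>" unfolding convergent_def by metis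
  have "convergent U" by (rule convergent_of_tail_bound[OF _ D0, of 2]) (auto simp: dist_norm intro!: leU)
  then obtain u where u: "U \<longlonglongrightarrow> u" unfolding convergent_def by metis
  have "(\<Sum>\<alpha>\<in>deg_le N. (cmod (c \<alpha>))\<^sup>2) \<le> K" for N
  proof (rule LIMSEQ_le_const2)
    show "(\<lambda>M. \<Sum>\<alpha>\<in>deg_le N. (cmod (C M \<alpha>))\<^sup>2) \<longlonglongrightarrow> (\<Sum>\<alpha>\<in>deg_le N. (cmod (c \<alpha>))\<^sup>2)"
      by (intro tendsto_intros c)
    have "(\<Sum>\<alpha>\<in>deg_le N. (cmod (C M \<alpha>))\<^sup>2) \<le> K" if "M \<ge> max 2 N" for M
    proof -
      have "(\<Sum>\<alpha>\<in>deg_le N. (cmod (C M \<alpha>))\<^sup>2) \<le> mass M (C M)"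
        unfolding mass_def using that by (intro sum_mono2 deg_le_mono) auto
      also have "\<dots> \<le> K" using bX[of M] that unfolding total_mass_def
        using zero_le_power2[of "cmod (P M)"] zero_le_power2[of "norm (U M)"] by linarith
      finally show ?thesis .
    qed
    then show "\<exists>M0. \<forall>M\<ge>M0. (\<Sum>\<alpha>\<in>deg_le N. (cmod (C M \<alpha>))\<^sup>2) \<le> K" by blast
  qed
  then obtain f where f: "coef_L2 f = c" using Riesz_Fischer[of c K] by blast
  have "residual \<gamma> \<xi> l N c \<rho> u (coef_L2 g) s w" for N
    unfolding residual_def
  proof (intro conjI ballI)
    fix \<alpha> assume a: "\<alpha> \<in> deg_le N"
    have "(\<lambda>M. l * C M \<alpha> - kinetic_coef \<xi> (C M) (P M) (U M) \<alpha>) \<longlonglongrightarrow> l * c \<alpha> - kinetic_coef \<xi> c \<rho> u \<alpha>"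
      by (intro tendsto_intros tendsto_kinetic_coef c \<rho> u)
    moreover have "\<forall>\<^sub>F M in sequentially. l * C M \<alpha> - kinetic_coef \<xi> (C M) (P M) (U M) \<alpha> = coef_L2 g \<alpha>"
      using eventually_ge_at_top[of "max 2 N"]
    proof eventually_elim
      case (elim M)
      then show ?case using R[of M] a deg_le_mono[of N M] by (auto simp: residual_def)
    qed
    then have "(\<lambda>M. l * C M \<alpha> - kinetic_coef \<xi> (C M) (P M) (U M) \<alpha>) \<longlonglongrightarrow> coef_L2 g \<alpha>" by (rule tendsto_eventually)
    ultimately show "coef_L2 g \<alpha> = l * c \<alpha> - kinetic_coef \<xi> c \<rho> u \<alpha>" using LIMSEQ_unique by blast
  next
    have "(\<lambda>M. l * P M + \<i> * rc_dot \<xi> (U M)) \<longlonglongrightarrow> l * \<rho> + \<i> * rc_dot \<xi> u"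
      by (intro tendsto_intros tendsto_rc_dot \<rho> u)
    moreover have "\<forall>\<^sub>F M in sequentially. l * P M + \<i> * rc_dot \<xi> (U M) = s"
      using eventually_ge_at_top[of 2] by eventually_elim (use R in \<open>auto simp: residual_def\<close>)
    then have "(\<lambda>M. l * P M + \<i> * rc_dot \<xi> (U M)) \<longlonglongrightarrow> s" by (rule tendsto_eventually)
    ultimately show "s = l * \<rho> + \<i> * rc_dot \<xi> u" using LIMSEQ_unique by blast
  next
    have "w $ j = (l *\<^sub>C u - velocity_part \<gamma> \<xi> (c 0) (first_shell c) \<rho> u) $ j" for j
    proof -
      have "(\<lambda>M. (l *\<^sub>C U M - velocity_part \<gamma> \<xi> (C M 0) (first_shell (C M)) (P M) (U M)) $ j) \<longlonglongrightarrow> (l *\<^sub>C u - velocity_part \<gamma> \<xi> (c 0) (first_shell c) \<rho> u) $ j"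
        unfolding velocity_part_def scaleC_vec_def scaleC_complex_def first_shell_def vector_minus_component vec_lambda_beta
        by (intro tendsto_intros c \<rho> u)
      moreover have "\<forall>\<^sub>F M in sequentially. (l *\<^sub>C U M - velocity_part \<gamma> \<xi> (C M 0) (first_shell (C M)) (P M) (U M)) $ j = w $ j"
        using eventually_ge_at_top[of 2] by eventually_elim (use R in \<open>auto simp: residual_def\<close>)
      then have "(\<lambda>M. (l *\<^sub>C U M - velocity_part \<gamma> \<xi> (C M 0) (first_shell (C M)) (P M) (U M)) $ j) \<longlonglongrightarrow> w $ j" by (rule tendsto_eventually)
      ultimately show ?thesis using LIMSEQ_unique by blast
    qed
    then show "w = l *\<^sub>C u - velocity_part \<gamma> \<xi> (c 0) (first_shell c) \<rho> u" by (simp add: vec_eq_iff)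
  qed
  then show ?thesis using f by blast
qed

end

section \<open>The operator in Hermite coordinates\<close>

definition field_fun :: "real^3 \<Rightarrow> complex \<Rightarrow> complex \<Rightarrow> complex^3 \<Rightarrow> real^3 \<Rightarrow> complex" where
  "field_fun \<xi> a \<rho> u v = (\<Sum>j\<in>UNIV. (- \<i> * complex_of_real (\<xi> $ j / (norm \<xi>)\<^sup>2) * (a - \<rho>) + u $ j) * hermite3 (unit j) v)"

lemma field_fun_sq_integrable: "sq_integrable (field_fun \<xi> a \<rho> u)"
  unfolding field_fun_def[abs_def] by (intro sq_integrable_sum sq_integrable_scale hermite3_sq_integrable)

lemma coef_hermite3: "coef (hermite3 \<alpha>) \<beta> = of_bool (\<alpha> = \<beta>)"
  by (simp add: coef_def hermite3_orthonormal)

lemma coef_sum: "(\<And>i. i \<in> I \<Longrightarrow> sq_integrable (f i)) \<Longrightarrow> coef (\<lambda>v. \<Sum>i\<in>I. f i v) \<alpha> = (\<Sum>i\<in>I. coef (f i) \<alpha>)"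
  unfolding coef_def sum_distrib_right by (rule Bochner_Integration.integral_sum) (rule integrable_mult_hermite3)

lemma coef_field_fun: "coef (field_fun \<xi> a \<rho> u) \<alpha> = field_coef \<xi> a \<rho> u \<alpha>"
proof -
  have "coef (field_fun \<xi> a \<rho> u) \<alpha> = (\<Sum>j\<in>UNIV. coef (\<lambda>v. (- \<i> * complex_of_real (\<xi> $ j / (norm \<xi>)\<^sup>2) * (a - \<rho>) + u $ j) * hermite3 (unit j) v) \<alpha>)"
    unfolding field_fun_def[abs_def] by (intro coef_sum sq_integrable_scale hermite3_sq_integrable)
  also have "\<dots> = field_coef \<xi> a \<rho> u \<alpha>"
    unfolding coef_scale coef_hermite3 field_coef_def by (intro sum.cong) auto
  finally show ?thesis .
qed

lemma M_kinetic_eq: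
  "M_kinetic \<xi> f \<rho> u v = (weak_laplacian f v - kinetic_pot \<xi> v * f v) + field_fun \<xi> (tau_a f) \<rho> u v"
proof -
  have "field_fun \<xi> (tau_a f) \<rho> u v = (\<Sum>j\<in>UNIV. - \<i> * (tau_a f - \<rho>) / complex_of_real ((norm \<xi>)\<^sup>2) * complex_of_real (chi0 v) * (complex_of_real (v $ j) * complex_of_real (\<xi> $ j))
      + complex_of_real (chi0 v) * (complex_of_real (v $ j) * u $ j))"
    unfolding field_fun_def hermite3_unit by (intro sum.cong refl) (simp only: distrib_right, simp add: mult_ac)
  also have "\<dots> = - \<i> * (tau_a f - \<rho>) / complex_of_real ((norm \<xi>)\<^sup>2) * complex_of_real (chi0 v) * complex_of_real (v \<bullet> \<xi>) + complex_of_real (chi0 v) * rc_dot v u"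
    unfolding sum.distrib sum_distrib_left[symmetric] rc_dot_def inner_vec_def by simp
  finally have e: "field_fun \<xi> (tau_a f) \<rho> u v = - \<i> * (tau_a f - \<rho>) / complex_of_real ((norm \<xi>)\<^sup>2) * complex_of_real (chi0 v) * complex_of_real (v \<bullet> \<xi>)
      + complex_of_real (chi0 v) * rc_dot v u" .
  define q where "q = tau_a f - \<rho>"
  show ?thesis
    unfolding M_kinetic_def L_op_def kinetic_pot_def e q_def[symmetric] by (simp add: algebra_simps)
qed

lemma tau_a_eq: "tau_a f = coef f 0"
  by (simp add: tau_a_def coef_def chi0_eq_hermite3 mult.commute)

lemma tau_b_eq: "tau_b f = first_shell (coef f)"
  by (simp add: tau_b_def first_shell_def coef_def hermite3_unit vec_eq_iff mult.commute)

lemma M_domain_coef: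
  assumes "(f, \<rho>, u) \<in> M_domain \<xi>"
  shows "coef_L2 (abs_L2 (M_kinetic \<xi> (rep_L2 f) \<rho> u)) \<alpha> = kinetic_coef \<xi> (coef_L2 f) \<rho> u \<alpha>"
proof -
  from assms have ex: "\<exists>h. has_weak_laplacian (rep_L2 f) h" and M: "sq_integrable (M_kinetic \<xi> (rep_L2 f) \<rho> u)"
    by (auto simp: M_domain_def)
  have wl: "has_weak_laplacian (rep_L2 f) (weak_laplacian (rep_L2 f))"
    unfolding weak_laplacian_def by (rule someI_ex[OF ex])
  define F where "F v = M_kinetic \<xi> (rep_L2 f) \<rho> u v - field_fun \<xi> (tau_a (rep_L2 f)) \<rho> u v" for v
  have F: "sq_integrable F" unfolding F_def by (intro sq_integrable_diff M field_fun_sq_integrable)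
  have "coef F \<alpha> = - of_nat (deg \<alpha>) * coef_L2 f \<alpha> - \<i> * jacobi \<xi> (coef_L2 f) \<alpha>"
    by (rule coef_of_weak_laplacian[OF _ F wl]) (simp_all add: F_def M_kinetic_eq)
  moreover have "coef F \<alpha> = coef (M_kinetic \<xi> (rep_L2 f) \<rho> u) \<alpha> - field_coef \<xi> (coef_L2 f 0) \<rho> u \<alpha>"
    unfolding F_def by (subst coef_diff[OF M field_fun_sq_integrable]) (simp add: coef_field_fun tau_a_eq)
  ultimately show ?thesis by (simp add: coef_rep_abs[OF M] kinetic_coef_def diff_eq_eq)
qed

text \<open>The weak Laplacian is only chosen, so its uniqueness identifies the operator with the constructed
image.\<close>

lemma M_domain_of_coef:
  assumes g: "\<And>\<alpha>. coef_L2 g \<alpha> = kinetic_coef \<xi> (coef_L2 f) \<rho> u \<alpha>"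
  shows "(f, \<rho>, u) \<in> M_domain \<xi>" "abs_L2 (M_kinetic \<xi> (rep_L2 f) \<rho> u) = g"
proof -
  define F where "F v = rep_L2 g v - field_fun \<xi> (tau_a (rep_L2 f)) \<rho> u v" for v
  have F: "sq_integrable F" unfolding F_def by (intro sq_integrable_diff field_fun_sq_integrable) simp
  have cF: "coef F \<alpha> = - of_nat (deg \<alpha>) * coef_L2 f \<alpha> - \<i> * jacobi \<xi> (coef_L2 f) \<alpha>" for \<alpha>
    unfolding F_def by (subst coef_diff[OF _ field_fun_sq_integrable]) (simp_all add: coef_field_fun tau_a_eq g kinetic_coef_def)
  have h: "has_weak_laplacian (rep_L2 f) (\<lambda>v. F v + kinetic_pot \<xi> v * rep_L2 f v)"
    by (rule has_weak_laplacian_of_coef[OF _ F cF]) simp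
  have wl: "has_weak_laplacian (rep_L2 f) (weak_laplacian (rep_L2 f))"
    unfolding weak_laplacian_def by (rule someI[where P="has_weak_laplacian (rep_L2 f)", OF h])
  have ae: "AE v in lborel. M_kinetic \<xi> (rep_L2 f) \<rho> u v = rep_L2 g v"
    using weak_laplacian_unique[OF wl h] by eventually_elim (simp add: M_kinetic_eq F_def)
  have [measurable]: "weak_laplacian (rep_L2 f) \<in> borel_measurable borel"
    using wl by (simp add: has_weak_laplacian_def locally_integrable_def)
  have [measurable]: "field_fun \<xi> (tau_a (rep_L2 f)) \<rho> u \<in> borel_measurable borel"
    by (rule sq_integrable_measurable[OF field_fun_sq_integrable])
  have m: "M_kinetic \<xi> (rep_L2 f) \<rho> u \<in> borel_measurable borel"
    unfolding M_kinetic_eq[abs_def] by measurable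
  have "integrable lborel (\<lambda>v. (cmod (M_kinetic \<xi> (rep_L2 f) \<rho> u v))\<^sup>2) \<longleftrightarrow> integrable lborel (\<lambda>v. (cmod (rep_L2 g v))\<^sup>2)"
    using m ae by (intro integrable_cong_AE) auto
  moreover have "integrable lborel (\<lambda>v. (cmod (rep_L2 g v))\<^sup>2)" using rep_L2_sq_integrable[of g] by (simp only: sq_integrable_def)
  ultimately have M: "sq_integrable (M_kinetic \<xi> (rep_L2 f) \<rho> u)" using m by (simp add: sq_integrable_def)
  then show "(f, \<rho>, u) \<in> M_domain \<xi>" using h by (auto simp: M_domain_def)
  show "abs_L2 (M_kinetic \<xi> (rep_L2 f) \<rho> u) = g"
    using abs_L2_eqI[OF M _ ae] by simp
qed

lemma M_op_eq:
  "M_op \<gamma> \<xi> (f, \<rho>, u) = (abs_L2 (M_kinetic \<xi> (rep_L2 f) \<rho> u), - \<i> * rc_dot \<xi> u, velocity_part \<gamma> \<xi> (coef_L2 f 0) (first_shell (coef_L2 f)) \<rho> u)"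
  by (simp add: M_op_def velocity_part_def tau_a_eq tau_b_eq)

text \<open>The domain is characterised together with the operator: a state belongs to it as soon as the equations
have a square summable right side.\<close>

lemma M_op_iff_residual:
  "(f, \<rho>, u) \<in> M_domain \<xi> \<and> l *\<^sub>C (f, \<rho>, u) - M_op \<gamma> \<xi> (f, \<rho>, u) = (g, s, w)
    \<longleftrightarrow> (\<forall>N. residual \<gamma> \<xi> l N (coef_L2 f) \<rho> u (coef_L2 g) s w)"
proof (intro iffI)
  assume a: "(f, \<rho>, u) \<in> M_domain \<xi> \<and> l *\<^sub>C (f, \<rho>, u) - M_op \<gamma> \<xi> (f, \<rho>, u) = (g, s, w)"
  then have g: "l *\<^sub>C f - abs_L2 (M_kinetic \<xi> (rep_L2 f) \<rho> u) = g" and sw: "s = l * \<rho> + \<i> * rc_dot \<xi> u"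
      "w = l *\<^sub>C u - velocity_part \<gamma> \<xi> (coef_L2 f 0) (first_shell (coef_L2 f)) \<rho> u"
    by (auto simp: M_op_eq scaleC_prod_def scaleC_complex_def)
  have "coef_L2 g \<alpha> = l * coef_L2 f \<alpha> - kinetic_coef \<xi> (coef_L2 f) \<rho> u \<alpha>" for \<alpha>
    unfolding g[symmetric] coef_L2_diff coef_L2_scaleC using a by (simp add: M_domain_coef)
  then show "\<forall>N. residual \<gamma> \<xi> l N (coef_L2 f) \<rho> u (coef_L2 g) s w" using sw by (simp add: residual_def)
next
  assume R: "\<forall>N. residual \<gamma> \<xi> l N (coef_L2 f) \<rho> u (coef_L2 g) s w"
  have "coef_L2 (l *\<^sub>C f - g) \<alpha> = kinetic_coef \<xi> (coef_L2 f) \<rho> u \<alpha>" for \<alpha>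
    using R[rule_format, of "deg \<alpha>"] by (simp add: residual_def deg_le_def coef_L2_diff coef_L2_scaleC)
  note M = M_domain_of_coef[OF this]
  have "s = l * \<rho> + \<i> * rc_dot \<xi> u" "w = l *\<^sub>C u - velocity_part \<gamma> \<xi> (coef_L2 f 0) (first_shell (coef_L2 f)) \<rho> u"
    using R by (auto simp: residual_def)
  then show "(f, \<rho>, u) \<in> M_domain \<xi> \<and> l *\<^sub>C (f, \<rho>, u) - M_op \<gamma> \<xi> (f, \<rho>, u) = (g, s, w)"
    using M by (simp add: M_op_eq scaleC_prod_def scaleC_complex_def)
qed

section \<open>The resolvent set\<close>

text \<open>A relation \<open>G\<close> that is linear, total and bounded, and that is the graph of \<open>l - A\<close> on \<open>D\<close>, has a
bounded inverse.\<close>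

lemma in_resolvent_set_of_graph:
  fixes A :: "'a::complex_normed_space \<Rightarrow> 'a"
  assumes G: "\<And>x y. G x y \<longleftrightarrow> x \<in> D \<and> l *\<^sub>C x - A x = y"
    and add: "\<And>x y x' y'. G x y \<Longrightarrow> G x' y' \<Longrightarrow> G (x + x') (y + y')"
    and scale: "\<And>t x y. G x y \<Longrightarrow> G (t *\<^sub>R x) (t *\<^sub>R y)"
    and total: "\<And>y. \<exists>x. G x y"
    and bound: "\<And>x y. G x y \<Longrightarrow> norm x \<le> K * norm y"
  shows "l \<in> resolvent_set D A"
proof -
  let ?F = "\<lambda>x. l *\<^sub>C x - A x"
  have unique: "x = x'" if "G x y" "G x' y" for x x' y
  proof -
    have "G (x + (-1) *\<^sub>R x') (y + (-1) *\<^sub>R y)" using that by (intro add scale)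
    from bound[OF this] show ?thesis by simp
  qed
  have inj: "inj_on ?F D" using G unique by (intro inj_onI) metis
  have onto: "?F ` D = UNIV" using G total by (auto simp: image_iff) metis
  define R where "R = inv_into D ?F"
  have R: "G (R y) y" for y
  proof -
    have "y \<in> ?F ` D" using onto by simp
    then show ?thesis unfolding G R_def by (intro conjI inv_into_into f_inv_into_f)
  qed
  have "bounded_linear R"
  proof (rule bounded_linear_intro)
    show "R (x + y) = R x + R y" for x y by (rule unique[OF R add[OF R R]])
    show "R (t *\<^sub>R x) = t *\<^sub>R R x" for t x by (rule unique[OF R scale[OF R]])
    show "norm (R x) \<le> norm x * K" for x using bound[OF R] by (simp add: mult.commute)
  qed
  then show ?thesis using inj onto by (simp add: resolvent_set_def bij_betw_def R_def)
qed

lemma gap_pos: "0 < r \<Longrightarrow> 1 \<le> \<gamma> \<Longrightarrow> gap \<gamma> r > 0"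
  by (simp add: gap_def add_pos_pos)

lemma half_plane_in_resolvent_set:
  assumes r: "0 < r" "r \<le> 1" "r \<le> (norm \<xi>)\<^sup>2" and \<gamma>: "\<gamma> \<ge> 1" and l: "Re l \<ge> - gap \<gamma> r"
  shows "l \<in> resolvent_set (M_domain \<xi>) (M_op \<gamma> \<xi>)"
proof -
  define G where "G x y \<longleftrightarrow> (\<forall>N. residual \<gamma> \<xi> l N (coef_L2 (fst x)) (fst (snd x)) (snd (snd x)) (coef_L2 (fst y)) (fst (snd y)) (snd (snd y)))"
    for x y :: "L2 \<times> complex \<times> (complex^3)"
  have cfa: "coef_L2 (f + f') = (\<lambda>\<alpha>. coef_L2 f \<alpha> + coef_L2 f' \<alpha>)" for f f' by (rule ext) (rule coef_L2_add)
  have cfs: "coef_L2 (t *\<^sub>R f) = (\<lambda>\<alpha>. complex_of_real t * coef_L2 f \<alpha>)" for t f by (rule ext) (rule coef_L2_scaleR)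
  show ?thesis
  proof (rule in_resolvent_set_of_graph[of G])
    fix x y :: "L2 \<times> complex \<times> (complex^3)"
    obtain f \<rho> u g s w where x: "x = (f, \<rho>, u)" and y: "y = (g, s, w)" by (metis surj_pair)
    show "G x y \<longleftrightarrow> x \<in> M_domain \<xi> \<and> l *\<^sub>C x - M_op \<gamma> \<xi> x = y"
      unfolding G_def x y fst_conv snd_conv using M_op_iff_residual by blast
  next
    fix x y x' y' assume "G x y" "G x' y'"
    then show "G (x + x') (y + y')"
      unfolding G_def fst_add snd_add cfa using residual_add by blast
  next
    fix t x y assume "G x y"
    then show "G (t *\<^sub>R x) (t *\<^sub>R y)"
      unfolding G_def fst_scaleR snd_scaleR cfs
      using residual_scale[of \<gamma> \<xi> l _ _ _ _ _ _ _ "complex_of_real t"] by (simp add: scaleC_of_real scaleR_conv_of_real)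
  next
    fix y :: "L2 \<times> complex \<times> (complex^3)"
    obtain f \<rho> u where "\<forall>N. residual \<gamma> \<xi> l N (coef_L2 f) \<rho> u (coef_L2 (fst y)) (fst (snd y)) (snd (snd y))"
      using resolvent_solution[OF r \<gamma> l] by blast
    then have "G (f, \<rho>, u) y" by (simp add: G_def)
    then show "\<exists>x. G x y" by blast
  next
    fix x y assume "G x y"
    then show "norm x \<le> inverse_const \<gamma> r \<xi> * norm y"
      using resolvent_bound[OF r \<gamma> l] unfolding G_def by (simp add: norm_prod_def add.assoc)
  qed
qed

theorem lemma2p5:
  fixes \<gamma> r0 :: real
  assumes "\<gamma> \<ge> 1" and "r0 > 0"
  shows "\<exists>\<beta>>0. \<forall>\<xi>::real^3. norm \<xi> \<ge> r0 \<longrightarrow>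
           spectrum (M_domain \<xi>) (M_op \<gamma> \<xi>) \<subseteq> {l. Re l < - \<beta>}"
proof (intro exI conjI allI impI)
  define r where "r = min 1 (r0\<^sup>2)"
  have r: "0 < r" "r \<le> 1" using assms by (simp_all add: r_def)
  show "gap \<gamma> r > 0" using r assms by (intro gap_pos)
  fix \<xi> :: "real^3" assume "norm \<xi> \<ge> r0"
  then have "r0\<^sup>2 \<le> (norm \<xi>)\<^sup>2" using assms by (intro power_mono) auto
  then have r3: "r \<le> (norm \<xi>)\<^sup>2" by (simp add: r_def)
  show "spectrum (M_domain \<xi>) (M_op \<gamma> \<xi>) \<subseteq> {l. Re l < - gap \<gamma> r}"
  proof
    fix l assume "l \<in> spectrum (M_domain \<xi>) (M_op \<gamma> \<xi>)"
    then have "l \<notin> resolvent_set (M_domain \<xi>) (M_op \<gamma> \<xi>)" by (simp add: spectrum_def)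
    then have "\<not> Re l \<ge> - gap \<gamma> r" using half_plane_in_resolvent_set[OF r r3 assms(1)] by blast
    then show "l \<in> {l. Re l < - gap \<gamma> r}" by simp
  qed
qed

end
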